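(* Let $\mathcal{C}$ be a pivotal fusion category and $\mathcal{M}$ a $\mathcal{C}$-module category with finite set $\{m_i\}_{i\in I}$ of representatives of the isomorphism classes of simple objects. Let $Q$ be the matrix with entries $Q_{ij}=\dim^{\mathcal{C}}(\underline{\mathrm{Hom}}(m_j,m_i))$, $i,j\in I$. If $\Theta$ is a $\mathcal{C}$-module trace on $\mathcal{M}$, then the dimension vector $d_i=\dim^{\Theta}(m_i)$, $i\in I$, consists of non-zero numbers and is a (right) eigenvector of $Q$ with eigenvalue $\dim(\mathcal{C})$, i.e. $\sum_{j}Q_{ij}d_j=\dim(\mathcal{C})\,d_i$. If a tuple of non-zero numbers $(d_i)_{i\in I}$ is a (right) eigenvector of $Q$ with eigenvalue $\dim(\mathcal{C})$, then the collection of linear maps $$\Theta_m(f)=\frac{1}{\dim(\mathcal{C})}\sum_{i\in I}\mathrm{tr}^{L}(\underline{\mathrm{Hom}}(m_i,f))\,d_i,\qquad f\in\mathrm{End}(m),\ m\in\mathcal{M},$$ defines a $\mathcal{C}$-module trace on $\mathcal{M}$. These two maps (between $\mathcal{C}$-module traces on $\mathcal{M}$ and such eigenvectors with non-zero entries) are mutually inverse.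
   Context: All categories are abelian and locally finite over $\mathbb{C}$. A fusion category is a semisimple rigid monoidal $\mathbb{C}$-linear category with tensor product bilinear on morphisms, simple unit $1$ and finitely many isomorphism classes of simple objects, with representatives $c_u$, $u\in U$ (treated as strict). The right dual of $c$ is $c^{*}$ with $\mathrm{ev}_c:c^{*}\otimes c\to1$, $\mathrm{coev}_c:1\to c\otimes c^{*}$; the left dual is ${}^{*}c$ with $\mathrm{ev}'_c:c\otimes{}^{*}c\to1$, $\mathrm{coev}'_c:1\to{}^{*}c\otimes c$; $({}^{*}c)^{*}\cong c\cong{}^{*}(c^{*})$ canonically, treated as identities. A pivotal structure is a monoidal natural isomorphism $a:\mathrm{id}\to(-)^{**}$; $\mathrm{tr}^{L}_c(f)=\mathrm{ev}_c\circ(a_{{}^{*}c}\otimes f)\circ\mathrm{coev}'_c$, $\dim^{\mathcal{C}}(c)=\mathrm{tr}^{L}_c(\mathrm{id}_c)$, and $\dim(\mathcal{C})=\sum_{u\in U}|\dim^{\mathcal{C}}(c_u)|^{2}\neq0$. A (left) $\mathcal{C}$-module category is a semisimple $\mathbb{C}$-linear abelian category $\mathcal{M}$ with a bifunctor $\triangleright:\mathcal{C}\times\mathcal{M}\to\mathcal{M}$ and natural isomorphisms $(c\otimes d)\triangleright m\cong c\triangleright(d\triangleright m)$, $1\triangleright m\cong m$ satisfying the usual pentagon and triangle axioms (suppressed). For $f\in\mathrm{End}_{\mathcal{M}}(c\triangleright m)$ put $\mathrm{tr}^{\mathcal{C}}(f)=(\mathrm{ev}_c\triangleright\mathrm{id}_m)\circ(a_{{}^{*}c}\triangleright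 f)\circ(\mathrm{coev}'_c\triangleright\mathrm{id}_m)$. A $\mathcal{C}$-module trace on $\mathcal{M}$ is a family of linear maps $\Theta_m:\mathrm{End}_{\mathcal{M}}(m)\to\mathbb{C}$ that is symmetric ($\Theta_m(g\circ f)=\Theta_n(f\circ g)$ for $f:m\to n$, $g:n\to m$), non-degenerate (the pairing $(f,g)\mapsto\Theta_m(g\circ f)$ on $\mathrm{Hom}(m,n)\times\mathrm{Hom}(n,m)$ is non-degenerate for all $m,n$) and $\mathcal{C}$-compatible ($\Theta_{c\triangleright m}=\Theta_m\circ\mathrm{tr}^{\mathcal{C}}$). Put $\dim^{\Theta}(m)=\Theta_m(\mathrm{id}_m)$. The inner hom is the bifunctor $\underline{\mathrm{Hom}}(-,-):\mathcal{M}^{\mathrm{op}}\times\mathcal{M}\to\mathcal{C}$ with natural isomorphisms $\mathrm{Hom}_{\mathcal{M}}(c\triangleright m,n)\cong\mathrm{Hom}_{\mathcal{C}}(c,\underline{\mathrm{Hom}}(m,n))$; $\underline{\mathrm{Hom}}(m_i,f)$ is the induced endomorphism of $\underline{\mathrm{Hom}}(m_i,m)$. *)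

theory Defs
  imports Complex_Main
begin

section \<open>Linear categories\<close>

text \<open>
  All hom spaces of a category are complex subspaces of one ambient complex vector space
  (the type \<open>'a\<close> with scalar multiplication \<open>smul\<close>), so that sums, zero morphisms and linearity
  are those of the library, and neither composition nor tensor product of morphisms has to be
  indexed by sources and targets.  This loses no generality: embedding the hom spaces of an
  arbitrary (small) linear category into their direct sum gives an isomorphic category of this
  form.  All axioms speak about morphisms between objects in \<open>Ob\<close> only.
\<close>

record ('o, 'a) lin_cat =
  Ob :: "'o set"
  Hom :: "'o \<Rightarrow> 'o \<Rightarrow> 'a set"
  ident :: "'o \<Rightarrow> 'a" ("\<i>\<index>")
  cmp :: "'a \<Rightarrow> 'a \<Rightarrow> 'a" (infixl "\<cdot>\<index>" 70)
  smul :: "complex \<Rightarrow> 'a \<Rightarrow> 'a"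

locale linear_category = vector_space "smul C"
  for C :: "('o, 'a::ab_group_add, 'z) lin_cat_scheme" (structure) +
  assumes Hom_subspace: "x \<in> Ob C \<Longrightarrow> y \<in> Ob C \<Longrightarrow> subspace (Hom C x y)"
    and ident_in_Hom: "x \<in> Ob C \<Longrightarrow> \<i> x \<in> Hom C x x"
    and cmp_in_Hom: "\<lbrakk>x \<in> Ob C; y \<in> Ob C; z \<in> Ob C; f \<in> Hom C x y; g \<in> Hom C y z\<rbrakk>
          \<Longrightarrow> g \<cdot> f \<in> Hom C x z"
    and cmp_ident_left: "\<lbrakk>x \<in> Ob C; y \<in> Ob C; f \<in> Hom C x y\<rbrakk> \<Longrightarrow> \<i> y \<cdot> f = f"
    and cmp_ident_right: "\<lbrakk>x \<in> Ob C; y \<in> Ob C; f \<in> Hom C x y\<rbrakk> \<Longrightarrow> f \<cdot> \<i> x = f"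
    and cmp_assoc: "\<lbrakk>w \<in> Ob C; x \<in> Ob C; y \<in> Ob C; z \<in> Ob C;
          f \<in> Hom C w x; g \<in> Hom C x y; h \<in> Hom C y z\<rbrakk> \<Longrightarrow> h \<cdot> (g \<cdot> f) = (h \<cdot> g) \<cdot> f"
    and cmp_add_left: "\<lbrakk>x \<in> Ob C; y \<in> Ob C; z \<in> Ob C;
          f \<in> Hom C x y; g \<in> Hom C y z; g' \<in> Hom C y z\<rbrakk> \<Longrightarrow> (g + g') \<cdot> f = g \<cdot> f + g' \<cdot> f"
    and cmp_add_right: "\<lbrakk>x \<in> Ob C; y \<in> Ob C; z \<in> Ob C;
          f \<in> Hom C x y; f' \<in> Hom C x y; g \<in> Hom C y z\<rbrakk> \<Longrightarrow> g \<cdot> (f + f') = g \<cdot> f + g \<cdot> f'"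
    and cmp_smul_left: "\<lbrakk>x \<in> Ob C; y \<in> Ob C; z \<in> Ob C; f \<in> Hom C x y; g \<in> Hom C y z\<rbrakk>
          \<Longrightarrow> smul C r g \<cdot> f = smul C r (g \<cdot> f)"
    and cmp_smul_right: "\<lbrakk>x \<in> Ob C; y \<in> Ob C; z \<in> Ob C; f \<in> Hom C x y; g \<in> Hom C y z\<rbrakk>
          \<Longrightarrow> g \<cdot> smul C r f = smul C r (g \<cdot> f)"

definition monic :: "('o, 'a, 'z) lin_cat_scheme \<Rightarrow> 'o \<Rightarrow> 'o \<Rightarrow> 'a \<Rightarrow> bool" where
  "monic C x y f \<longleftrightarrow> f \<in> Hom C x y \<and>
     (\<forall>w\<in>Ob C. \<forall>g\<in>Hom C w x. \<forall>h\<in>Hom C w x. f \<cdot>\<^bsub>C\<^esub> g = f \<cdot>\<^bsub>C\<^esub> h \<longrightarrow> g = h)"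

definition epic :: "('o, 'a, 'z) lin_cat_scheme \<Rightarrow> 'o \<Rightarrow> 'o \<Rightarrow> 'a \<Rightarrow> bool" where
  "epic C x y f \<longleftrightarrow> f \<in> Hom C x y \<and>
     (\<forall>z\<in>Ob C. \<forall>g\<in>Hom C y z. \<forall>h\<in>Hom C y z. g \<cdot>\<^bsub>C\<^esub> f = h \<cdot>\<^bsub>C\<^esub> f \<longrightarrow> g = h)"

definition is_inverse ::
    "('o, 'a, 'z) lin_cat_scheme \<Rightarrow> 'o \<Rightarrow> 'o \<Rightarrow> 'a \<Rightarrow> 'a \<Rightarrow> bool" where
  "is_inverse C x y f g \<longleftrightarrow> g \<in> Hom C y x \<and> g \<cdot>\<^bsub>C\<^esub> f = \<i>\<^bsub>C\<^esub> x \<and> f \<cdot>\<^bsub>C\<^esub> g = \<i>\<^bsub>C\<^esub> y"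

definition iso :: "('o, 'a, 'z) lin_cat_scheme \<Rightarrow> 'o \<Rightarrow> 'o \<Rightarrow> 'a \<Rightarrow> bool" where
  "iso C x y f \<longleftrightarrow> f \<in> Hom C x y \<and> (\<exists>g. is_inverse C x y f g)"

definition inv_ar :: "('o, 'a, 'z) lin_cat_scheme \<Rightarrow> 'o \<Rightarrow> 'o \<Rightarrow> 'a \<Rightarrow> 'a" where
  "inv_ar C x y f = (THE g. is_inverse C x y f g)"

definition isomorphic :: "('o, 'a, 'z) lin_cat_scheme \<Rightarrow> 'o \<Rightarrow> 'o \<Rightarrow> bool" where
  "isomorphic C x y \<longleftrightarrow> (\<exists>f. iso C x y f)"

definition zero_object :: "('o, 'a::zero, 'z) lin_cat_scheme \<Rightarrow> 'o \<Rightarrow> bool" where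
  "zero_object C x \<longleftrightarrow> x \<in> Ob C \<and> (\<forall>y\<in>Ob C. Hom C x y = {0} \<and> Hom C y x = {0})"

definition is_biproduct ::
    "('o, 'a::ab_group_add, 'z) lin_cat_scheme \<Rightarrow> 'o \<Rightarrow> 'o \<Rightarrow> 'o \<Rightarrow> bool" where
  "is_biproduct C x y s \<longleftrightarrow> s \<in> Ob C \<and>
     (\<exists>i\<in>Hom C x s. \<exists>j\<in>Hom C y s. \<exists>p\<in>Hom C s x. \<exists>q\<in>Hom C s y.
        p \<cdot>\<^bsub>C\<^esub> i = \<i>\<^bsub>C\<^esub> x \<and> q \<cdot>\<^bsub>C\<^esub> j = \<i>\<^bsub>C\<^esub> y \<and> p \<cdot>\<^bsub>C\<^esub> j = 0 \<and> q \<cdot>\<^bsub>C\<^esub> i = 0 \<and>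
        i \<cdot>\<^bsub>C\<^esub> p + j \<cdot>\<^bsub>C\<^esub> q = \<i>\<^bsub>C\<^esub> s)"

text \<open>The morphism \<open>k : w \<rightarrow> x\<close> is a kernel, and \<open>q : y \<rightarrow> w\<close> is a cokernel, of \<open>f : x \<rightarrow> y\<close>.\<close>

definition is_kernel ::
    "('o, 'a::zero, 'z) lin_cat_scheme \<Rightarrow> 'o \<Rightarrow> 'o \<Rightarrow> 'a \<Rightarrow> 'o \<Rightarrow> 'a \<Rightarrow> bool" where
  "is_kernel C x y f w k \<longleftrightarrow> w \<in> Ob C \<and> k \<in> Hom C w x \<and> f \<cdot>\<^bsub>C\<^esub> k = 0 \<and>
     (\<forall>v\<in>Ob C. \<forall>g\<in>Hom C v x. f \<cdot>\<^bsub>C\<^esub> g = 0 \<longrightarrow> (\<exists>!h. h \<in> Hom C v w \<and> k \<cdot>\<^bsub>C\<^esub> h = g))"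

definition is_cokernel ::
    "('o, 'a::zero, 'z) lin_cat_scheme \<Rightarrow> 'o \<Rightarrow> 'o \<Rightarrow> 'a \<Rightarrow> 'o \<Rightarrow> 'a \<Rightarrow> bool" where
  "is_cokernel C x y f w q \<longleftrightarrow> w \<in> Ob C \<and> q \<in> Hom C y w \<and> q \<cdot>\<^bsub>C\<^esub> f = 0 \<and>
     (\<forall>v\<in>Ob C. \<forall>g\<in>Hom C y v. g \<cdot>\<^bsub>C\<^esub> f = 0 \<longrightarrow> (\<exists>!h. h \<in> Hom C w v \<and> h \<cdot>\<^bsub>C\<^esub> q = g))"

locale abelian_category = linear_category +
  assumes ex_zero_object: "\<exists>x. zero_object C x"
    and ex_biproduct: "x \<in> Ob C \<Longrightarrow> y \<in> Ob C \<Longrightarrow> \<exists>s. is_biproduct C x y s"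
    and ex_kernel: "\<lbrakk>x \<in> Ob C; y \<in> Ob C; f \<in> Hom C x y\<rbrakk> \<Longrightarrow> \<exists>w k. is_kernel C x y f w k"
    and ex_cokernel: "\<lbrakk>x \<in> Ob C; y \<in> Ob C; f \<in> Hom C x y\<rbrakk> \<Longrightarrow> \<exists>w q. is_cokernel C x y f w q"
    and monic_is_kernel: "\<lbrakk>x \<in> Ob C; y \<in> Ob C; monic C x y f\<rbrakk>
          \<Longrightarrow> \<exists>z\<in>Ob C. \<exists>g\<in>Hom C y z. is_kernel C y z g x f"
    and epic_is_cokernel: "\<lbrakk>x \<in> Ob C; y \<in> Ob C; epic C x y f\<rbrakk>
          \<Longrightarrow> \<exists>z\<in>Ob C. \<exists>g\<in>Hom C z x. is_cokernel C z x g y f"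

definition simple_object :: "('o, 'a::zero, 'z) lin_cat_scheme \<Rightarrow> 'o \<Rightarrow> bool" where
  "simple_object C x \<longleftrightarrow> x \<in> Ob C \<and> \<not> zero_object C x \<and>
     (\<forall>y\<in>Ob C. \<forall>f. monic C y x f \<longrightarrow> zero_object C y \<or> iso C y x f)"

text \<open>Existence of a finite filtration with simple quotients.\<close>

inductive finite_length :: "('o, 'a::zero, 'z) lin_cat_scheme \<Rightarrow> 'o \<Rightarrow> bool"
  for C :: "('o, 'a::zero, 'z) lin_cat_scheme" where
  finite_length_zero: "zero_object C x \<Longrightarrow> finite_length C x"
| finite_length_step: "\<lbrakk>finite_length C y; x \<in> Ob C; monic C y x f; is_cokernel C y x f s q;
     simple_object C s\<rbrakk> \<Longrightarrow> finite_length C x"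

locale locally_finite_category = abelian_category +
  assumes Hom_finite_dim:
      "x \<in> Ob C \<Longrightarrow> y \<in> Ob C \<Longrightarrow> \<exists>B. finite B \<and> Hom C x y = span B"
    and ob_finite_length: "x \<in> Ob C \<Longrightarrow> finite_length C x"

text \<open>The object \<open>x\<close> is a direct sum (coproduct) of the objects \<open>S 0, \<dots>, S (n - 1)\<close>.\<close>

definition is_direct_sum ::
    "('o, 'a, 'z) lin_cat_scheme \<Rightarrow> nat \<Rightarrow> (nat \<Rightarrow> 'o) \<Rightarrow> 'o \<Rightarrow> bool" where
  "is_direct_sum C n S x \<longleftrightarrow> x \<in> Ob C \<and> (\<exists>e. (\<forall>k<n. e k \<in> Hom C (S k) x) \<and>
     (\<forall>y\<in>Ob C. \<forall>g. (\<forall>k<n. g k \<in> Hom C (S k) y) \<longrightarrow>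
        (\<exists>!h. h \<in> Hom C x y \<and> (\<forall>k<n. h \<cdot>\<^bsub>C\<^esub> e k = g k))))"

locale semisimple_category = locally_finite_category +
  assumes semisimple:
    "x \<in> Ob C \<Longrightarrow> \<exists>n S. (\<forall>k<n. simple_object C (S k)) \<and> is_direct_sum C n S x"

definition simple_representatives ::
    "('o, 'a::zero, 'z) lin_cat_scheme \<Rightarrow> 'i set \<Rightarrow> ('i \<Rightarrow> 'o) \<Rightarrow> bool" where
  "simple_representatives C I m \<longleftrightarrow>
     (\<forall>i\<in>I. simple_object C (m i)) \<and>
     (\<forall>x. simple_object C x \<longrightarrow> (\<exists>i\<in>I. isomorphic C x (m i))) \<and>
     (\<forall>i\<in>I. \<forall>j\<in>I. isomorphic C (m i) (m j) \<longrightarrow> i = j)"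


section \<open>Monoidal categories and duals\<close>

text \<open>
  Tensor products of objects and morphisms are written \<open>\<otimes>\<close> and \<open>\<odot>\<close>.  The constraints are
  \<open>assoc x y z : (x \<otimes> y) \<otimes> z \<rightarrow> x \<otimes> (y \<otimes> z)\<close>, \<open>lunit x : \<one> \<otimes> x \<rightarrow> x\<close> and
  \<open>runit x : x \<otimes> \<one> \<rightarrow> x\<close>; strictness is not assumed.
\<close>

record ('o, 'a) mon_cat = "('o, 'a) lin_cat" +
  tens_ob :: "'o \<Rightarrow> 'o \<Rightarrow> 'o" (infixr "\<otimes>\<index>" 75)
  tens_ar :: "'a \<Rightarrow> 'a \<Rightarrow> 'a" (infixr "\<odot>\<index>" 75)
  unit_ob :: 'o ("\<one>\<index>")
  assoc :: "'o \<Rightarrow> 'o \<Rightarrow> 'o \<Rightarrow> 'a"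
  lunit :: "'o \<Rightarrow> 'a"
  runit :: "'o \<Rightarrow> 'a"

definition inv_assoc :: "('o, 'a, 'z) mon_cat_scheme \<Rightarrow> 'o \<Rightarrow> 'o \<Rightarrow> 'o \<Rightarrow> 'a" where
  "inv_assoc C x y z = inv_ar C ((x \<otimes>\<^bsub>C\<^esub> y) \<otimes>\<^bsub>C\<^esub> z) (x \<otimes>\<^bsub>C\<^esub> (y \<otimes>\<^bsub>C\<^esub> z)) (assoc C x y z)"

definition inv_lunit :: "('o, 'a, 'z) mon_cat_scheme \<Rightarrow> 'o \<Rightarrow> 'a" where
  "inv_lunit C x = inv_ar C (\<one>\<^bsub>C\<^esub> \<otimes>\<^bsub>C\<^esub> x) x (lunit C x)"

definition inv_runit :: "('o, 'a, 'z) mon_cat_scheme \<Rightarrow> 'o \<Rightarrow> 'a" where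
  "inv_runit C x = inv_ar C (x \<otimes>\<^bsub>C\<^esub> \<one>\<^bsub>C\<^esub>) x (runit C x)"

locale linear_monoidal_category = linear_category C
  for C :: "('o, 'a::ab_group_add, 'z) mon_cat_scheme" (structure) +
  assumes unit_in_Ob: "\<one> \<in> Ob C"
    and tens_ob_in_Ob: "x \<in> Ob C \<Longrightarrow> y \<in> Ob C \<Longrightarrow> x \<otimes> y \<in> Ob C"
    and tens_in_Hom: "\<lbrakk>x \<in> Ob C; x' \<in> Ob C; y \<in> Ob C; y' \<in> Ob C;
          f \<in> Hom C x x'; g \<in> Hom C y y'\<rbrakk> \<Longrightarrow> f \<odot> g \<in> Hom C (x \<otimes> y) (x' \<otimes> y')"
    and tens_ident: "x \<in> Ob C \<Longrightarrow> y \<in> Ob C \<Longrightarrow> \<i> x \<odot> \<i> y = \<i> (x \<otimes> y)"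
    and tens_cmp: "\<lbrakk>x \<in> Ob C; x' \<in> Ob C; x'' \<in> Ob C; y \<in> Ob C; y' \<in> Ob C; y'' \<in> Ob C;
          f \<in> Hom C x x'; f' \<in> Hom C x' x''; g \<in> Hom C y y'; g' \<in> Hom C y' y''\<rbrakk>
          \<Longrightarrow> (f' \<cdot> f) \<odot> (g' \<cdot> g) = (f' \<odot> g') \<cdot> (f \<odot> g)"
    and tens_add_left: "\<lbrakk>x \<in> Ob C; x' \<in> Ob C; y \<in> Ob C; y' \<in> Ob C;
          f \<in> Hom C x x'; f' \<in> Hom C x x'; g \<in> Hom C y y'\<rbrakk>
          \<Longrightarrow> (f + f') \<odot> g = f \<odot> g + f' \<odot> g"
    and tens_add_right: "\<lbrakk>x \<in> Ob C; x' \<in> Ob C; y \<in> Ob C; y' \<in> Ob C;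
          f \<in> Hom C x x'; g \<in> Hom C y y'; g' \<in> Hom C y y'\<rbrakk>
          \<Longrightarrow> f \<odot> (g + g') = f \<odot> g + f \<odot> g'"
    and tens_smul_left: "\<lbrakk>x \<in> Ob C; x' \<in> Ob C; y \<in> Ob C; y' \<in> Ob C;
          f \<in> Hom C x x'; g \<in> Hom C y y'\<rbrakk> \<Longrightarrow> smul C r f \<odot> g = smul C r (f \<odot> g)"
    and tens_smul_right: "\<lbrakk>x \<in> Ob C; x' \<in> Ob C; y \<in> Ob C; y' \<in> Ob C;
          f \<in> Hom C x x'; g \<in> Hom C y y'\<rbrakk> \<Longrightarrow> f \<odot> smul C r g = smul C r (f \<odot> g)"
    and assoc_iso: "\<lbrakk>x \<in> Ob C; y \<in> Ob C; z \<in> Ob C\<rbrakk>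
          \<Longrightarrow> iso C ((x \<otimes> y) \<otimes> z) (x \<otimes> (y \<otimes> z)) (assoc C x y z)"
    and assoc_natural: "\<lbrakk>x \<in> Ob C; x' \<in> Ob C; y \<in> Ob C; y' \<in> Ob C; z \<in> Ob C; z' \<in> Ob C;
          f \<in> Hom C x x'; g \<in> Hom C y y'; h \<in> Hom C z z'\<rbrakk>
          \<Longrightarrow> assoc C x' y' z' \<cdot> ((f \<odot> g) \<odot> h) = (f \<odot> (g \<odot> h)) \<cdot> assoc C x y z"
    and lunit_iso: "x \<in> Ob C \<Longrightarrow> iso C (\<one> \<otimes> x) x (lunit C x)"
    and lunit_natural: "\<lbrakk>x \<in> Ob C; y \<in> Ob C; f \<in> Hom C x y\<rbrakk>
          \<Longrightarrow> lunit C y \<cdot> (\<i> \<one> \<odot> f) = f \<cdot> lunit C x"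
    and runit_iso: "x \<in> Ob C \<Longrightarrow> iso C (x \<otimes> \<one>) x (runit C x)"
    and runit_natural: "\<lbrakk>x \<in> Ob C; y \<in> Ob C; f \<in> Hom C x y\<rbrakk>
          \<Longrightarrow> runit C y \<cdot> (f \<odot> \<i> \<one>) = f \<cdot> runit C x"
    and pentagon: "\<lbrakk>w \<in> Ob C; x \<in> Ob C; y \<in> Ob C; z \<in> Ob C\<rbrakk>
          \<Longrightarrow> assoc C w x (y \<otimes> z) \<cdot> assoc C (w \<otimes> x) y z
            = (\<i> w \<odot> assoc C x y z) \<cdot> assoc C w (x \<otimes> y) z \<cdot> (assoc C w x y \<odot> \<i> z)"
    and triangle: "\<lbrakk>x \<in> Ob C; y \<in> Ob C\<rbrakk>
          \<Longrightarrow> (\<i> x \<odot> lunit C y) \<cdot> assoc C x \<one> y = runit C x \<odot> \<i> y"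

text \<open>
  Given \<open>\<epsilon> : u \<otimes> y \<rightarrow> \<one>\<close>, \<open>\<eta> : \<one> \<rightarrow> x \<otimes> v\<close> and \<open>f : x \<rightarrow> y\<close>, the mate of \<open>f\<close> is the morphism
  \<open>u \<cong> u \<otimes> \<one> \<rightarrow> u \<otimes> (x \<otimes> v) \<rightarrow> u \<otimes> (y \<otimes> v) \<cong> (u \<otimes> y) \<otimes> v \<rightarrow> \<one> \<otimes> v \<cong> v\<close>.
  It specialises to the dual of a morphism and, for \<open>f = \<i> x\<close>, to the canonical morphism
  between two right duals of the same object.
\<close>

definition mate ::
    "('o, 'a, 'z) mon_cat_scheme \<Rightarrow> 'o \<Rightarrow> 'a \<Rightarrow> 'o \<Rightarrow> 'o \<Rightarrow> 'o \<Rightarrow> 'a \<Rightarrow> 'a \<Rightarrow> 'a" where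
  "mate C u \<epsilon> x y v \<eta> f =
     lunit C v \<cdot>\<^bsub>C\<^esub> (\<epsilon> \<odot>\<^bsub>C\<^esub> \<i>\<^bsub>C\<^esub> v) \<cdot>\<^bsub>C\<^esub> inv_assoc C u y v \<cdot>\<^bsub>C\<^esub> (\<i>\<^bsub>C\<^esub> u \<odot>\<^bsub>C\<^esub> (f \<odot>\<^bsub>C\<^esub> \<i>\<^bsub>C\<^esub> v))
       \<cdot>\<^bsub>C\<^esub> (\<i>\<^bsub>C\<^esub> u \<odot>\<^bsub>C\<^esub> \<eta>) \<cdot>\<^bsub>C\<^esub> inv_runit C u"

text \<open>
  \<open>y\<close> is a right dual of \<open>x\<close> (equivalently \<open>x\<close> is a left dual of \<open>y\<close>) with
  \<open>\<epsilon> : y \<otimes> x \<rightarrow> \<one>\<close> and \<open>\<eta> : \<one> \<rightarrow> x \<otimes> y\<close>.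
\<close>

definition dual_pair ::
    "('o, 'a, 'z) mon_cat_scheme \<Rightarrow> 'o \<Rightarrow> 'o \<Rightarrow> 'a \<Rightarrow> 'a \<Rightarrow> bool" where
  "dual_pair C x y \<epsilon> \<eta> \<longleftrightarrow>
     \<epsilon> \<in> Hom C (y \<otimes>\<^bsub>C\<^esub> x) \<one>\<^bsub>C\<^esub> \<and> \<eta> \<in> Hom C \<one>\<^bsub>C\<^esub> (x \<otimes>\<^bsub>C\<^esub> y) \<and>
     runit C x \<cdot>\<^bsub>C\<^esub> (\<i>\<^bsub>C\<^esub> x \<odot>\<^bsub>C\<^esub> \<epsilon>) \<cdot>\<^bsub>C\<^esub> assoc C x y x \<cdot>\<^bsub>C\<^esub> (\<eta> \<odot>\<^bsub>C\<^esub> \<i>\<^bsub>C\<^esub> x) \<cdot>\<^bsub>C\<^esub> inv_lunit C x = \<i>\<^bsub>C\<^esub> x \<and>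
     lunit C y \<cdot>\<^bsub>C\<^esub> (\<epsilon> \<odot>\<^bsub>C\<^esub> \<i>\<^bsub>C\<^esub> y) \<cdot>\<^bsub>C\<^esub> inv_assoc C y x y \<cdot>\<^bsub>C\<^esub> (\<i>\<^bsub>C\<^esub> y \<odot>\<^bsub>C\<^esub> \<eta>) \<cdot>\<^bsub>C\<^esub> inv_runit C y = \<i>\<^bsub>C\<^esub> y"


section \<open>Pivotal fusion categories\<close>

text \<open>
  \<open>ev x : rdual x \<otimes> x \<rightarrow> \<one>\<close> and \<open>coev x : \<one> \<rightarrow> x \<otimes> rdual x\<close> for the right dual,
  \<open>evl x : x \<otimes> ldual x \<rightarrow> \<one>\<close> and \<open>coevl x : \<one> \<rightarrow> ldual x \<otimes> x\<close> for the left dual,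
  \<open>piv x : x \<rightarrow> rdual (rdual x)\<close> for the pivotal structure.
\<close>

record ('o, 'a) pivotal_cat = "('o, 'a) mon_cat" +
  rdual :: "'o \<Rightarrow> 'o"
  ev :: "'o \<Rightarrow> 'a"
  coev :: "'o \<Rightarrow> 'a"
  ldual :: "'o \<Rightarrow> 'o"
  evl :: "'o \<Rightarrow> 'a"
  coevl :: "'o \<Rightarrow> 'a"
  piv :: "'o \<Rightarrow> 'a"

locale fusion_category =
  linear_monoidal_category C + semisimple_category C
  for C :: "('o, 'a::ab_group_add, 'z) pivotal_cat_scheme" (structure) +
  assumes rdual_in_Ob: "x \<in> Ob C \<Longrightarrow> rdual C x \<in> Ob C"
    and ldual_in_Ob: "x \<in> Ob C \<Longrightarrow> ldual C x \<in> Ob C"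
    and right_dual: "x \<in> Ob C \<Longrightarrow> dual_pair C x (rdual C x) (ev C x) (coev C x)"
    and left_dual: "x \<in> Ob C \<Longrightarrow> dual_pair C (ldual C x) x (evl C x) (coevl C x)"
    and simple_unit: "simple_object C \<one>"
    and finitely_many_simples: "\<exists>S. finite S \<and> simple_representatives C S (\<lambda>x. x)"

text \<open>The dual \<open>rdual y \<rightarrow> rdual x\<close> of \<open>f : x \<rightarrow> y\<close>.\<close>

definition dual_ar :: "('o, 'a, 'z) pivotal_cat_scheme \<Rightarrow> 'o \<Rightarrow> 'o \<Rightarrow> 'a \<Rightarrow> 'a" where
  "dual_ar C x y f = mate C (rdual C y) (ev C y) x y (rdual C x) (coev C x) f"

text \<open>
  The object \<open>rdual y \<otimes> rdual x\<close> is a right dual of \<open>x \<otimes> y\<close>; its coevaluation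
  \<open>\<one> \<rightarrow> (x \<otimes> y) \<otimes> (rdual y \<otimes> rdual x)\<close> and the resulting canonical isomorphism
  \<open>rdual (x \<otimes> y) \<rightarrow> rdual y \<otimes> rdual x\<close>.
\<close>

definition tens_coev :: "('o, 'a, 'z) pivotal_cat_scheme \<Rightarrow> 'o \<Rightarrow> 'o \<Rightarrow> 'a" where
  "tens_coev C x y =
     inv_assoc C x y (rdual C y \<otimes>\<^bsub>C\<^esub> rdual C x)
       \<cdot>\<^bsub>C\<^esub> (\<i>\<^bsub>C\<^esub> x \<odot>\<^bsub>C\<^esub> assoc C y (rdual C y) (rdual C x))
       \<cdot>\<^bsub>C\<^esub> (\<i>\<^bsub>C\<^esub> x \<odot>\<^bsub>C\<^esub> (coev C y \<odot>\<^bsub>C\<^esub> \<i>\<^bsub>C\<^esub> (rdual C x)))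
       \<cdot>\<^bsub>C\<^esub> (\<i>\<^bsub>C\<^esub> x \<odot>\<^bsub>C\<^esub> inv_lunit C (rdual C x)) \<cdot>\<^bsub>C\<^esub> coev C x"

definition rdual_tens :: "('o, 'a, 'z) pivotal_cat_scheme \<Rightarrow> 'o \<Rightarrow> 'o \<Rightarrow> 'a" where
  "rdual_tens C x y =
     mate C (rdual C (x \<otimes>\<^bsub>C\<^esub> y)) (ev C (x \<otimes>\<^bsub>C\<^esub> y)) (x \<otimes>\<^bsub>C\<^esub> y) (x \<otimes>\<^bsub>C\<^esub> y)
       (rdual C y \<otimes>\<^bsub>C\<^esub> rdual C x) (tens_coev C x y) (\<i>\<^bsub>C\<^esub> (x \<otimes>\<^bsub>C\<^esub> y))"

text \<open>
  The monoidal structure of the double dual functor: the isomorphism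
  \<open>x** \<otimes> y** \<rightarrow> (y* \<otimes> x*)* \<rightarrow> (x \<otimes> y)**\<close>.
\<close>

definition ddual_tens :: "('o, 'a, 'z) pivotal_cat_scheme \<Rightarrow> 'o \<Rightarrow> 'o \<Rightarrow> 'a" where
  "ddual_tens C x y =
     dual_ar C (rdual C (x \<otimes>\<^bsub>C\<^esub> y)) (rdual C y \<otimes>\<^bsub>C\<^esub> rdual C x) (rdual_tens C x y)
       \<cdot>\<^bsub>C\<^esub> inv_ar C (rdual C (rdual C y \<otimes>\<^bsub>C\<^esub> rdual C x))
            (rdual C (rdual C x) \<otimes>\<^bsub>C\<^esub> rdual C (rdual C y)) (rdual_tens C (rdual C y) (rdual C x))"

text \<open>
  The canonical isomorphism \<open>\<one> \<rightarrow> \<one>*\<close>.  The canonical isomorphism \<open>\<one> \<rightarrow> \<one>**\<close> is its composite with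
  the inverse of its dual \<open>\<one>** \<rightarrow> \<one>*\<close>.
\<close>

definition unit_rdual :: "('o, 'a, 'z) pivotal_cat_scheme \<Rightarrow> 'a" where
  "unit_rdual C =
     mate C \<one>\<^bsub>C\<^esub> (lunit C \<one>\<^bsub>C\<^esub>) \<one>\<^bsub>C\<^esub> \<one>\<^bsub>C\<^esub> (rdual C \<one>\<^bsub>C\<^esub>) (coev C \<one>\<^bsub>C\<^esub>) (\<i>\<^bsub>C\<^esub> \<one>\<^bsub>C\<^esub>)"

definition unit_ddual :: "('o, 'a, 'z) pivotal_cat_scheme \<Rightarrow> 'a" where
  "unit_ddual C =
     inv_ar C (rdual C (rdual C \<one>\<^bsub>C\<^esub>)) (rdual C \<one>\<^bsub>C\<^esub>)
       (dual_ar C \<one>\<^bsub>C\<^esub> (rdual C \<one>\<^bsub>C\<^esub>) (unit_rdual C)) \<cdot>\<^bsub>C\<^esub> unit_rdual C"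

locale pivotal_fusion_category = fusion_category +
  assumes piv_iso: "x \<in> Ob C \<Longrightarrow> iso C x (rdual C (rdual C x)) (piv C x)"
    and piv_natural: "\<lbrakk>x \<in> Ob C; y \<in> Ob C; f \<in> Hom C x y\<rbrakk>
          \<Longrightarrow> piv C y \<cdot> f = dual_ar C (rdual C y) (rdual C x) (dual_ar C x y f) \<cdot> piv C x"
    and piv_tens: "x \<in> Ob C \<Longrightarrow> y \<in> Ob C
          \<Longrightarrow> piv C (x \<otimes> y) = ddual_tens C x y \<cdot> (piv C x \<odot> piv C y)"
    and piv_unit: "piv C \<one> = unit_ddual C"

text \<open>
  In \<open>ev\<^sub>x \<circ> (a \<odot> f) \<circ> coev'\<^sub>x\<close> with \<open>a\<close> the pivotal structure at \<open>ldual x\<close>, the target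
  \<open>rdual (rdual (ldual x))\<close> of \<open>a\<close> is identified with \<open>rdual x\<close> by the dual of the canonical
  isomorphism \<open>x \<rightarrow> rdual (ldual x)\<close>.
\<close>

definition rdual_ldual :: "('o, 'a, 'z) pivotal_cat_scheme \<Rightarrow> 'o \<Rightarrow> 'a" where
  "rdual_ldual C x =
     mate C x (evl C x) (ldual C x) (ldual C x) (rdual C (ldual C x)) (coev C (ldual C x))
       (\<i>\<^bsub>C\<^esub> (ldual C x))"

definition piv_ldual :: "('o, 'a, 'z) pivotal_cat_scheme \<Rightarrow> 'o \<Rightarrow> 'a" where
  "piv_ldual C x = dual_ar C x (rdual C (ldual C x)) (rdual_ldual C x) \<cdot>\<^bsub>C\<^esub> piv C (ldual C x)"

text \<open>As \<open>\<one>\<close> is simple, its endomorphisms are identified with the scalars.\<close>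

definition unit_scalar :: "('o, 'a, 'z) mon_cat_scheme \<Rightarrow> 'a \<Rightarrow> complex" where
  "unit_scalar C f = (THE z. f = smul C z (\<i>\<^bsub>C\<^esub> \<one>\<^bsub>C\<^esub>))"

definition left_trace :: "('o, 'a, 'z) pivotal_cat_scheme \<Rightarrow> 'o \<Rightarrow> 'a \<Rightarrow> complex" where
  "left_trace C x f = unit_scalar C (ev C x \<cdot>\<^bsub>C\<^esub> (piv_ldual C x \<odot>\<^bsub>C\<^esub> f) \<cdot>\<^bsub>C\<^esub> coevl C x)"

definition ob_dim :: "('o, 'a, 'z) pivotal_cat_scheme \<Rightarrow> 'o \<Rightarrow> complex" where
  "ob_dim C x = left_trace C x (\<i>\<^bsub>C\<^esub> x)"

definition cat_dim ::
    "('o, 'a, 'z) pivotal_cat_scheme \<Rightarrow> 'u set \<Rightarrow> ('u \<Rightarrow> 'o) \<Rightarrow> complex" where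
  "cat_dim C U c = (\<Sum>u\<in>U. complex_of_real ((cmod (ob_dim C (c u)))\<^sup>2))"


section \<open>Module categories, module traces, inner homs\<close>

text \<open>
  The action on objects and morphisms is written \<open>\<rhd>\<close> and \<open>\<unrhd>\<close>; the constraints are
  \<open>act_assoc x y m : (x \<otimes> y) \<rhd> m \<rightarrow> x \<rhd> (y \<rhd> m)\<close> and \<open>act_unit m : \<one> \<rhd> m \<rightarrow> m\<close>.
\<close>

record ('o, 'a, 'n, 'b) module_cat = "('n, 'b) lin_cat" +
  act_ob :: "'o \<Rightarrow> 'n \<Rightarrow> 'n" (infixr "\<rhd>\<index>" 75)
  act_ar :: "'a \<Rightarrow> 'b \<Rightarrow> 'b" (infixr "\<unrhd>\<index>" 75)
  act_assoc :: "'o \<Rightarrow> 'o \<Rightarrow> 'n \<Rightarrow> 'b"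
  act_unit :: "'n \<Rightarrow> 'b"

locale module_category =
  C: linear_monoidal_category C + M: semisimple_category M
  for C :: "('o, 'a::ab_group_add, 'z) mon_cat_scheme" (structure)
    and M :: "('o, 'a, 'n, 'b::ab_group_add, 'w) module_cat_scheme" (structure) +
  assumes act_ob_in_Ob: "x \<in> Ob C \<Longrightarrow> m \<in> Ob M \<Longrightarrow> x \<rhd>\<^bsub>M\<^esub> m \<in> Ob M"
    and act_in_Hom: "\<lbrakk>x \<in> Ob C; x' \<in> Ob C; m \<in> Ob M; m' \<in> Ob M;
          f \<in> Hom C x x'; g \<in> Hom M m m'\<rbrakk> \<Longrightarrow> f \<unrhd>\<^bsub>M\<^esub> g \<in> Hom M (x \<rhd>\<^bsub>M\<^esub> m) (x' \<rhd>\<^bsub>M\<^esub> m')"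
    and act_ident: "x \<in> Ob C \<Longrightarrow> m \<in> Ob M \<Longrightarrow> \<i>\<^bsub>C\<^esub> x \<unrhd>\<^bsub>M\<^esub> \<i>\<^bsub>M\<^esub> m = \<i>\<^bsub>M\<^esub> (x \<rhd>\<^bsub>M\<^esub> m)"
    and act_cmp: "\<lbrakk>x \<in> Ob C; x' \<in> Ob C; x'' \<in> Ob C; m \<in> Ob M; m' \<in> Ob M; m'' \<in> Ob M;
          f \<in> Hom C x x'; f' \<in> Hom C x' x''; g \<in> Hom M m m'; g' \<in> Hom M m' m''\<rbrakk>
          \<Longrightarrow> (f' \<cdot>\<^bsub>C\<^esub> f) \<unrhd>\<^bsub>M\<^esub> (g' \<cdot>\<^bsub>M\<^esub> g) = (f' \<unrhd>\<^bsub>M\<^esub> g') \<cdot>\<^bsub>M\<^esub> (f \<unrhd>\<^bsub>M\<^esub> g)"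
    and act_add_left: "\<lbrakk>x \<in> Ob C; x' \<in> Ob C; m \<in> Ob M; m' \<in> Ob M;
          f \<in> Hom C x x'; f' \<in> Hom C x x'; g \<in> Hom M m m'\<rbrakk>
          \<Longrightarrow> (f + f') \<unrhd>\<^bsub>M\<^esub> g = f \<unrhd>\<^bsub>M\<^esub> g + f' \<unrhd>\<^bsub>M\<^esub> g"
    and act_add_right: "\<lbrakk>x \<in> Ob C; x' \<in> Ob C; m \<in> Ob M; m' \<in> Ob M;
          f \<in> Hom C x x'; g \<in> Hom M m m'; g' \<in> Hom M m m'\<rbrakk>
          \<Longrightarrow> f \<unrhd>\<^bsub>M\<^esub> (g + g') = f \<unrhd>\<^bsub>M\<^esub> g + f \<unrhd>\<^bsub>M\<^esub> g'"
    and act_smul_left: "\<lbrakk>x \<in> Ob C; x' \<in> Ob C; m \<in> Ob M; m' \<in> Ob M;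
          f \<in> Hom C x x'; g \<in> Hom M m m'\<rbrakk> \<Longrightarrow> smul C r f \<unrhd>\<^bsub>M\<^esub> g = smul M r (f \<unrhd>\<^bsub>M\<^esub> g)"
    and act_smul_right: "\<lbrakk>x \<in> Ob C; x' \<in> Ob C; m \<in> Ob M; m' \<in> Ob M;
          f \<in> Hom C x x'; g \<in> Hom M m m'\<rbrakk> \<Longrightarrow> f \<unrhd>\<^bsub>M\<^esub> smul M r g = smul M r (f \<unrhd>\<^bsub>M\<^esub> g)"
    and act_assoc_iso: "\<lbrakk>x \<in> Ob C; y \<in> Ob C; m \<in> Ob M\<rbrakk>
          \<Longrightarrow> iso M ((x \<otimes>\<^bsub>C\<^esub> y) \<rhd>\<^bsub>M\<^esub> m) (x \<rhd>\<^bsub>M\<^esub> (y \<rhd>\<^bsub>M\<^esub> m)) (act_assoc M x y m)"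
    and act_assoc_natural: "\<lbrakk>x \<in> Ob C; x' \<in> Ob C; y \<in> Ob C; y' \<in> Ob C; m \<in> Ob M; m' \<in> Ob M;
          f \<in> Hom C x x'; f' \<in> Hom C y y'; g \<in> Hom M m m'\<rbrakk>
          \<Longrightarrow> act_assoc M x' y' m' \<cdot>\<^bsub>M\<^esub> ((f \<odot>\<^bsub>C\<^esub> f') \<unrhd>\<^bsub>M\<^esub> g)
            = (f \<unrhd>\<^bsub>M\<^esub> (f' \<unrhd>\<^bsub>M\<^esub> g)) \<cdot>\<^bsub>M\<^esub> act_assoc M x y m"
    and act_unit_iso: "m \<in> Ob M \<Longrightarrow> iso M (\<one>\<^bsub>C\<^esub> \<rhd>\<^bsub>M\<^esub> m) m (act_unit M m)"
    and act_unit_natural: "\<lbrakk>m \<in> Ob M; m' \<in> Ob M; g \<in> Hom M m m'\<rbrakk>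
          \<Longrightarrow> act_unit M m' \<cdot>\<^bsub>M\<^esub> (\<i>\<^bsub>C\<^esub> \<one>\<^bsub>C\<^esub> \<unrhd>\<^bsub>M\<^esub> g) = g \<cdot>\<^bsub>M\<^esub> act_unit M m"
    and act_pentagon: "\<lbrakk>x \<in> Ob C; y \<in> Ob C; z \<in> Ob C; m \<in> Ob M\<rbrakk>
          \<Longrightarrow> act_assoc M x y (z \<rhd>\<^bsub>M\<^esub> m) \<cdot>\<^bsub>M\<^esub> act_assoc M (x \<otimes>\<^bsub>C\<^esub> y) z m
            = (\<i>\<^bsub>C\<^esub> x \<unrhd>\<^bsub>M\<^esub> act_assoc M y z m) \<cdot>\<^bsub>M\<^esub> act_assoc M x (y \<otimes>\<^bsub>C\<^esub> z) m
                \<cdot>\<^bsub>M\<^esub> (assoc C x y z \<unrhd>\<^bsub>M\<^esub> \<i>\<^bsub>M\<^esub> m)"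
    and act_triangle: "\<lbrakk>x \<in> Ob C; m \<in> Ob M\<rbrakk>
          \<Longrightarrow> (\<i>\<^bsub>C\<^esub> x \<unrhd>\<^bsub>M\<^esub> act_unit M m) \<cdot>\<^bsub>M\<^esub> act_assoc M x \<one>\<^bsub>C\<^esub> m = runit C x \<unrhd>\<^bsub>M\<^esub> \<i>\<^bsub>M\<^esub> m"

text \<open>For \<open>f\<close> an endomorphism of \<open>x \<rhd> m\<close>, an endomorphism of \<open>m\<close>.\<close>

definition partial_trace ::
    "('o, 'a, 'z) pivotal_cat_scheme \<Rightarrow> ('o, 'a, 'n, 'b, 'w) module_cat_scheme
      \<Rightarrow> 'o \<Rightarrow> 'n \<Rightarrow> 'b \<Rightarrow> 'b" where
  "partial_trace C M x m f =
     act_unit M m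
       \<cdot>\<^bsub>M\<^esub> (ev C x \<unrhd>\<^bsub>M\<^esub> \<i>\<^bsub>M\<^esub> m)
       \<cdot>\<^bsub>M\<^esub> inv_ar M ((rdual C x \<otimes>\<^bsub>C\<^esub> x) \<rhd>\<^bsub>M\<^esub> m) (rdual C x \<rhd>\<^bsub>M\<^esub> (x \<rhd>\<^bsub>M\<^esub> m))
            (act_assoc M (rdual C x) x m)
       \<cdot>\<^bsub>M\<^esub> (piv_ldual C x \<unrhd>\<^bsub>M\<^esub> f)
       \<cdot>\<^bsub>M\<^esub> act_assoc M (ldual C x) x m
       \<cdot>\<^bsub>M\<^esub> (coevl C x \<unrhd>\<^bsub>M\<^esub> \<i>\<^bsub>M\<^esub> m)
       \<cdot>\<^bsub>M\<^esub> inv_ar M (\<one>\<^bsub>C\<^esub> \<rhd>\<^bsub>M\<^esub> m) m (act_unit M m)"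

text \<open>Only the values \<open>\<Theta> m f\<close> with \<open>m\<close> an object and \<open>f\<close> an endomorphism of \<open>m\<close> matter.\<close>

locale module_trace =
  fixes C :: "('o, 'a::ab_group_add, 'z) pivotal_cat_scheme"
    and M :: "('o, 'a, 'n, 'b::ab_group_add, 'w) module_cat_scheme"
    and \<Theta> :: "'n \<Rightarrow> 'b \<Rightarrow> complex"
  assumes trace_add: "\<lbrakk>m \<in> Ob M; f \<in> Hom M m m; g \<in> Hom M m m\<rbrakk> \<Longrightarrow> \<Theta> m (f + g) = \<Theta> m f + \<Theta> m g"
    and trace_smul: "\<lbrakk>m \<in> Ob M; f \<in> Hom M m m\<rbrakk> \<Longrightarrow> \<Theta> m (smul M r f) = r * \<Theta> m f"
    and trace_symmetric: "\<lbrakk>m \<in> Ob M; n \<in> Ob M; f \<in> Hom M m n; g \<in> Hom M n m\<rbrakk>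
          \<Longrightarrow> \<Theta> m (g \<cdot>\<^bsub>M\<^esub> f) = \<Theta> n (f \<cdot>\<^bsub>M\<^esub> g)"
    and trace_nondegenerate_left: "\<lbrakk>m \<in> Ob M; n \<in> Ob M; f \<in> Hom M m n;
          \<And>g. g \<in> Hom M n m \<Longrightarrow> \<Theta> m (g \<cdot>\<^bsub>M\<^esub> f) = 0\<rbrakk> \<Longrightarrow> f = 0"
    and trace_nondegenerate_right: "\<lbrakk>m \<in> Ob M; n \<in> Ob M; g \<in> Hom M n m;
          \<And>f. f \<in> Hom M m n \<Longrightarrow> \<Theta> m (g \<cdot>\<^bsub>M\<^esub> f) = 0\<rbrakk> \<Longrightarrow> g = 0"
    and trace_compatible: "\<lbrakk>x \<in> Ob C; m \<in> Ob M; f \<in> Hom M (x \<rhd>\<^bsub>M\<^esub> m) (x \<rhd>\<^bsub>M\<^esub> m)\<rbrakk>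
          \<Longrightarrow> \<Theta> (x \<rhd>\<^bsub>M\<^esub> m) f = \<Theta> m (partial_trace C M x m f)"

definition trace_dim ::
    "('n, 'b, 'z) lin_cat_scheme \<Rightarrow> ('n \<Rightarrow> 'b \<Rightarrow> complex) \<Rightarrow> 'n \<Rightarrow> complex" where
  "trace_dim M \<Theta> m = \<Theta> m (\<i>\<^bsub>M\<^esub> m)"

text \<open>
  For \<open>g : m' \<rightarrow> m\<close> and \<open>f : n \<rightarrow> n'\<close>, \<open>ihom_ar g f : ihom_ob m n \<rightarrow> ihom_ob m' n'\<close> is the
  action of the bifunctor; \<open>ihom_adj x m n\<close> is the bijection from the morphisms \<open>x \<rhd> m \<rightarrow> n\<close>
  to the morphisms \<open>x \<rightarrow> ihom_ob m n\<close>.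
\<close>

record ('o, 'a, 'n, 'b) inner_hom =
  ihom_ob :: "'n \<Rightarrow> 'n \<Rightarrow> 'o"
  ihom_ar :: "'b \<Rightarrow> 'b \<Rightarrow> 'a"
  ihom_adj :: "'o \<Rightarrow> 'n \<Rightarrow> 'n \<Rightarrow> 'b \<Rightarrow> 'a"

locale is_inner_hom =
  fixes C :: "('o, 'a::ab_group_add, 'z) mon_cat_scheme"
    and M :: "('o, 'a, 'n, 'b::ab_group_add, 'w) module_cat_scheme"
    and H :: "('o, 'a, 'n, 'b, 'v) inner_hom_scheme"
  assumes ihom_ob_in_Ob: "m \<in> Ob M \<Longrightarrow> n \<in> Ob M \<Longrightarrow> ihom_ob H m n \<in> Ob C"
    and ihom_ar_in_Hom: "\<lbrakk>m \<in> Ob M; m' \<in> Ob M; n \<in> Ob M; n' \<in> Ob M;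
          g \<in> Hom M m' m; f \<in> Hom M n n'\<rbrakk>
          \<Longrightarrow> ihom_ar H g f \<in> Hom C (ihom_ob H m n) (ihom_ob H m' n')"
    and ihom_ident: "\<lbrakk>m \<in> Ob M; n \<in> Ob M\<rbrakk>
          \<Longrightarrow> ihom_ar H (\<i>\<^bsub>M\<^esub> m) (\<i>\<^bsub>M\<^esub> n) = \<i>\<^bsub>C\<^esub> (ihom_ob H m n)"
    and ihom_cmp: "\<lbrakk>m \<in> Ob M; m' \<in> Ob M; m'' \<in> Ob M; n \<in> Ob M; n' \<in> Ob M; n'' \<in> Ob M;
          g \<in> Hom M m' m; g' \<in> Hom M m'' m'; f \<in> Hom M n n'; f' \<in> Hom M n' n''\<rbrakk>
          \<Longrightarrow> ihom_ar H (g \<cdot>\<^bsub>M\<^esub> g') (f' \<cdot>\<^bsub>M\<^esub> f) = ihom_ar H g' f' \<cdot>\<^bsub>C\<^esub> ihom_ar H g f"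
    and adj_bij: "\<lbrakk>x \<in> Ob C; m \<in> Ob M; n \<in> Ob M\<rbrakk>
          \<Longrightarrow> bij_betw (ihom_adj H x m n) (Hom M (x \<rhd>\<^bsub>M\<^esub> m) n) (Hom C x (ihom_ob H m n))"
    and adj_add: "\<lbrakk>x \<in> Ob C; m \<in> Ob M; n \<in> Ob M;
          k \<in> Hom M (x \<rhd>\<^bsub>M\<^esub> m) n; k' \<in> Hom M (x \<rhd>\<^bsub>M\<^esub> m) n\<rbrakk>
          \<Longrightarrow> ihom_adj H x m n (k + k') = ihom_adj H x m n k + ihom_adj H x m n k'"
    and adj_smul: "\<lbrakk>x \<in> Ob C; m \<in> Ob M; n \<in> Ob M; k \<in> Hom M (x \<rhd>\<^bsub>M\<^esub> m) n\<rbrakk>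
          \<Longrightarrow> ihom_adj H x m n (smul M r k) = smul C r (ihom_adj H x m n k)"
    and adj_natural: "\<lbrakk>x \<in> Ob C; x' \<in> Ob C; m \<in> Ob M; m' \<in> Ob M; n \<in> Ob M; n' \<in> Ob M;
          h \<in> Hom C x' x; g \<in> Hom M m' m; f \<in> Hom M n n'; k \<in> Hom M (x \<rhd>\<^bsub>M\<^esub> m) n\<rbrakk>
          \<Longrightarrow> ihom_adj H x' m' n' (f \<cdot>\<^bsub>M\<^esub> k \<cdot>\<^bsub>M\<^esub> (h \<unrhd>\<^bsub>M\<^esub> g))
            = ihom_ar H g f \<cdot>\<^bsub>C\<^esub> ihom_adj H x m n k \<cdot>\<^bsub>C\<^esub> h"

definition ihom_matrix ::
    "('o, 'a, 'z) pivotal_cat_scheme \<Rightarrow> ('o, 'a, 'n, 'b, 'v) inner_hom_scheme \<Rightarrow> ('i \<Rightarrow> 'n)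
      \<Rightarrow> 'i \<Rightarrow> 'i \<Rightarrow> complex" where
  "ihom_matrix C H m i j = ob_dim C (ihom_ob H (m j) (m i))"

text \<open>Both parts of the condition are imposed only for indices in \<open>I\<close>.\<close>

definition nonzero_eigenvector ::
    "'i set \<Rightarrow> ('i \<Rightarrow> 'i \<Rightarrow> complex) \<Rightarrow> complex \<Rightarrow> ('i \<Rightarrow> complex) \<Rightarrow> bool" where
  "nonzero_eigenvector I Q D d \<longleftrightarrow>
     (\<forall>i\<in>I. d i \<noteq> 0) \<and> (\<forall>i\<in>I. (\<Sum>j\<in>I. Q i j * d j) = D * d i)"

definition trace_of_vector ::
    "('o, 'a, 'z) pivotal_cat_scheme \<Rightarrow> ('n, 'b, 'w) lin_cat_scheme
      \<Rightarrow> ('o, 'a, 'n, 'b, 'v) inner_hom_scheme \<Rightarrow> complex \<Rightarrow> 'i set \<Rightarrow> ('i \<Rightarrow> 'n)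
      \<Rightarrow> ('i \<Rightarrow> complex) \<Rightarrow> 'n \<Rightarrow> 'b \<Rightarrow> complex" where
  "trace_of_vector C M H D I m d n f =
     1 / D * (\<Sum>i\<in>I. left_trace C (ihom_ob H (m i) n) (ihom_ar H (\<i>\<^bsub>M\<^esub> (m i)) f) * d i)"

end

theory Submission
  imports Defs "HOL-Computational_Algebra.Fundamental_Theorem_Algebra"
begin

text \<open>
  Write \<open>F i n\<close> for the inner hom from the simple object \<open>m i\<close> to \<open>n\<close>, \<open>D\<close> for the dimension of the
  category \<open>C\<close>, and \<open>x*\<close> for the right dual of \<open>x\<close>.

  From a module trace to an eigenvector.  The entry \<open>Q i j\<close> is the dimension of \<open>F j (m i)\<close>, in which
  the simple object \<open>c u\<close> occurs with multiplicity \<open>dim Hom (c u \<rhd> m j) (m i)\<close>.  By semisimplicity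
  and duality this is the multiplicity of \<open>m j\<close> in \<open>(c u)* \<rhd> m i\<close>.  Summing over \<open>j\<close> with weights
  \<open>d j\<close> therefore gives the trace dimension of \<open>(c u)* \<rhd> m i\<close>, which by compatibility is
  \<open>dim (c u)* \<cdot> d i\<close>.  Since the dimension of \<open>x*\<close> is the complex conjugate of that of \<open>x\<close>
  (\<open>ob_dim_rdual\<close>), the remaining sum over \<open>u\<close> is \<open>D \<cdot> d i\<close>; this is
  \<open>eigenvector_of_module_trace\<close>.

  From an eigenvector to a module trace.  A linear symmetric trace on a semisimple category over the
  complex numbers is determined by its values on the identities of the simple objects
  (\<open>symmetric_trace_eqI\<close>), and it is non-degenerate if these are not zero
  (\<open>symmetric_trace_nondegenerate\<close>).  The pivotal trace is symmetric, hence so is the trace built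
  from \<open>d\<close>, and by the eigenvector equation its value on \<open>m j\<close> is \<open>d j\<close>; division by \<open>D\<close> is possible
  because simple objects have non-zero dimension (\<open>ob_dim_simple_nonzero\<close>).  This also shows that the
  two constructions are mutually inverse.  Compatibility with the action is a statement about
  each \<open>F i\<close> separately (\<open>trace_ar_\<F>_compatible\<close>): the functor \<open>F i\<close> is right adjoint to the module
  functor \<open>x \<mapsto> x \<rhd> m i\<close>, so by rigidity it is itself a module functor, \<open>F i (x \<rhd> n) \<cong> x \<otimes> F i n\<close>
  (\<open>\<phi>_iso\<close>).  Hence it preserves partial traces over \<open>x\<close> (\<open>\<F>_ptrace\<close>), and the pivotal trace over
  \<open>x \<otimes> y\<close> is the trace over \<open>y\<close> of the partial trace over \<open>x\<close> (\<open>trace_ar_tens\<close>), which is where the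
  monoidality of the pivotal structure is used.

  The categories are not strict.  Their coherence isomorphisms are handled through one device: for a
  dual pair \<open>x, x*\<close>, transposition is a bijection \<open>Hom (x* \<rhd> p) q \<cong> Hom p (x \<rhd> q)\<close>
  (\<open>uncurry_curry\<close>, \<open>curry_uncurry\<close>).  Transposing along a tensor product is transposing twice
  (\<open>curry_nest\<close>, \<open>uncurry_nest\<close>), so tensor products of dual pairs are dual pairs, and the double
  duals, canonical isomorphisms and mates in the definition of the pivotal trace are thereafter
  characterised by equations between evaluations instead of by formulas.
\<close>

section \<open>Categories of typed arrows\<close>

text \<open>
  The given categories have bare morphisms, so an equation between composites does not determine
  the objects involved.  An arrow that carries its source and target makes these side conditions
  computable by rewriting: source and target of a composite or a tensor product are given by
  unconditional equations, and only \<open>arr\<close> has to be checked.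
\<close>

datatype ('o, 'a) arrow = Arr (src: 'o) (tgt: 'o) (ar: 'a)

locale typed_category =
  fixes ob :: "'o \<Rightarrow> bool" and arr :: "('o, 'a) arrow \<Rightarrow> bool"
    and idn :: "'o \<Rightarrow> ('o, 'a) arrow"
    and comp :: "('o, 'a) arrow \<Rightarrow> ('o, 'a) arrow \<Rightarrow> ('o, 'a) arrow" (infixr "\<star>" 60)
  assumes src_comp [simp]: "src (g \<star> f) = src f"
    and tgt_comp [simp]: "tgt (g \<star> f) = tgt g"
    and src_idn [simp]: "src (idn x) = x"
    and tgt_idn [simp]: "tgt (idn x) = x"
    and ob_src [simp]: "arr f \<Longrightarrow> ob (src f)"
    and ob_tgt [simp]: "arr f \<Longrightarrow> ob (tgt f)"
    and arr_idn [simp]: "ob x \<Longrightarrow> arr (idn x)"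
    and arr_comp [simp]: "\<lbrakk>arr g; arr f; src g = tgt f\<rbrakk> \<Longrightarrow> arr (g \<star> f)"
    and idn_comp [simp]: "\<lbrakk>arr f; tgt f = x\<rbrakk> \<Longrightarrow> idn x \<star> f = f"
    and comp_idn [simp]: "\<lbrakk>arr f; src f = x\<rbrakk> \<Longrightarrow> f \<star> idn x = f"
    and comp_assoc: "\<lbrakk>arr h; arr g; arr f; src h = tgt g; src g = tgt f\<rbrakk>
          \<Longrightarrow> (h \<star> g) \<star> f = h \<star> (g \<star> f)"
begin

abbreviation hom :: "('o, 'a) arrow \<Rightarrow> 'o \<Rightarrow> 'o \<Rightarrow> bool" where
  "hom f x y \<equiv> arr f \<and> src f = x \<and> tgt f = y"

text \<open>
  All composites are kept right-nested.  This rule turns an equation for two adjacent factors into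
  one that rewrites them in front of a longer composite.
\<close>

lemma comp_nest:
  assumes "g \<star> f = h" "arr g" "arr f" "src g = tgt f" "arr k" "tgt k = src f"
  shows "g \<star> (f \<star> k) = h \<star> k"
  using assms comp_assoc[of g f k] by auto

lemma mono_of_retraction:
  assumes "g \<star> f = idn x" "arr f" "arr g" "src f = x" "src g = tgt f"
    "arr h" "arr k" "tgt h = x" "tgt k = x" "f \<star> h = f \<star> k"
  shows "h = k"
proof -
  have "h = (g \<star> f) \<star> h" using assms(1,6,8) by simp
  also have "\<dots> = g \<star> (f \<star> h)" by (rule comp_assoc) (use assms(2-9) in simp_all)
  also have "\<dots> = (g \<star> f) \<star> k"
    unfolding assms(10) by (rule comp_assoc[symmetric]) (use assms(2-9) in simp_all)
  also have "\<dots> = k" using assms(1,7,9) by simp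
  finally show ?thesis .
qed

lemma epi_of_section:
  assumes "f \<star> g = idn y" "arr f" "arr g" "tgt f = y" "src f = tgt g"
    "arr h" "arr k" "src h = y" "src k = y" "h \<star> f = k \<star> f"
  shows "h = k"
proof -
  have "h = h \<star> (f \<star> g)" using assms(1,6,8) by simp
  also have "\<dots> = (h \<star> f) \<star> g" by (rule comp_assoc[symmetric]) (use assms(2-9) in simp_all)
  also have "\<dots> = k \<star> (f \<star> g)"
    unfolding assms(10) by (rule comp_assoc) (use assms(2-9) in simp_all)
  also have "\<dots> = k" using assms(1,7,9) by simp
  finally show ?thesis .
qed

end

locale typed_monoidal = typed_category ob arr idn comp
  for ob :: "'o \<Rightarrow> bool" and arr :: "('o, 'a) arrow \<Rightarrow> bool"
    and idn :: "'o \<Rightarrow> ('o, 'a) arrow"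
    and comp :: "('o, 'a) arrow \<Rightarrow> ('o, 'a) arrow \<Rightarrow> ('o, 'a) arrow" (infixr "\<star>" 60) +
  fixes tensO :: "'o \<Rightarrow> 'o \<Rightarrow> 'o" (infixr "\<otimes>\<^sub>o" 75)
    and tens :: "('o, 'a) arrow \<Rightarrow> ('o, 'a) arrow \<Rightarrow> ('o, 'a) arrow" (infixr "\<boxtimes>" 75)
    and unit :: 'o
    and \<alpha> \<alpha>' :: "'o \<Rightarrow> 'o \<Rightarrow> 'o \<Rightarrow> ('o, 'a) arrow"
    and \<l> \<l>' \<r> \<r>' :: "'o \<Rightarrow> ('o, 'a) arrow"
  assumes ob_unit [simp]: "ob unit"
    and ob_tens [simp]: "ob x \<Longrightarrow> ob y \<Longrightarrow> ob (x \<otimes>\<^sub>o y)"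
    and src_tens [simp]: "src (f \<boxtimes> g) = src f \<otimes>\<^sub>o src g"
    and tgt_tens [simp]: "tgt (f \<boxtimes> g) = tgt f \<otimes>\<^sub>o tgt g"
    and arr_tens [simp]: "arr f \<Longrightarrow> arr g \<Longrightarrow> arr (f \<boxtimes> g)"
    and tens_idn [simp]: "ob x \<Longrightarrow> ob y \<Longrightarrow> idn x \<boxtimes> idn y = idn (x \<otimes>\<^sub>o y)"
    and tens_comp: "\<lbrakk>arr f; arr f'; arr g; arr g'; src f' = tgt f; src g' = tgt g\<rbrakk>
          \<Longrightarrow> (f' \<star> f) \<boxtimes> (g' \<star> g) = (f' \<boxtimes> g') \<star> (f \<boxtimes> g)"
    and src_\<alpha> [simp]: "src (\<alpha> x y z) = (x \<otimes>\<^sub>o y) \<otimes>\<^sub>o z"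
    and tgt_\<alpha> [simp]: "tgt (\<alpha> x y z) = x \<otimes>\<^sub>o (y \<otimes>\<^sub>o z)"
    and src_\<alpha>' [simp]: "src (\<alpha>' x y z) = x \<otimes>\<^sub>o (y \<otimes>\<^sub>o z)"
    and tgt_\<alpha>' [simp]: "tgt (\<alpha>' x y z) = (x \<otimes>\<^sub>o y) \<otimes>\<^sub>o z"
    and src_\<l> [simp]: "src (\<l> x) = unit \<otimes>\<^sub>o x" and tgt_\<l> [simp]: "tgt (\<l> x) = x"
    and src_\<l>' [simp]: "src (\<l>' x) = x" and tgt_\<l>' [simp]: "tgt (\<l>' x) = unit \<otimes>\<^sub>o x"
    and src_\<r> [simp]: "src (\<r> x) = x \<otimes>\<^sub>o unit" and tgt_\<r> [simp]: "tgt (\<r> x) = x"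
    and src_\<r>' [simp]: "src (\<r>' x) = x" and tgt_\<r>' [simp]: "tgt (\<r>' x) = x \<otimes>\<^sub>o unit"
    and arr_\<alpha> [simp]: "\<lbrakk>ob x; ob y; ob z\<rbrakk> \<Longrightarrow> arr (\<alpha> x y z)"
    and arr_\<alpha>' [simp]: "\<lbrakk>ob x; ob y; ob z\<rbrakk> \<Longrightarrow> arr (\<alpha>' x y z)"
    and arr_\<l> [simp]: "ob x \<Longrightarrow> arr (\<l> x)" and arr_\<l>' [simp]: "ob x \<Longrightarrow> arr (\<l>' x)"
    and arr_\<r> [simp]: "ob x \<Longrightarrow> arr (\<r> x)" and arr_\<r>' [simp]: "ob x \<Longrightarrow> arr (\<r>' x)"
    and \<alpha>_\<alpha>' [simp]: "\<lbrakk>ob x; ob y; ob z\<rbrakk> \<Longrightarrow> \<alpha> x y z \<star> \<alpha>' x y z = idn (x \<otimes>\<^sub>o (y \<otimes>\<^sub>o z))"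
    and \<alpha>'_\<alpha> [simp]: "\<lbrakk>ob x; ob y; ob z\<rbrakk> \<Longrightarrow> \<alpha>' x y z \<star> \<alpha> x y z = idn ((x \<otimes>\<^sub>o y) \<otimes>\<^sub>o z)"
    and \<l>_\<l>' [simp]: "ob x \<Longrightarrow> \<l> x \<star> \<l>' x = idn x"
    and \<l>'_\<l> [simp]: "ob x \<Longrightarrow> \<l>' x \<star> \<l> x = idn (unit \<otimes>\<^sub>o x)"
    and \<r>_\<r>' [simp]: "ob x \<Longrightarrow> \<r> x \<star> \<r>' x = idn x"
    and \<r>'_\<r> [simp]: "ob x \<Longrightarrow> \<r>' x \<star> \<r> x = idn (x \<otimes>\<^sub>o unit)"
    and \<alpha>_nat: "\<lbrakk>arr f; arr g; arr h; tgt f = x; tgt g = y; tgt h = z\<rbrakk>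
          \<Longrightarrow> \<alpha> x y z \<star> ((f \<boxtimes> g) \<boxtimes> h) = (f \<boxtimes> (g \<boxtimes> h)) \<star> \<alpha> (src f) (src g) (src h)"
    and \<l>_nat: "\<lbrakk>arr f; tgt f = y\<rbrakk> \<Longrightarrow> \<l> y \<star> (idn unit \<boxtimes> f) = f \<star> \<l> (src f)"
    and \<r>_nat: "\<lbrakk>arr f; tgt f = y\<rbrakk> \<Longrightarrow> \<r> y \<star> (f \<boxtimes> idn unit) = f \<star> \<r> (src f)"
    and pentagon: "\<lbrakk>ob w; ob x; ob y; ob z\<rbrakk> \<Longrightarrow> \<alpha> w x (y \<otimes>\<^sub>o z) \<star> \<alpha> (w \<otimes>\<^sub>o x) y z
            = (idn w \<boxtimes> \<alpha> x y z) \<star> \<alpha> w (x \<otimes>\<^sub>o y) z \<star> (\<alpha> w x y \<boxtimes> idn z)"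
    and triangle: "\<lbrakk>ob x; ob y\<rbrakk> \<Longrightarrow> (idn x \<boxtimes> \<l> y) \<star> \<alpha> x unit y = \<r> x \<boxtimes> idn y"

text \<open>
  The monoidal category itself is an instance, its regular module \<open>reg\<close>, so that whatever is proved
  about the action \<open>\<rhd>\<^sub>a\<close> is available for \<open>\<boxtimes>\<close>.
\<close>

locale typed_module =
  typed_monoidal ob arr idn comp tensO tens unit \<alpha> \<alpha>' \<l> \<l>' \<r> \<r>' +
  M: typed_category obM arrM idM compM
  for ob :: "'o \<Rightarrow> bool" and arr :: "('o, 'a) arrow \<Rightarrow> bool"
    and idn :: "'o \<Rightarrow> ('o, 'a) arrow"
    and comp :: "('o, 'a) arrow \<Rightarrow> ('o, 'a) arrow \<Rightarrow> ('o, 'a) arrow" (infixr "\<star>" 60)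
    and tensO :: "'o \<Rightarrow> 'o \<Rightarrow> 'o" (infixr "\<otimes>\<^sub>o" 75)
    and tens :: "('o, 'a) arrow \<Rightarrow> ('o, 'a) arrow \<Rightarrow> ('o, 'a) arrow" (infixr "\<boxtimes>" 75)
    and unit :: 'o
    and \<alpha> \<alpha>' :: "'o \<Rightarrow> 'o \<Rightarrow> 'o \<Rightarrow> ('o, 'a) arrow"
    and \<l> \<l>' \<r> \<r>' :: "'o \<Rightarrow> ('o, 'a) arrow"
    and obM :: "'n \<Rightarrow> bool" and arrM :: "('n, 'b) arrow \<Rightarrow> bool"
    and idM :: "'n \<Rightarrow> ('n, 'b) arrow"
    and compM :: "('n, 'b) arrow \<Rightarrow> ('n, 'b) arrow \<Rightarrow> ('n, 'b) arrow" (infixr "\<bullet>" 60) +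
  fixes actO :: "'o \<Rightarrow> 'n \<Rightarrow> 'n" (infixr "\<rhd>\<^sub>o" 75)
    and act :: "('o, 'a) arrow \<Rightarrow> ('n, 'b) arrow \<Rightarrow> ('n, 'b) arrow" (infixr "\<rhd>\<^sub>a" 75)
    and \<beta> \<beta>' :: "'o \<Rightarrow> 'o \<Rightarrow> 'n \<Rightarrow> ('n, 'b) arrow"
    and \<u> \<u>' :: "'n \<Rightarrow> ('n, 'b) arrow"
  assumes ob_act [simp]: "ob x \<Longrightarrow> obM p \<Longrightarrow> obM (x \<rhd>\<^sub>o p)"
    and src_act [simp]: "src (f \<rhd>\<^sub>a k) = src f \<rhd>\<^sub>o src k"
    and tgt_act [simp]: "tgt (f \<rhd>\<^sub>a k) = tgt f \<rhd>\<^sub>o tgt k"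
    and arr_act [simp]: "arr f \<Longrightarrow> arrM k \<Longrightarrow> arrM (f \<rhd>\<^sub>a k)"
    and act_idn [simp]: "ob x \<Longrightarrow> obM p \<Longrightarrow> idn x \<rhd>\<^sub>a idM p = idM (x \<rhd>\<^sub>o p)"
    and act_comp: "\<lbrakk>arr f; arr f'; arrM k; arrM k'; src f' = tgt f; src k' = tgt k\<rbrakk>
          \<Longrightarrow> (f' \<star> f) \<rhd>\<^sub>a (k' \<bullet> k) = (f' \<rhd>\<^sub>a k') \<bullet> (f \<rhd>\<^sub>a k)"
    and src_\<beta> [simp]: "src (\<beta> x y p) = (x \<otimes>\<^sub>o y) \<rhd>\<^sub>o p"
    and tgt_\<beta> [simp]: "tgt (\<beta> x y p) = x \<rhd>\<^sub>o (y \<rhd>\<^sub>o p)"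
    and src_\<beta>' [simp]: "src (\<beta>' x y p) = x \<rhd>\<^sub>o (y \<rhd>\<^sub>o p)"
    and tgt_\<beta>' [simp]: "tgt (\<beta>' x y p) = (x \<otimes>\<^sub>o y) \<rhd>\<^sub>o p"
    and src_\<u> [simp]: "src (\<u> p) = unit \<rhd>\<^sub>o p" and tgt_\<u> [simp]: "tgt (\<u> p) = p"
    and src_\<u>' [simp]: "src (\<u>' p) = p" and tgt_\<u>' [simp]: "tgt (\<u>' p) = unit \<rhd>\<^sub>o p"
    and arr_\<beta> [simp]: "\<lbrakk>ob x; ob y; obM p\<rbrakk> \<Longrightarrow> arrM (\<beta> x y p)"
    and arr_\<beta>' [simp]: "\<lbrakk>ob x; ob y; obM p\<rbrakk> \<Longrightarrow> arrM (\<beta>' x y p)"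
    and arr_\<u> [simp]: "obM p \<Longrightarrow> arrM (\<u> p)" and arr_\<u>' [simp]: "obM p \<Longrightarrow> arrM (\<u>' p)"
    and \<beta>_\<beta>' [simp]: "\<lbrakk>ob x; ob y; obM p\<rbrakk> \<Longrightarrow> \<beta> x y p \<bullet> \<beta>' x y p = idM (x \<rhd>\<^sub>o (y \<rhd>\<^sub>o p))"
    and \<beta>'_\<beta> [simp]: "\<lbrakk>ob x; ob y; obM p\<rbrakk> \<Longrightarrow> \<beta>' x y p \<bullet> \<beta> x y p = idM ((x \<otimes>\<^sub>o y) \<rhd>\<^sub>o p)"
    and \<u>_\<u>' [simp]: "obM p \<Longrightarrow> \<u> p \<bullet> \<u>' p = idM p"
    and \<u>'_\<u> [simp]: "obM p \<Longrightarrow> \<u>' p \<bullet> \<u> p = idM (unit \<rhd>\<^sub>o p)"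
    and \<beta>_nat: "\<lbrakk>arr f; arr g; arrM k; tgt f = x; tgt g = y; tgt k = p\<rbrakk>
          \<Longrightarrow> \<beta> x y p \<bullet> ((f \<boxtimes> g) \<rhd>\<^sub>a k) = (f \<rhd>\<^sub>a (g \<rhd>\<^sub>a k)) \<bullet> \<beta> (src f) (src g) (src k)"
    and \<u>_nat: "\<lbrakk>arrM k; tgt k = p\<rbrakk> \<Longrightarrow> \<u> p \<bullet> (idn unit \<rhd>\<^sub>a k) = k \<bullet> \<u> (src k)"
    and act_pentagon: "\<lbrakk>ob x; ob y; ob z; obM p\<rbrakk> \<Longrightarrow> \<beta> x y (z \<rhd>\<^sub>o p) \<bullet> \<beta> (x \<otimes>\<^sub>o y) z p
            = (idn x \<rhd>\<^sub>a \<beta> y z p) \<bullet> \<beta> x (y \<otimes>\<^sub>o z) p \<bullet> (\<alpha> x y z \<rhd>\<^sub>a idM p)"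
    and act_triangle: "\<lbrakk>ob x; obM p\<rbrakk> \<Longrightarrow> (idn x \<rhd>\<^sub>a \<u> p) \<bullet> \<beta> x unit p = \<r> x \<rhd>\<^sub>a idM p"
begin

lemma whisker_left:
  "\<lbrakk>ob x; arrM g; arrM f; src g = tgt f\<rbrakk>
    \<Longrightarrow> idn x \<rhd>\<^sub>a (g \<bullet> f) = (idn x \<rhd>\<^sub>a g) \<bullet> (idn x \<rhd>\<^sub>a f)"
  using act_comp[of "idn x" "idn x" f g] by simp

lemma whisker_right:
  "\<lbrakk>obM p; arr g; arr f; src g = tgt f\<rbrakk>
    \<Longrightarrow> (g \<star> f) \<rhd>\<^sub>a idM p = (g \<rhd>\<^sub>a idM p) \<bullet> (f \<rhd>\<^sub>a idM p)"
  using act_comp[of f g "idM p" "idM p"] by simp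

lemma interchange:
  "\<lbrakk>arr f; arrM g; src f = x; tgt f = x'; src g = p; tgt g = p'\<rbrakk>
    \<Longrightarrow> (f \<rhd>\<^sub>a idM p') \<bullet> (idn x \<rhd>\<^sub>a g) = (idn x' \<rhd>\<^sub>a g) \<bullet> (f \<rhd>\<^sub>a idM p)"
  using act_comp[of "idn x" f g "idM p'"] act_comp[of f "idn x'" "idM p" g] by auto

lemma \<beta>_cancel_right:
  assumes "ob x" "ob y" "obM p" "arrM h" "arrM k" "src h = x \<rhd>\<^sub>o (y \<rhd>\<^sub>o p)" "src k = x \<rhd>\<^sub>o (y \<rhd>\<^sub>o p)"
    "h \<bullet> \<beta> x y p = k \<bullet> \<beta> x y p"
  shows "h = k"
  by (rule M.epi_of_section[of "\<beta> x y p" "\<beta>' x y p"]) (use assms in simp_all)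

lemma \<beta>_cancel_left:
  assumes "ob x" "ob y" "obM p" "arrM h" "arrM k" "tgt h = (x \<otimes>\<^sub>o y) \<rhd>\<^sub>o p" "tgt k = (x \<otimes>\<^sub>o y) \<rhd>\<^sub>o p"
    "\<beta> x y p \<bullet> h = \<beta> x y p \<bullet> k"
  shows "h = k"
  by (rule M.mono_of_retraction[of "\<beta>' x y p" "\<beta> x y p"]) (use assms in simp_all)

lemma \<beta>'_nat:
  assumes "arr f" "arr g" "arrM h" "tgt f = x" "tgt g = y" "tgt h = p"
  shows "\<beta>' x y p \<bullet> (f \<rhd>\<^sub>a (g \<rhd>\<^sub>a h)) = ((f \<boxtimes> g) \<rhd>\<^sub>a h) \<bullet> \<beta>' (src f) (src g) (src h)"
proof (rule \<beta>_cancel_left[of x y p])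
  have *: "ob x" "ob y" "obM p" using assms by auto
  show "\<beta> x y p \<bullet> \<beta>' x y p \<bullet> (f \<rhd>\<^sub>a (g \<rhd>\<^sub>a h))
      = \<beta> x y p \<bullet> ((f \<boxtimes> g) \<rhd>\<^sub>a h) \<bullet> \<beta>' (src f) (src g) (src h)"
    using assms * by (simp add: M.comp_nest[OF \<beta>_\<beta>'] M.comp_nest[OF \<beta>_nat] M.comp_assoc)
qed (use assms in auto)

end


sublocale typed_monoidal \<subseteq> reg: typed_module ob arr idn comp tensO tens unit \<alpha> \<alpha>' \<l> \<l>' \<r> \<r>'
    ob arr idn comp tensO tens \<alpha> \<alpha>' \<l> \<l>'
  by unfold_locales
    ((rule tens_comp \<alpha>_nat \<l>_nat pentagon triangle; assumption) | (simp; fail))+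

section \<open>Unit coherence and transposition along a dual pair\<close>

context typed_module
begin

lemma unit_act_faithful:
  assumes "arrM g" "arrM h" "src g = src h" "tgt g = tgt h" "idn unit \<rhd>\<^sub>a g = idn unit \<rhd>\<^sub>a h"
  shows "g = h"
proof (rule M.epi_of_section)
  show "\<u> (src g) \<bullet> \<u>' (src g) = idM (src g)" using assms by simp
  have "g \<bullet> \<u> (src g) = \<u> (tgt g) \<bullet> (idn unit \<rhd>\<^sub>a g)" using assms \<u>_nat[of g] by simp
  also have "\<dots> = h \<bullet> \<u> (src g)" unfolding assms(5) using assms \<u>_nat[of h] by simp
  finally show "g \<bullet> \<u> (src g) = h \<bullet> \<u> (src g)" .
qed (use assms in simp_all)

text \<open>
  Kelly's argument: after whiskering with the unit, which is faithful, both sides become equal by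
  the pentagon and the two triangles.
\<close>

lemma unit_act_\<beta>:
  assumes x: "ob x" and p: "obM p"
  shows "\<u> (x \<rhd>\<^sub>o p) \<bullet> \<beta> unit x p = \<l> x \<rhd>\<^sub>a idM p"
proof (rule unit_act_faithful)
  note [simp] = x p
  let ?L = "idn unit \<rhd>\<^sub>a (\<u> (x \<rhd>\<^sub>o p) \<bullet> \<beta> unit x p)"
  let ?R = "idn unit \<rhd>\<^sub>a (\<l> x \<rhd>\<^sub>a idM p)"
  let ?b = "\<beta> unit (unit \<otimes>\<^sub>o x) p" and ?a = "\<alpha> unit unit x \<rhd>\<^sub>a idM p"
  have "?L \<bullet> ?b \<bullet> ?a = (idn unit \<rhd>\<^sub>a \<u> (x \<rhd>\<^sub>o p)) \<bullet> (idn unit \<rhd>\<^sub>a \<beta> unit x p) \<bullet> ?b \<bullet> ?a"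
    by (simp add: whisker_left M.comp_assoc)
  also have "\<dots> = (idn unit \<rhd>\<^sub>a \<u> (x \<rhd>\<^sub>o p)) \<bullet> \<beta> unit unit (x \<rhd>\<^sub>o p) \<bullet> \<beta> (unit \<otimes>\<^sub>o unit) x p"
    by (simp add: act_pentagon)
  also have "\<dots> = (\<r> unit \<rhd>\<^sub>a idM (x \<rhd>\<^sub>o p)) \<bullet> \<beta> (unit \<otimes>\<^sub>o unit) x p"
    by (simp add: M.comp_nest[OF act_triangle])
  also have "\<dots> = \<beta> unit x p \<bullet> ((\<r> unit \<boxtimes> idn x) \<rhd>\<^sub>a idM p)"
    by (simp add: \<beta>_nat)
  also have "\<dots> = \<beta> unit x p \<bullet> ((idn unit \<boxtimes> \<l> x) \<rhd>\<^sub>a idM p) \<bullet> ?a"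
    by (simp add: triangle[symmetric] whisker_right)
  also have "\<dots> = ?R \<bullet> ?b \<bullet> ?a"
    by (simp add: M.comp_nest[OF \<beta>_nat] M.comp_assoc)
  finally have *: "?L \<bullet> ?b \<bullet> ?a = ?R \<bullet> ?b \<bullet> ?a" .
  have a: "?a \<bullet> (\<alpha>' unit unit x \<rhd>\<^sub>a idM p) = idM ((unit \<otimes>\<^sub>o (unit \<otimes>\<^sub>o x)) \<rhd>\<^sub>o p)"
    by (simp flip: whisker_right)
  show "?L = ?R"
    by (rule \<beta>_cancel_right[of unit "unit \<otimes>\<^sub>o x" p], simp_all,
      rule M.epi_of_section[OF a]) (use * in \<open>simp_all add: M.comp_assoc\<close>)
qed (use assms in simp_all)

lemma \<beta>'_unit_act:
  assumes x: "ob x" and p: "obM p"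
  shows "\<beta>' x unit p \<bullet> (idn x \<rhd>\<^sub>a \<u>' p) = \<r>' x \<rhd>\<^sub>a idM p"
proof (rule M.mono_of_retraction)
  note [simp] = x p
  show "(\<r>' x \<rhd>\<^sub>a idM p) \<bullet> (\<r> x \<rhd>\<^sub>a idM p) = idM ((x \<otimes>\<^sub>o unit) \<rhd>\<^sub>o p)"
    by (simp flip: whisker_right)
  have "(\<r> x \<rhd>\<^sub>a idM p) \<bullet> \<beta>' x unit p \<bullet> (idn x \<rhd>\<^sub>a \<u>' p) = (idn x \<rhd>\<^sub>a \<u> p) \<bullet> (idn x \<rhd>\<^sub>a \<u>' p)"
    by (simp add: act_triangle[symmetric] M.comp_assoc M.comp_nest[OF \<beta>_\<beta>'])
  then show "(\<r> x \<rhd>\<^sub>a idM p) \<bullet> \<beta>' x unit p \<bullet> (idn x \<rhd>\<^sub>a \<u>' p) = (\<r> x \<rhd>\<^sub>a idM p) \<bullet> (\<r>' x \<rhd>\<^sub>a idM p)"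
    by (simp flip: whisker_right whisker_left)
qed (use assms in simp_all)

lemma act_pentagon':
  assumes "ob x" "ob y" "ob z" "obM p"
  shows "\<beta>' x y (z \<rhd>\<^sub>o p) \<bullet> (idn x \<rhd>\<^sub>a \<beta> y z p)
    = \<beta> (x \<otimes>\<^sub>o y) z p \<bullet> (\<alpha>' x y z \<rhd>\<^sub>a idM p) \<bullet> \<beta>' x (y \<otimes>\<^sub>o z) p"
proof (rule \<beta>_cancel_left[of x y "z \<rhd>\<^sub>o p"])
  note [simp] = assms
  have "(\<alpha> x y z \<rhd>\<^sub>a idM p) \<bullet> (\<alpha>' x y z \<rhd>\<^sub>a idM p) = idM ((x \<otimes>\<^sub>o y \<otimes>\<^sub>o z) \<rhd>\<^sub>o p)"
    by (simp flip: whisker_right)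
  then show "\<beta> x y (z \<rhd>\<^sub>o p) \<bullet> \<beta>' x y (z \<rhd>\<^sub>o p) \<bullet> (idn x \<rhd>\<^sub>a \<beta> y z p)
    = \<beta> x y (z \<rhd>\<^sub>o p) \<bullet> \<beta> (x \<otimes>\<^sub>o y) z p \<bullet> (\<alpha>' x y z \<rhd>\<^sub>a idM p) \<bullet> \<beta>' x (y \<otimes>\<^sub>o z) p"
    by (simp add: M.comp_nest[OF \<beta>_\<beta>'] M.comp_nest[OF act_pentagon] M.comp_assoc
        M.comp_nest[of "\<alpha> x y z \<rhd>\<^sub>a idM p" "\<alpha>' x y z \<rhd>\<^sub>a idM p"])
qed (use assms in simp_all)

lemma act_pentagon'':
  assumes "ob x" "ob y" "ob z" "obM p"
  shows "(idn x \<rhd>\<^sub>a \<beta>' y z p) \<bullet> \<beta> x y (z \<rhd>\<^sub>o p)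
    = \<beta> x (y \<otimes>\<^sub>o z) p \<bullet> (\<alpha> x y z \<rhd>\<^sub>a idM p) \<bullet> \<beta>' (x \<otimes>\<^sub>o y) z p"
proof (rule \<beta>_cancel_right[of "x \<otimes>\<^sub>o y" z p])
  note [simp] = assms
  have "(idn x \<rhd>\<^sub>a \<beta>' y z p) \<bullet> (idn x \<rhd>\<^sub>a \<beta> y z p) = idM (x \<rhd>\<^sub>o (y \<otimes>\<^sub>o z) \<rhd>\<^sub>o p)"
    by (simp flip: whisker_left)
  then show "((idn x \<rhd>\<^sub>a \<beta>' y z p) \<bullet> \<beta> x y (z \<rhd>\<^sub>o p)) \<bullet> \<beta> (x \<otimes>\<^sub>o y) z p
    = (\<beta> x (y \<otimes>\<^sub>o z) p \<bullet> (\<alpha> x y z \<rhd>\<^sub>a idM p) \<bullet> \<beta>' (x \<otimes>\<^sub>o y) z p) \<bullet> \<beta> (x \<otimes>\<^sub>o y) z p"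
    by (simp add: M.comp_assoc act_pentagon
        M.comp_nest[of "idn x \<rhd>\<^sub>a \<beta>' y z p" "idn x \<rhd>\<^sub>a \<beta> y z p"])
qed (use assms in simp_all)

lemma \<beta>'_unit:
  assumes x: "ob x" and p: "obM p"
  shows "\<beta>' unit x p \<bullet> \<u>' (x \<rhd>\<^sub>o p) = \<l>' x \<rhd>\<^sub>a idM p"
proof (rule M.mono_of_retraction)
  note [simp] = x p
  show "(\<l>' x \<rhd>\<^sub>a idM p) \<bullet> (\<l> x \<rhd>\<^sub>a idM p) = idM ((unit \<otimes>\<^sub>o x) \<rhd>\<^sub>o p)"
    by (simp flip: whisker_right)
  have "(\<l> x \<rhd>\<^sub>a idM p) \<bullet> \<beta>' unit x p \<bullet> \<u>' (x \<rhd>\<^sub>o p) = idM (x \<rhd>\<^sub>o p)"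
    by (simp add: unit_act_\<beta>[symmetric] M.comp_assoc M.comp_nest[OF \<beta>_\<beta>'])
  then show "(\<l> x \<rhd>\<^sub>a idM p) \<bullet> \<beta>' unit x p \<bullet> \<u>' (x \<rhd>\<^sub>o p)
      = (\<l> x \<rhd>\<^sub>a idM p) \<bullet> (\<l>' x \<rhd>\<^sub>a idM p)"
    by (simp flip: whisker_right)
qed (use assms in simp_all)

lemma \<u>'_nat:
  assumes "arrM k" "src k = p"
  shows "(idn unit \<rhd>\<^sub>a k) \<bullet> \<u>' p = \<u>' (tgt k) \<bullet> k"
proof (rule M.mono_of_retraction)
  show "\<u>' (tgt k) \<bullet> \<u> (tgt k) = idM (unit \<rhd>\<^sub>o tgt k)" using assms by simp
  show "\<u> (tgt k) \<bullet> (idn unit \<rhd>\<^sub>a k) \<bullet> \<u>' p = \<u> (tgt k) \<bullet> \<u>' (tgt k) \<bullet> k"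
    using assms by (auto simp add: M.comp_nest[OF \<u>_nat] M.comp_nest[OF \<u>_\<u>'] M.comp_assoc)
qed (use assms in auto)

end

context typed_monoidal
begin

lemma tens_unit_faithful:
  assumes "arr g" "arr h" "src g = src h" "tgt g = tgt h" "g \<boxtimes> idn unit = h \<boxtimes> idn unit"
  shows "g = h"
proof (rule epi_of_section)
  show "\<r> (src g) \<star> \<r>' (src g) = idn (src g)" using assms by simp
  have "g \<star> \<r> (src g) = \<r> (tgt g) \<star> (g \<boxtimes> idn unit)" using assms \<r>_nat[of g] by simp
  also have "\<dots> = h \<star> \<r> (src g)" unfolding assms(5) using assms \<r>_nat[of h] by simp
  finally show "g \<star> \<r> (src g) = h \<star> \<r> (src g)" .
qed (use assms in simp_all)

text \<open>
  The analogue on the right, by the same argument with tensoring by the unit on the right as the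
  faithful functor.
\<close>

lemma \<r>_tens:
  assumes x: "ob x" and y: "ob y"
  shows "(idn x \<boxtimes> \<r> y) \<star> \<alpha> x y unit = \<r> (x \<otimes>\<^sub>o y)"
proof (rule tens_unit_faithful)
  note [simp] = x y
  show "((idn x \<boxtimes> \<r> y) \<star> \<alpha> x y unit) \<boxtimes> idn unit = \<r> (x \<otimes>\<^sub>o y) \<boxtimes> idn unit"
  proof (rule reg.\<beta>_cancel_left[of x y unit])
    have "\<alpha> x y unit \<star> (\<r> (x \<otimes>\<^sub>o y) \<boxtimes> idn unit)
        = \<alpha> x y unit \<star> (idn (x \<otimes>\<^sub>o y) \<boxtimes> \<l> unit) \<star> \<alpha> (x \<otimes>\<^sub>o y) unit unit"
      by (simp add: triangle)
    also have "\<dots> = (idn x \<boxtimes> (idn y \<boxtimes> \<l> unit)) \<star> \<alpha> x y (unit \<otimes>\<^sub>o unit) \<star> \<alpha> (x \<otimes>\<^sub>o y) unit unit"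
      using comp_nest[OF \<alpha>_nat[of "idn x" "idn y" "\<l> unit" x y unit], of "\<alpha> (x \<otimes>\<^sub>o y) unit unit"]
      by (simp add: comp_assoc)
    also have "\<dots> = (idn x \<boxtimes> (idn y \<boxtimes> \<l> unit)) \<star> (idn x \<boxtimes> \<alpha> y unit unit)
        \<star> \<alpha> x (y \<otimes>\<^sub>o unit) unit \<star> (\<alpha> x y unit \<boxtimes> idn unit)"
      by (simp add: pentagon)
    also have "\<dots> = (idn x \<boxtimes> ((idn y \<boxtimes> \<l> unit) \<star> \<alpha> y unit unit))
        \<star> \<alpha> x (y \<otimes>\<^sub>o unit) unit \<star> (\<alpha> x y unit \<boxtimes> idn unit)"
      by (simp add: reg.whisker_left comp_assoc)
    also have "\<dots> = \<alpha> x y unit \<star> ((idn x \<boxtimes> \<r> y) \<boxtimes> idn unit) \<star> (\<alpha> x y unit \<boxtimes> idn unit)"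
      by (simp add: triangle comp_nest[OF \<alpha>_nat] comp_assoc)
    also have "\<dots> = \<alpha> x y unit \<star> (((idn x \<boxtimes> \<r> y) \<star> \<alpha> x y unit) \<boxtimes> idn unit)"
      by (simp add: reg.whisker_right)
    finally show "\<alpha> x y unit \<star> (((idn x \<boxtimes> \<r> y) \<star> \<alpha> x y unit) \<boxtimes> idn unit)
      = \<alpha> x y unit \<star> (\<r> (x \<otimes>\<^sub>o y) \<boxtimes> idn unit)" ..
  qed simp_all
qed (use x y in simp_all)

lemma \<l>_unit: "\<l> unit = \<r> unit"
proof (rule tens_unit_faithful)
  have "idn unit \<boxtimes> \<l> unit = \<l> (unit \<otimes>\<^sub>o unit)"
  proof (rule mono_of_retraction)
    show "\<l>' unit \<star> \<l> unit = idn (unit \<otimes>\<^sub>o unit)" by simp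
    show "\<l> unit \<star> (idn unit \<boxtimes> \<l> unit) = \<l> unit \<star> \<l> (unit \<otimes>\<^sub>o unit)"
      using \<l>_nat[of "\<l> unit"] by simp
  qed simp_all
  then show "\<l> unit \<boxtimes> idn unit = \<r> unit \<boxtimes> idn unit"
    using triangle[of unit unit] reg.unit_act_\<beta>[of unit unit] by simp
qed simp_all

lemma \<l>'_unit: "\<l>' unit = \<r>' unit"
proof (rule mono_of_retraction)
  show "\<l>' unit \<star> \<l> unit = idn (unit \<otimes>\<^sub>o unit)" by simp
  show "\<l> unit \<star> \<l>' unit = \<l> unit \<star> \<r>' unit" by (metis \<l>_unit \<l>_\<l>' \<r>_\<r>' ob_unit)
qed simp_all

text \<open>
  Here \<open>y\<close> is the right dual, so the evaluation has \<open>y\<close> as its left factor.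
\<close>

definition duality :: "'o \<Rightarrow> 'o \<Rightarrow> ('o, 'a) arrow \<Rightarrow> ('o, 'a) arrow \<Rightarrow> bool" where
  "duality x y \<epsilon> \<eta> \<longleftrightarrow> ob x \<and> ob y \<and> hom \<epsilon> (y \<otimes>\<^sub>o x) unit \<and> hom \<eta> unit (x \<otimes>\<^sub>o y) \<and>
     \<r> x \<star> (idn x \<boxtimes> \<epsilon>) \<star> \<alpha> x y x \<star> (\<eta> \<boxtimes> idn x) \<star> \<l>' x = idn x \<and>
     \<l> y \<star> (\<epsilon> \<boxtimes> idn y) \<star> \<alpha>' y x y \<star> (idn y \<boxtimes> \<eta>) \<star> \<r>' y = idn y"

end

context typed_module
begin

text \<open>
  Transposition \<open>Hom (y \<rhd> p) q \<rightarrow> Hom p (x \<rhd> q)\<close> along a dual pair, and its inverse.  Each uses only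
  one half of the pair, so they make sense before the snake identities are known.
\<close>

definition curry :: "'o \<Rightarrow> 'o \<Rightarrow> ('o, 'a) arrow \<Rightarrow> 'n \<Rightarrow> ('n, 'b) arrow \<Rightarrow> ('n, 'b) arrow" where
  "curry x y \<eta> p f = (idn x \<rhd>\<^sub>a f) \<bullet> \<beta> x y p \<bullet> (\<eta> \<rhd>\<^sub>a idM p) \<bullet> \<u>' p"

definition uncurry :: "'o \<Rightarrow> 'o \<Rightarrow> ('o, 'a) arrow \<Rightarrow> 'n \<Rightarrow> ('n, 'b) arrow \<Rightarrow> ('n, 'b) arrow" where
  "uncurry x y \<epsilon> q k = \<u> q \<bullet> (\<epsilon> \<rhd>\<^sub>a idM q) \<bullet> \<beta>' y x q \<bullet> (idn y \<rhd>\<^sub>a k)"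

lemma src_curry [simp]: "src (curry x y \<eta> p f) = p"
  and tgt_curry [simp]: "tgt (curry x y \<eta> p f) = x \<rhd>\<^sub>o tgt f"
  and src_uncurry [simp]: "src (uncurry x y \<epsilon> q k) = y \<rhd>\<^sub>o src k"
  and tgt_uncurry [simp]: "tgt (uncurry x y \<epsilon> q k) = q"
  by (simp_all add: curry_def uncurry_def)

lemma arr_curry:
  "\<lbrakk>ob x; ob y; hom \<eta> unit (x \<otimes>\<^sub>o y); obM p; arrM f; src f = y \<rhd>\<^sub>o p\<rbrakk> \<Longrightarrow> arrM (curry x y \<eta> p f)"
  by (simp add: curry_def)

lemma arr_uncurry:
  "\<lbrakk>ob x; ob y; hom \<epsilon> (y \<otimes>\<^sub>o x) unit; obM q; arrM k; tgt k = x \<rhd>\<^sub>o q\<rbrakk> \<Longrightarrow> arrM (uncurry x y \<epsilon> q k)"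
  by (simp add: uncurry_def)

text \<open>
  Naturality moves \<open>f\<close> to the front, the pentagon rebrackets what is left, and the unit coherences
  turn it into the second snake identity acting on \<open>p\<close>.
\<close>

lemma uncurry_curry:
  assumes d: "duality x y \<epsilon> \<eta>" and f: "M.hom f (y \<rhd>\<^sub>o p) q" and p: "obM p"
  shows "uncurry x y \<epsilon> q (curry x y \<eta> p f) = f"
proof -
  have [simp]: "ob x" "ob y" "arr \<epsilon>" "arr \<eta>" "src \<epsilon> = y \<otimes>\<^sub>o x" "tgt \<epsilon> = unit" "src \<eta> = unit"
      "tgt \<eta> = x \<otimes>\<^sub>o y" "arrM f" "src f = y \<rhd>\<^sub>o p" "tgt f = q" "obM p" "obM q"
    using assms M.ob_tgt[of f] by (auto simp: duality_def)
  have zz: "\<l> y \<star> (\<epsilon> \<boxtimes> idn y) \<star> \<alpha>' y x y \<star> (idn y \<boxtimes> \<eta>) \<star> \<r>' y = idn y"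
    using d by (simp add: duality_def)
  have "uncurry x y \<epsilon> q (curry x y \<eta> p f) =
      \<u> q \<bullet> (\<epsilon> \<rhd>\<^sub>a idM q) \<bullet> \<beta>' y x q \<bullet> (idn y \<rhd>\<^sub>a (idn x \<rhd>\<^sub>a f))
      \<bullet> (idn y \<rhd>\<^sub>a \<beta> x y p) \<bullet> (idn y \<rhd>\<^sub>a (\<eta> \<rhd>\<^sub>a idM p)) \<bullet> (idn y \<rhd>\<^sub>a \<u>' p)"
    by (simp add: curry_def uncurry_def whisker_left M.comp_assoc)
  also have "\<dots> = \<u> q \<bullet> (\<epsilon> \<rhd>\<^sub>a idM q) \<bullet> (idn (y \<otimes>\<^sub>o x) \<rhd>\<^sub>a f) \<bullet> \<beta>' y x (y \<rhd>\<^sub>o p)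
      \<bullet> (idn y \<rhd>\<^sub>a \<beta> x y p) \<bullet> (idn y \<rhd>\<^sub>a (\<eta> \<rhd>\<^sub>a idM p)) \<bullet> (idn y \<rhd>\<^sub>a \<u>' p)"
    by (simp add: M.comp_nest[OF \<beta>'_nat] M.comp_assoc)
  also have "\<dots> = f \<bullet> \<u> (y \<rhd>\<^sub>o p) \<bullet> (\<epsilon> \<rhd>\<^sub>a idM (y \<rhd>\<^sub>o p)) \<bullet> \<beta>' y x (y \<rhd>\<^sub>o p)
      \<bullet> (idn y \<rhd>\<^sub>a \<beta> x y p) \<bullet> (idn y \<rhd>\<^sub>a (\<eta> \<rhd>\<^sub>a idM p)) \<bullet> (idn y \<rhd>\<^sub>a \<u>' p)"
    by (simp add: M.comp_nest[OF interchange] M.comp_nest[OF \<u>_nat] M.comp_assoc)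
  also have "\<dots> = f \<bullet> \<u> (y \<rhd>\<^sub>o p) \<bullet> (\<epsilon> \<rhd>\<^sub>a idM (y \<rhd>\<^sub>o p)) \<bullet> \<beta> (y \<otimes>\<^sub>o x) y p
      \<bullet> (\<alpha>' y x y \<rhd>\<^sub>a idM p) \<bullet> \<beta>' y (x \<otimes>\<^sub>o y) p \<bullet> (idn y \<rhd>\<^sub>a (\<eta> \<rhd>\<^sub>a idM p)) \<bullet> (idn y \<rhd>\<^sub>a \<u>' p)"
    by (simp add: M.comp_nest[OF act_pentagon'] M.comp_assoc)
  also have "\<dots> = f \<bullet> (\<u> (y \<rhd>\<^sub>o p) \<bullet> \<beta> unit y p) \<bullet> ((\<epsilon> \<boxtimes> idn y) \<rhd>\<^sub>a idM p)
      \<bullet> (\<alpha>' y x y \<rhd>\<^sub>a idM p) \<bullet> ((idn y \<boxtimes> \<eta>) \<rhd>\<^sub>a idM p) \<bullet> (\<beta>' y unit p \<bullet> (idn y \<rhd>\<^sub>a \<u>' p))"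
    using M.comp_nest[OF \<beta>_nat[of \<epsilon> "idn y" "idM p" unit y p]]
    by (simp add: M.comp_nest[OF \<beta>'_nat] M.comp_assoc)
  also have "\<dots> = f \<bullet> ((\<l> y \<star> (\<epsilon> \<boxtimes> idn y) \<star> \<alpha>' y x y \<star> (idn y \<boxtimes> \<eta>) \<star> \<r>' y) \<rhd>\<^sub>a idM p)"
    by (simp add: unit_act_\<beta> \<beta>'_unit_act whisker_right M.comp_assoc)
  also have "\<dots> = f" unfolding zz by simp
  finally show ?thesis .
qed

lemma curry_uncurry:
  assumes d: "duality x y \<epsilon> \<eta>" and k: "M.hom k p (x \<rhd>\<^sub>o q)" and q: "obM q"
  shows "curry x y \<eta> p (uncurry x y \<epsilon> q k) = k"
proof -
  have [simp]: "ob x" "ob y" "arr \<epsilon>" "arr \<eta>" "src \<epsilon> = y \<otimes>\<^sub>o x" "tgt \<epsilon> = unit" "src \<eta> = unit"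
      "tgt \<eta> = x \<otimes>\<^sub>o y" "arrM k" "src k = p" "tgt k = x \<rhd>\<^sub>o q" "obM p" "obM q"
    using assms M.ob_src[of k] by (auto simp: duality_def)
  have zz: "\<r> x \<star> (idn x \<boxtimes> \<epsilon>) \<star> \<alpha> x y x \<star> (\<eta> \<boxtimes> idn x) \<star> \<l>' x = idn x"
    using d by (simp add: duality_def)
  have "curry x y \<eta> p (uncurry x y \<epsilon> q k) =
      (idn x \<rhd>\<^sub>a \<u> q) \<bullet> (idn x \<rhd>\<^sub>a (\<epsilon> \<rhd>\<^sub>a idM q)) \<bullet> (idn x \<rhd>\<^sub>a \<beta>' y x q)
      \<bullet> (idn x \<rhd>\<^sub>a (idn y \<rhd>\<^sub>a k)) \<bullet> \<beta> x y p \<bullet> (\<eta> \<rhd>\<^sub>a idM p) \<bullet> \<u>' p"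
    by (simp add: curry_def uncurry_def whisker_left M.comp_assoc)
  also have "\<dots> = (idn x \<rhd>\<^sub>a \<u> q) \<bullet> (idn x \<rhd>\<^sub>a (\<epsilon> \<rhd>\<^sub>a idM q)) \<bullet> (idn x \<rhd>\<^sub>a \<beta>' y x q)
      \<bullet> \<beta> x y (x \<rhd>\<^sub>o q) \<bullet> (idn (x \<otimes>\<^sub>o y) \<rhd>\<^sub>a k) \<bullet> (\<eta> \<rhd>\<^sub>a idM p) \<bullet> \<u>' p"
    using M.comp_nest[OF \<beta>_nat[of "idn x" "idn y" k x y "x \<rhd>\<^sub>o q"]]
    by (simp add: M.comp_assoc)
  also have "\<dots> = (idn x \<rhd>\<^sub>a \<u> q) \<bullet> (idn x \<rhd>\<^sub>a (\<epsilon> \<rhd>\<^sub>a idM q)) \<bullet> (idn x \<rhd>\<^sub>a \<beta>' y x q)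
      \<bullet> \<beta> x y (x \<rhd>\<^sub>o q) \<bullet> (\<eta> \<rhd>\<^sub>a idM (x \<rhd>\<^sub>o q)) \<bullet> \<u>' (x \<rhd>\<^sub>o q) \<bullet> k"
    using M.comp_nest[OF interchange[of \<eta> k unit "x \<otimes>\<^sub>o y" p "x \<rhd>\<^sub>o q"], of "\<u>' p"]
    by (simp add: M.comp_nest[OF \<u>'_nat] \<u>'_nat M.comp_assoc)
  also have "\<dots> = (idn x \<rhd>\<^sub>a \<u> q) \<bullet> (idn x \<rhd>\<^sub>a (\<epsilon> \<rhd>\<^sub>a idM q)) \<bullet> \<beta> x (y \<otimes>\<^sub>o x) q
      \<bullet> (\<alpha> x y x \<rhd>\<^sub>a idM q) \<bullet> \<beta>' (x \<otimes>\<^sub>o y) x q \<bullet> (\<eta> \<rhd>\<^sub>a idM (x \<rhd>\<^sub>o q)) \<bullet> \<u>' (x \<rhd>\<^sub>o q) \<bullet> k"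
    by (simp add: M.comp_nest[OF act_pentagon''] M.comp_assoc)
  also have "\<dots> = ((idn x \<rhd>\<^sub>a \<u> q) \<bullet> \<beta> x unit q) \<bullet> ((idn x \<boxtimes> \<epsilon>) \<rhd>\<^sub>a idM q)
      \<bullet> (\<alpha> x y x \<rhd>\<^sub>a idM q) \<bullet> ((\<eta> \<boxtimes> idn x) \<rhd>\<^sub>a idM q) \<bullet> (\<beta>' unit x q \<bullet> \<u>' (x \<rhd>\<^sub>o q)) \<bullet> k"
    using M.comp_nest[OF \<beta>'_nat[of \<eta> "idn x" "idM q" "x \<otimes>\<^sub>o y" x q]]
    by (simp add: M.comp_nest[OF \<beta>_nat] M.comp_assoc)
  also have "\<dots> = ((\<r> x \<star> (idn x \<boxtimes> \<epsilon>) \<star> \<alpha> x y x \<star> (\<eta> \<boxtimes> idn x) \<star> \<l>' x) \<rhd>\<^sub>a idM q) \<bullet> k"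
    by (simp add: act_triangle \<beta>'_unit whisker_right M.comp_assoc)
  also have "\<dots> = k" unfolding zz by simp
  finally show ?thesis .
qed

end

section \<open>Dual pairs of tensor products\<close>

context typed_module
begin

lemma \<u>'_\<beta>:
  assumes "ob x" "obM p"
  shows "\<beta> unit x p \<bullet> (\<l>' x \<rhd>\<^sub>a idM p) = \<u>' (x \<rhd>\<^sub>o p)"
  using assms by (simp add: \<beta>'_unit[symmetric] M.comp_nest[OF \<beta>_\<beta>'])

text \<open>
  Transposing a morphism out of \<open>y' \<rhd> (y \<rhd> p)\<close> only involves the transpose of the identity of
  \<open>y' \<otimes> y\<close> in the monoidal category itself.
\<close>

lemma curry_act:
  assumes "ob x'" "ob y'" "ob y" "hom \<eta>' unit (x' \<otimes>\<^sub>o y')" "obM p" "arrM f" "src f = y' \<rhd>\<^sub>o (y \<rhd>\<^sub>o p)"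
  shows "curry x' y' \<eta>' (y \<rhd>\<^sub>o p) f = (idn x' \<rhd>\<^sub>a f) \<bullet> (idn x' \<rhd>\<^sub>a \<beta> y' y p)
    \<bullet> \<beta> x' (y' \<otimes>\<^sub>o y) p \<bullet> ((\<alpha> x' y' y \<star> (\<eta>' \<boxtimes> idn y) \<star> \<l>' y) \<rhd>\<^sub>a idM p)"
proof -
  note [simp] = assms
  have "((idn x' \<rhd>\<^sub>a \<beta> y' y p) \<bullet> \<beta> x' (y' \<otimes>\<^sub>o y) p \<bullet> (\<alpha> x' y' y \<rhd>\<^sub>a idM p))
      \<bullet> ((\<eta>' \<boxtimes> idn y) \<rhd>\<^sub>a idM p) \<bullet> (\<l>' y \<rhd>\<^sub>a idM p)
    = \<beta> x' y' (y \<rhd>\<^sub>o p) \<bullet> (\<eta>' \<rhd>\<^sub>a idM (y \<rhd>\<^sub>o p)) \<bullet> \<beta> unit y p \<bullet> (\<l>' y \<rhd>\<^sub>a idM p)"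
    using M.comp_nest[OF \<beta>_nat[of \<eta>' "idn y" "idM p" "x' \<otimes>\<^sub>o y'" y p]]
    by (simp add: act_pentagon[symmetric] M.comp_assoc)
  also have "\<dots> = \<beta> x' y' (y \<rhd>\<^sub>o p) \<bullet> (\<eta>' \<rhd>\<^sub>a idM (y \<rhd>\<^sub>o p)) \<bullet> \<u>' (y \<rhd>\<^sub>o p)"
    by (simp add: \<u>'_\<beta>)
  finally show ?thesis by (simp add: curry_def whisker_right M.comp_assoc)
qed

end

context typed_monoidal
begin

text \<open>
  Two pairings, one nested inside the other.  For a coevaluation inside another one this is the
  bracketing in which the coevaluation of a tensor product is given.
\<close>

definition nest_coev where
  "nest_coev p q q' p' \<eta> \<eta>' =
    \<alpha>' p q (q' \<otimes>\<^sub>o p') \<star> (idn p \<boxtimes> (\<alpha> q q' p' \<star> (\<eta>' \<boxtimes> idn p') \<star> \<l>' p')) \<star> \<eta>"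

definition nest_ev where
  "nest_ev p q q' p' \<epsilon> \<epsilon>' =
    \<epsilon> \<star> (idn p \<boxtimes> (\<l> p' \<star> (\<epsilon>' \<boxtimes> idn p') \<star> \<alpha>' q q' p')) \<star> \<alpha> p q (q' \<otimes>\<^sub>o p')"

lemma hom_nest_coev:
  "\<lbrakk>ob p; ob q; ob q'; ob p'; hom \<eta> unit (p \<otimes>\<^sub>o p'); hom \<eta>' unit (q \<otimes>\<^sub>o q')\<rbrakk>
    \<Longrightarrow> hom (nest_coev p q q' p' \<eta> \<eta>') unit ((p \<otimes>\<^sub>o q) \<otimes>\<^sub>o (q' \<otimes>\<^sub>o p'))"
  by (simp add: nest_coev_def)

lemma hom_nest_ev:
  "\<lbrakk>ob p; ob q; ob q'; ob p'; hom \<epsilon> (p \<otimes>\<^sub>o p') unit; hom \<epsilon>' (q \<otimes>\<^sub>o q') unit\<rbrakk>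
    \<Longrightarrow> hom (nest_ev p q q' p' \<epsilon> \<epsilon>') ((p \<otimes>\<^sub>o q) \<otimes>\<^sub>o (q' \<otimes>\<^sub>o p')) unit"
  by (simp add: nest_ev_def)

end

context typed_module
begin

text \<open>
  Transposing along a nested coevaluation means transposing twice.  With the corresponding fact for
  evaluations this reduces duality of tensor products to that of the factors, without a computation
  with snakes.
\<close>

lemma curry_nest:
  assumes "ob x" "ob y" "ob x'" "ob y'" "hom \<eta> unit (x \<otimes>\<^sub>o y)" "hom \<eta>' unit (x' \<otimes>\<^sub>o y')"
    "obM p" "arrM f" "src f = (y' \<otimes>\<^sub>o y) \<rhd>\<^sub>o p" "tgt f = n"
  shows "\<beta> x x' n \<bullet> curry (x \<otimes>\<^sub>o x') (y' \<otimes>\<^sub>o y) (nest_coev x x' y' y \<eta> \<eta>') p f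
    = curry x y \<eta> p (curry x' y' \<eta>' (y \<rhd>\<^sub>o p) (f \<bullet> \<beta>' y' y p))"
proof -
  note [simp] = assms
  have n[simp]: "obM n" using M.ob_tgt[of f] by simp
  define h where "h = \<alpha> x' y' y \<star> (\<eta>' \<boxtimes> idn y) \<star> \<l>' y"
  have h[simp]: "arr h" "src h = y" "tgt h = x' \<otimes>\<^sub>o (y' \<otimes>\<^sub>o y)" by (simp_all add: h_def)
  let ?v = "y' \<otimes>\<^sub>o y"
  have aa: "(\<alpha> x x' ?v \<rhd>\<^sub>a idM p) \<bullet> (\<alpha>' x x' ?v \<rhd>\<^sub>a idM p) = idM ((x \<otimes>\<^sub>o x' \<otimes>\<^sub>o ?v) \<rhd>\<^sub>o p)"
    by (simp flip: whisker_right)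
  have "\<beta> x x' n \<bullet> curry (x \<otimes>\<^sub>o x') (y' \<otimes>\<^sub>o y) (nest_coev x x' y' y \<eta> \<eta>') p f
    = (idn x \<rhd>\<^sub>a (idn x' \<rhd>\<^sub>a f)) \<bullet> \<beta> x x' (?v \<rhd>\<^sub>o p) \<bullet> \<beta> (x \<otimes>\<^sub>o x') ?v p
      \<bullet> (\<alpha>' x x' ?v \<rhd>\<^sub>a idM p) \<bullet> ((idn x \<boxtimes> h) \<rhd>\<^sub>a idM p) \<bullet> (\<eta> \<rhd>\<^sub>a idM p) \<bullet> \<u>' p"
    using M.comp_nest[OF \<beta>_nat[of "idn x" "idn x'" f x x' n]]
    by (simp add: curry_def nest_coev_def h_def[symmetric] whisker_right M.comp_assoc)
  also have "\<dots> = (idn x \<rhd>\<^sub>a (idn x' \<rhd>\<^sub>a f)) \<bullet> (idn x \<rhd>\<^sub>a \<beta> x' ?v p)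
      \<bullet> \<beta> x (x' \<otimes>\<^sub>o ?v) p \<bullet> ((idn x \<boxtimes> h) \<rhd>\<^sub>a idM p) \<bullet> (\<eta> \<rhd>\<^sub>a idM p) \<bullet> \<u>' p"
    by (simp add: M.comp_nest[OF act_pentagon] M.comp_nest[OF aa] M.comp_assoc)
  also have "\<dots> = (idn x \<rhd>\<^sub>a (idn x' \<rhd>\<^sub>a f)) \<bullet> (idn x \<rhd>\<^sub>a \<beta> x' ?v p)
      \<bullet> (idn x \<rhd>\<^sub>a (h \<rhd>\<^sub>a idM p)) \<bullet> \<beta> x y p \<bullet> (\<eta> \<rhd>\<^sub>a idM p) \<bullet> \<u>' p"
    by (simp add: M.comp_nest[OF \<beta>_nat] M.comp_assoc)
  also have "\<dots> = curry x y \<eta> p ((idn x' \<rhd>\<^sub>a f) \<bullet> \<beta> x' ?v p \<bullet> (h \<rhd>\<^sub>a idM p))"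
    by (simp add: curry_def whisker_left M.comp_assoc)
  also have "(idn x' \<rhd>\<^sub>a f) \<bullet> \<beta> x' ?v p \<bullet> (h \<rhd>\<^sub>a idM p)
      = curry x' y' \<eta>' (y \<rhd>\<^sub>o p) (f \<bullet> \<beta>' y' y p)"
  proof -
    have bb: "(idn x' \<rhd>\<^sub>a \<beta>' y' y p) \<bullet> (idn x' \<rhd>\<^sub>a \<beta> y' y p) = idM (x' \<rhd>\<^sub>o (?v \<rhd>\<^sub>o p))"
      by (simp flip: whisker_left)
    show ?thesis
      by (subst curry_act)
        (simp_all add: h_def[symmetric] whisker_left M.comp_assoc M.comp_nest[OF bb])
  qed
  finally show ?thesis .
qed

lemma uncurry_nest:
  assumes "ob x" "ob y" "ob x'" "ob y'" "hom \<epsilon> (y \<otimes>\<^sub>o x) unit" "hom \<epsilon>' (y' \<otimes>\<^sub>o x') unit"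
    "obM q" "arrM k" "src k = p" "tgt k = (x \<otimes>\<^sub>o x') \<rhd>\<^sub>o q"
  shows "uncurry (x \<otimes>\<^sub>o x') (y' \<otimes>\<^sub>o y) (nest_ev y' y x x' \<epsilon>' \<epsilon>) q k
    = uncurry x' y' \<epsilon>' q (uncurry x y \<epsilon> (x' \<rhd>\<^sub>o q) (\<beta> x x' q \<bullet> k)) \<bullet> \<beta> y' y p"
proof -
  note [simp] = assms
  have p[simp]: "obM p" using M.ob_src[of k] by simp
  define h where "h = \<l> x' \<star> (\<epsilon> \<boxtimes> idn x') \<star> \<alpha>' y x x'"
  have h[simp]: "arr h" "src h = y \<otimes>\<^sub>o (x \<otimes>\<^sub>o x')" "tgt h = x'" by (simp_all add: h_def)
  let ?z = "x \<otimes>\<^sub>o x'"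
  have "uncurry x y \<epsilon> (x' \<rhd>\<^sub>o q) (\<beta> x x' q \<bullet> k)
    = \<u> (x' \<rhd>\<^sub>o q) \<bullet> (\<epsilon> \<rhd>\<^sub>a idM (x' \<rhd>\<^sub>o q)) \<bullet> \<beta> (y \<otimes>\<^sub>o x) x' q
      \<bullet> (\<alpha>' y x x' \<rhd>\<^sub>a idM q) \<bullet> \<beta>' y ?z q \<bullet> (idn y \<rhd>\<^sub>a k)"
    by (simp add: uncurry_def whisker_left M.comp_nest[OF act_pentagon'] M.comp_assoc)
  also have "\<dots> = (\<u> (x' \<rhd>\<^sub>o q) \<bullet> \<beta> unit x' q) \<bullet> ((\<epsilon> \<boxtimes> idn x') \<rhd>\<^sub>a idM q)
      \<bullet> (\<alpha>' y x x' \<rhd>\<^sub>a idM q) \<bullet> \<beta>' y ?z q \<bullet> (idn y \<rhd>\<^sub>a k)"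
    using M.comp_nest[OF \<beta>_nat[of \<epsilon> "idn x'" "idM q" unit x' q]]
    by (simp add: M.comp_assoc)
  also have "\<dots> = (h \<rhd>\<^sub>a idM q) \<bullet> \<beta>' y ?z q \<bullet> (idn y \<rhd>\<^sub>a k)"
    by (simp add: unit_act_\<beta> h_def whisker_right M.comp_assoc)
  finally have 1: "uncurry x y \<epsilon> (x' \<rhd>\<^sub>o q) (\<beta> x x' q \<bullet> k)
    = (h \<rhd>\<^sub>a idM q) \<bullet> \<beta>' y ?z q \<bullet> (idn y \<rhd>\<^sub>a k)" .
  have "uncurry x' y' \<epsilon>' q (uncurry x y \<epsilon> (x' \<rhd>\<^sub>o q) (\<beta> x x' q \<bullet> k)) \<bullet> \<beta> y' y p
    = \<u> q \<bullet> (\<epsilon>' \<rhd>\<^sub>a idM q) \<bullet> ((idn y' \<boxtimes> h) \<rhd>\<^sub>a idM q) \<bullet> \<beta>' y' (y \<otimes>\<^sub>o ?z) q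
      \<bullet> (idn y' \<rhd>\<^sub>a \<beta>' y ?z q) \<bullet> (idn y' \<rhd>\<^sub>a (idn y \<rhd>\<^sub>a k)) \<bullet> \<beta> y' y p"
    unfolding 1 by (simp add: uncurry_def whisker_left M.comp_nest[OF \<beta>'_nat] M.comp_assoc)
  also have "\<dots> = \<u> q \<bullet> (\<epsilon>' \<rhd>\<^sub>a idM q) \<bullet> ((idn y' \<boxtimes> h) \<rhd>\<^sub>a idM q) \<bullet> \<beta>' y' (y \<otimes>\<^sub>o ?z) q
      \<bullet> (idn y' \<rhd>\<^sub>a \<beta>' y ?z q) \<bullet> \<beta> y' y (?z \<rhd>\<^sub>o q) \<bullet> (idn (y' \<otimes>\<^sub>o y) \<rhd>\<^sub>a k)"
    using \<beta>_nat[of "idn y'" "idn y" k y' y "?z \<rhd>\<^sub>o q"] by simp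
  also have "\<dots> = \<u> q \<bullet> (\<epsilon>' \<rhd>\<^sub>a idM q) \<bullet> ((idn y' \<boxtimes> h) \<rhd>\<^sub>a idM q)
      \<bullet> (\<alpha> y' y ?z \<rhd>\<^sub>a idM q) \<bullet> \<beta>' (y' \<otimes>\<^sub>o y) ?z q \<bullet> (idn (y' \<otimes>\<^sub>o y) \<rhd>\<^sub>a k)"
    by (simp add: M.comp_nest[OF act_pentagon''] M.comp_nest[OF \<beta>'_\<beta>] M.comp_assoc)
  also have "\<dots> = uncurry ?z (y' \<otimes>\<^sub>o y) (nest_ev y' y x x' \<epsilon>' \<epsilon>) q k"
    by (simp add: uncurry_def nest_ev_def h_def[symmetric] whisker_right M.comp_assoc)
  finally show ?thesis ..
qed

end

context typed_monoidal
begin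

lemma dualityD [dest]:
  assumes "duality x y \<epsilon> \<eta>"
  shows "ob x" "ob y" "hom \<epsilon> (y \<otimes>\<^sub>o x) unit" "hom \<eta> unit (x \<otimes>\<^sub>o y)"
  using assms by (simp_all add: duality_def)

lemma \<r>'_nat:
  assumes "arr f" "src f = x"
  shows "(f \<boxtimes> idn unit) \<star> \<r>' x = \<r>' (tgt f) \<star> f"
proof (rule mono_of_retraction)
  show "\<r>' (tgt f) \<star> \<r> (tgt f) = idn (tgt f \<otimes>\<^sub>o unit)" using assms by simp
  show "\<r> (tgt f) \<star> (f \<boxtimes> idn unit) \<star> \<r>' x = \<r> (tgt f) \<star> \<r>' (tgt f) \<star> f"
    using assms by (auto simp add: comp_nest[OF \<r>_nat] comp_nest[OF \<r>_\<r>'] comp_assoc)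
qed (use assms in auto)

lemma \<r>'_tens:
  assumes x: "ob x" and y: "ob y"
  shows "\<alpha>' x y unit \<star> (idn x \<boxtimes> \<r>' y) = \<r>' (x \<otimes>\<^sub>o y)"
proof (rule mono_of_retraction)
  note [simp] = x y
  show "\<r>' (x \<otimes>\<^sub>o y) \<star> \<r> (x \<otimes>\<^sub>o y) = idn ((x \<otimes>\<^sub>o y) \<otimes>\<^sub>o unit)" by simp
  have *: "(idn x \<boxtimes> \<r> y) \<star> (idn x \<boxtimes> \<r>' y) = idn (x \<otimes>\<^sub>o y)"
    by (simp flip: reg.whisker_left)
  have "\<r> (x \<otimes>\<^sub>o y) \<star> \<alpha>' x y unit \<star> (idn x \<boxtimes> \<r>' y)
      = ((idn x \<boxtimes> \<r> y) \<star> \<alpha> x y unit) \<star> \<alpha>' x y unit \<star> (idn x \<boxtimes> \<r>' y)"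
    by (simp only: \<r>_tens x y)
  also have "\<dots> = idn (x \<otimes>\<^sub>o y)"
    by (simp add: comp_assoc comp_nest[OF \<alpha>_\<alpha>'] *)
  finally show "\<r> (x \<otimes>\<^sub>o y) \<star> \<alpha>' x y unit \<star> (idn x \<boxtimes> \<r>' y) = \<r> (x \<otimes>\<^sub>o y) \<star> \<r>' (x \<otimes>\<^sub>o y)"
    by simp
qed (use assms in simp_all)

lemma curry_unit:
  assumes "ob x" "ob y" "hom \<eta> unit (x \<otimes>\<^sub>o y)" "arr g" "src g = y"
  shows "reg.curry x y \<eta> unit (g \<star> \<r> y) = (idn x \<boxtimes> g) \<star> \<eta>"
proof -
  note [simp] = assms
  have "reg.curry x y \<eta> unit (g \<star> \<r> y)
    = (idn x \<boxtimes> g) \<star> (idn x \<boxtimes> \<r> y) \<star> \<alpha> x y unit \<star> (\<eta> \<boxtimes> idn unit) \<star> \<l>' unit"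
    by (simp add: reg.curry_def reg.whisker_left comp_assoc)
  also have "\<dots> = (idn x \<boxtimes> g) \<star> \<r> (x \<otimes>\<^sub>o y) \<star> (\<eta> \<boxtimes> idn unit) \<star> \<r>' unit"
    by (simp add: comp_nest[OF \<r>_tens] \<l>'_unit)
  also have "\<dots> = (idn x \<boxtimes> g) \<star> \<eta>"
    by (simp add: comp_nest[OF \<r>_nat] comp_assoc)
  finally show ?thesis .
qed

lemma uncurry_unit:
  assumes "ob x" "ob y" "hom \<epsilon> (y \<otimes>\<^sub>o x) unit" "arr f" "tgt f = x"
  shows "reg.uncurry x y \<epsilon> unit (\<r>' x \<star> f) = \<epsilon> \<star> (idn y \<boxtimes> f)"
proof -
  note [simp] = assms
  have "reg.uncurry x y \<epsilon> unit (\<r>' x \<star> f)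
    = \<l> unit \<star> (\<epsilon> \<boxtimes> idn unit) \<star> \<alpha>' y x unit \<star> (idn y \<boxtimes> \<r>' x) \<star> (idn y \<boxtimes> f)"
    by (simp add: reg.uncurry_def reg.whisker_left comp_assoc)
  also have "\<dots> = \<r> unit \<star> (\<epsilon> \<boxtimes> idn unit) \<star> \<r>' (y \<otimes>\<^sub>o x) \<star> (idn y \<boxtimes> f)"
    by (simp add: comp_nest[OF \<r>'_tens] \<l>_unit)
  also have "\<dots> = \<epsilon> \<star> (idn y \<boxtimes> f)"
    by (simp add: comp_nest[OF \<r>'_nat] comp_nest[OF \<r>_\<r>'] comp_assoc)
  finally show ?thesis .
qed

text \<open>
  The snake identities say that \<open>\<eta>\<close> is the transpose of \<open>\<r> y\<close> and \<open>\<epsilon>\<close> the inverse transpose of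
  \<open>\<r>' x\<close>.
\<close>

lemma duality_of_transposes:
  assumes "ob x" "ob y" "hom \<epsilon> (y \<otimes>\<^sub>o x) unit" "hom \<eta> unit (x \<otimes>\<^sub>o y)"
    and uc: "\<And>f p q. \<lbrakk>hom f (y \<otimes>\<^sub>o p) q; ob p\<rbrakk> \<Longrightarrow> reg.uncurry x y \<epsilon> q (reg.curry x y \<eta> p f) = f"
    and cu: "\<And>k p q. \<lbrakk>hom k p (x \<otimes>\<^sub>o q); ob q\<rbrakk> \<Longrightarrow> reg.curry x y \<eta> p (reg.uncurry x y \<epsilon> q k) = k"
  shows "duality x y \<epsilon> \<eta>"
proof -
  note [simp] = assms(1-4)
  have "reg.curry x y \<eta> unit (idn y \<star> \<r> y) = (idn x \<boxtimes> idn y) \<star> \<eta>"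
    by (rule curry_unit) simp_all
  then have "reg.curry x y \<eta> unit (\<r> y) = \<eta>" by simp
  then have "reg.uncurry x y \<epsilon> y \<eta> = \<r> y" using uc[of "\<r> y" unit y] by simp
  then have "(\<l> y \<star> (\<epsilon> \<boxtimes> idn y) \<star> \<alpha>' y x y \<star> (idn y \<boxtimes> \<eta>)) \<star> \<r>' y = idn y"
    by (simp add: reg.uncurry_def)
  then have 2: "\<l> y \<star> (\<epsilon> \<boxtimes> idn y) \<star> \<alpha>' y x y \<star> (idn y \<boxtimes> \<eta>) \<star> \<r>' y = idn y"
    by (simp add: comp_assoc)
  have "reg.uncurry x y \<epsilon> unit (\<r>' x \<star> idn x) = \<epsilon> \<star> (idn y \<boxtimes> idn x)"
    by (rule uncurry_unit) simp_all
  then have "reg.uncurry x y \<epsilon> unit (\<r>' x) = \<epsilon>" by simp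
  then have "reg.curry x y \<eta> x \<epsilon> = \<r>' x" using cu[of "\<r>' x" x unit] by simp
  then have "\<r> x \<star> (idn x \<boxtimes> \<epsilon>) \<star> \<alpha> x y x \<star> (\<eta> \<boxtimes> idn x) \<star> \<l>' x = idn x"
    by (simp add: reg.curry_def)
  with 2 show ?thesis by (simp add: duality_def)
qed

lemma duality_tens:
  assumes d: "duality x y \<epsilon> \<eta>" and d': "duality x' y' \<epsilon>' \<eta>'"
  shows "duality (x \<otimes>\<^sub>o x') (y' \<otimes>\<^sub>o y) (nest_ev y' y x x' \<epsilon>' \<epsilon>) (nest_coev x x' y' y \<eta> \<eta>')"
proof (rule duality_of_transposes)
  note [simp] = dualityD[OF d] dualityD[OF d']
  show "hom (nest_ev y' y x x' \<epsilon>' \<epsilon>) ((y' \<otimes>\<^sub>o y) \<otimes>\<^sub>o x \<otimes>\<^sub>o x') unit"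
    by (rule hom_nest_ev) simp_all
  show "hom (nest_coev x x' y' y \<eta> \<eta>') unit ((x \<otimes>\<^sub>o x') \<otimes>\<^sub>o (y' \<otimes>\<^sub>o y))"
    by (rule hom_nest_coev) simp_all
  let ?C = "reg.curry (x \<otimes>\<^sub>o x') (y' \<otimes>\<^sub>o y) (nest_coev x x' y' y \<eta> \<eta>')"
  let ?U = "reg.uncurry (x \<otimes>\<^sub>o x') (y' \<otimes>\<^sub>o y) (nest_ev y' y x x' \<epsilon>' \<epsilon>)"
  have C: "arr (?C p f)" if "hom f ((y' \<otimes>\<^sub>o y) \<otimes>\<^sub>o p) q" "ob p" for f p q
    by (rule reg.arr_curry) (use that hom_nest_coev in simp_all)
  have U: "arr (?U q k)" if "hom k p ((x \<otimes>\<^sub>o x') \<otimes>\<^sub>o q)" "ob q" for k p q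
    by (rule reg.arr_uncurry) (use that hom_nest_ev in simp_all)
  note arr_t [simp] = reg.arr_curry reg.arr_uncurry
  {
    fix f p q assume f: "hom f ((y' \<otimes>\<^sub>o y) \<otimes>\<^sub>o p) q" and p: "ob p"
    have q: "ob q" using f ob_tgt by blast
    have 1: "\<alpha> x x' q \<star> ?C p f = reg.curry x y \<eta> p (reg.curry x' y' \<eta>' (y \<otimes>\<^sub>o p) (f \<star> \<alpha>' y' y p))"
      by (rule reg.curry_nest) (use f p in simp_all)
    have "?U q (?C p f) = reg.uncurry x' y' \<epsilon>' q (reg.uncurry x y \<epsilon> (x' \<otimes>\<^sub>o q) (\<alpha> x x' q \<star> ?C p f)) \<star> \<alpha> y' y p"
      by (rule reg.uncurry_nest) (use f p q C[OF f p] in simp_all)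
    also have "reg.uncurry x y \<epsilon> (x' \<otimes>\<^sub>o q) (\<alpha> x x' q \<star> ?C p f) = reg.curry x' y' \<eta>' (y \<otimes>\<^sub>o p) (f \<star> \<alpha>' y' y p)"
      unfolding 1 by (rule reg.uncurry_curry[OF d]) (use f p in simp_all)
    also have "reg.uncurry x' y' \<epsilon>' q \<dots> = f \<star> \<alpha>' y' y p"
      by (rule reg.uncurry_curry[OF d']) (use f p in simp_all)
    finally show "?U q (?C p f) = f" using f p by (simp add: comp_assoc)
  }
  {
    fix k p q assume k: "hom k p ((x \<otimes>\<^sub>o x') \<otimes>\<^sub>o q)" and q: "ob q"
    have p: "ob p" using k ob_src by blast
    have 1: "?U q k = reg.uncurry x' y' \<epsilon>' q (reg.uncurry x y \<epsilon> (x' \<otimes>\<^sub>o q) (\<alpha> x x' q \<star> k)) \<star> \<alpha> y' y p"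
      by (rule reg.uncurry_nest) (use k q in simp_all)
    have 2: "?U q k \<star> \<alpha>' y' y p = reg.uncurry x' y' \<epsilon>' q (reg.uncurry x y \<epsilon> (x' \<otimes>\<^sub>o q) (\<alpha> x x' q \<star> k))"
      unfolding 1 using k p q by (simp add: comp_assoc)
    have "\<alpha> x x' q \<star> ?C p (?U q k) = reg.curry x y \<eta> p (reg.curry x' y' \<eta>' (y \<otimes>\<^sub>o p) (?U q k \<star> \<alpha>' y' y p))"
      by (rule reg.curry_nest) (use k p q U[OF k q] in simp_all)
    also have "reg.curry x' y' \<eta>' (y \<otimes>\<^sub>o p) (?U q k \<star> \<alpha>' y' y p) = reg.uncurry x y \<epsilon> (x' \<otimes>\<^sub>o q) (\<alpha> x x' q \<star> k)"
      unfolding 2 by (rule reg.curry_uncurry[OF d']) (use k p q in simp_all)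
    also have "reg.curry x y \<eta> p \<dots> = \<alpha> x x' q \<star> k"
      by (rule reg.curry_uncurry[OF d]) (use k p q in simp_all)
    finally have 3: "\<alpha> x x' q \<star> ?C p (?U q k) = \<alpha> x x' q \<star> k" .
    have "arr (?C p (?U q k))"
      by (rule C[of _ _ q]) (use U[OF k q] k p in simp_all)
    then show "?C p (?U q k) = k"
      by (intro reg.\<beta>_cancel_left[of x x' q _ k, OF _ _ _ _ _ _ _ 3]) (use k p q in simp_all)
  }
qed (use dualityD[OF d] dualityD[OF d'] in simp_all)

end

section \<open>Mates\<close>

context typed_monoidal
begin

lemma ev_right_inj:
  assumes d: "duality x y \<epsilon> \<eta>" and f: "hom f s x" "hom g s x" "\<epsilon> \<star> (idn y \<boxtimes> f) = \<epsilon> \<star> (idn y \<boxtimes> g)"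
  shows "f = g"
proof -
  note [simp] = dualityD[OF d]
  have "reg.uncurry x y \<epsilon> unit (\<r>' x \<star> f) = reg.uncurry x y \<epsilon> unit (\<r>' x \<star> g)"
    using f by (simp add: uncurry_unit)
  then have "reg.curry x y \<eta> s (reg.uncurry x y \<epsilon> unit (\<r>' x \<star> f))
      = reg.curry x y \<eta> s (reg.uncurry x y \<epsilon> unit (\<r>' x \<star> g))" by simp
  then have "\<r>' x \<star> f = \<r>' x \<star> g"
    using reg.curry_uncurry[OF d, of "\<r>' x \<star> f" s unit] reg.curry_uncurry[OF d, of "\<r>' x \<star> g" s unit] f
    by simp
  moreover have "ob x" by simp
  ultimately show ?thesis by (intro mono_of_retraction[OF \<r>_\<r>', of x f g]) (use f in simp_all)
qed

lemma ev_right_exists: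
  assumes d: "duality x y \<epsilon> \<eta>" and p: "hom p (y \<otimes>\<^sub>o s) unit" and s: "ob s"
  obtains f where "hom f s x" "\<epsilon> \<star> (idn y \<boxtimes> f) = p"
proof
  note [simp] = dualityD[OF d]
  have c: "hom (reg.curry x y \<eta> s p) s (x \<otimes>\<^sub>o unit)" using p s by (simp add: reg.arr_curry)
  show h: "hom (\<r> x \<star> reg.curry x y \<eta> s p) s x" using c by simp
  have "\<epsilon> \<star> (idn y \<boxtimes> (\<r> x \<star> reg.curry x y \<eta> s p))
      = reg.uncurry x y \<epsilon> unit (\<r>' x \<star> \<r> x \<star> reg.curry x y \<eta> s p)"
    using h by (subst uncurry_unit) simp_all
  also have "\<r>' x \<star> \<r> x \<star> reg.curry x y \<eta> s p = reg.curry x y \<eta> s p"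
    using c by (simp add: comp_nest[OF \<r>'_\<r>])
  also have "reg.uncurry x y \<epsilon> unit \<dots> = p"
    by (rule reg.uncurry_curry[OF d]) (use p s in simp_all)
  finally show "\<epsilon> \<star> (idn y \<boxtimes> (\<r> x \<star> reg.curry x y \<eta> s p)) = p" .
qed

lemma coev_right_exists:
  assumes d: "duality x y \<epsilon> \<eta>" and h: "hom h unit (x \<otimes>\<^sub>o q)" and q: "ob q"
  obtains g where "hom g y q" "(idn x \<boxtimes> g) \<star> \<eta> = h"
proof
  note [simp] = dualityD[OF d]
  have c: "hom (reg.uncurry x y \<epsilon> q h) (y \<otimes>\<^sub>o unit) q" using h q by (simp add: reg.arr_uncurry)
  show g: "hom (reg.uncurry x y \<epsilon> q h \<star> \<r>' y) y q" using c by simp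
  have "(idn x \<boxtimes> (reg.uncurry x y \<epsilon> q h \<star> \<r>' y)) \<star> \<eta>
      = reg.curry x y \<eta> unit ((reg.uncurry x y \<epsilon> q h \<star> \<r>' y) \<star> \<r> y)"
    using g by (subst curry_unit) simp_all
  also have "(reg.uncurry x y \<epsilon> q h \<star> \<r>' y) \<star> \<r> y = reg.uncurry x y \<epsilon> q h"
    using c by (simp add: comp_assoc)
  also have "reg.curry x y \<eta> unit \<dots> = h"
    by (rule reg.curry_uncurry[OF d]) (use h q in simp_all)
  finally show "(idn x \<boxtimes> (reg.uncurry x y \<epsilon> q h \<star> \<r>' y)) \<star> \<eta> = h" .
qed

text \<open>
  An arrow into \<open>y\<close> is determined by its pairing with \<open>x\<close>, and an explicit formula recovers it; this
  avoids transposition along tensoring on the right.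
\<close>

lemma ev_left_recover:
  assumes d: "duality x y \<epsilon> \<eta>" and g: "hom g s y"
  shows "\<l> y \<star> ((\<epsilon> \<star> (g \<boxtimes> idn x)) \<boxtimes> idn y) \<star> \<alpha>' s x y \<star> (idn s \<boxtimes> \<eta>) \<star> \<r>' s = g"
proof -
  note [simp] = dualityD[OF d] g
  have s[simp]: "ob s" using g ob_src by blast
  have zz: "\<l> y \<star> (\<epsilon> \<boxtimes> idn y) \<star> \<alpha>' y x y \<star> (idn y \<boxtimes> \<eta>) \<star> \<r>' y = idn y"
    using d by (simp add: duality_def)
  have "\<l> y \<star> ((\<epsilon> \<star> (g \<boxtimes> idn x)) \<boxtimes> idn y) \<star> \<alpha>' s x y \<star> (idn s \<boxtimes> \<eta>) \<star> \<r>' s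
    = \<l> y \<star> (\<epsilon> \<boxtimes> idn y) \<star> ((g \<boxtimes> idn x) \<boxtimes> idn y) \<star> \<alpha>' s x y \<star> (idn s \<boxtimes> \<eta>) \<star> \<r>' s"
    by (simp add: reg.whisker_right comp_assoc)
  also have "\<dots> = \<l> y \<star> (\<epsilon> \<boxtimes> idn y) \<star> \<alpha>' y x y \<star> (g \<boxtimes> idn (x \<otimes>\<^sub>o y)) \<star> (idn s \<boxtimes> \<eta>) \<star> \<r>' s"
    using comp_nest[OF reg.\<beta>'_nat[of g "idn x" "idn y" y x y], of "(idn s \<boxtimes> \<eta>) \<star> \<r>' s"]
    by (simp add: comp_assoc)
  also have "\<dots> = \<l> y \<star> (\<epsilon> \<boxtimes> idn y) \<star> \<alpha>' y x y \<star> (idn y \<boxtimes> \<eta>) \<star> \<r>' y \<star> g"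
    by (simp add: comp_nest[OF reg.interchange] \<r>'_nat comp_assoc)
  also have "\<dots> = (\<l> y \<star> (\<epsilon> \<boxtimes> idn y) \<star> \<alpha>' y x y \<star> (idn y \<boxtimes> \<eta>) \<star> \<r>' y) \<star> g"
    by (simp add: comp_assoc)
  also have "\<dots> = g" unfolding zz by simp
  finally show ?thesis .
qed

lemma coev_left_recover:
  assumes d: "duality x y \<epsilon> \<eta>" and f: "hom f x s"
  shows "\<r> s \<star> (idn s \<boxtimes> \<epsilon>) \<star> \<alpha> s y x \<star> (((f \<boxtimes> idn y) \<star> \<eta>) \<boxtimes> idn x) \<star> \<l>' x = f"
proof -
  note [simp] = dualityD[OF d] f
  have s[simp]: "ob s" using f ob_tgt by blast
  have zz: "\<r> x \<star> (idn x \<boxtimes> \<epsilon>) \<star> \<alpha> x y x \<star> (\<eta> \<boxtimes> idn x) \<star> \<l>' x = idn x"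
    using d by (simp add: duality_def)
  have "\<r> s \<star> (idn s \<boxtimes> \<epsilon>) \<star> \<alpha> s y x \<star> (((f \<boxtimes> idn y) \<star> \<eta>) \<boxtimes> idn x) \<star> \<l>' x
    = \<r> s \<star> (idn s \<boxtimes> \<epsilon>) \<star> (f \<boxtimes> idn (y \<otimes>\<^sub>o x)) \<star> \<alpha> x y x \<star> (\<eta> \<boxtimes> idn x) \<star> \<l>' x"
    by (simp add: reg.whisker_right comp_nest[OF \<alpha>_nat] comp_assoc)
  also have "\<dots> = \<r> s \<star> (f \<boxtimes> idn unit) \<star> (idn x \<boxtimes> \<epsilon>) \<star> \<alpha> x y x \<star> (\<eta> \<boxtimes> idn x) \<star> \<l>' x"
    using comp_nest[OF reg.interchange[of f \<epsilon> x s "y \<otimes>\<^sub>o x" unit],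
        of "\<alpha> x y x \<star> (\<eta> \<boxtimes> idn x) \<star> \<l>' x"]
    by (simp add: comp_assoc)
  also have "\<dots> = f \<star> (\<r> x \<star> (idn x \<boxtimes> \<epsilon>) \<star> \<alpha> x y x \<star> (\<eta> \<boxtimes> idn x) \<star> \<l>' x)"
    by (simp add: comp_nest[OF \<r>_nat] comp_assoc)
  also have "\<dots> = f" unfolding zz by simp
  finally show ?thesis .
qed

lemma ev_left_inj:
  assumes d: "duality x y \<epsilon> \<eta>" and g: "hom g s y" "hom h s y" "\<epsilon> \<star> (g \<boxtimes> idn x) = \<epsilon> \<star> (h \<boxtimes> idn x)"
  shows "g = h"
  using ev_left_recover[OF d g(1)] ev_left_recover[OF d g(2)] unfolding g(3) by (rule trans[OF sym])

text \<open>
  A pair \<open>f, g\<close> of mates is characterised by the evaluations as well as by the coevaluations.  One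
  direction compares inverse transposes.  For the other, the evaluations provide a mate \<open>k\<close> of \<open>g\<close>,
  and \<open>k = f\<close> because both satisfy the coevaluation equation.
\<close>

lemma mates_iff:
  assumes d1: "duality x v \<epsilon>\<^sub>1 \<eta>\<^sub>1" and d2: "duality y u \<epsilon>\<^sub>2 \<eta>\<^sub>2" and f: "hom f x y" and g: "hom g u v"
  shows "\<epsilon>\<^sub>1 \<star> (g \<boxtimes> idn x) = \<epsilon>\<^sub>2 \<star> (idn u \<boxtimes> f) \<longleftrightarrow> (idn y \<boxtimes> g) \<star> \<eta>\<^sub>2 = (f \<boxtimes> idn v) \<star> \<eta>\<^sub>1"
proof -
  note [simp] = dualityD[OF d1] dualityD[OF d2] g
  have forward: "(idn y \<boxtimes> g) \<star> \<eta>\<^sub>2 = (k \<boxtimes> idn v) \<star> \<eta>\<^sub>1"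
    if k[simp]: "hom k x y" and eq: "\<epsilon>\<^sub>1 \<star> (g \<boxtimes> idn x) = \<epsilon>\<^sub>2 \<star> (idn u \<boxtimes> k)" for k
  proof -
    have "reg.uncurry y u \<epsilon>\<^sub>2 v ((k \<boxtimes> idn v) \<star> \<eta>\<^sub>1)
        = \<l> v \<star> (\<epsilon>\<^sub>2 \<boxtimes> idn v) \<star> \<alpha>' u y v \<star> (idn u \<boxtimes> (k \<boxtimes> idn v)) \<star> (idn u \<boxtimes> \<eta>\<^sub>1)"
      by (simp add: reg.uncurry_def reg.whisker_left comp_assoc)
    also have "\<dots> = \<l> v \<star> ((\<epsilon>\<^sub>2 \<star> (idn u \<boxtimes> k)) \<boxtimes> idn v) \<star> \<alpha>' u x v \<star> (idn u \<boxtimes> \<eta>\<^sub>1)"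
      by (simp add: comp_nest[OF reg.\<beta>'_nat] reg.whisker_right comp_assoc)
    also have "\<dots> = (\<l> v \<star> ((\<epsilon>\<^sub>1 \<star> (g \<boxtimes> idn x)) \<boxtimes> idn v) \<star> \<alpha>' u x v \<star> (idn u \<boxtimes> \<eta>\<^sub>1) \<star> \<r>' u) \<star> \<r> u"
      unfolding eq[symmetric] by (simp add: comp_assoc)
    also have "\<dots> = g \<star> \<r> u" by (subst ev_left_recover[OF d1 g]) simp
    finally have "reg.curry y u \<eta>\<^sub>2 unit (g \<star> \<r> u)
        = reg.curry y u \<eta>\<^sub>2 unit (reg.uncurry y u \<epsilon>\<^sub>2 v ((k \<boxtimes> idn v) \<star> \<eta>\<^sub>1))" by simp
    also have "\<dots> = (k \<boxtimes> idn v) \<star> \<eta>\<^sub>1"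
      by (rule reg.curry_uncurry[OF d2]) simp_all
    finally show ?thesis by (simp add: curry_unit)
  qed
  show ?thesis
  proof
    assume "\<epsilon>\<^sub>1 \<star> (g \<boxtimes> idn x) = \<epsilon>\<^sub>2 \<star> (idn u \<boxtimes> f)"
    then show "(idn y \<boxtimes> g) \<star> \<eta>\<^sub>2 = (f \<boxtimes> idn v) \<star> \<eta>\<^sub>1" using forward f by blast
  next
    assume R: "(idn y \<boxtimes> g) \<star> \<eta>\<^sub>2 = (f \<boxtimes> idn v) \<star> \<eta>\<^sub>1"
    obtain k where k: "hom k x y" "\<epsilon>\<^sub>2 \<star> (idn u \<boxtimes> k) = \<epsilon>\<^sub>1 \<star> (g \<boxtimes> idn x)"
      by (rule ev_right_exists[OF d2, of "\<epsilon>\<^sub>1 \<star> (g \<boxtimes> idn x)" x]) simp_all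
    have "(k \<boxtimes> idn v) \<star> \<eta>\<^sub>1 = (f \<boxtimes> idn v) \<star> \<eta>\<^sub>1" using forward[OF k(1) k(2)[symmetric]] R by simp
    then have "k = f"
      using coev_left_recover[OF d1 f] coev_left_recover[OF d1 k(1)] by (metis (no_types))
    with k show "\<epsilon>\<^sub>1 \<star> (g \<boxtimes> idn x) = \<epsilon>\<^sub>2 \<star> (idn u \<boxtimes> f)" by simp
  qed
qed

definition typed_mate where
  "typed_mate u \<epsilon> x y v \<eta> f = \<l> v \<star> (\<epsilon> \<boxtimes> idn v) \<star> \<alpha>' u y v \<star> (idn u \<boxtimes> (f \<boxtimes> idn v))
    \<star> (idn u \<boxtimes> \<eta>) \<star> \<r>' u"

text \<open>
  The equation between evaluations characterises the mate, by \<open>ev_left_inj\<close>.  It holds because the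
  defining formula is the inverse transpose of a coevaluation.
\<close>

lemma typed_mate:
  assumes d1: "duality x v \<epsilon>\<^sub>1 \<eta>\<^sub>1" and d2: "duality y u \<epsilon>\<^sub>2 \<eta>\<^sub>2" and f: "hom f x y"
  shows "hom (typed_mate u \<epsilon>\<^sub>2 x y v \<eta>\<^sub>1 f) u v"
    and "\<epsilon>\<^sub>1 \<star> (typed_mate u \<epsilon>\<^sub>2 x y v \<eta>\<^sub>1 f \<boxtimes> idn x) = \<epsilon>\<^sub>2 \<star> (idn u \<boxtimes> f)"
proof -
  note [simp] = dualityD[OF d1] dualityD[OF d2] f
  show h: "hom (typed_mate u \<epsilon>\<^sub>2 x y v \<eta>\<^sub>1 f) u v" by (simp add: typed_mate_def)
  have *: "typed_mate u \<epsilon>\<^sub>2 x y v \<eta>\<^sub>1 f \<star> \<r> u = reg.uncurry y u \<epsilon>\<^sub>2 v ((f \<boxtimes> idn v) \<star> \<eta>\<^sub>1)"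
    by (simp add: typed_mate_def reg.uncurry_def reg.whisker_left comp_assoc)
  have "(idn y \<boxtimes> typed_mate u \<epsilon>\<^sub>2 x y v \<eta>\<^sub>1 f) \<star> \<eta>\<^sub>2
      = reg.curry y u \<eta>\<^sub>2 unit (typed_mate u \<epsilon>\<^sub>2 x y v \<eta>\<^sub>1 f \<star> \<r> u)"
    using h by (subst curry_unit) simp_all
  also have "\<dots> = (f \<boxtimes> idn v) \<star> \<eta>\<^sub>1"
    unfolding * by (rule reg.curry_uncurry[OF d2]) simp_all
  finally show "\<epsilon>\<^sub>1 \<star> (typed_mate u \<epsilon>\<^sub>2 x y v \<eta>\<^sub>1 f \<boxtimes> idn x) = \<epsilon>\<^sub>2 \<star> (idn u \<boxtimes> f)"
    using mates_iff[OF d1 d2 f h] by blast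
qed

lemma nest_ev_nat:
  assumes "hom f p P" "hom g q Q" "hom h q' Q'" "hom k p' P'" "hom \<epsilon> (P \<otimes>\<^sub>o P') unit" "hom \<epsilon>' (Q \<otimes>\<^sub>o Q') unit"
  shows "nest_ev P Q Q' P' \<epsilon> \<epsilon>' \<star> ((f \<boxtimes> g) \<boxtimes> (h \<boxtimes> k))
    = nest_ev p q q' p' (\<epsilon> \<star> (f \<boxtimes> k)) (\<epsilon>' \<star> (g \<boxtimes> h))"
proof -
  note [simp] = assms
  have ob[simp]: "ob p" "ob q" "ob q'" "ob p'" "ob P" "ob Q" "ob Q'" "ob P'"
    using ob_src[of f] ob_src[of g] ob_src[of h] ob_src[of k] ob_tgt[of f] ob_tgt[of g]
      ob_tgt[of h] ob_tgt[of k] by simp_all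
  have "(\<l> P' \<star> (\<epsilon>' \<boxtimes> idn P') \<star> \<alpha>' Q Q' P') \<star> (g \<boxtimes> (h \<boxtimes> k))
      = \<l> P' \<star> ((\<epsilon>' \<star> (g \<boxtimes> h)) \<boxtimes> (idn P' \<star> k)) \<star> \<alpha>' q q' p'"
    by (simp add: reg.\<beta>'_nat comp_nest[OF tens_comp[symmetric]] comp_assoc)
  also have "\<dots> = \<l> P' \<star> (idn unit \<boxtimes> k) \<star> ((\<epsilon>' \<star> (g \<boxtimes> h)) \<boxtimes> idn p') \<star> \<alpha>' q q' p'"
    by (simp add: comp_nest[OF tens_comp[symmetric]])
  also have "\<dots> = k \<star> (\<l> p' \<star> ((\<epsilon>' \<star> (g \<boxtimes> h)) \<boxtimes> idn p') \<star> \<alpha>' q q' p')"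
    by (simp add: comp_nest[OF \<l>_nat] comp_assoc)
  finally have 1: "(\<l> P' \<star> (\<epsilon>' \<boxtimes> idn P') \<star> \<alpha>' Q Q' P') \<star> (g \<boxtimes> (h \<boxtimes> k))
    = k \<star> (\<l> p' \<star> ((\<epsilon>' \<star> (g \<boxtimes> h)) \<boxtimes> idn p') \<star> \<alpha>' q q' p')" .
  have "nest_ev P Q Q' P' \<epsilon> \<epsilon>' \<star> ((f \<boxtimes> g) \<boxtimes> (h \<boxtimes> k))
    = \<epsilon> \<star> (idn P \<boxtimes> (\<l> P' \<star> (\<epsilon>' \<boxtimes> idn P') \<star> \<alpha>' Q Q' P')) \<star> (f \<boxtimes> (g \<boxtimes> (h \<boxtimes> k)))
      \<star> \<alpha> p q (q' \<otimes>\<^sub>o p')"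
    by (simp add: nest_ev_def \<alpha>_nat comp_assoc)
  also have "\<dots> = \<epsilon> \<star> ((idn P \<star> f) \<boxtimes> ((\<l> P' \<star> (\<epsilon>' \<boxtimes> idn P') \<star> \<alpha>' Q Q' P') \<star> (g \<boxtimes> (h \<boxtimes> k))))
      \<star> \<alpha> p q (q' \<otimes>\<^sub>o p')"
    by (simp add: comp_nest[OF tens_comp[symmetric]])
  also have "\<dots> = \<epsilon> \<star> ((f \<star> idn p) \<boxtimes> (k \<star> (\<l> p' \<star> ((\<epsilon>' \<star> (g \<boxtimes> h)) \<boxtimes> idn p') \<star> \<alpha>' q q' p')))
      \<star> \<alpha> p q (q' \<otimes>\<^sub>o p')"
    unfolding 1 by simp
  also have "\<dots> = nest_ev p q q' p' (\<epsilon> \<star> (f \<boxtimes> k)) (\<epsilon>' \<star> (g \<boxtimes> h))"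
    by (subst tens_comp) (simp_all add: nest_ev_def comp_assoc)
  finally show ?thesis .
qed

end

section \<open>The pivotal trace of a tensor product\<close>

context typed_module
begin

text \<open>
  The partial trace over \<open>x\<close> for an arbitrary pair \<open>\<epsilon> : x' \<otimes> x \<rightarrow> 1\<close>, \<open>\<eta> : 1 \<rightarrow> x' \<otimes> x\<close>; for the
  pivotal trace, \<open>x'\<close> is the left dual and \<open>\<epsilon>\<close> the evaluation twisted by the pivotal structure.
\<close>

definition ptrace where
  "ptrace x' x \<epsilon> \<eta> p f = \<u> p \<bullet> (\<epsilon> \<rhd>\<^sub>a idM p) \<bullet> \<beta>' x' x p \<bullet> (idn x' \<rhd>\<^sub>a f) \<bullet> \<beta> x' x p
    \<bullet> (\<eta> \<rhd>\<^sub>a idM p) \<bullet> \<u>' p"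

lemma hom_ptrace:
  "\<lbrakk>ob x'; ob x; hom \<epsilon> (x' \<otimes>\<^sub>o x) unit; hom \<eta> unit (x' \<otimes>\<^sub>o x); obM p; M.hom f (x \<rhd>\<^sub>o p) (x \<rhd>\<^sub>o p)\<rbrakk>
    \<Longrightarrow> M.hom (ptrace x' x \<epsilon> \<eta> p f) p p"
  by (simp add: ptrace_def)

end

locale typed_pivotal = typed_monoidal ob arr idn comp tensO tens unit \<alpha> \<alpha>' \<l> \<l>' \<r> \<r>'
  for ob :: "'o \<Rightarrow> bool" and arr :: "('o, 'a) arrow \<Rightarrow> bool"
    and idn :: "'o \<Rightarrow> ('o, 'a) arrow"
    and comp :: "('o, 'a) arrow \<Rightarrow> ('o, 'a) arrow \<Rightarrow> ('o, 'a) arrow" (infixr "\<star>" 60)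
    and tensO :: "'o \<Rightarrow> 'o \<Rightarrow> 'o" (infixr "\<otimes>\<^sub>o" 75)
    and tens :: "('o, 'a) arrow \<Rightarrow> ('o, 'a) arrow \<Rightarrow> ('o, 'a) arrow" (infixr "\<boxtimes>" 75)
    and unit :: 'o
    and \<alpha> \<alpha>' :: "'o \<Rightarrow> 'o \<Rightarrow> 'o \<Rightarrow> ('o, 'a) arrow"
    and \<l> \<l>' \<r> \<r>' :: "'o \<Rightarrow> ('o, 'a) arrow" +
  fixes rd ld :: "'o \<Rightarrow> 'o" and ev coev evl coevl piv :: "'o \<Rightarrow> ('o, 'a) arrow"
  assumes duality_right: "ob x \<Longrightarrow> duality x (rd x) (ev x) (coev x)"
    and duality_left: "ob x \<Longrightarrow> duality (ld x) x (evl x) (coevl x)"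
begin

definition dual_map :: "('o, 'a) arrow \<Rightarrow> ('o, 'a) arrow" where
  "dual_map f = typed_mate (rd (tgt f)) (ev (tgt f)) (src f) (tgt f) (rd (src f)) (coev (src f)) f"

definition ldual_iso :: "'o \<Rightarrow> ('o, 'a) arrow" where
  "ldual_iso x = typed_mate x (evl x) (ld x) (ld x) (rd (ld x)) (coev (ld x)) (idn (ld x))"

definition rdual_tens_iso :: "'o \<Rightarrow> 'o \<Rightarrow> ('o, 'a) arrow" where
  "rdual_tens_iso x y = typed_mate (rd (x \<otimes>\<^sub>o y)) (ev (x \<otimes>\<^sub>o y)) (x \<otimes>\<^sub>o y) (x \<otimes>\<^sub>o y) (rd y \<otimes>\<^sub>o rd x)
    (nest_coev x y (rd y) (rd x) (coev x) (coev y)) (idn (x \<otimes>\<^sub>o y))"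

lemma ob_rd [simp]: "ob x \<Longrightarrow> ob (rd x)" and ob_ld [simp]: "ob x \<Longrightarrow> ob (ld x)"
  using duality_right duality_left by auto

lemma hom_ev [simp]: "ob x \<Longrightarrow> arr (ev x)" "ob x \<Longrightarrow> src (ev x) = rd x \<otimes>\<^sub>o x" "ob x \<Longrightarrow> tgt (ev x) = unit"
  and hom_evl [simp]: "ob x \<Longrightarrow> arr (evl x)" "ob x \<Longrightarrow> src (evl x) = x \<otimes>\<^sub>o ld x" "ob x \<Longrightarrow> tgt (evl x) = unit"
  and hom_coev [simp]: "ob x \<Longrightarrow> arr (coev x)" "ob x \<Longrightarrow> tgt (coev x) = x \<otimes>\<^sub>o rd x" "ob x \<Longrightarrow> src (coev x) = unit"
  and hom_coevl [simp]: "ob x \<Longrightarrow> arr (coevl x)" "ob x \<Longrightarrow> tgt (coevl x) = ld x \<otimes>\<^sub>o x" "ob x \<Longrightarrow> src (coevl x) = unit"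
  using duality_right[of x] duality_left[of x] by (auto simp: duality_def)

lemma hom_dual_map [simp]: "arr f \<Longrightarrow> arr (dual_map f)" "arr f \<Longrightarrow> src (dual_map f) = rd (tgt f)" "arr f \<Longrightarrow> tgt (dual_map f) = rd (src f)"
  and ev_dual_map: "arr f \<Longrightarrow> ev (src f) \<star> (dual_map f \<boxtimes> idn (src f)) = ev (tgt f) \<star> (idn (rd (tgt f)) \<boxtimes> f)"
  using typed_mate[OF duality_right duality_right, of "src f" "tgt f" f] unfolding dual_map_def by auto

lemma hom_ldual_iso [simp]: "ob x \<Longrightarrow> arr (ldual_iso x)" "ob x \<Longrightarrow> src (ldual_iso x) = x" "ob x \<Longrightarrow> tgt (ldual_iso x) = rd (ld x)"
  and ev_ldual_iso: "ob x \<Longrightarrow> ev (ld x) \<star> (ldual_iso x \<boxtimes> idn (ld x)) = evl x"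
  using typed_mate[OF duality_right duality_left, of "ld x" x "idn (ld x)"] unfolding ldual_iso_def by auto

lemma duality_rdual_tens:
  assumes "ob x" "ob y"
  shows "duality (x \<otimes>\<^sub>o y) (rd y \<otimes>\<^sub>o rd x) (nest_ev (rd y) (rd x) x y (ev y) (ev x))
    (nest_coev x y (rd y) (rd x) (coev x) (coev y))"
  using duality_tens[OF duality_right[OF assms(1)] duality_right[OF assms(2)]] .

lemma hom_rdual_tens_iso [simp]:
    "\<lbrakk>ob x; ob y\<rbrakk> \<Longrightarrow> arr (rdual_tens_iso x y)" "\<lbrakk>ob x; ob y\<rbrakk> \<Longrightarrow> src (rdual_tens_iso x y) = rd (x \<otimes>\<^sub>o y)"
    "\<lbrakk>ob x; ob y\<rbrakk> \<Longrightarrow> tgt (rdual_tens_iso x y) = rd y \<otimes>\<^sub>o rd x"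
  and ev_rdual_tens_iso: "\<lbrakk>ob x; ob y\<rbrakk> \<Longrightarrow> nest_ev (rd y) (rd x) x y (ev y) (ev x)
      \<star> (rdual_tens_iso x y \<boxtimes> idn (x \<otimes>\<^sub>o y)) = ev (x \<otimes>\<^sub>o y)"
  using typed_mate[OF duality_rdual_tens duality_right, of x y "x \<otimes>\<^sub>o y" "idn (x \<otimes>\<^sub>o y)"] unfolding rdual_tens_iso_def by auto

text \<open>
  Both composites of the canonical morphisms between two right duals are compatible with the
  evaluations, hence identities.
\<close>

lemma rdual_tens_iso_inverse:
  assumes "ob x" "ob y"
  obtains s where "hom s (rd y \<otimes>\<^sub>o rd x) (rd (x \<otimes>\<^sub>o y))" "rdual_tens_iso x y \<star> s = idn (rd y \<otimes>\<^sub>o rd x)"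
    "s \<star> rdual_tens_iso x y = idn (rd (x \<otimes>\<^sub>o y))" "ev (x \<otimes>\<^sub>o y) \<star> (s \<boxtimes> idn (x \<otimes>\<^sub>o y)) =
      nest_ev (rd y) (rd x) x y (ev y) (ev x)"
proof -
  note [simp] = assms
  let ?z = "x \<otimes>\<^sub>o y" and ?v = "rd y \<otimes>\<^sub>o rd x" and ?n = "nest_ev (rd y) (rd x) x y (ev y) (ev x)"
  define s where "s = typed_mate ?v ?n ?z ?z (rd ?z) (coev ?z) (idn ?z)"
  have n[simp]: "arr ?n" "src ?n = ?v \<otimes>\<^sub>o ?z" "tgt ?n = unit"
    using duality_rdual_tens[OF assms] by (auto simp: duality_def)
  have s: "hom s ?v (rd ?z)" and es: "ev ?z \<star> (s \<boxtimes> idn ?z) = ?n"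
    using typed_mate[OF duality_right duality_rdual_tens, of ?z x y "idn ?z"] unfolding s_def by auto
  note [simp] = s
  have "rdual_tens_iso x y \<star> s = idn ?v"
  proof (rule ev_left_inj[OF duality_rdual_tens[OF assms]])
    show "?n \<star> ((rdual_tens_iso x y \<star> s) \<boxtimes> idn ?z) = ?n \<star> (idn ?v \<boxtimes> idn ?z)"
      by (simp add: reg.whisker_right comp_nest[OF ev_rdual_tens_iso] es)
  qed simp_all
  moreover have "s \<star> rdual_tens_iso x y = idn (rd ?z)"
  proof (rule ev_left_inj[OF duality_right[of ?z]])
    show "ev ?z \<star> ((s \<star> rdual_tens_iso x y) \<boxtimes> idn ?z) = ev ?z \<star> (idn (rd ?z) \<boxtimes> idn ?z)"
      by (simp add: reg.whisker_right comp_nest[OF es] ev_rdual_tens_iso)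
  qed simp_all
  ultimately show ?thesis using that s es by blast
qed

end

text \<open>
  The double dual of a tensor product involves the inverse of a canonical isomorphism.  Quantifying
  over an arbitrary inverse \<open>s\<close> states its compatibility without a choice operator.
\<close>

locale typed_pivotal_structure = typed_pivotal +
  assumes hom_piv [simp]: "ob x \<Longrightarrow> arr (piv x)" "src (piv x) = x" "tgt (piv x) = rd (rd x)"
    and piv_nat: "arr f \<Longrightarrow> piv (tgt f) \<star> f = dual_map (dual_map f) \<star> piv (src f)"
    and piv_tens: "\<lbrakk>ob x; ob y; hom s (rd (rd x) \<otimes>\<^sub>o rd (rd y)) (rd (rd y \<otimes>\<^sub>o rd x));
        rdual_tens_iso (rd y) (rd x) \<star> s = idn (rd (rd x) \<otimes>\<^sub>o rd (rd y));
        s \<star> rdual_tens_iso (rd y) (rd x) = idn (rd (rd y \<otimes>\<^sub>o rd x))\<rbrakk>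
      \<Longrightarrow> piv (x \<otimes>\<^sub>o y) = dual_map (rdual_tens_iso x y) \<star> s \<star> (piv x \<boxtimes> piv y)"
begin

text \<open>
  The pivotal structure turns the left dual into a right dual with this evaluation.
\<close>

definition piv_ev where
  "piv_ev x = ev x \<star> ((dual_map (ldual_iso x) \<star> piv (ld x)) \<boxtimes> idn x)"

definition trace_ar where
  "trace_ar x f = piv_ev x \<star> (idn (ld x) \<boxtimes> f) \<star> coevl x"

lemma hom_piv_ev [simp]: "ob x \<Longrightarrow> arr (piv_ev x)" "ob x \<Longrightarrow> src (piv_ev x) = ld x \<otimes>\<^sub>o x" "ob x \<Longrightarrow> tgt (piv_ev x) = unit"
  by (simp_all add: piv_ev_def)

text \<open>
  In this form the pivotal structure is applied to the left dual directly and its naturality can be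
  used, while the canonical isomorphism \<open>ldual_iso\<close> sits on the other tensor factor.
\<close>

lemma piv_ev_eq: "ob x \<Longrightarrow> piv_ev x = ev (rd (ld x)) \<star> (piv (ld x) \<boxtimes> ldual_iso x)"
proof -
  assume [simp]: "ob x"
  have "piv_ev x = (ev x \<star> (dual_map (ldual_iso x) \<boxtimes> idn x)) \<star> (piv (ld x) \<boxtimes> idn x)"
    by (simp add: piv_ev_def reg.whisker_right comp_assoc)
  also have "\<dots> = ev (rd (ld x)) \<star> ((idn (rd (rd (ld x))) \<boxtimes> ldual_iso x) \<star> (piv (ld x) \<boxtimes> idn x))"
    using ev_dual_map[of "ldual_iso x"] by (simp add: comp_assoc)
  finally show ?thesis by (simp flip: tens_comp)
qed

lemma ev_dual_map_tens:
  assumes "arr f" "arr g" "arr h" "tgt g = rd (tgt f)" "tgt h = src f"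
  shows "ev (src f) \<star> ((dual_map f \<star> g) \<boxtimes> h) = ev (tgt f) \<star> (g \<boxtimes> (f \<star> h))"
proof -
  note [simp] = assms
  have "ev (src f) \<star> ((dual_map f \<star> g) \<boxtimes> h) = ev (src f) \<star> (dual_map f \<boxtimes> idn (src f)) \<star> (g \<boxtimes> h)"
    by (simp flip: tens_comp)
  also have "\<dots> = ev (tgt f) \<star> (idn (rd (tgt f)) \<boxtimes> f) \<star> (g \<boxtimes> h)"
    by (simp add: comp_nest[OF ev_dual_map] comp_assoc)
  also have "\<dots> = ev (tgt f) \<star> (g \<boxtimes> (f \<star> h))"
    by (simp flip: tens_comp)
  finally show ?thesis .
qed

lemma ev_ldual_iso_tens:
  assumes "ob x" "arr g" "arr h" "tgt g = x" "tgt h = ld x"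
  shows "ev (ld x) \<star> ((ldual_iso x \<star> g) \<boxtimes> h) = evl x \<star> (g \<boxtimes> h)"
proof -
  note [simp] = assms
  have "ev (ld x) \<star> ((ldual_iso x \<star> g) \<boxtimes> h) = ev (ld x) \<star> (ldual_iso x \<boxtimes> idn (ld x)) \<star> (g \<boxtimes> h)"
    by (simp flip: tens_comp)
  then show ?thesis by (simp add: comp_nest[OF ev_ldual_iso])
qed

text \<open>
  The arrow \<open>k\<close> is the left dual of \<open>f\<close>.  Naturality of the pivotal structure produces the double
  dual of \<open>k\<close>, one dual of which is moved to the other factor, where it meets \<open>ldual_iso\<close>.
\<close>

lemma piv_ev_nat:
  assumes f: "hom f x y" and k: "hom k (ld y) (ld x)"
    and kf: "evl x \<star> (idn x \<boxtimes> k) = evl y \<star> (f \<boxtimes> idn (ld y))"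
  shows "piv_ev y \<star> (idn (ld y) \<boxtimes> f) = piv_ev x \<star> (k \<boxtimes> idn x)"
proof -
  note [simp] = f k
  have [simp]: "ob x" "ob y" using ob_src[of f] ob_tgt[of f] by simp_all
  have ldual_iso: "dual_map k \<star> ldual_iso x = ldual_iso y \<star> f"
  proof (rule ev_left_inj[OF duality_right[of "ld y"]])
    have "ev (ld y) \<star> ((dual_map k \<star> ldual_iso x) \<boxtimes> idn (ld y)) = ev (ld x) \<star> (ldual_iso x \<boxtimes> k)"
      using ev_dual_map_tens[of k "ldual_iso x" "idn (ld y)"] by simp
    also have "\<dots> = evl x \<star> (idn x \<boxtimes> k)"
      using ev_ldual_iso_tens[of x "idn x" k] by simp
    also have "\<dots> = ev (ld y) \<star> ((ldual_iso y \<star> f) \<boxtimes> idn (ld y))"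
      unfolding kf using ev_ldual_iso_tens[of y f "idn (ld y)"] by simp
    finally show "ev (ld y) \<star> ((dual_map k \<star> ldual_iso x) \<boxtimes> idn (ld y)) = ev (ld y) \<star> ((ldual_iso y \<star> f) \<boxtimes> idn (ld y))" .
  qed simp_all
  have "piv_ev x \<star> (k \<boxtimes> idn x) = ev (rd (ld x)) \<star> ((dual_map (dual_map k) \<star> piv (ld y)) \<boxtimes> ldual_iso x)"
    using piv_nat[of k] by (simp add: piv_ev_eq comp_assoc flip: tens_comp)
  also have "\<dots> = ev (rd (ld y)) \<star> (piv (ld y) \<boxtimes> (ldual_iso y \<star> f))"
    using ev_dual_map_tens[of "dual_map k" "piv (ld y)" "ldual_iso x"] by (simp add: ldual_iso)
  also have "\<dots> = piv_ev y \<star> (idn (ld y) \<boxtimes> f)"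
    by (simp add: piv_ev_eq comp_assoc flip: tens_comp)
  finally show ?thesis ..
qed

text \<open>
  Slide \<open>f\<close> around the loop: through the coevaluation it becomes its left dual, and \<open>piv_ev_nat\<close>
  turns it back at the evaluation.
\<close>

lemma trace_ar_cyclic:
  assumes f: "hom f x y" and g: "hom g y x"
  shows "trace_ar x (g \<star> f) = trace_ar y (f \<star> g)"
proof -
  note [simp] = f g
  have [simp]: "ob x" "ob y" using ob_src[of f] ob_tgt[of f] by simp_all
  obtain k where k[simp]: "hom k (ld y) (ld x)" and kf: "evl x \<star> (idn x \<boxtimes> k) = evl y \<star> (f \<boxtimes> idn (ld y))"
    by (rule ev_right_exists[OF duality_left[of x], of "evl y \<star> (f \<boxtimes> idn (ld y))" "ld y"]) simp_all
  have co: "(idn (ld x) \<boxtimes> f) \<star> coevl x = (k \<boxtimes> idn y) \<star> coevl y"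
    using mates_iff[OF duality_left[of y] duality_left[of x], of k f] kf by simp
  have "trace_ar x (g \<star> f) = piv_ev x \<star> (idn (ld x) \<boxtimes> g) \<star> (idn (ld x) \<boxtimes> f) \<star> coevl x"
    by (simp add: trace_ar_def reg.whisker_left comp_assoc)
  also have "\<dots> = piv_ev x \<star> (idn (ld x) \<boxtimes> g) \<star> (k \<boxtimes> idn y) \<star> coevl y"
    unfolding co ..
  also have "\<dots> = (piv_ev x \<star> (k \<boxtimes> idn x)) \<star> (idn (ld y) \<boxtimes> g) \<star> coevl y"
    using comp_nest[OF reg.interchange[of k g "ld y" "ld x" y x], of "coevl y"] by (simp add: comp_assoc)
  also have "\<dots> = trace_ar y (f \<star> g)"
    unfolding piv_ev_nat[OF f k kf, symmetric] by (simp add: trace_ar_def reg.whisker_left comp_assoc)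
  finally show ?thesis .
qed

text \<open>
  This is where monoidality of the pivotal structure enters.  The arrow \<open>\<theta>\<close> is the canonical
  isomorphism from \<open>ld y \<otimes> ld x\<close> to the left dual of \<open>x \<otimes> y\<close>; under it, the twisted evaluation of the
  tensor product is the nested one.
\<close>

lemma piv_ev_tens:
  assumes x: "ob x" and y: "ob y"
  obtains \<theta> where "hom \<theta> (ld y \<otimes>\<^sub>o ld x) (ld (x \<otimes>\<^sub>o y))"
    "(\<theta> \<boxtimes> idn (x \<otimes>\<^sub>o y)) \<star> nest_coev (ld y) (ld x) x y (coevl y) (coevl x) = coevl (x \<otimes>\<^sub>o y)"
    "piv_ev (x \<otimes>\<^sub>o y) \<star> (\<theta> \<boxtimes> idn (x \<otimes>\<^sub>o y)) = nest_ev (ld y) (ld x) x y (piv_ev y) (piv_ev x)"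
proof -
  note [simp] = x y
  let ?z = "x \<otimes>\<^sub>o y" and ?a = "ld x" and ?b = "ld y"
  let ?e = "nest_ev x y ?b ?a (evl x) (evl y)"
  have d: "duality (?b \<otimes>\<^sub>o ?a) ?z ?e (nest_coev ?b ?a x y (coevl y) (coevl x))"
    by (rule duality_tens[OF duality_left[OF y] duality_left[OF x]])
  have e: "hom ?e (?z \<otimes>\<^sub>o (?b \<otimes>\<^sub>o ?a)) unit" using d by (simp add: duality_def)
  obtain \<theta> where th[simp]: "hom \<theta> (?b \<otimes>\<^sub>o ?a) (ld ?z)" and ev: "evl ?z \<star> (idn ?z \<boxtimes> \<theta>) = ?e"
    by (rule ev_right_exists[OF duality_left[of ?z] e]) simp_all
  have "?e \<star> (idn ?z \<boxtimes> idn (?b \<otimes>\<^sub>o ?a)) = evl ?z \<star> (idn ?z \<boxtimes> \<theta>)"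
    unfolding ev using e by simp
  then have "(idn (ld ?z) \<boxtimes> idn ?z) \<star> coevl ?z
      = (\<theta> \<boxtimes> idn ?z) \<star> nest_coev ?b ?a x y (coevl y) (coevl x)"
    by (rule iffD1[OF mates_iff[OF d duality_left[of ?z]], rotated -1]) simp_all
  then have 1: "(\<theta> \<boxtimes> idn ?z) \<star> nest_coev ?b ?a x y (coevl y) (coevl x) = coevl ?z" by simp
  obtain s where s[simp]: "hom s (rd (rd ?b) \<otimes>\<^sub>o rd (rd ?a)) (rd (rd ?a \<otimes>\<^sub>o rd ?b))"
    and s1: "rdual_tens_iso (rd ?a) (rd ?b) \<star> s = idn (rd (rd ?b) \<otimes>\<^sub>o rd (rd ?a))"
    and s2: "s \<star> rdual_tens_iso (rd ?a) (rd ?b) = idn (rd (rd ?a \<otimes>\<^sub>o rd ?b))"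
    and s3: "ev (rd ?a \<otimes>\<^sub>o rd ?b) \<star> (s \<boxtimes> idn (rd ?a \<otimes>\<^sub>o rd ?b))
      = nest_ev (rd (rd ?b)) (rd (rd ?a)) (rd ?a) (rd ?b) (ev (rd ?b)) (ev (rd ?a))"
    by (rule rdual_tens_iso_inverse[of "rd ?a" "rd ?b"]) simp_all
  have pt: "piv (?b \<otimes>\<^sub>o ?a) = dual_map (rdual_tens_iso ?b ?a) \<star> s \<star> (piv ?b \<boxtimes> piv ?a)"
    by (rule piv_tens) (use s s1 s2 in simp_all)
  have rr: "rdual_tens_iso ?b ?a \<star> dual_map \<theta> \<star> ldual_iso ?z = ldual_iso x \<boxtimes> ldual_iso y"
  proof (rule ev_left_inj[OF duality_rdual_tens[of ?b ?a]])
    let ?n = "nest_ev (rd ?a) (rd ?b) ?b ?a (ev ?a) (ev ?b)"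
    have n[simp]: "arr ?n" "src ?n = (rd ?a \<otimes>\<^sub>o rd ?b) \<otimes>\<^sub>o (?b \<otimes>\<^sub>o ?a)" "tgt ?n = unit"
      using duality_rdual_tens[of ?b ?a] by (auto simp: duality_def)
    have "?n \<star> ((rdual_tens_iso ?b ?a \<star> dual_map \<theta> \<star> ldual_iso ?z) \<boxtimes> idn (?b \<otimes>\<^sub>o ?a))
        = ev (?b \<otimes>\<^sub>o ?a) \<star> ((dual_map \<theta> \<star> ldual_iso ?z) \<boxtimes> idn (?b \<otimes>\<^sub>o ?a))"
      by (simp add: reg.whisker_right comp_nest[OF ev_rdual_tens_iso])
    also have "\<dots> = ev (ld ?z) \<star> (ldual_iso ?z \<boxtimes> \<theta>)"
      using ev_dual_map_tens[of \<theta> "ldual_iso ?z" "idn (?b \<otimes>\<^sub>o ?a)"] by simp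
    also have "\<dots> = ?e" using ev_ldual_iso_tens[of ?z "idn ?z" \<theta>] ev by simp
    also have "\<dots> = nest_ev x y ?b ?a (ev ?a \<star> (ldual_iso x \<boxtimes> idn ?a)) (ev ?b \<star> (ldual_iso y \<boxtimes> idn ?b))"
      by (simp add: ev_ldual_iso)
    also have "\<dots> = ?n \<star> ((ldual_iso x \<boxtimes> ldual_iso y) \<boxtimes> (idn ?b \<boxtimes> idn ?a))"
      by (rule nest_ev_nat[symmetric]) simp_all
    finally show "?n \<star> ((rdual_tens_iso ?b ?a \<star> dual_map \<theta> \<star> ldual_iso ?z) \<boxtimes> idn (?b \<otimes>\<^sub>o ?a))
        = ?n \<star> ((ldual_iso x \<boxtimes> ldual_iso y) \<boxtimes> idn (?b \<otimes>\<^sub>o ?a))" by simp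
  qed simp_all
  have "piv_ev ?z \<star> (\<theta> \<boxtimes> idn ?z) = ev (rd (ld ?z)) \<star> ((dual_map (dual_map \<theta>) \<star> piv (?b \<otimes>\<^sub>o ?a)) \<boxtimes> ldual_iso ?z)"
    using piv_nat[of \<theta>] by (simp add: piv_ev_eq comp_assoc flip: tens_comp)
  also have "\<dots> = ev (rd (?b \<otimes>\<^sub>o ?a)) \<star> (piv (?b \<otimes>\<^sub>o ?a) \<boxtimes> (dual_map \<theta> \<star> ldual_iso ?z))"
    using ev_dual_map_tens[of "dual_map \<theta>" "piv (?b \<otimes>\<^sub>o ?a)" "ldual_iso ?z"] by simp
  also have "\<dots> = ev (rd ?a \<otimes>\<^sub>o rd ?b) \<star> ((s \<star> (piv ?b \<boxtimes> piv ?a)) \<boxtimes> (ldual_iso x \<boxtimes> ldual_iso y))"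
    unfolding pt
    using ev_dual_map_tens[of "rdual_tens_iso ?b ?a" "s \<star> (piv ?b \<boxtimes> piv ?a)" "dual_map \<theta> \<star> ldual_iso ?z"] by (simp add: rr)
  also have "\<dots> = ev (rd ?a \<otimes>\<^sub>o rd ?b) \<star> (s \<boxtimes> idn (rd ?a \<otimes>\<^sub>o rd ?b)) \<star> ((piv ?b \<boxtimes> piv ?a) \<boxtimes> (ldual_iso x \<boxtimes> ldual_iso y))"
    by (simp flip: tens_comp)
  also have "\<dots> = (ev (rd ?a \<otimes>\<^sub>o rd ?b) \<star> (s \<boxtimes> idn (rd ?a \<otimes>\<^sub>o rd ?b))) \<star> ((piv ?b \<boxtimes> piv ?a) \<boxtimes> (ldual_iso x \<boxtimes> ldual_iso y))"
    by (subst comp_assoc) simp_all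
  also have "\<dots> = nest_ev ?b ?a x y (ev (rd ?b) \<star> (piv ?b \<boxtimes> ldual_iso y)) (ev (rd ?a) \<star> (piv ?a \<boxtimes> ldual_iso x))"
    unfolding s3 by (rule nest_ev_nat) simp_all
  also have "\<dots> = nest_ev ?b ?a x y (piv_ev y) (piv_ev x)" by (simp add: piv_ev_eq)
  finally show ?thesis using that th 1 by blast
qed

text \<open>
  Replace evaluation and coevaluation of \<open>x \<otimes> y\<close> by the nested ones; the inner loop is then the
  partial trace over \<open>x\<close>.
\<close>

lemma trace_ar_tens:
  assumes x: "ob x" and y: "ob y" and f: "hom f (x \<otimes>\<^sub>o y) (x \<otimes>\<^sub>o y)"
  shows "trace_ar (x \<otimes>\<^sub>o y) f = trace_ar y (reg.ptrace (ld x) x (piv_ev x) (coevl x) y f)"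
proof -
  note [simp] = x y f
  let ?z = "x \<otimes>\<^sub>o y" and ?a = "ld x" and ?b = "ld y"
  let ?e = "nest_ev ?b ?a x y (piv_ev y) (piv_ev x)" and ?c = "nest_coev ?b ?a x y (coevl y) (coevl x)"
  obtain \<theta> where th[simp]: "hom \<theta> (?b \<otimes>\<^sub>o ?a) (ld ?z)"
    and 1: "(\<theta> \<boxtimes> idn ?z) \<star> ?c = coevl ?z" and 2: "piv_ev ?z \<star> (\<theta> \<boxtimes> idn ?z) = ?e"
    by (rule piv_ev_tens[OF x y]) blast
  have c[simp]: "arr ?c" "src ?c = unit" "tgt ?c = (?b \<otimes>\<^sub>o ?a) \<otimes>\<^sub>o ?z"
    using hom_nest_coev[of ?b ?a x y "coevl y" "coevl x"] by simp_all
  have "trace_ar ?z f = piv_ev ?z \<star> (idn (ld ?z) \<boxtimes> f) \<star> (\<theta> \<boxtimes> idn ?z) \<star> ?c"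
    unfolding 1 by (simp add: trace_ar_def)
  also have "\<dots> = (piv_ev ?z \<star> (\<theta> \<boxtimes> idn ?z)) \<star> (idn (?b \<otimes>\<^sub>o ?a) \<boxtimes> f) \<star> ?c"
    using comp_nest[OF reg.interchange[of \<theta> f "?b \<otimes>\<^sub>o ?a" "ld ?z" ?z ?z], of ?c] by (simp add: comp_assoc)
  also have "\<dots> = ?e \<star> (idn (?b \<otimes>\<^sub>o ?a) \<boxtimes> f) \<star> ?c" unfolding 2 ..
  also have "\<dots> = piv_ev y \<star> (idn ?b \<boxtimes> (\<l> y \<star> (piv_ev x \<boxtimes> idn y) \<star> \<alpha>' ?a x y))
      \<star> (idn ?b \<boxtimes> (idn ?a \<boxtimes> f)) \<star> (idn ?b \<boxtimes> (\<alpha> ?a x y \<star> (coevl x \<boxtimes> idn y) \<star> \<l>' y)) \<star> coevl y"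
    using comp_nest[OF \<alpha>_nat[of "idn ?b" "idn ?a" f ?b ?a ?z]]
    by (simp add: nest_ev_def nest_coev_def comp_assoc comp_nest[OF \<alpha>_\<alpha>'])
  also have "\<dots> = trace_ar y (reg.ptrace ?a x (piv_ev x) (coevl x) y f)"
    by (simp add: trace_ar_def reg.ptrace_def reg.whisker_left comp_assoc)
  finally show ?thesis .
qed

end

section \<open>The inner hom as a module functor\<close>

text \<open>
  The functor \<open>\<F>\<close> is right adjoint to \<open>- \<rhd> m\<close>, given by its counit \<open>e\<close> and the universal property.
\<close>

locale typed_inner_hom =
  typed_pivotal_structure ob arr idn comp tensO tens unit \<alpha> \<alpha>' \<l> \<l>' \<r> \<r>' rd ld ev coev evl coevl piv +
  typed_module ob arr idn comp tensO tens unit \<alpha> \<alpha>' \<l> \<l>' \<r> \<r>' obM arrM idM compM actO act \<beta> \<beta>' \<u> \<u>'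
  for ob :: "'o \<Rightarrow> bool" and arr :: "('o, 'a) arrow \<Rightarrow> bool"
    and idn :: "'o \<Rightarrow> ('o, 'a) arrow"
    and comp :: "('o, 'a) arrow \<Rightarrow> ('o, 'a) arrow \<Rightarrow> ('o, 'a) arrow" (infixr "\<star>" 60)
    and tensO :: "'o \<Rightarrow> 'o \<Rightarrow> 'o" (infixr "\<otimes>\<^sub>o" 75)
    and tens :: "('o, 'a) arrow \<Rightarrow> ('o, 'a) arrow \<Rightarrow> ('o, 'a) arrow" (infixr "\<boxtimes>" 75)
    and unit :: 'o
    and \<alpha> \<alpha>' :: "'o \<Rightarrow> 'o \<Rightarrow> 'o \<Rightarrow> ('o, 'a) arrow"
    and \<l> \<l>' \<r> \<r>' :: "'o \<Rightarrow> ('o, 'a) arrow"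
    and rd ld :: "'o \<Rightarrow> 'o" and ev coev evl coevl piv :: "'o \<Rightarrow> ('o, 'a) arrow"
    and obM :: "'n \<Rightarrow> bool" and arrM :: "('n, 'b) arrow \<Rightarrow> bool"
    and idM :: "'n \<Rightarrow> ('n, 'b) arrow"
    and compM :: "('n, 'b) arrow \<Rightarrow> ('n, 'b) arrow \<Rightarrow> ('n, 'b) arrow" (infixr "\<bullet>" 60)
    and actO :: "'o \<Rightarrow> 'n \<Rightarrow> 'n" (infixr "\<rhd>\<^sub>o" 75)
    and act :: "('o, 'a) arrow \<Rightarrow> ('n, 'b) arrow \<Rightarrow> ('n, 'b) arrow" (infixr "\<rhd>\<^sub>a" 75)
    and \<beta> \<beta>' :: "'o \<Rightarrow> 'o \<Rightarrow> 'n \<Rightarrow> ('n, 'b) arrow"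
    and \<u> \<u>' :: "'n \<Rightarrow> ('n, 'b) arrow" +
  fixes m :: 'n and F :: "'n \<Rightarrow> 'o" and \<F> :: "('n, 'b) arrow \<Rightarrow> ('o, 'a) arrow"
    and e :: "'n \<Rightarrow> ('n, 'b) arrow"
  assumes ob_m [simp]: "obM m"
    and ob_F [simp]: "obM n \<Longrightarrow> ob (F n)"
    and hom_e [simp]: "obM n \<Longrightarrow> arrM (e n)" "src (e n) = F n \<rhd>\<^sub>o m" "tgt (e n) = n"
    and hom_\<F> [simp]: "arrM k \<Longrightarrow> arr (\<F> k)" "src (\<F> k) = F (src k)" "tgt (\<F> k) = F (tgt k)"
    and e_\<F>: "\<lbrakk>arrM k; tgt k = n\<rbrakk> \<Longrightarrow> e n \<bullet> (\<F> k \<rhd>\<^sub>a idM m) = k \<bullet> e (src k)"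
    and e_inj: "\<lbrakk>obM n; arr h; arr h'; src h = y; src h' = y; tgt h = F n; tgt h' = F n;
          e n \<bullet> (h \<rhd>\<^sub>a idM m) = e n \<bullet> (h' \<rhd>\<^sub>a idM m)\<rbrakk> \<Longrightarrow> h = h'"
    and e_surj: "\<lbrakk>ob y; obM n; arrM k; src k = y \<rhd>\<^sub>o m; tgt k = n\<rbrakk>
          \<Longrightarrow> \<exists>h. arr h \<and> src h = y \<and> tgt h = F n \<and> e n \<bullet> (h \<rhd>\<^sub>a idM m) = k"
begin

lemma \<F>_comp: "\<lbrakk>arrM k; arrM k'; src k' = tgt k\<rbrakk> \<Longrightarrow> \<F> (k' \<bullet> k) = \<F> k' \<star> \<F> k"
  by (rule e_inj[of "tgt k'"])
    (simp_all add: whisker_right e_\<F> M.comp_nest[OF e_\<F>] M.comp_assoc)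

lemma \<F>_idM [simp]: "obM n \<Longrightarrow> \<F> (idM n) = idn (F n)"
  by (rule e_inj[of n]) (simp_all add: e_\<F>)

text \<open>
  The lax module structure \<open>x \<otimes> F n \<rightarrow> F (x \<rhd> n)\<close>: the morphism adjoint to
  \<open>(x \<otimes> F n) \<rhd> m \<cong> x \<rhd> (F n \<rhd> m) \<rightarrow> x \<rhd> n\<close>.  Its coherence follows by comparing adjoints.
\<close>

definition \<phi> :: "'o \<Rightarrow> 'n \<Rightarrow> ('o, 'a) arrow" where
  "\<phi> x n = (SOME h. hom h (x \<otimes>\<^sub>o F n) (F (x \<rhd>\<^sub>o n)) \<and>
     e (x \<rhd>\<^sub>o n) \<bullet> (h \<rhd>\<^sub>a idM m) = (idn x \<rhd>\<^sub>a e n) \<bullet> \<beta> x (F n) m)"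

lemma hom_\<phi> [simp]: "\<lbrakk>ob x; obM n\<rbrakk> \<Longrightarrow> arr (\<phi> x n)" "\<lbrakk>ob x; obM n\<rbrakk> \<Longrightarrow> src (\<phi> x n) = x \<otimes>\<^sub>o F n"
    "\<lbrakk>ob x; obM n\<rbrakk> \<Longrightarrow> tgt (\<phi> x n) = F (x \<rhd>\<^sub>o n)"
  and e_\<phi>: "\<lbrakk>ob x; obM n\<rbrakk> \<Longrightarrow> e (x \<rhd>\<^sub>o n) \<bullet> (\<phi> x n \<rhd>\<^sub>a idM m) = (idn x \<rhd>\<^sub>a e n) \<bullet> \<beta> x (F n) m"
proof -
  assume [simp]: "ob x" "obM n"
  have "\<exists>h. hom h (x \<otimes>\<^sub>o F n) (F (x \<rhd>\<^sub>o n)) \<and>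
     e (x \<rhd>\<^sub>o n) \<bullet> (h \<rhd>\<^sub>a idM m) = (idn x \<rhd>\<^sub>a e n) \<bullet> \<beta> x (F n) m"
    using e_surj[of "x \<otimes>\<^sub>o F n" "x \<rhd>\<^sub>o n" "(idn x \<rhd>\<^sub>a e n) \<bullet> \<beta> x (F n) m"] by simp
  note * = someI_ex[OF this, folded \<phi>_def]
  show "arr (\<phi> x n)" "src (\<phi> x n) = x \<otimes>\<^sub>o F n" "tgt (\<phi> x n) = F (x \<rhd>\<^sub>o n)"
    "e (x \<rhd>\<^sub>o n) \<bullet> (\<phi> x n \<rhd>\<^sub>a idM m) = (idn x \<rhd>\<^sub>a e n) \<bullet> \<beta> x (F n) m"
    using * by simp_all
qed

lemma \<phi>_nat:
  assumes "arr g" "arrM k" "tgt g = x" "tgt k = n"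
  shows "\<F> (g \<rhd>\<^sub>a k) \<star> \<phi> (src g) (src k) = \<phi> x n \<star> (g \<boxtimes> \<F> k)"
proof (rule e_inj[of "x \<rhd>\<^sub>o n"])
  have [simp]: "ob x" "obM n" "arr g" "arrM k" "tgt g = x" "tgt k = n" using assms by auto
  have "e (x \<rhd>\<^sub>o n) \<bullet> ((\<F> (g \<rhd>\<^sub>a k) \<star> \<phi> (src g) (src k)) \<rhd>\<^sub>a idM m)
      = (g \<rhd>\<^sub>a k) \<bullet> (idn (src g) \<rhd>\<^sub>a e (src k)) \<bullet> \<beta> (src g) (F (src k)) m"
    by (simp add: whisker_right M.comp_nest[OF e_\<F>] e_\<phi> M.comp_assoc)
  also have "\<dots> = (g \<rhd>\<^sub>a (k \<bullet> e (src k))) \<bullet> \<beta> (src g) (F (src k)) m"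
    using act_comp[of "idn (src g)" g "e (src k)" k] M.comp_assoc[of "g \<rhd>\<^sub>a k" "idn (src g) \<rhd>\<^sub>a e (src k)"]
    by simp
  also have "k \<bullet> e (src k) = e n \<bullet> (\<F> k \<rhd>\<^sub>a idM m)" by (simp add: e_\<F>)
  also have "(g \<rhd>\<^sub>a \<dots>) \<bullet> \<beta> (src g) (F (src k)) m
      = (idn x \<rhd>\<^sub>a e n) \<bullet> (g \<rhd>\<^sub>a (\<F> k \<rhd>\<^sub>a idM m)) \<bullet> \<beta> (src g) (F (src k)) m"
    using act_comp[of g "idn x" "\<F> k \<rhd>\<^sub>a idM m" "e n"] by (simp add: M.comp_assoc)
  also have "\<dots> = e (x \<rhd>\<^sub>o n) \<bullet> ((\<phi> x n \<star> (g \<boxtimes> \<F> k)) \<rhd>\<^sub>a idM m)"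
    by (simp add: whisker_right M.comp_nest[OF e_\<phi>] \<beta>_nat M.comp_assoc)
  finally show "e (x \<rhd>\<^sub>o n) \<bullet> ((\<F> (g \<rhd>\<^sub>a k) \<star> \<phi> (src g) (src k)) \<rhd>\<^sub>a idM m)
      = e (x \<rhd>\<^sub>o n) \<bullet> ((\<phi> x n \<star> (g \<boxtimes> \<F> k)) \<rhd>\<^sub>a idM m)" .
qed (use assms in auto)

lemma \<phi>_assoc:
  assumes "ob x" "ob y" "obM n"
  shows "\<F> (\<beta> x y n) \<star> \<phi> (x \<otimes>\<^sub>o y) n = \<phi> x (y \<rhd>\<^sub>o n) \<star> (idn x \<boxtimes> \<phi> y n) \<star> \<alpha> x y (F n)"
proof (rule e_inj[of "x \<rhd>\<^sub>o y \<rhd>\<^sub>o n"])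
  note [simp] = assms
  have "e (x \<rhd>\<^sub>o y \<rhd>\<^sub>o n) \<bullet> ((\<F> (\<beta> x y n) \<star> \<phi> (x \<otimes>\<^sub>o y) n) \<rhd>\<^sub>a idM m)
      = \<beta> x y n \<bullet> (idn (x \<otimes>\<^sub>o y) \<rhd>\<^sub>a e n) \<bullet> \<beta> (x \<otimes>\<^sub>o y) (F n) m"
    by (simp add: whisker_right M.comp_nest[OF e_\<F>] e_\<phi> M.comp_assoc)
  also have "\<dots> = (idn x \<rhd>\<^sub>a (idn y \<rhd>\<^sub>a e n)) \<bullet> \<beta> x y (F n \<rhd>\<^sub>o m) \<bullet> \<beta> (x \<otimes>\<^sub>o y) (F n) m"
    using M.comp_nest[OF \<beta>_nat[of "idn x" "idn y" "e n" x y n], of "\<beta> (x \<otimes>\<^sub>o y) (F n) m"]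
    by (simp add: M.comp_assoc)
  also have "\<dots> = (idn x \<rhd>\<^sub>a ((idn y \<rhd>\<^sub>a e n) \<bullet> \<beta> y (F n) m)) \<bullet> \<beta> x (y \<otimes>\<^sub>o F n) m
      \<bullet> (\<alpha> x y (F n) \<rhd>\<^sub>a idM m)"
    by (simp add: act_pentagon whisker_left M.comp_assoc)
  also have "\<dots> = (idn x \<rhd>\<^sub>a e (y \<rhd>\<^sub>o n)) \<bullet> (idn x \<rhd>\<^sub>a (\<phi> y n \<rhd>\<^sub>a idM m)) \<bullet> \<beta> x (y \<otimes>\<^sub>o F n) m
      \<bullet> (\<alpha> x y (F n) \<rhd>\<^sub>a idM m)"
    by (simp add: e_\<phi>[symmetric] whisker_left M.comp_assoc)
  also have "\<dots> = e (x \<rhd>\<^sub>o y \<rhd>\<^sub>o n) \<bullet> ((\<phi> x (y \<rhd>\<^sub>o n) \<star> (idn x \<boxtimes> \<phi> y n) \<star> \<alpha> x y (F n)) \<rhd>\<^sub>a idM m)"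
    by (simp add: whisker_right M.comp_nest[OF e_\<phi>] M.comp_nest[OF \<beta>_nat] M.comp_assoc)
  finally show "e (x \<rhd>\<^sub>o y \<rhd>\<^sub>o n) \<bullet> ((\<F> (\<beta> x y n) \<star> \<phi> (x \<otimes>\<^sub>o y) n) \<rhd>\<^sub>a idM m)
    = e (x \<rhd>\<^sub>o y \<rhd>\<^sub>o n) \<bullet> ((\<phi> x (y \<rhd>\<^sub>o n) \<star> (idn x \<boxtimes> \<phi> y n) \<star> \<alpha> x y (F n)) \<rhd>\<^sub>a idM m)" .
qed (use assms in simp_all)

lemma \<phi>_unit:
  assumes n: "obM n"
  shows "\<F> (\<u> n) \<star> \<phi> unit n = \<l> (F n)"
proof (rule e_inj[of n])
  note [simp] = n
  have "e n \<bullet> ((\<F> (\<u> n) \<star> \<phi> unit n) \<rhd>\<^sub>a idM m)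
      = \<u> n \<bullet> (idn unit \<rhd>\<^sub>a e n) \<bullet> \<beta> unit (F n) m"
    by (simp add: whisker_right M.comp_nest[OF e_\<F>] e_\<phi> M.comp_assoc)
  also have "\<dots> = e n \<bullet> \<u> (F n \<rhd>\<^sub>o m) \<bullet> \<beta> unit (F n) m"
    by (simp add: M.comp_nest[OF \<u>_nat] M.comp_assoc)
  also have "\<dots> = e n \<bullet> (\<l> (F n) \<rhd>\<^sub>a idM m)"
    by (simp add: unit_act_\<beta>)
  finally show "e n \<bullet> ((\<F> (\<u> n) \<star> \<phi> unit n) \<rhd>\<^sub>a idM m) = e n \<bullet> (\<l> (F n) \<rhd>\<^sub>a idM m)" .
qed (use assms in simp_all)

text \<open>
  Under the adjunctions, composition with \<open>\<phi> x n\<close> corresponds to the chain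
  \<open>Hom y (x \<otimes> F n) \<cong> Hom (x* \<otimes> y) (F n) \<cong> Hom (x* \<rhd> y \<rhd> m) n \<cong> Hom (y \<rhd> m) (x \<rhd> n)\<close>
  of bijections.
\<close>

lemma e_\<phi>_curry:
  assumes "ob x" "ob y" "obM n" "hom h (rd x \<otimes>\<^sub>o y) (F n)"
  shows "e (x \<rhd>\<^sub>o n) \<bullet> ((\<phi> x n \<star> reg.curry x (rd x) (coev x) y h) \<rhd>\<^sub>a idM m)
    = curry x (rd x) (coev x) (y \<rhd>\<^sub>o m) (e n \<bullet> (h \<rhd>\<^sub>a idM m) \<bullet> \<beta>' (rd x) y m)"
proof -
  note [simp] = assms
  let ?b = "\<alpha> x (rd x) y \<star> (coev x \<boxtimes> idn y) \<star> \<l>' y"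
  have bb: "(idn x \<rhd>\<^sub>a \<beta>' (rd x) y m) \<bullet> (idn x \<rhd>\<^sub>a \<beta> (rd x) y m) = idM (x \<rhd>\<^sub>o (rd x \<otimes>\<^sub>o y) \<rhd>\<^sub>o m)"
    by (simp flip: whisker_left)
  have "e (x \<rhd>\<^sub>o n) \<bullet> ((\<phi> x n \<star> reg.curry x (rd x) (coev x) y h) \<rhd>\<^sub>a idM m)
    = (idn x \<rhd>\<^sub>a e n) \<bullet> \<beta> x (F n) m \<bullet> ((idn x \<boxtimes> h) \<rhd>\<^sub>a idM m) \<bullet> (?b \<rhd>\<^sub>a idM m)"
    by (simp add: reg.curry_def whisker_right M.comp_nest[OF e_\<phi>] M.comp_assoc)
  also have "\<dots> = (idn x \<rhd>\<^sub>a e n) \<bullet> (idn x \<rhd>\<^sub>a (h \<rhd>\<^sub>a idM m)) \<bullet> \<beta> x (rd x \<otimes>\<^sub>o y) m \<bullet> (?b \<rhd>\<^sub>a idM m)"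
    by (simp add: M.comp_nest[OF \<beta>_nat] M.comp_assoc)
  also have "\<dots> = curry x (rd x) (coev x) (y \<rhd>\<^sub>o m) (e n \<bullet> (h \<rhd>\<^sub>a idM m) \<bullet> \<beta>' (rd x) y m)"
    by (subst curry_act) (simp_all add: whisker_left M.comp_assoc M.comp_nest[OF bb])
  finally show ?thesis .
qed

text \<open>
  By the Yoneda lemma: composition with \<open>\<phi> x n\<close> is bijective by \<open>e_\<phi>_curry\<close>.
\<close>

lemma \<phi>_iso:
  assumes x: "ob x" and n: "obM n"
  obtains \<mu> where "hom \<mu> (F (x \<rhd>\<^sub>o n)) (x \<otimes>\<^sub>o F n)" "\<phi> x n \<star> \<mu> = idn (F (x \<rhd>\<^sub>o n))"
    "\<mu> \<star> \<phi> x n = idn (x \<otimes>\<^sub>o F n)"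
proof -
  note [simp] = x n
  let ?C = "reg.curry x (rd x) (coev x)" and ?U = "reg.uncurry x (rd x) (ev x)"
  note d = duality_right[OF x]
  have inj: "k = k'" if k: "hom k y (x \<otimes>\<^sub>o F n)" "hom k' y (x \<otimes>\<^sub>o F n)"
    and eq: "\<phi> x n \<star> k = \<phi> x n \<star> k'" for k k' y
  proof -
    have y[simp]: "ob y" using k ob_src[of k] by simp
    define h where "h = ?U (F n) k"
    define h' where "h' = ?U (F n) k'"
    have h[simp]: "arr h" "src h = rd x \<otimes>\<^sub>o y" "tgt h = F n"
      and h'[simp]: "arr h'" "src h' = rd x \<otimes>\<^sub>o y" "tgt h' = F n"
      using k by (simp_all add: h_def h'_def reg.arr_uncurry)
    have kh: "?C y h = k" unfolding h_def by (rule reg.curry_uncurry[OF d]) (use k in simp_all)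
    have kh': "?C y h' = k'" unfolding h'_def by (rule reg.curry_uncurry[OF d]) (use k in simp_all)
    let ?K = "\<lambda>h. e n \<bullet> (h \<rhd>\<^sub>a idM m) \<bullet> \<beta>' (rd x) y m"
    have "curry x (rd x) (coev x) (y \<rhd>\<^sub>o m) (?K h) = curry x (rd x) (coev x) (y \<rhd>\<^sub>o m) (?K h')"
      using e_\<phi>_curry[of x y n h] e_\<phi>_curry[of x y n h'] eq by (simp add: kh kh')
    then have "uncurry x (rd x) (ev x) n (curry x (rd x) (coev x) (y \<rhd>\<^sub>o m) (?K h))
        = uncurry x (rd x) (ev x) n (curry x (rd x) (coev x) (y \<rhd>\<^sub>o m) (?K h'))" by simp
    moreover have "uncurry x (rd x) (ev x) n (curry x (rd x) (coev x) (y \<rhd>\<^sub>o m) (?K h)) = ?K h"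
      by (rule uncurry_curry[OF d]) simp_all
    moreover have "uncurry x (rd x) (ev x) n (curry x (rd x) (coev x) (y \<rhd>\<^sub>o m) (?K h')) = ?K h'"
      by (rule uncurry_curry[OF d]) simp_all
    ultimately have "?K h = ?K h'" by simp
    then have "?K h \<bullet> \<beta> (rd x) y m = ?K h' \<bullet> \<beta> (rd x) y m" by simp
    then have "e n \<bullet> (h \<rhd>\<^sub>a idM m) = e n \<bullet> (h' \<rhd>\<^sub>a idM m)" by (simp add: M.comp_assoc)
    then have "h = h'" by (intro e_inj[of n h h']) simp_all
    then show ?thesis using kh kh' by simp
  qed
  have surj: "\<exists>k'. hom k' y (x \<otimes>\<^sub>o F n) \<and> \<phi> x n \<star> k' = k" if k: "hom k y (F (x \<rhd>\<^sub>o n))" for k y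
  proof -
    have y[simp]: "ob y" using k ob_src[of k] by simp
    define K where "K = e (x \<rhd>\<^sub>o n) \<bullet> (k \<rhd>\<^sub>a idM m)"
    have K[simp]: "arrM K" "src K = y \<rhd>\<^sub>o m" "tgt K = x \<rhd>\<^sub>o n" using k by (simp_all add: K_def)
    define K1 where "K1 = uncurry x (rd x) (ev x) n K"
    have K1[simp]: "arrM K1" "src K1 = rd x \<rhd>\<^sub>o (y \<rhd>\<^sub>o m)" "tgt K1 = n"
      by (simp_all add: K1_def arr_uncurry)
    obtain h where h[simp]: "arr h" "src h = rd x \<otimes>\<^sub>o y" "tgt h = F n"
      and eh: "e n \<bullet> (h \<rhd>\<^sub>a idM m) = K1 \<bullet> \<beta> (rd x) y m"
      using e_surj[of "rd x \<otimes>\<^sub>o y" n "K1 \<bullet> \<beta> (rd x) y m"] by auto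
    have c: "hom (?C y h) y (x \<otimes>\<^sub>o F n)" by (simp add: reg.arr_curry)
    have "e n \<bullet> (h \<rhd>\<^sub>a idM m) \<bullet> \<beta>' (rd x) y m = (e n \<bullet> (h \<rhd>\<^sub>a idM m)) \<bullet> \<beta>' (rd x) y m"
      by (simp add: M.comp_assoc)
    also have "\<dots> = K1" unfolding eh by (simp add: M.comp_assoc)
    finally have eK: "e n \<bullet> (h \<rhd>\<^sub>a idM m) \<bullet> \<beta>' (rd x) y m = K1" .
    have "e (x \<rhd>\<^sub>o n) \<bullet> ((\<phi> x n \<star> ?C y h) \<rhd>\<^sub>a idM m) = curry x (rd x) (coev x) (y \<rhd>\<^sub>o m) K1"
      by (subst e_\<phi>_curry) (simp_all add: eK)
    also have "\<dots> = K" unfolding K1_def by (rule curry_uncurry[OF d]) simp_all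
    finally have "e (x \<rhd>\<^sub>o n) \<bullet> ((\<phi> x n \<star> ?C y h) \<rhd>\<^sub>a idM m) = e (x \<rhd>\<^sub>o n) \<bullet> (k \<rhd>\<^sub>a idM m)"
      unfolding K_def .
    then have "\<phi> x n \<star> ?C y h = k"
      by (intro e_inj[of "x \<rhd>\<^sub>o n" "\<phi> x n \<star> ?C y h" k y]) (use k c in simp_all)
    with c show ?thesis by blast
  qed
  obtain \<mu> where \<mu>: "hom \<mu> (F (x \<rhd>\<^sub>o n)) (x \<otimes>\<^sub>o F n)" "\<phi> x n \<star> \<mu> = idn (F (x \<rhd>\<^sub>o n))"
    using surj[of "idn (F (x \<rhd>\<^sub>o n))" "F (x \<rhd>\<^sub>o n)"] by auto
  have "\<mu> \<star> \<phi> x n = idn (x \<otimes>\<^sub>o F n)"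
    by (rule inj[of _ "x \<otimes>\<^sub>o F n"]) (use \<mu> in \<open>simp_all add: comp_nest[OF \<mu>(2)]\<close>)
  with \<mu> that show ?thesis by blast
qed

text \<open>
  A module functor preserves partial traces: \<open>\<phi>\<close> is pushed through the loop, turning each factor of
  the partial trace in the module category into the one in the acting category.
\<close>

lemma \<F>_ptrace:
  assumes x: "ob x" and n: "obM n" and f: "M.hom f (x \<rhd>\<^sub>o n) (x \<rhd>\<^sub>o n)"
    and g: "hom g (x \<otimes>\<^sub>o F n) (x \<otimes>\<^sub>o F n)" and gf: "\<phi> x n \<star> g = \<F> f \<star> \<phi> x n"
    and w: "ob w" and \<epsilon>: "hom \<epsilon> (w \<otimes>\<^sub>o x) unit" and \<eta>: "hom \<eta> unit (w \<otimes>\<^sub>o x)"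
  shows "\<F> (ptrace w x \<epsilon> \<eta> n f) = reg.ptrace w x \<epsilon> \<eta> (F n) g"
proof (rule epi_of_section)
  note [simp] = x n f g w \<epsilon> \<eta>
  show "\<l> (F n) \<star> \<l>' (F n) = idn (F n)" by simp
  have pt: "M.hom (ptrace w x \<epsilon> \<eta> n f) n n" by (rule hom_ptrace) simp_all
  then show "arr (\<F> (ptrace w x \<epsilon> \<eta> n f))" "src (\<F> (ptrace w x \<epsilon> \<eta> n f)) = F n" by simp_all
  have rpt: "hom (reg.ptrace w x \<epsilon> \<eta> (F n) g) (F n) (F n)" by (rule reg.hom_ptrace) simp_all
  then show "arr (reg.ptrace w x \<epsilon> \<eta> (F n) g)" "src (reg.ptrace w x \<epsilon> \<eta> (F n) g) = F n" by simp_all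
  have 1: "\<F> (\<beta>' w x n) \<star> \<phi> w (x \<rhd>\<^sub>o n) \<star> (idn w \<boxtimes> \<phi> x n) = \<phi> (w \<otimes>\<^sub>o x) n \<star> \<alpha>' w x (F n)"
  proof (rule epi_of_section)
    show "\<alpha> w x (F n) \<star> \<alpha>' w x (F n) = idn (w \<otimes>\<^sub>o x \<otimes>\<^sub>o F n)" by simp
    have "(\<F> (\<beta>' w x n) \<star> \<phi> w (x \<rhd>\<^sub>o n) \<star> (idn w \<boxtimes> \<phi> x n)) \<star> \<alpha> w x (F n)
        = (\<F> (\<beta>' w x n) \<star> \<F> (\<beta> w x n)) \<star> \<phi> (w \<otimes>\<^sub>o x) n"
      by (simp add: \<phi>_assoc comp_assoc)
    also have "\<dots> = \<phi> (w \<otimes>\<^sub>o x) n" by (simp flip: \<F>_comp)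
    finally show "(\<F> (\<beta>' w x n) \<star> \<phi> w (x \<rhd>\<^sub>o n) \<star> (idn w \<boxtimes> \<phi> x n)) \<star> \<alpha> w x (F n)
        = (\<phi> (w \<otimes>\<^sub>o x) n \<star> \<alpha>' w x (F n)) \<star> \<alpha> w x (F n)" by (simp add: comp_assoc)
  qed simp_all
  have gg: "(idn w \<boxtimes> \<F> f) \<star> (idn w \<boxtimes> \<phi> x n) = (idn w \<boxtimes> \<phi> x n) \<star> (idn w \<boxtimes> g)"
    using gf by (simp flip: reg.whisker_left)
  have "\<F> (ptrace w x \<epsilon> \<eta> n f) \<star> \<l> (F n) = \<F> (ptrace w x \<epsilon> \<eta> n f \<bullet> \<u> n) \<star> \<phi> unit n"
    using pt by (simp add: \<F>_comp \<phi>_unit comp_assoc)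
  also have "ptrace w x \<epsilon> \<eta> n f \<bullet> \<u> n = \<u> n \<bullet> (\<epsilon> \<rhd>\<^sub>a idM n) \<bullet> \<beta>' w x n \<bullet> (idn w \<rhd>\<^sub>a f)
      \<bullet> \<beta> w x n \<bullet> (\<eta> \<rhd>\<^sub>a idM n)"
    by (simp add: ptrace_def M.comp_assoc)
  also have "\<F> \<dots> \<star> \<phi> unit n = \<F> (\<u> n) \<star> \<F> (\<epsilon> \<rhd>\<^sub>a idM n) \<star> \<F> (\<beta>' w x n) \<star> \<F> (idn w \<rhd>\<^sub>a f)
      \<star> \<F> (\<beta> w x n) \<star> \<F> (\<eta> \<rhd>\<^sub>a idM n) \<star> \<phi> unit n"
    by (simp add: \<F>_comp comp_assoc)
  also have "\<dots> = \<F> (\<u> n) \<star> \<F> (\<epsilon> \<rhd>\<^sub>a idM n) \<star> \<F> (\<beta>' w x n) \<star> \<F> (idn w \<rhd>\<^sub>a f)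
      \<star> \<phi> w (x \<rhd>\<^sub>o n) \<star> (idn w \<boxtimes> \<phi> x n) \<star> \<alpha> w x (F n) \<star> (\<eta> \<boxtimes> idn (F n))"
    using \<phi>_nat[of \<eta> "idM n" "w \<otimes>\<^sub>o x" n] by (simp add: comp_nest[OF \<phi>_assoc] comp_assoc)
  also have "\<dots> = \<F> (\<u> n) \<star> \<F> (\<epsilon> \<rhd>\<^sub>a idM n) \<star> \<F> (\<beta>' w x n)
      \<star> \<phi> w (x \<rhd>\<^sub>o n) \<star> (idn w \<boxtimes> \<phi> x n) \<star> (idn w \<boxtimes> g) \<star> \<alpha> w x (F n) \<star> (\<eta> \<boxtimes> idn (F n))"
    using comp_nest[OF \<phi>_nat[of "idn w" f w "x \<rhd>\<^sub>o n"],
        of "(idn w \<boxtimes> \<phi> x n) \<star> \<alpha> w x (F n) \<star> (\<eta> \<boxtimes> idn (F n))"]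
    by (simp add: comp_nest[OF gg] comp_assoc)
  also have "\<dots> = \<F> (\<u> n) \<star> \<F> (\<epsilon> \<rhd>\<^sub>a idM n) \<star> (\<F> (\<beta>' w x n)
      \<star> \<phi> w (x \<rhd>\<^sub>o n) \<star> (idn w \<boxtimes> \<phi> x n)) \<star> (idn w \<boxtimes> g) \<star> \<alpha> w x (F n) \<star> (\<eta> \<boxtimes> idn (F n))"
    by (simp add: comp_assoc)
  also have "\<dots> = \<F> (\<u> n) \<star> \<F> (\<epsilon> \<rhd>\<^sub>a idM n) \<star> \<phi> (w \<otimes>\<^sub>o x) n
      \<star> \<alpha>' w x (F n) \<star> (idn w \<boxtimes> g) \<star> \<alpha> w x (F n) \<star> (\<eta> \<boxtimes> idn (F n))"
    unfolding 1 by (simp add: comp_assoc)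
  also have "\<dots> = \<l> (F n) \<star> (\<epsilon> \<boxtimes> idn (F n))
      \<star> \<alpha>' w x (F n) \<star> (idn w \<boxtimes> g) \<star> \<alpha> w x (F n) \<star> (\<eta> \<boxtimes> idn (F n))"
    using comp_nest[OF \<phi>_nat[of \<epsilon> "idM n" unit n],
        of "\<alpha>' w x (F n) \<star> (idn w \<boxtimes> g) \<star> \<alpha> w x (F n) \<star> (\<eta> \<boxtimes> idn (F n))"]
    by (simp add: comp_nest[OF \<phi>_unit] comp_assoc)
  also have "\<dots> = reg.ptrace w x \<epsilon> \<eta> (F n) g \<star> \<l> (F n)"
    by (simp add: reg.ptrace_def comp_assoc)
  finally show "\<F> (ptrace w x \<epsilon> \<eta> n f) \<star> \<l> (F n) = reg.ptrace w x \<epsilon> \<eta> (F n) g \<star> \<l> (F n)" .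
qed (use n in simp_all)

text \<open>
  Conjugation with \<open>\<phi>\<close> replaces \<open>F (x \<rhd> n)\<close> by \<open>x \<otimes> F n\<close>, where the trace is a trace of a
  partial trace.
\<close>

theorem trace_ar_\<F>_compatible:
  assumes x: "ob x" and n: "obM n" and f: "M.hom f (x \<rhd>\<^sub>o n) (x \<rhd>\<^sub>o n)"
  shows "trace_ar (F (x \<rhd>\<^sub>o n)) (\<F> f) = trace_ar (F n) (\<F> (ptrace (ld x) x (piv_ev x) (coevl x) n f))"
proof -
  note [simp] = x n f
  obtain \<mu> where \<mu>[simp]: "arr \<mu>" "src \<mu> = F (x \<rhd>\<^sub>o n)" "tgt \<mu> = x \<otimes>\<^sub>o F n"
    and 1: "\<phi> x n \<star> \<mu> = idn (F (x \<rhd>\<^sub>o n))"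
    by (rule \<phi>_iso[OF x n]) blast
  define g where "g = \<mu> \<star> \<F> f \<star> \<phi> x n"
  have g: "hom g (x \<otimes>\<^sub>o F n) (x \<otimes>\<^sub>o F n)" by (simp add: g_def)
  have gf: "\<phi> x n \<star> g = \<F> f \<star> \<phi> x n" by (simp add: g_def comp_nest[OF 1])
  have "trace_ar (F (x \<rhd>\<^sub>o n)) (\<F> f) = trace_ar (F (x \<rhd>\<^sub>o n)) ((\<F> f \<star> \<phi> x n) \<star> \<mu>)"
    by (simp add: comp_assoc 1)
  also have "\<dots> = trace_ar (x \<otimes>\<^sub>o F n) g"
    unfolding g_def by (rule trace_ar_cyclic) simp_all
  also have "\<dots> = trace_ar (F n) (reg.ptrace (ld x) x (piv_ev x) (coevl x) (F n) g)"
    by (rule trace_ar_tens) (use g in simp_all)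
  also have "reg.ptrace (ld x) x (piv_ev x) (coevl x) (F n) g = \<F> (ptrace (ld x) x (piv_ev x) (coevl x) n f)"
    by (rule \<F>_ptrace[symmetric]) (use g gf in simp_all)
  finally show ?thesis .
qed

end

section \<open>Schur's lemma and direct sum decompositions\<close>

context linear_category
begin

lemma zero_in_Hom [simp]: "\<lbrakk>x \<in> Ob C; y \<in> Ob C\<rbrakk> \<Longrightarrow> 0 \<in> Hom C x y"
  and add_in_Hom: "\<lbrakk>x \<in> Ob C; y \<in> Ob C; f \<in> Hom C x y; g \<in> Hom C x y\<rbrakk> \<Longrightarrow> f + g \<in> Hom C x y"
  and diff_in_Hom: "\<lbrakk>x \<in> Ob C; y \<in> Ob C; f \<in> Hom C x y; g \<in> Hom C x y\<rbrakk> \<Longrightarrow> f - g \<in> Hom C x y"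
  and smul_in_Hom: "\<lbrakk>x \<in> Ob C; y \<in> Ob C; f \<in> Hom C x y\<rbrakk> \<Longrightarrow> smul C r f \<in> Hom C x y"
  and sum_in_Hom: "\<lbrakk>x \<in> Ob C; y \<in> Ob C; \<And>k. k \<in> A \<Longrightarrow> h k \<in> Hom C x y\<rbrakk> \<Longrightarrow> sum h A \<in> Hom C x y"
  using Hom_subspace by (auto simp: subspace_0 subspace_add subspace_diff subspace_scale subspace_sum)

lemma cmp_zero_right: "\<lbrakk>x \<in> Ob C; y \<in> Ob C; z \<in> Ob C; g \<in> Hom C y z\<rbrakk> \<Longrightarrow> g \<cdot> 0 = 0"
  using cmp_smul_right[of x y z 0 g 0] by simp

lemma cmp_zero_left: "\<lbrakk>x \<in> Ob C; y \<in> Ob C; z \<in> Ob C; f \<in> Hom C x y\<rbrakk> \<Longrightarrow> 0 \<cdot> f = 0"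
  using cmp_smul_left[of x y z f 0 0] by simp

lemma cmp_diff_right:
  assumes "x \<in> Ob C" "y \<in> Ob C" "z \<in> Ob C" "f \<in> Hom C x y" "f' \<in> Hom C x y" "g \<in> Hom C y z"
  shows "g \<cdot> (f - f') = g \<cdot> f - g \<cdot> f'"
  using cmp_add_right[of x y z "f - f'" f' g] assms diff_in_Hom by (simp add: algebra_simps)

lemma cmp_diff_left:
  assumes "x \<in> Ob C" "y \<in> Ob C" "z \<in> Ob C" "f \<in> Hom C x y" "g \<in> Hom C y z" "g' \<in> Hom C y z"
  shows "(g - g') \<cdot> f = g \<cdot> f - g' \<cdot> f"
  using cmp_add_left[of x y z f "g - g'" g'] assms diff_in_Hom by (simp add: algebra_simps)

lemma cmp_sum_right:
  assumes "x \<in> Ob C" "y \<in> Ob C" "z \<in> Ob C" "g \<in> Hom C y z" "finite A" "\<And>k. k \<in> A \<Longrightarrow> h k \<in> Hom C x y"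
  shows "g \<cdot> (\<Sum>k\<in>A. h k) = (\<Sum>k\<in>A. g \<cdot> h k)"
  using assms(5,6)
proof (induction A rule: finite_induct)
  case empty
  then show ?case using assms cmp_zero_right by simp
next
  case (insert k A)
  then show ?case using assms(1-4) by (simp add: cmp_add_right[of x y z] sum_in_Hom)
qed

lemma cmp_sum_left:
  assumes "x \<in> Ob C" "y \<in> Ob C" "z \<in> Ob C" "f \<in> Hom C x y" "finite A" "\<And>k. k \<in> A \<Longrightarrow> h k \<in> Hom C y z"
  shows "(\<Sum>k\<in>A. h k) \<cdot> f = (\<Sum>k\<in>A. h k \<cdot> f)"
  using assms(5,6)
proof (induction A rule: finite_induct)
  case empty
  then show ?case using assms cmp_zero_left by simp
next
  case (insert k A)
  then show ?case using assms(1-4) by (simp add: cmp_add_left[of x y z] sum_in_Hom)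
qed

lemma inverse_unique:
  assumes "x \<in> Ob C" "y \<in> Ob C" "f \<in> Hom C x y" "is_inverse C x y f g" "is_inverse C x y f h"
  shows "g = h"
proof -
  have "g = g \<cdot> (f \<cdot> h)" using assms cmp_ident_right[of y x g] by (simp add: is_inverse_def)
  also have "\<dots> = (g \<cdot> f) \<cdot> h" using assms by (intro cmp_assoc[of y x y x]) (auto simp: is_inverse_def)
  also have "\<dots> = h" using assms cmp_ident_left[of y x h] by (simp add: is_inverse_def)
  finally show ?thesis .
qed

lemma inv_ar_eq:
  assumes "x \<in> Ob C" "y \<in> Ob C" "f \<in> Hom C x y" "is_inverse C x y f g"
  shows "inv_ar C x y f = g"
  unfolding inv_ar_def
proof (rule the_equality)
  show "is_inverse C x y f g" by (rule assms(4))
  show "h = g" if "is_inverse C x y f h" for h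
    by (rule inverse_unique[OF assms(1-3) that assms(4)])
qed

lemma inv_ar_is_inverse:
  assumes "x \<in> Ob C" "y \<in> Ob C" "iso C x y f"
  shows "is_inverse C x y f (inv_ar C x y f)"
proof -
  obtain g where "f \<in> Hom C x y" "is_inverse C x y f g" using assms(3) unfolding iso_def by blast
  then show ?thesis using inv_ar_eq[OF assms(1,2)] by simp
qed

lemma isomorphic_sym: "isomorphic C x y \<Longrightarrow> isomorphic C y x"
  unfolding isomorphic_def iso_def is_inverse_def by blast

lemma isomorphic_trans:
  assumes "x \<in> Ob C" "y \<in> Ob C" "z \<in> Ob C" "isomorphic C x y" "isomorphic C y z"
  shows "isomorphic C x z"
proof -
  obtain f f' where f: "f \<in> Hom C x y" "f' \<in> Hom C y x" "f' \<cdot> f = \<i> x" "f \<cdot> f' = \<i> y"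
    using assms(4) by (auto simp: isomorphic_def iso_def is_inverse_def)
  obtain g g' where g: "g \<in> Hom C y z" "g' \<in> Hom C z y" "g' \<cdot> g = \<i> y" "g \<cdot> g' = \<i> z"
    using assms(5) by (auto simp: isomorphic_def iso_def is_inverse_def)
  have h: "g \<cdot> f \<in> Hom C x z" "f' \<cdot> g' \<in> Hom C z x"
    using assms f g cmp_in_Hom by blast+
  have "(f' \<cdot> g') \<cdot> (g \<cdot> f) = ((f' \<cdot> g') \<cdot> g) \<cdot> f" using assms f g h by (intro cmp_assoc) auto
  also have "(f' \<cdot> g') \<cdot> g = f'"
    using cmp_assoc[of y z y x g g' f'] cmp_ident_right[of y x f'] assms f g by simp
  finally have 1: "(f' \<cdot> g') \<cdot> (g \<cdot> f) = \<i> x" using f by simp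
  have "(g \<cdot> f) \<cdot> (f' \<cdot> g') = ((g \<cdot> f) \<cdot> f') \<cdot> g'" using assms f g h by (intro cmp_assoc) auto
  also have "(g \<cdot> f) \<cdot> f' = g"
    using cmp_assoc[of y x y z f' f g] cmp_ident_right[of y z g] assms f g by simp
  finally have 2: "(g \<cdot> f) \<cdot> (f' \<cdot> g') = \<i> z" using g by simp
  show ?thesis unfolding isomorphic_def iso_def is_inverse_def using h 1 2 by blast
qed

primrec power_ar where
  "power_ar x f 0 = \<i> x"
| "power_ar x f (Suc n) = f \<cdot> power_ar x f n"

lemma power_ar_in_Hom: "\<lbrakk>x \<in> Ob C; f \<in> Hom C x x\<rbrakk> \<Longrightarrow> power_ar x f n \<in> Hom C x x"
  by (induction n) (auto simp: ident_in_Hom intro: cmp_in_Hom)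

definition poly_ar where
  "poly_ar x f p = (\<Sum>i\<le>degree p. smul C (coeff p i) (power_ar x f i))"

lemma poly_ar_bound:
  assumes "degree p \<le> N"
  shows "poly_ar x f p = (\<Sum>i\<le>N. smul C (coeff p i) (power_ar x f i))"
  unfolding poly_ar_def
  by (rule sum.mono_neutral_left) (use assms in \<open>auto simp: coeff_eq_0\<close>)

lemma poly_ar_in_Hom: "\<lbrakk>x \<in> Ob C; f \<in> Hom C x x\<rbrakk> \<Longrightarrow> poly_ar x f p \<in> Hom C x x"
  unfolding poly_ar_def by (intro sum_in_Hom smul_in_Hom power_ar_in_Hom)

lemma poly_ar_pCons:
  assumes x: "x \<in> Ob C" and f: "f \<in> Hom C x x"
  shows "poly_ar x f (pCons a p) = smul C a (\<i> x) + f \<cdot> poly_ar x f p"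
proof -
  have "poly_ar x f (pCons a p)
      = (\<Sum>i\<le>Suc (degree p). smul C (coeff (pCons a p) i) (power_ar x f i))"
    by (rule poly_ar_bound) (simp add: degree_pCons_le)
  also have "\<dots> = smul C a (\<i> x) + (\<Sum>i\<le>degree p. smul C (coeff p i) (f \<cdot> power_ar x f i))"
    by (subst sum.atMost_Suc_shift) simp
  also have "(\<Sum>i\<le>degree p. smul C (coeff p i) (f \<cdot> power_ar x f i)) = f \<cdot> poly_ar x f p"
    unfolding poly_ar_def
    by (subst cmp_sum_right[of x x x])
      (use x f in \<open>auto simp: cmp_smul_right[of x x x] power_ar_in_Hom smul_in_Hom\<close>)
  finally show ?thesis .
qed

lemma poly_ar_add: "poly_ar x f (p + q) = poly_ar x f p + poly_ar x f q"
proof -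
  let ?N = "max (degree p) (degree q)"
  have "poly_ar x f (p + q) = (\<Sum>i\<le>?N. smul C (coeff (p + q) i) (power_ar x f i))"
    by (rule poly_ar_bound) (rule degree_add_le_max)
  then show ?thesis
    using poly_ar_bound[of p ?N x f] poly_ar_bound[of q ?N x f]
    by (simp add: scale_left_distrib sum.distrib)
qed

lemma poly_ar_smult: "poly_ar x f (Polynomial.smult a p) = smul C a (poly_ar x f p)"
proof -
  have "poly_ar x f (Polynomial.smult a p) = (\<Sum>i\<le>degree p. smul C (coeff (Polynomial.smult a p) i) (power_ar x f i))"
    by (rule poly_ar_bound) simp
  then show ?thesis by (simp add: poly_ar_def scale_sum_right)
qed

lemma poly_ar_linear_factor:
  assumes x: "x \<in> Ob C" and f: "f \<in> Hom C x x"
  shows "poly_ar x f ([:- a, 1:] * q) = (f - smul C a (\<i> x)) \<cdot> poly_ar x f q"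
proof -
  have E: "poly_ar x f q \<in> Hom C x x" by (rule poly_ar_in_Hom[OF x f])
  have "[:- a, 1:] * q = Polynomial.smult (- a) q + pCons 0 q" by simp
  then have "poly_ar x f ([:- a, 1:] * q) = smul C (- a) (poly_ar x f q) + f \<cdot> poly_ar x f q"
    by (simp only: poly_ar_add poly_ar_smult poly_ar_pCons[OF x f] scale_zero_left add_0_left)
  also have "\<dots> = (f - smul C a (\<i> x)) \<cdot> poly_ar x f q"
    using cmp_diff_left[OF x x x E f smul_in_Hom[OF x x ident_in_Hom[OF x]]]
      cmp_smul_left[OF x x x E ident_in_Hom[OF x]] cmp_ident_left[OF x x E] by simp
  finally show ?thesis .
qed

end

text \<open>
  There are more powers of \<open>f\<close> than the dimension of the space of endomorphisms, so they satisfy a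
  linear relation.
\<close>

lemma (in locally_finite_category) annihilating_polynomial:
  assumes x: "x \<in> Ob C" and f: "f \<in> Hom C x x"
  obtains p :: "complex poly" where "p \<noteq> 0" "poly_ar x f p = 0"
proof -
  obtain B where B: "finite B" "Hom C x x = span B" using Hom_finite_dim[OF x x] by blast
  let ?n = "card B" and ?P = "power_ar x f"
  have P: "?P ` {..?n} \<subseteq> span B" using power_ar_in_Hom[OF x f] B by blast
  show thesis
  proof (cases "inj_on ?P {..?n}")
    case False
    \<comment> \<open>Two coinciding powers are not seen by linear dependence of the set of powers.\<close>
    then obtain i j where ij: "i \<noteq> j" "?P i = ?P j" by (auto simp: inj_on_def)
    let ?p = "monom 1 i + Polynomial.smult (-1) (monom 1 j) :: complex poly"
    have mon: "poly_ar x f (monom 1 k) = ?P k" for k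
      by (simp add: poly_ar_def degree_monom_eq if_distrib[of "\<lambda>c. smul C c _"] cong: if_cong)
    have "coeff ?p i = 1" using ij by simp
    then have "?p \<noteq> 0" by (metis coeff_0 zero_neq_one)
    moreover have "poly_ar x f ?p = 0"
      by (simp only: poly_ar_add poly_ar_smult mon ij) simp
    ultimately show thesis using that by blast
  next
    case True
    have "dependent (?P ` {..?n})"
    proof (rule ccontr)
      assume "independent (?P ` {..?n})"
      then have "card (?P ` {..?n}) \<le> ?n" using independent_span_bound[OF B(1)] P by blast
      then show False using True by (simp add: card_image)
    qed
    then obtain u v where uv: "v \<in> ?P ` {..?n}" "u v \<noteq> 0" "(\<Sum>w\<in>?P ` {..?n}. smul C (u w) w) = 0"
      by (subst (asm) dependent_finite) auto
    obtain k where k: "k \<le> ?n" "v = ?P k" using uv(1) by auto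
    let ?p = "Abs_poly (\<lambda>i. if i \<le> ?n then u (?P i) else 0)"
    have c: "coeff ?p i = (if i \<le> ?n then u (?P i) else 0)" for i
      by (rule coeff_Abs_poly[where n = ?n, THEN fun_cong]) simp
    have "?p \<noteq> 0" using c[of k] k uv(2) by (metis coeff_0)
    moreover have "poly_ar x f ?p = (\<Sum>i\<le>?n. smul C (coeff ?p i) (?P i))"
      by (rule poly_ar_bound) (simp add: degree_le c)
    then have "poly_ar x f ?p = 0"
      using uv(3) by (simp add: c sum.reindex[OF True])
    ultimately show thesis using that by blast
  qed
qed

context abelian_category
begin

lemma simple_nonzero: "simple_object C x \<Longrightarrow> \<i> x \<noteq> 0"
proof
  assume s: "simple_object C x" and 0: "\<i> x = 0"
  have x: "x \<in> Ob C" using s by (simp add: simple_object_def)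
  have "Hom C x y = {0} \<and> Hom C y x = {0}" if y: "y \<in> Ob C" for y
  proof -
    have "f = 0" if "f \<in> Hom C x y" for f
      using cmp_ident_right[OF x y that] cmp_zero_right[OF x x y that] by (simp add: 0)
    moreover have "f = 0" if "f \<in> Hom C y x" for f
      using cmp_ident_left[OF y x that] cmp_zero_left[OF y x x that] by (simp add: 0)
    ultimately show ?thesis using x y zero_in_Hom by blast
  qed
  then show False using s x by (auto simp: simple_object_def zero_object_def)
qed

text \<open>
  The kernel of \<open>f\<close> is a subobject of \<open>x\<close> and, as \<open>f \<noteq> 0\<close>, not all of \<open>x\<close>.  So it is zero, and \<open>f\<close> is
  monic, which makes \<open>x\<close> a non-zero subobject of \<open>y\<close>.
\<close>

lemma schur_iso:
  assumes sx: "simple_object C x" and sy: "simple_object C y" and f: "f \<in> Hom C x y" "f \<noteq> 0"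
  shows "iso C x y f"
proof -
  have x: "x \<in> Ob C" and y: "y \<in> Ob C" using sx sy by (simp_all add: simple_object_def)
  obtain w k where ker: "is_kernel C x y f w k" using ex_kernel[OF x y f(1)] by blast
  then have w: "w \<in> Ob C" and k: "k \<in> Hom C w x" and fk: "f \<cdot> k = 0"
    and un: "\<And>v g. v \<in> Ob C \<Longrightarrow> g \<in> Hom C v x \<Longrightarrow> f \<cdot> g = 0 \<Longrightarrow> \<exists>!h. h \<in> Hom C v w \<and> k \<cdot> h = g"
    by (auto simp: is_kernel_def)
  have "monic C w x k"
    unfolding monic_def
  proof (intro conjI ballI impI k)
    fix v g h assume v: "v \<in> Ob C" and g: "g \<in> Hom C v w" and h: "h \<in> Hom C v w" and eq: "k \<cdot> g = k \<cdot> h"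
    have "f \<cdot> (k \<cdot> g) = 0" using cmp_assoc[OF v w x y g k f(1)] fk cmp_zero_left[OF v w y g] by simp
    then show "g = h" using un[OF v cmp_in_Hom[OF v w x g k]] g h eq by metis
  qed
  then have "zero_object C w \<or> iso C w x k" using sx w by (auto simp: simple_object_def)
  moreover have "\<not> iso C w x k"
  proof
    assume "iso C w x k"
    then obtain k' where k': "k' \<in> Hom C x w" "k \<cdot> k' = \<i> x" by (auto simp: iso_def is_inverse_def)
    have "f = (f \<cdot> k) \<cdot> k'"
      using cmp_ident_right[OF x y f(1)] cmp_assoc[OF x w x y k'(1) k f(1)] k'(2) by simp
    then show False using f(2) fk cmp_zero_left[OF x w y k'(1)] by simp
  qed
  ultimately have zw: "zero_object C w" by blast
  have "monic C x y f"
    unfolding monic_def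
  proof (intro conjI ballI impI f(1))
    fix v g h assume v: "v \<in> Ob C" and g: "g \<in> Hom C v x" and h: "h \<in> Hom C v x" and eq: "f \<cdot> g = f \<cdot> h"
    have "f \<cdot> (g - h) = 0" using cmp_diff_right[OF v x y g h f(1)] eq by simp
    then obtain u where u: "u \<in> Hom C v w" "k \<cdot> u = g - h" using un[OF v diff_in_Hom[OF v x g h]] by blast
    then have "u = 0" using zw v by (auto simp: zero_object_def)
    then show "g = h" using u(2) cmp_zero_right[OF v w x k] by simp
  qed
  then show ?thesis using sy sx x by (auto simp: simple_object_def)
qed

end

context locally_finite_category
begin

text \<open>
  A root of an annihilating polynomial splits off a factor \<open>f - a\<close>.  If this factor is not zero it is
  invertible and can be cancelled, which lowers the degree.
\<close>

lemma schur_scalar: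
  assumes sx: "simple_object C x" and f: "f \<in> Hom C x x"
  obtains a where "f = smul C a (\<i> x)"
proof -
  have x: "x \<in> Ob C" using sx by (simp add: simple_object_def)
  obtain p :: "complex poly" where p: "p \<noteq> 0" "poly_ar x f p = 0"
    by (rule annihilating_polynomial[OF x f])
  have "\<exists>a. f = smul C a (\<i> x)"
    using p
  proof (induction "degree p" arbitrary: p rule: less_induct)
    case less
    show ?case
    proof (cases "degree p = 0")
      case True
      then obtain b where b: "p = [:b:]" by (rule degree_eq_zeroE)
      then have "smul C b (\<i> x) = 0" using less.prems(2) by (simp add: poly_ar_def)
      then have "b = 0" using simple_nonzero[OF sx] by simp
      then show ?thesis using b less.prems(1) by simp
    next
      case False
      then have "\<not> constant (poly p)" by (simp add: constant_degree)
      then obtain a where "poly p a = 0" using fundamental_theorem_of_algebra by blast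
      then obtain q where q: "p = [:- a, 1:] * q" by (auto simp: poly_eq_0_iff_dvd dvd_def)
      have q0: "q \<noteq> 0" using q less.prems(1) by auto
      have deg: "degree q < degree p" unfolding q using q0 by (subst degree_mult_eq) auto
      let ?g = "f - smul C a (\<i> x)"
      have g: "?g \<in> Hom C x x" using x f by (intro diff_in_Hom smul_in_Hom ident_in_Hom)
      have E: "poly_ar x f q \<in> Hom C x x" by (rule poly_ar_in_Hom[OF x f])
      have 0: "?g \<cdot> poly_ar x f q = 0" using less.prems(2) poly_ar_linear_factor[OF x f] q by simp
      show ?thesis
      proof (cases "?g = 0")
        case True
        then show ?thesis by auto
      next
        case False
        then obtain g' where g': "g' \<in> Hom C x x" "g' \<cdot> ?g = \<i> x"
          using schur_iso[OF sx sx g] by (auto simp: iso_def is_inverse_def)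
        have "poly_ar x f q = g' \<cdot> (?g \<cdot> poly_ar x f q)"
          using cmp_assoc[OF x x x x E g g'(1)] g'(2) cmp_ident_left[OF x x E] by simp
        then have "poly_ar x f q = 0" using 0 cmp_zero_right[OF x x x g'(1)] by simp
        then show ?thesis using less.hyps[OF deg q0] by blast
      qed
    qed
  qed
  then show ?thesis using that by blast
qed

end

context semisimple_category
begin

text \<open>
  The coproduct property gives the projections, and it shows that the idempotents sum to the identity
  since this can be tested on the inclusions.
\<close>

lemma decomposition:
  assumes x: "x \<in> Ob C"
  obtains n :: nat and S e p where "\<And>k. k < n \<Longrightarrow> simple_object C (S k)"
    "\<And>k. k < n \<Longrightarrow> e k \<in> Hom C (S k) x" "\<And>k. k < n \<Longrightarrow> p k \<in> Hom C x (S k)"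
    "\<And>k l. k < n \<Longrightarrow> l < n \<Longrightarrow> p k \<cdot> e l = (if k = l then \<i> (S k) else 0)"
    "(\<Sum>k<n. e k \<cdot> p k) = \<i> x"
proof -
  obtain n S where S: "\<And>k. k < n \<Longrightarrow> simple_object C (S k)" and ds: "is_direct_sum C n S x"
    using semisimple[OF x] by blast
  have SO: "S k \<in> Ob C" if "k < n" for k using S[OF that] by (simp add: simple_object_def)
  obtain e where e': "\<forall>k<n. e k \<in> Hom C (S k) x"
    and un': "\<forall>y\<in>Ob C. \<forall>g. (\<forall>k<n. g k \<in> Hom C (S k) y) \<longrightarrow>
       (\<exists>!h. h \<in> Hom C x y \<and> (\<forall>k<n. h \<cdot> e k = g k))"
    using ds unfolding is_direct_sum_def by (elim conjE exE)
  have e: "e k \<in> Hom C (S k) x" if "k < n" for k using e' that by simp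
  have un: "\<exists>!h. h \<in> Hom C x y \<and> (\<forall>k<n. h \<cdot> e k = g k)"
    if "y \<in> Ob C" "\<And>k. k < n \<Longrightarrow> g k \<in> Hom C (S k) y" for y g
    using un'[rule_format, of y g] that by simp
  have "\<exists>h. h \<in> Hom C x (S l) \<and> (\<forall>k<n. h \<cdot> e k = (if l = k then \<i> (S l) else 0))" if l: "l < n" for l
  proof -
    have "(if l = k then \<i> (S l) else 0) \<in> Hom C (S k) (S l)" if "k < n" for k
      using SO[OF l] SO[OF that] ident_in_Hom by auto
    then show ?thesis using un[OF SO[OF l], of "\<lambda>k. if l = k then \<i> (S l) else 0"] by blast
  qed
  then obtain p where p: "\<And>l. l < n \<Longrightarrow> p l \<in> Hom C x (S l)"
    and pe: "\<And>l k. l < n \<Longrightarrow> k < n \<Longrightarrow> p l \<cdot> e k = (if l = k then \<i> (S l) else 0)"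
    by metis
  have ep: "e k \<cdot> p k \<in> Hom C x x" if "k < n" for k
    using cmp_in_Hom[OF x SO[OF that] x p[OF that] e[OF that]] .
  have "(\<Sum>k<n. e k \<cdot> p k) = \<i> x"
  proof -
    have 1: "(\<Sum>k<n. e k \<cdot> p k) \<cdot> e l = e l" if l: "l < n" for l
    proof -
      have "(\<Sum>k<n. e k \<cdot> p k) \<cdot> e l = (\<Sum>k<n. (e k \<cdot> p k) \<cdot> e l)"
        using x SO[OF l] e[OF l] ep by (intro cmp_sum_left[of "S l" x x]) auto
      also have "\<dots> = (\<Sum>k<n. if k = l then e l else 0)"
      proof (rule sum.cong)
        fix k assume "k \<in> {..<n}"
        then have k: "k < n" by simp
        have "(e k \<cdot> p k) \<cdot> e l = e k \<cdot> (p k \<cdot> e l)"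
          using cmp_assoc[OF SO[OF l] x SO[OF k] x e[OF l] p[OF k] e[OF k]] by simp
        also have "\<dots> = (if k = l then e l else 0)"
          using pe[OF k l] cmp_ident_right[OF SO[OF k] x e[OF k]] cmp_zero_right[OF SO[OF l] SO[OF k] x e[OF k]]
          by (cases "k = l") simp_all
        finally show "(e k \<cdot> p k) \<cdot> e l = (if k = l then e l else 0)" .
      qed simp
      finally show ?thesis using l by simp
    qed
    have 2: "\<i> x \<cdot> e l = e l" if "l < n" for l using cmp_ident_left[OF SO[OF that] x e[OF that]] .
    have "(\<Sum>k<n. e k \<cdot> p k) \<in> Hom C x x" using x ep by (intro sum_in_Hom) auto
    then show ?thesis using un[OF x, of e] e 1 2 ident_in_Hom[OF x] by blast
  qed
  then show thesis using that[of n S e p] S e p pe by blast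
qed

end

section \<open>Symmetric traces and multiplicities\<close>

lemma (in vector_space_pair) dim_eq_of_linear_bij:
  assumes V: "vs1.subspace V" "finite B" "V = vs1.span B" and W: "vs2.subspace W"
    and bij: "bij_betw T V W"
    and add: "\<And>u v. u \<in> V \<Longrightarrow> v \<in> V \<Longrightarrow> T (u + v) = T u + T v"
    and scale: "\<And>r v. v \<in> V \<Longrightarrow> T (s1 r v) = s2 r (T v)"
  shows "vs1.dim V = vs2.dim W"
proof -
  obtain D where D: "D \<subseteq> V" "vs1.independent D" "V \<subseteq> vs1.span D" "card D = vs1.dim V"
    using vs1.basis_exists[of V] by blast
  have "D \<subseteq> vs1.span B" using D(1) V(3) by blast
  then have fD: "finite D" using vs1.independent_span_bound[OF V(2) D(2)] by blast
  have inj: "inj_on T V" and img: "T ` V = W" using bij by (auto simp: bij_betw_def)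
  have T0: "T 0 = 0" using scale[of 0 0] vs1.subspace_0[OF V(1)] by simp
  have T_sum: "T (\<Sum>v\<in>A. s1 (c v) v) = (\<Sum>v\<in>A. s2 (c v) (T v))" if "A \<subseteq> V" "finite A" for A c
    using that(2,1)
  proof (induction A rule: finite_induct)
    case empty
    then show ?case by (simp add: T0)
  next
    case (insert a A)
    have "(\<Sum>v\<in>A. s1 (c v) v) \<in> V" using insert.prems by (intro vs1.subspace_sum[OF V(1)] vs1.subspace_scale[OF V(1)]) auto
    moreover have "s1 (c a) a \<in> V" using insert.prems by (intro vs1.subspace_scale[OF V(1)]) auto
    ultimately show ?case using insert by (simp add: add scale)
  qed
  have injD: "inj_on T D" by (rule inj_on_subset[OF inj D(1)])
  have "vs2.independent (T ` D)"
  proof (rule ccontr)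
    assume "\<not> vs2.independent (T ` D)"
    then obtain u v where uv: "v \<in> D" "u (T v) \<noteq> 0" "(\<Sum>w\<in>T ` D. s2 (u w) w) = 0"
      using fD by (subst (asm) vs2.dependent_finite) auto
    have "T (\<Sum>v\<in>D. s1 (u (T v)) v) = T 0"
      using uv(3) by (simp add: T_sum[OF D(1) fD] sum.reindex[OF injD] T0)
    moreover have "(\<Sum>v\<in>D. s1 (u (T v)) v) \<in> V"
      using D(1) by (intro vs1.subspace_sum[OF V(1)] vs1.subspace_scale[OF V(1)]) auto
    ultimately have "(\<Sum>v\<in>D. s1 (u (T v)) v) = 0"
      using inj vs1.subspace_0[OF V(1)] by (auto dest: inj_onD)
    then show False using vs1.independentD[OF D(2) fD order_refl, of "\<lambda>v. u (T v)"] uv(1,2) by blast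
  qed
  moreover have "T ` D \<subseteq> W" using D(1) img by blast
  moreover have "W \<subseteq> vs2.span (T ` D)"
  proof
    fix w assume "w \<in> W"
    then obtain v where v: "v \<in> V" "w = T v" using img by blast
    then obtain c where "v = (\<Sum>a\<in>D. s1 (c a) a)"
      using D(3) vs1.span_finite[OF fD] by auto
    then have "w = (\<Sum>a\<in>D. s2 (c a) (T a))" using v T_sum[OF D(1) fD] by simp
    then show "w \<in> vs2.span (T ` D)"
      by (simp add: vs2.span_sum vs2.span_scale vs2.span_base)
  qed
  ultimately have "vs2.dim W = card (T ` D)" by (intro vs2.dim_unique) auto
  then show ?thesis using D(4) by (simp add: card_image[OF injD])
qed

context linear_category
begin

definition symmetric_trace :: "('o \<Rightarrow> 'a \<Rightarrow> complex) \<Rightarrow> bool" where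
  "symmetric_trace \<tau> \<longleftrightarrow>
     (\<forall>x\<in>Ob C. \<forall>f\<in>Hom C x x. \<forall>g\<in>Hom C x x. \<tau> x (f + g) = \<tau> x f + \<tau> x g) \<and>
     (\<forall>x\<in>Ob C. \<forall>f\<in>Hom C x x. \<forall>r. \<tau> x (smul C r f) = r * \<tau> x f) \<and>
     (\<forall>x\<in>Ob C. \<forall>y\<in>Ob C. \<forall>f\<in>Hom C x y. \<forall>g\<in>Hom C y x. \<tau> x (g \<cdot> f) = \<tau> y (f \<cdot> g))"

lemma symmetric_traceD:
  assumes "symmetric_trace \<tau>"
  shows "\<lbrakk>x \<in> Ob C; f \<in> Hom C x x; g \<in> Hom C x x\<rbrakk> \<Longrightarrow> \<tau> x (f + g) = \<tau> x f + \<tau> x g"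
    and "\<lbrakk>x \<in> Ob C; f \<in> Hom C x x\<rbrakk> \<Longrightarrow> \<tau> x (smul C r f) = r * \<tau> x f"
    and "\<lbrakk>x \<in> Ob C; y \<in> Ob C; f \<in> Hom C x y; g \<in> Hom C y x\<rbrakk> \<Longrightarrow> \<tau> x (g \<cdot> f) = \<tau> y (f \<cdot> g)"
  using assms unfolding symmetric_trace_def by blast+

lemma symmetric_trace_sum:
  assumes t: "symmetric_trace \<tau>" and x: "x \<in> Ob C" and "finite A" "\<And>k. k \<in> A \<Longrightarrow> h k \<in> Hom C x x"
  shows "\<tau> x (\<Sum>k\<in>A. h k) = (\<Sum>k\<in>A. \<tau> x (h k))"
  using assms(3,4)
proof (induction A rule: finite_induct)
  case empty
  then show ?case using symmetric_traceD(2)[OF t x zero_in_Hom[OF x x], of 0] by simp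
next
  case (insert k A)
  then show ?case using symmetric_traceD(1)[OF t x] x by (simp add: sum_in_Hom)
qed

end

context semisimple_category
begin

context
  fixes I :: "'i set" and m :: "'i \<Rightarrow> 'a"
  assumes reps: "simple_representatives C I m"
begin

lemma rep_simple: "i \<in> I \<Longrightarrow> simple_object C (m i)"
  and rep_Ob: "i \<in> I \<Longrightarrow> m i \<in> Ob C"
  using reps by (simp_all add: simple_representatives_def simple_object_def)

lemma rep_Hom_zero:
  assumes "i \<in> I" "j \<in> I" "i \<noteq> j" "f \<in> Hom C (m i) (m j)"
  shows "f = 0"
proof (rule ccontr)
  assume "f \<noteq> 0"
  then have "isomorphic C (m i) (m j)"
    using schur_iso[OF rep_simple rep_simple] assms unfolding isomorphic_def by blast
  then show False using reps assms unfolding simple_representatives_def by blast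
qed

lemma rep_decomposition:
  assumes x: "x \<in> Ob C"
  obtains n :: nat and \<iota> e p where "\<And>k. k < n \<Longrightarrow> \<iota> k \<in> I"
    "\<And>k. k < n \<Longrightarrow> e k \<in> Hom C (m (\<iota> k)) x" "\<And>k. k < n \<Longrightarrow> p k \<in> Hom C x (m (\<iota> k))"
    "\<And>k l. k < n \<Longrightarrow> l < n \<Longrightarrow> p k \<cdot> e l = (if k = l then \<i> (m (\<iota> k)) else 0)"
    "(\<Sum>k<n. e k \<cdot> p k) = \<i> x"
proof -
  obtain n :: nat and S e p where S: "\<And>k. k < n \<Longrightarrow> simple_object C (S k)"
    and e: "\<And>k. k < n \<Longrightarrow> e k \<in> Hom C (S k) x" and p: "\<And>k. k < n \<Longrightarrow> p k \<in> Hom C x (S k)"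
    and pe: "\<And>k l. k < n \<Longrightarrow> l < n \<Longrightarrow> p k \<cdot> e l = (if k = l then \<i> (S k) else 0)"
    and ep: "(\<Sum>k<n. e k \<cdot> p k) = \<i> x"
    by (rule decomposition[OF x]) blast
  have SO: "S k \<in> Ob C" if "k < n" for k using S[OF that] by (simp add: simple_object_def)
  have "\<exists>i a b. i \<in> I \<and> a \<in> Hom C (S k) (m i) \<and> b \<in> Hom C (m i) (S k) \<and> b \<cdot> a = \<i> (S k) \<and> a \<cdot> b = \<i> (m i)"
    if "k < n" for k
    using reps S[OF that] unfolding simple_representatives_def isomorphic_def iso_def is_inverse_def by blast
  then obtain \<iota> a b where \<iota>: "\<And>k. k < n \<Longrightarrow> \<iota> k \<in> I"
    and a: "\<And>k. k < n \<Longrightarrow> a k \<in> Hom C (S k) (m (\<iota> k))" and b: "\<And>k. k < n \<Longrightarrow> b k \<in> Hom C (m (\<iota> k)) (S k)"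
    and ba: "\<And>k. k < n \<Longrightarrow> b k \<cdot> a k = \<i> (S k)" and ab: "\<And>k. k < n \<Longrightarrow> a k \<cdot> b k = \<i> (m (\<iota> k))"
    by metis
  have mO: "m (\<iota> k) \<in> Ob C" if "k < n" for k using rep_Ob \<iota> that by blast
  have eb: "e k \<cdot> b k \<in> Hom C (m (\<iota> k)) x" if "k < n" for k
    using cmp_in_Hom[OF mO[OF that] SO[OF that] x b[OF that] e[OF that]] .
  have ap: "a k \<cdot> p k \<in> Hom C x (m (\<iota> k))" if "k < n" for k
    using cmp_in_Hom[OF x SO[OF that] mO[OF that] p[OF that] a[OF that]] .
  show thesis
  proof (rule that[of n \<iota> "\<lambda>k. e k \<cdot> b k" "\<lambda>k. a k \<cdot> p k"])
    show "(a k \<cdot> p k) \<cdot> (e l \<cdot> b l) = (if k = l then \<i> (m (\<iota> k)) else 0)" if k: "k < n" and l: "l < n" for k l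
    proof -
      have "(a k \<cdot> p k) \<cdot> (e l \<cdot> b l) = ((a k \<cdot> p k) \<cdot> e l) \<cdot> b l"
        by (rule cmp_assoc[OF mO[OF l] SO[OF l] x mO[OF k] b[OF l] e[OF l] ap[OF k]])
      also have "(a k \<cdot> p k) \<cdot> e l = a k \<cdot> (p k \<cdot> e l)"
        by (rule cmp_assoc[OF SO[OF l] x SO[OF k] mO[OF k] e[OF l] p[OF k] a[OF k], symmetric])
      also have "\<dots> = (if k = l then a k else 0)"
        using pe[OF k l] cmp_ident_right[OF SO[OF k] mO[OF k] a[OF k]] cmp_zero_right[OF SO[OF l] SO[OF k] mO[OF k] a[OF k]]
        by (cases "k = l") simp_all
      also have "\<dots> \<cdot> b l = (if k = l then \<i> (m (\<iota> k)) else 0)"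
        using ab[OF l] cmp_zero_left[OF mO[OF l] SO[OF l] mO[OF k] b[OF l]] by (cases "k = l") simp_all
      finally show ?thesis .
    qed
    have "(e k \<cdot> b k) \<cdot> (a k \<cdot> p k) = e k \<cdot> p k" if k: "k < n" for k
    proof -
      have "(e k \<cdot> b k) \<cdot> (a k \<cdot> p k) = ((e k \<cdot> b k) \<cdot> a k) \<cdot> p k"
        by (rule cmp_assoc[OF x SO[OF k] mO[OF k] x p[OF k] a[OF k] eb[OF k]])
      also have "(e k \<cdot> b k) \<cdot> a k = e k"
        using cmp_assoc[OF SO[OF k] mO[OF k] SO[OF k] x a[OF k] b[OF k] e[OF k]] ba[OF k]
          cmp_ident_right[OF SO[OF k] x e[OF k]] by simp
      finally show ?thesis .
    qed
    then show "(\<Sum>k<n. (e k \<cdot> b k) \<cdot> (a k \<cdot> p k)) = \<i> x" using ep by simp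
  qed (use \<iota> eb ap in blast)+
qed

text \<open>
  By symmetry the trace of \<open>f \<cdot> e k \<cdot> p k\<close> is that of the diagonal entry \<open>p k \<cdot> f \<cdot> e k\<close>.
\<close>

lemma symmetric_trace_expand:
  assumes t: "symmetric_trace \<tau>" and x: "x \<in> Ob C" and f: "f \<in> Hom C x x"
    and \<iota>: "\<And>k. k < (n::nat) \<Longrightarrow> \<iota> k \<in> I"
    and e: "\<And>k. k < n \<Longrightarrow> e k \<in> Hom C (m (\<iota> k)) x" and p: "\<And>k. k < n \<Longrightarrow> p k \<in> Hom C x (m (\<iota> k))"
    and ep: "(\<Sum>k<n. e k \<cdot> p k) = \<i> x"
  shows "\<tau> x f = (\<Sum>k<n. \<tau> (m (\<iota> k)) (p k \<cdot> (f \<cdot> e k)))"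
proof -
  have mO: "m (\<iota> k) \<in> Ob C" if "k < n" for k using rep_Ob \<iota> that by blast
  have E: "e k \<cdot> p k \<in> Hom C x x" if "k < n" for k
    using cmp_in_Hom[OF x mO[OF that] x p[OF that] e[OF that]] .
  have fe: "f \<cdot> e k \<in> Hom C (m (\<iota> k)) x" if "k < n" for k
    using cmp_in_Hom[OF mO[OF that] x x e[OF that] f] .
  have "f = f \<cdot> (\<Sum>k<n. e k \<cdot> p k)" using cmp_ident_right[OF x x f] ep by simp
  also have "\<dots> = (\<Sum>k<n. f \<cdot> (e k \<cdot> p k))"
    using x f E by (intro cmp_sum_right[of x x x]) auto
  finally have "\<tau> x f = \<tau> x (\<Sum>k<n. f \<cdot> (e k \<cdot> p k))" by simp
  also have "\<dots> = (\<Sum>k<n. \<tau> x (f \<cdot> (e k \<cdot> p k)))"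
    using x E f by (intro symmetric_trace_sum[OF t]) (auto intro: cmp_in_Hom)
  also have "\<dots> = (\<Sum>k<n. \<tau> (m (\<iota> k)) (p k \<cdot> (f \<cdot> e k)))"
  proof (rule sum.cong)
    fix k assume "k \<in> {..<n}"
    then have k: "k < n" by simp
    have "\<tau> x (f \<cdot> (e k \<cdot> p k)) = \<tau> x ((f \<cdot> e k) \<cdot> p k)"
      using cmp_assoc[OF x mO[OF k] x x p[OF k] e[OF k] f] by simp
    also have "\<dots> = \<tau> (m (\<iota> k)) (p k \<cdot> (f \<cdot> e k))"
      by (rule symmetric_traceD(3)[OF t x mO[OF k] p[OF k] fe[OF k]])
    finally show "\<tau> x (f \<cdot> (e k \<cdot> p k)) = \<tau> (m (\<iota> k)) (p k \<cdot> (f \<cdot> e k))" .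
  qed simp
  finally show ?thesis .
qed

text \<open>
  The diagonal entries are scalars by Schur's lemma.
\<close>

lemma symmetric_trace_eqI:
  assumes t: "symmetric_trace \<tau>" and s: "symmetric_trace \<sigma>"
    and eq: "\<And>i. i \<in> I \<Longrightarrow> \<tau> (m i) (\<i> (m i)) = \<sigma> (m i) (\<i> (m i))"
    and x: "x \<in> Ob C" and f: "f \<in> Hom C x x"
  shows "\<tau> x f = \<sigma> x f"
proof -
  obtain n :: nat and \<iota> e p where \<iota>: "\<And>k. k < n \<Longrightarrow> \<iota> k \<in> I"
    and e: "\<And>k. k < n \<Longrightarrow> e k \<in> Hom C (m (\<iota> k)) x" and p: "\<And>k. k < n \<Longrightarrow> p k \<in> Hom C x (m (\<iota> k))"
    and ep: "(\<Sum>k<n. e k \<cdot> p k) = \<i> x"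
    by (rule rep_decomposition[OF x]) blast
  have "\<tau> (m (\<iota> k)) (p k \<cdot> (f \<cdot> e k)) = \<sigma> (m (\<iota> k)) (p k \<cdot> (f \<cdot> e k))" if k: "k < n" for k
  proof -
    have mO: "m (\<iota> k) \<in> Ob C" using rep_Ob \<iota> k by blast
    have "p k \<cdot> (f \<cdot> e k) \<in> Hom C (m (\<iota> k)) (m (\<iota> k))"
      using cmp_in_Hom[OF mO x mO cmp_in_Hom[OF mO x x e[OF k] f] p[OF k]] .
    then obtain a where "p k \<cdot> (f \<cdot> e k) = smul C a (\<i> (m (\<iota> k)))"
      by (rule schur_scalar[OF rep_simple[OF \<iota>[OF k]]])
    then show ?thesis
      using symmetric_traceD(2)[OF t mO ident_in_Hom[OF mO]] symmetric_traceD(2)[OF s mO ident_in_Hom[OF mO]]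
        eq[OF \<iota>[OF k]] by simp
  qed
  then show ?thesis
    using symmetric_trace_expand[OF t x f \<iota> e p ep] symmetric_trace_expand[OF s x f \<iota> e p ep] by simp
qed

text \<open>
  Some matrix entry \<open>p' l \<cdot> f \<cdot> e k\<close> is non-zero, so it is an isomorphism between two copies of the
  same simple object; the matrix unit \<open>e k \<cdot> p' l\<close> then pairs with \<open>f\<close> to a non-zero multiple of the
  trace of that simple object.
\<close>

lemma symmetric_trace_nondegenerate:
  assumes t: "symmetric_trace \<tau>" and nz: "\<And>i. i \<in> I \<Longrightarrow> \<tau> (m i) (\<i> (m i)) \<noteq> 0"
    and x: "x \<in> Ob C" and y: "y \<in> Ob C" and f: "f \<in> Hom C x y" "f \<noteq> 0"
  obtains g where "g \<in> Hom C y x" "\<tau> x (g \<cdot> f) \<noteq> 0"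
proof -
  obtain n :: nat and \<iota> e p where \<iota>: "\<And>k. k < n \<Longrightarrow> \<iota> k \<in> I"
    and e: "\<And>k. k < n \<Longrightarrow> e k \<in> Hom C (m (\<iota> k)) x" and p: "\<And>k. k < n \<Longrightarrow> p k \<in> Hom C x (m (\<iota> k))"
    and ep: "(\<Sum>k<n. e k \<cdot> p k) = \<i> x"
    by (rule rep_decomposition[OF x]) blast
  obtain n' :: nat and \<iota>' e' p' where \<iota>': "\<And>k. k < n' \<Longrightarrow> \<iota>' k \<in> I"
    and e': "\<And>k. k < n' \<Longrightarrow> e' k \<in> Hom C (m (\<iota>' k)) y" and p': "\<And>k. k < n' \<Longrightarrow> p' k \<in> Hom C y (m (\<iota>' k))"
    and ep': "(\<Sum>k<n'. e' k \<cdot> p' k) = \<i> y"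
    by (rule rep_decomposition[OF y]) blast
  have mO: "m (\<iota> k) \<in> Ob C" if "k < n" for k using rep_Ob \<iota> that by blast
  have mO': "m (\<iota>' k) \<in> Ob C" if "k < n'" for k using rep_Ob \<iota>' that by blast
  have E: "e k \<cdot> p k \<in> Hom C x x" if "k < n" for k
    using cmp_in_Hom[OF x mO[OF that] x p[OF that] e[OF that]] .
  have E': "e' k \<cdot> p' k \<in> Hom C y y" if "k < n'" for k
    using cmp_in_Hom[OF y mO'[OF that] y p'[OF that] e'[OF that]] .
  have "\<exists>k<n. f \<cdot> e k \<noteq> 0"
  proof (rule ccontr)
    assume "\<not> (\<exists>k<n. f \<cdot> e k \<noteq> 0)"
    then have 0: "f \<cdot> e k = 0" if "k < n" for k using that by blast
    have "f = f \<cdot> (\<Sum>k<n. e k \<cdot> p k)" using cmp_ident_right[OF x y f(1)] ep by simp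
    also have "\<dots> = (\<Sum>k<n. f \<cdot> (e k \<cdot> p k))"
      using x y f E by (intro cmp_sum_right[of x x y]) auto
    also have "\<dots> = 0"
    proof (rule sum.neutral, safe)
      fix k assume k: "k < n"
      show "f \<cdot> (e k \<cdot> p k) = 0"
        using cmp_assoc[OF x mO[OF k] x y p[OF k] e[OF k] f(1)] 0[OF k] cmp_zero_left[OF x mO[OF k] y p[OF k]] by simp
    qed
    finally show False using f(2) by simp
  qed
  then obtain k where k: "k < n" and fe0: "f \<cdot> e k \<noteq> 0" by blast
  have fe: "f \<cdot> e k \<in> Hom C (m (\<iota> k)) y" by (rule cmp_in_Hom[OF mO[OF k] x y e[OF k] f(1)])
  have "\<exists>l<n'. p' l \<cdot> (f \<cdot> e k) \<noteq> 0"
  proof (rule ccontr)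
    assume "\<not> (\<exists>l<n'. p' l \<cdot> (f \<cdot> e k) \<noteq> 0)"
    then have 0: "p' l \<cdot> (f \<cdot> e k) = 0" if "l < n'" for l using that by blast
    have "f \<cdot> e k = (\<Sum>l<n'. e' l \<cdot> p' l) \<cdot> (f \<cdot> e k)" using cmp_ident_left[OF mO[OF k] y fe] ep' by simp
    also have "\<dots> = (\<Sum>l<n'. (e' l \<cdot> p' l) \<cdot> (f \<cdot> e k))"
      using y fe E' mO[OF k] by (intro cmp_sum_left[of "m (\<iota> k)" y y]) auto
    also have "\<dots> = 0"
    proof (rule sum.neutral, safe)
      fix l assume l: "l < n'"
      show "(e' l \<cdot> p' l) \<cdot> (f \<cdot> e k) = 0"
        using cmp_assoc[OF mO[OF k] y mO'[OF l] y fe p'[OF l] e'[OF l]] 0[OF l]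
          cmp_zero_right[OF mO[OF k] mO'[OF l] y e'[OF l]] by simp
    qed
    finally show False using fe0 by simp
  qed
  then obtain l where l: "l < n'" and nz': "p' l \<cdot> (f \<cdot> e k) \<noteq> 0" by blast
  have h: "p' l \<cdot> (f \<cdot> e k) \<in> Hom C (m (\<iota> k)) (m (\<iota>' l))"
    by (rule cmp_in_Hom[OF mO[OF k] y mO'[OF l] fe p'[OF l]])
  have eq: "\<iota>' l = \<iota> k" using rep_Hom_zero[OF \<iota>[OF k] \<iota>'[OF l] _ h] nz' by metis
  have p'l: "p' l \<in> Hom C y (m (\<iota> k))" using p'[OF l] eq by simp
  obtain a where a: "p' l \<cdot> (f \<cdot> e k) = smul C a (\<i> (m (\<iota> k)))"
    by (rule schur_scalar[OF rep_simple[OF \<iota>[OF k]]]) (use h eq in auto)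
  have a0: "a \<noteq> 0" using a nz' by auto
  have pf: "p' l \<cdot> f \<in> Hom C x (m (\<iota> k))" by (rule cmp_in_Hom[OF x y mO[OF k] f(1) p'l])
  have "\<tau> x ((e k \<cdot> p' l) \<cdot> f) = \<tau> x (e k \<cdot> (p' l \<cdot> f))"
    using cmp_assoc[OF x y mO[OF k] x f(1) p'l e[OF k]] by simp
  also have "\<dots> = \<tau> (m (\<iota> k)) ((p' l \<cdot> f) \<cdot> e k)"
    by (rule symmetric_traceD(3)[OF t x mO[OF k] pf e[OF k]])
  also have "(p' l \<cdot> f) \<cdot> e k = smul C a (\<i> (m (\<iota> k)))"
    using cmp_assoc[OF mO[OF k] x y mO[OF k] e[OF k] f(1) p'l] a by simp
  also have "\<tau> (m (\<iota> k)) \<dots> \<noteq> 0"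
    using symmetric_traceD(2)[OF t mO[OF k] ident_in_Hom[OF mO[OF k]]] a0 nz[OF \<iota>[OF k]] by simp
  finally show thesis using that cmp_in_Hom[OF y mO[OF k] x p'l e[OF k]] by blast
qed

text \<open>
  The inclusions of the summands isomorphic to \<open>m j\<close> are a basis of \<open>Hom (m j) x\<close>, the projections
  one of \<open>Hom x (m j)\<close>; each family is dual to the other under composition.
\<close>

lemma dim_Hom_eq_multiplicity:
  assumes x: "x \<in> Ob C" and j: "j \<in> I"
    and \<iota>: "\<And>k. k < (n::nat) \<Longrightarrow> \<iota> k \<in> I"
    and e: "\<And>k. k < n \<Longrightarrow> e k \<in> Hom C (m (\<iota> k)) x" and p: "\<And>k. k < n \<Longrightarrow> p k \<in> Hom C x (m (\<iota> k))"
    and pe: "\<And>k l. k < n \<Longrightarrow> l < n \<Longrightarrow> p k \<cdot> e l = (if k = l then \<i> (m (\<iota> k)) else 0)"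
    and ep: "(\<Sum>k<n. e k \<cdot> p k) = \<i> x"
  shows "dim (Hom C (m j) x) = card {k\<in>{..<n}. \<iota> k = j}"
    and "dim (Hom C x (m j)) = card {k\<in>{..<n}. \<iota> k = j}"
proof -
  have mO: "m (\<iota> k) \<in> Ob C" if "k < n" for k using rep_Ob \<iota> that by blast
  have jO: "m j \<in> Ob C" by (rule rep_Ob[OF j])
  have id0: "\<i> (m j) \<noteq> 0" by (rule simple_nonzero[OF rep_simple[OF j]])
  have E: "e k \<cdot> p k \<in> Hom C x x" if "k < n" for k
    using cmp_in_Hom[OF x mO[OF that] x p[OF that] e[OF that]] .
  let ?K = "{k\<in>{..<n}. \<iota> k = j}"
  have eK: "e k \<in> Hom C (m j) x" and pK: "p k \<in> Hom C x (m j)" if "k \<in> ?K" for k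
    using e[of k] p[of k] that by auto
  have peK: "p k \<cdot> e l = (if k = l then \<i> (m j) else 0)" if "k \<in> ?K" "l \<in> ?K" for k l
    using pe[of k l] that by auto
  have inj_e: "inj_on e ?K"
  proof (rule inj_onI, rule ccontr)
    fix k l assume "k \<in> ?K" "l \<in> ?K" "e k = e l" "k \<noteq> l"
    then show False using peK[of k k] peK[of k l] id0 by simp
  qed
  have inj_p: "inj_on p ?K"
  proof (rule inj_onI, rule ccontr)
    fix k l assume "k \<in> ?K" "l \<in> ?K" "p k = p l" "k \<noteq> l"
    then show False using peK[of k k] peK[of l k] id0 by simp
  qed
  have smul_id: "r = 0" if "smul C r (\<i> (m j)) = 0" for r using that id0 by simp
  have ind_e: "independent (e ` ?K)"
  proof (rule ccontr)
    assume "\<not> independent (e ` ?K)"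
    then obtain u l where l: "l \<in> ?K" "u (e l) \<noteq> 0" and "(\<Sum>w\<in>e ` ?K. smul C (u w) w) = 0"
      by (subst (asm) dependent_finite) auto
    then have 0: "(\<Sum>k\<in>?K. smul C (u (e k)) (e k)) = 0" by (simp only: sum.reindex[OF inj_e] o_def)
    have "p l \<cdot> (\<Sum>k\<in>?K. smul C (u (e k)) (e k)) = (\<Sum>k\<in>?K. p l \<cdot> smul C (u (e k)) (e k))"
      using x jO pK[OF l(1)] eK smul_in_Hom by (intro cmp_sum_right[of "m j" x "m j"]) auto
    also have "\<dots> = (\<Sum>k\<in>?K. if k = l then smul C (u (e l)) (\<i> (m j)) else 0)"
    proof (rule sum.cong)
      fix k assume k: "k \<in> ?K"
      show "p l \<cdot> smul C (u (e k)) (e k) = (if k = l then smul C (u (e l)) (\<i> (m j)) else 0)"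
        using cmp_smul_right[OF jO x jO eK[OF k] pK[OF l(1)]] peK[OF l(1) k] by simp
    qed simp
    also have "\<dots> = smul C (u (e l)) (\<i> (m j))" using l(1) by (simp add: sum.delta)
    finally have "smul C (u (e l)) (\<i> (m j)) = 0" using 0 cmp_zero_right[OF jO x jO pK[OF l(1)]] by simp
    then show False using smul_id l(2) by blast
  qed
  have ind_p: "independent (p ` ?K)"
  proof (rule ccontr)
    assume "\<not> independent (p ` ?K)"
    then obtain u l where l: "l \<in> ?K" "u (p l) \<noteq> 0" and "(\<Sum>w\<in>p ` ?K. smul C (u w) w) = 0"
      by (subst (asm) dependent_finite) auto
    then have 0: "(\<Sum>k\<in>?K. smul C (u (p k)) (p k)) = 0" by (simp only: sum.reindex[OF inj_p] o_def)
    have "(\<Sum>k\<in>?K. smul C (u (p k)) (p k)) \<cdot> e l = (\<Sum>k\<in>?K. smul C (u (p k)) (p k) \<cdot> e l)"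
      using x jO eK[OF l(1)] pK smul_in_Hom by (intro cmp_sum_left[of "m j" x "m j"]) auto
    also have "\<dots> = (\<Sum>k\<in>?K. if k = l then smul C (u (p l)) (\<i> (m j)) else 0)"
    proof (rule sum.cong)
      fix k assume k: "k \<in> ?K"
      show "smul C (u (p k)) (p k) \<cdot> e l = (if k = l then smul C (u (p l)) (\<i> (m j)) else 0)"
        using cmp_smul_left[OF jO x jO eK[OF l(1)] pK[OF k]] peK[OF k l(1)] by simp
    qed simp
    also have "\<dots> = smul C (u (p l)) (\<i> (m j))" using l(1) by (simp add: sum.delta)
    finally have "smul C (u (p l)) (\<i> (m j)) = 0" using 0 cmp_zero_left[OF jO x jO eK[OF l(1)]] by simp
    then show False using smul_id l(2) by blast
  qed
  have span_e: "Hom C (m j) x \<subseteq> span (e ` ?K)"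
  proof
    fix g assume g: "g \<in> Hom C (m j) x"
    have "g = (\<Sum>k<n. e k \<cdot> p k) \<cdot> g" using cmp_ident_left[OF jO x g] ep by simp
    also have "\<dots> = (\<Sum>k<n. (e k \<cdot> p k) \<cdot> g)"
      using x jO g E by (intro cmp_sum_left[of "m j" x x]) auto
    also have "\<dots> \<in> span (e ` ?K)"
    proof (rule span_sum)
      fix k assume "k \<in> {..<n}"
      then have k: "k < n" by simp
      have pg: "p k \<cdot> g \<in> Hom C (m j) (m (\<iota> k))" by (rule cmp_in_Hom[OF jO x mO[OF k] g p[OF k]])
      have eq: "(e k \<cdot> p k) \<cdot> g = e k \<cdot> (p k \<cdot> g)"
        using cmp_assoc[OF jO x mO[OF k] x g p[OF k] e[OF k]] by simp
      show "(e k \<cdot> p k) \<cdot> g \<in> span (e ` ?K)"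
      proof (cases "\<iota> k = j")
        case True
        obtain a where "p k \<cdot> g = smul C a (\<i> (m j))"
          by (rule schur_scalar[OF rep_simple[OF j]]) (use pg True in auto)
        then have "e k \<cdot> (p k \<cdot> g) = smul C a (e k)"
          using cmp_smul_right[OF jO jO x ident_in_Hom[OF jO], of "e k"] cmp_ident_right[OF jO x, of "e k"] e[OF k] True
          by simp
        moreover have "e k \<in> e ` ?K" using k True by simp
        ultimately show ?thesis unfolding eq by (simp add: span_scale span_base)
      next
        case False
        then have "p k \<cdot> g = 0" using rep_Hom_zero[OF j \<iota>[OF k] _ pg] by metis
        then show ?thesis unfolding eq using cmp_zero_right[OF jO mO[OF k] x e[OF k]] by (simp add: span_zero)
      qed
    qed
    finally show "g \<in> span (e ` ?K)" .
  qed
  have span_p: "Hom C x (m j) \<subseteq> span (p ` ?K)"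
  proof
    fix g assume g: "g \<in> Hom C x (m j)"
    have "g = g \<cdot> (\<Sum>k<n. e k \<cdot> p k)" using cmp_ident_right[OF x jO g] ep by simp
    also have "\<dots> = (\<Sum>k<n. g \<cdot> (e k \<cdot> p k))"
      using x jO g E by (intro cmp_sum_right[of x x "m j"]) auto
    also have "\<dots> \<in> span (p ` ?K)"
    proof (rule span_sum)
      fix k assume "k \<in> {..<n}"
      then have k: "k < n" by simp
      have ge: "g \<cdot> e k \<in> Hom C (m (\<iota> k)) (m j)" by (rule cmp_in_Hom[OF mO[OF k] x jO e[OF k] g])
      have eq: "g \<cdot> (e k \<cdot> p k) = (g \<cdot> e k) \<cdot> p k"
        using cmp_assoc[OF x mO[OF k] x jO p[OF k] e[OF k] g] by simp
      show "g \<cdot> (e k \<cdot> p k) \<in> span (p ` ?K)"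
      proof (cases "\<iota> k = j")
        case True
        obtain a where "g \<cdot> e k = smul C a (\<i> (m j))"
          by (rule schur_scalar[OF rep_simple[OF j]]) (use ge True in auto)
        then have "(g \<cdot> e k) \<cdot> p k = smul C a (p k)"
          using cmp_smul_left[OF x jO jO _ ident_in_Hom[OF jO], of "p k"] cmp_ident_left[OF x jO, of "p k"] p[OF k] True
          by simp
        moreover have "p k \<in> p ` ?K" using k True by simp
        ultimately show ?thesis unfolding eq by (simp add: span_scale span_base)
      next
        case False
        then have "g \<cdot> e k = 0" using rep_Hom_zero[OF \<iota>[OF k] j _ ge] by metis
        then show ?thesis unfolding eq using cmp_zero_left[OF x mO[OF k] jO p[OF k]] by (simp add: span_zero)
      qed
    qed
    finally show "g \<in> span (p ` ?K)" .
  qed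
  have "e ` ?K \<subseteq> Hom C (m j) x" "p ` ?K \<subseteq> Hom C x (m j)" using eK pK by blast+
  then show "dim (Hom C (m j) x) = card ?K" "dim (Hom C x (m j)) = card ?K"
    using dim_unique[OF _ span_e ind_e card_image[OF inj_e]] dim_unique[OF _ span_p ind_p card_image[OF inj_p]]
    by blast+
qed

lemma dim_Hom_swap:
  assumes x: "x \<in> Ob C" and j: "j \<in> I"
  shows "dim (Hom C (m j) x) = dim (Hom C x (m j))"
proof -
  obtain n :: nat and \<iota> e p where \<iota>: "\<And>k. k < n \<Longrightarrow> \<iota> k \<in> I"
    and e: "\<And>k. k < n \<Longrightarrow> e k \<in> Hom C (m (\<iota> k)) x" and p: "\<And>k. k < n \<Longrightarrow> p k \<in> Hom C x (m (\<iota> k))"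
    and pe: "\<And>k l. k < n \<Longrightarrow> l < n \<Longrightarrow> p k \<cdot> e l = (if k = l then \<i> (m (\<iota> k)) else 0)"
    and ep: "(\<Sum>k<n. e k \<cdot> p k) = \<i> x"
    by (rule rep_decomposition[OF x]) blast
  show ?thesis using dim_Hom_eq_multiplicity[OF x j \<iota> e p pe ep] by simp
qed

lemma symmetric_trace_ident:
  assumes t: "symmetric_trace \<tau>" and x: "x \<in> Ob C" and fin: "finite I"
  shows "\<tau> x (\<i> x) = (\<Sum>i\<in>I. of_nat (dim (Hom C (m i) x)) * \<tau> (m i) (\<i> (m i)))"
proof -
  obtain n :: nat and \<iota> e p where \<iota>: "\<And>k. k < n \<Longrightarrow> \<iota> k \<in> I"
    and e: "\<And>k. k < n \<Longrightarrow> e k \<in> Hom C (m (\<iota> k)) x" and p: "\<And>k. k < n \<Longrightarrow> p k \<in> Hom C x (m (\<iota> k))"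
    and pe: "\<And>k l. k < n \<Longrightarrow> l < n \<Longrightarrow> p k \<cdot> e l = (if k = l then \<i> (m (\<iota> k)) else 0)"
    and ep: "(\<Sum>k<n. e k \<cdot> p k) = \<i> x"
    by (rule rep_decomposition[OF x]) blast
  have "\<tau> x (\<i> x) = (\<Sum>k<n. \<tau> (m (\<iota> k)) (p k \<cdot> (\<i> x \<cdot> e k)))"
    by (rule symmetric_trace_expand[OF t x ident_in_Hom[OF x] \<iota> e p ep])
  also have "\<dots> = (\<Sum>k<n. \<tau> (m (\<iota> k)) (\<i> (m (\<iota> k))))"
    using cmp_ident_left[OF rep_Ob[OF \<iota>] x e] pe by (intro sum.cong) auto
  also have "\<dots> = (\<Sum>i\<in>I. \<Sum>k\<in>{k\<in>{..<n}. \<iota> k = i}. \<tau> (m (\<iota> k)) (\<i> (m (\<iota> k))))"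
    by (rule sum.group[symmetric]) (use fin \<iota> in auto)
  also have "\<dots> = (\<Sum>i\<in>I. of_nat (dim (Hom C (m i) x)) * \<tau> (m i) (\<i> (m i)))"
  proof (rule sum.cong)
    fix i assume i: "i \<in> I"
    have "(\<Sum>k\<in>{k\<in>{..<n}. \<iota> k = i}. \<tau> (m (\<iota> k)) (\<i> (m (\<iota> k)))) = (\<Sum>k\<in>{k\<in>{..<n}. \<iota> k = i}. \<tau> (m i) (\<i> (m i)))"
      by (intro sum.cong) auto
    then show "(\<Sum>k\<in>{k\<in>{..<n}. \<iota> k = i}. \<tau> (m (\<iota> k)) (\<i> (m (\<iota> k)))) = of_nat (dim (Hom C (m i) x)) * \<tau> (m i) (\<i> (m i))"
      using dim_Hom_eq_multiplicity(1)[OF x i \<iota> e p pe ep] by simp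
  qed simp
  finally show ?thesis .
qed

end

lemma finite_representatives:
  assumes S: "finite S" "simple_representatives C S (\<lambda>x. x)" and U: "simple_representatives C U c"
  shows "finite U"
proof -
  have "\<exists>s\<in>S. isomorphic C (c u) s" if "u \<in> U" for u
    using S(2) rep_simple[OF U that] unfolding simple_representatives_def by blast
  then obtain s where s: "\<And>u. u \<in> U \<Longrightarrow> s u \<in> S" "\<And>u. u \<in> U \<Longrightarrow> isomorphic C (c u) (s u)" by metis
  have O: "c u \<in> Ob C" "s u \<in> Ob C" if "u \<in> U" for u
    using rep_Ob[OF U that] rep_Ob[OF S(2) s(1)[OF that]] by simp_all
  have "inj_on s U"
  proof (rule inj_onI)
    fix u v assume u: "u \<in> U" and v: "v \<in> U" and eq: "s u = s v"
    have "isomorphic C (s u) (c v)" using isomorphic_sym[OF s(2)[OF v]] eq by simp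
    then have "isomorphic C (c u) (c v)"
      by (rule isomorphic_trans[OF O(1)[OF u] O(2)[OF u] O(1)[OF v] s(2)[OF u]])
    then show "u = v" using U u v unfolding simple_representatives_def by blast
  qed
  moreover have "s ` U \<subseteq> S" using s by blast
  ultimately show ?thesis using S(1) by (meson finite_imageD finite_subset)
qed

end

section \<open>The given categories as categories of typed arrows\<close>

definition typed_arr :: "('o, 'a, 'z) lin_cat_scheme \<Rightarrow> ('o, 'a) arrow \<Rightarrow> bool" where
  "typed_arr C f \<longleftrightarrow> src f \<in> Ob C \<and> tgt f \<in> Ob C \<and> ar f \<in> Hom C (src f) (tgt f)"

definition typed_idn :: "('o, 'a, 'z) lin_cat_scheme \<Rightarrow> 'o \<Rightarrow> ('o, 'a) arrow" where
  "typed_idn C x = Arr x x (\<i>\<^bsub>C\<^esub> x)"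

definition typed_comp ::
    "('o, 'a, 'z) lin_cat_scheme \<Rightarrow> ('o, 'a) arrow \<Rightarrow> ('o, 'a) arrow \<Rightarrow> ('o, 'a) arrow" where
  "typed_comp C g f = Arr (src f) (tgt g) (ar g \<cdot>\<^bsub>C\<^esub> ar f)"

definition typed_tens ::
    "('o, 'a, 'z) mon_cat_scheme \<Rightarrow> ('o, 'a) arrow \<Rightarrow> ('o, 'a) arrow \<Rightarrow> ('o, 'a) arrow" where
  "typed_tens C f g = Arr (src f \<otimes>\<^bsub>C\<^esub> src g) (tgt f \<otimes>\<^bsub>C\<^esub> tgt g) (ar f \<odot>\<^bsub>C\<^esub> ar g)"

definition typed_assoc where
  "typed_assoc C x y z = Arr ((x \<otimes>\<^bsub>C\<^esub> y) \<otimes>\<^bsub>C\<^esub> z) (x \<otimes>\<^bsub>C\<^esub> (y \<otimes>\<^bsub>C\<^esub> z)) (assoc C x y z)"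
definition typed_inv_assoc where
  "typed_inv_assoc C x y z = Arr (x \<otimes>\<^bsub>C\<^esub> (y \<otimes>\<^bsub>C\<^esub> z)) ((x \<otimes>\<^bsub>C\<^esub> y) \<otimes>\<^bsub>C\<^esub> z) (inv_assoc C x y z)"
definition typed_lunit where "typed_lunit C x = Arr (\<one>\<^bsub>C\<^esub> \<otimes>\<^bsub>C\<^esub> x) x (lunit C x)"
definition typed_inv_lunit where "typed_inv_lunit C x = Arr x (\<one>\<^bsub>C\<^esub> \<otimes>\<^bsub>C\<^esub> x) (inv_lunit C x)"
definition typed_runit where "typed_runit C x = Arr (x \<otimes>\<^bsub>C\<^esub> \<one>\<^bsub>C\<^esub>) x (runit C x)"
definition typed_inv_runit where "typed_inv_runit C x = Arr x (x \<otimes>\<^bsub>C\<^esub> \<one>\<^bsub>C\<^esub>) (inv_runit C x)"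

lemmas typed_defs = typed_idn_def typed_comp_def typed_tens_def typed_assoc_def
  typed_inv_assoc_def typed_lunit_def typed_inv_lunit_def typed_runit_def typed_inv_runit_def

lemma (in linear_category) typed_category:
  "typed_category (\<lambda>x. x \<in> Ob C) (typed_arr C) (typed_idn C) (typed_comp C)"
proof
  fix f g h :: "('o, 'a) arrow"
  assume "typed_arr C h" "typed_arr C g" "typed_arr C f" "src h = tgt g" "src g = tgt f"
  then show "typed_comp C (typed_comp C h g) f = typed_comp C h (typed_comp C g f)"
    using cmp_assoc[of "src f" "tgt f" "tgt g" "tgt h" "ar f" "ar g" "ar h"] by (simp add: typed_arr_def typed_defs)
next
  fix f g :: "('o, 'a) arrow"
  assume "typed_arr C g" "typed_arr C f" "src g = tgt f"
  then show "typed_arr C (typed_comp C g f)"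
    using cmp_in_Hom[of "src f" "tgt f" "tgt g" "ar f" "ar g"] by (simp add: typed_arr_def typed_defs)
qed (auto simp: typed_arr_def typed_defs ident_in_Hom cmp_ident_left cmp_ident_right)

lemma (in linear_category) iso_inverse_in_Hom:
  assumes "x \<in> Ob C" "y \<in> Ob C" "iso C x y f"
  shows "f \<in> Hom C x y" "inv_ar C x y f \<in> Hom C y x"
    "inv_ar C x y f \<cdot> f = \<i> x" "f \<cdot> inv_ar C x y f = \<i> y"
  using inv_ar_is_inverse[OF assms] assms(3) by (auto simp: iso_def is_inverse_def)

lemma (in linear_monoidal_category) typed_monoidal:
  "typed_monoidal (\<lambda>x. x \<in> Ob C) (typed_arr C) (typed_idn C) (typed_comp C) (tens_ob C) (typed_tens C)
    \<one> (typed_assoc C) (typed_inv_assoc C) (typed_lunit C) (typed_inv_lunit C) (typed_runit C) (typed_inv_runit C)"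
proof -
  note ia = iso_inverse_in_Hom[OF _ _ assoc_iso, folded inv_assoc_def]
    and il = iso_inverse_in_Hom[OF _ _ lunit_iso, folded inv_lunit_def]
    and ir = iso_inverse_in_Hom[OF _ _ runit_iso, folded inv_runit_def]
  show ?thesis
  proof (intro typed_monoidal.intro typed_category typed_monoidal_axioms.intro)
    fix f f' g g' :: "('o, 'a) arrow"
    assume "typed_arr C f" "typed_arr C f'" "typed_arr C g" "typed_arr C g'" "src f' = tgt f" "src g' = tgt g"
    then show "typed_tens C (typed_comp C f' f) (typed_comp C g' g) = typed_comp C (typed_tens C f' g') (typed_tens C f g)"
      using tens_cmp[of "src f" "tgt f" "tgt f'" "src g" "tgt g" "tgt g'" "ar f" "ar f'" "ar g" "ar g'"]
      by (simp add: typed_arr_def typed_defs)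
  next
    fix f g h :: "('o, 'a) arrow" and x y z
    assume "typed_arr C f" "typed_arr C g" "typed_arr C h" "tgt f = x" "tgt g = y" "tgt h = z"
    then show "typed_comp C (typed_assoc C x y z) (typed_tens C (typed_tens C f g) h) =
       typed_comp C (typed_tens C f (typed_tens C g h)) (typed_assoc C (src f) (src g) (src h))"
      using assoc_natural[of "src f" "tgt f" "src g" "tgt g" "src h" "tgt h" "ar f" "ar g" "ar h"]
      by (simp add: typed_arr_def typed_defs)
  next
    fix w x y z assume *: "w \<in> Ob C" "x \<in> Ob C" "y \<in> Ob C" "z \<in> Ob C"
    have "(\<i> w \<odot> assoc C x y z) \<cdot> assoc C w (x \<otimes> y) z \<cdot> (assoc C w x y \<odot> \<i> z)
        = (\<i> w \<odot> assoc C x y z) \<cdot> (assoc C w (x \<otimes> y) z \<cdot> (assoc C w x y \<odot> \<i> z))"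
      using * by (intro cmp_assoc[symmetric, of "((w \<otimes> x) \<otimes> y) \<otimes> z" "(w \<otimes> (x \<otimes> y)) \<otimes> z"
            "w \<otimes> ((x \<otimes> y) \<otimes> z)" "w \<otimes> (x \<otimes> (y \<otimes> z))"])
        (auto intro!: tens_in_Hom tens_ob_in_Ob ident_in_Hom ia(1))
    then show "typed_comp C (typed_assoc C w x (y \<otimes> z)) (typed_assoc C (w \<otimes> x) y z) =
       typed_comp C (typed_tens C (typed_idn C w) (typed_assoc C x y z))
        (typed_comp C (typed_assoc C w (x \<otimes> y) z) (typed_tens C (typed_assoc C w x y) (typed_idn C z)))"
      using pentagon[OF *] by (simp add: typed_arr_def typed_defs)
  qed (auto simp: typed_arr_def typed_defs unit_in_Ob tens_ob_in_Ob tens_in_Hom tens_ident ia il ir lunit_natural runit_natural triangle)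
qed

sublocale linear_monoidal_category \<subseteq> T: typed_monoidal "\<lambda>x. x \<in> Ob C" "typed_arr C" "typed_idn C"
  "typed_comp C" "tens_ob C" "typed_tens C" "\<one>" "typed_assoc C" "typed_inv_assoc C" "typed_lunit C"
  "typed_inv_lunit C" "typed_runit C" "typed_inv_runit C"
  by (rule typed_monoidal)

context linear_monoidal_category
begin

lemma typed_arr_Arr [simp]: "x \<in> Ob C \<Longrightarrow> y \<in> Ob C \<Longrightarrow> typed_arr C (Arr x y f) \<longleftrightarrow> f \<in> Hom C x y"
  by (simp add: typed_arr_def)

text \<open>
  Composites in the given categories are left-nested and those of typed arrows right-nested, so a
  typed composite is compared with the left-nested one and rebracketed.
\<close>

lemma duality_of_dual_pair:
  assumes x: "x \<in> Ob C" and y: "y \<in> Ob C" and d: "dual_pair C x y \<epsilon> \<eta>"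
  shows "T.duality x y (Arr (y \<otimes> x) \<one> \<epsilon>) (Arr \<one> (x \<otimes> y) \<eta>)"
proof -
  note [simp] = x y
  have e[simp]: "\<epsilon> \<in> Hom C (y \<otimes> x) \<one>" "\<eta> \<in> Hom C \<one> (x \<otimes> y)" using d by (auto simp: dual_pair_def)
  let ?c = "typed_comp C" and ?t = "typed_tens C" and ?e = "Arr (y \<otimes> x) \<one> \<epsilon>" and ?n = "Arr \<one> (x \<otimes> y) \<eta>"
  have "?c (?c (?c (?c (typed_runit C x) (?t (typed_idn C x) ?e)) (typed_assoc C x y x)) (?t ?n (typed_idn C x)))
      (typed_inv_lunit C x) = typed_idn C x"
    using d by (simp add: typed_defs dual_pair_def)
  moreover have "?c (?c (?c (?c (typed_lunit C y) (?t ?e (typed_idn C y))) (typed_inv_assoc C y x y)) (?t (typed_idn C y) ?n))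
      (typed_inv_runit C y) = typed_idn C y"
    using d by (simp add: typed_defs dual_pair_def)
  ultimately show ?thesis by (simp add: T.duality_def T.comp_assoc)
qed

lemma typed_mate_eq_mate:
  assumes "u \<in> Ob C" "x \<in> Ob C" "y \<in> Ob C" "v \<in> Ob C" "\<epsilon> \<in> Hom C (u \<otimes> y) \<one>" "\<eta> \<in> Hom C \<one> (x \<otimes> v)" "f \<in> Hom C x y"
  shows "T.typed_mate u (Arr (u \<otimes> y) \<one> \<epsilon>) x y v (Arr \<one> (x \<otimes> v) \<eta>) (Arr x y f) = Arr u v (mate C u \<epsilon> x y v \<eta> f)"
proof -
  note [simp] = assms
  let ?c = "typed_comp C" and ?t = "typed_tens C" and ?e = "Arr (u \<otimes> y) \<one> \<epsilon>" and ?n = "Arr \<one> (x \<otimes> v) \<eta>"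
  have "Arr u v (mate C u \<epsilon> x y v \<eta> f)
    = ?c (?c (?c (?c (?c (typed_lunit C v) (?t ?e (typed_idn C v))) (typed_inv_assoc C u y v))
        (?t (typed_idn C u) (?t (Arr x y f) (typed_idn C v)))) (?t (typed_idn C u) ?n)) (typed_inv_runit C u)"
    by (simp add: typed_defs mate_def)
  then show ?thesis by (simp add: T.typed_mate_def T.comp_assoc)
qed

end

definition typed_ev where "typed_ev C x = Arr (rdual C x \<otimes>\<^bsub>C\<^esub> x) \<one>\<^bsub>C\<^esub> (ev C x)"
definition typed_coev where "typed_coev C x = Arr \<one>\<^bsub>C\<^esub> (x \<otimes>\<^bsub>C\<^esub> rdual C x) (coev C x)"
definition typed_evl where "typed_evl C x = Arr (x \<otimes>\<^bsub>C\<^esub> ldual C x) \<one>\<^bsub>C\<^esub> (evl C x)"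
definition typed_coevl where "typed_coevl C x = Arr \<one>\<^bsub>C\<^esub> (ldual C x \<otimes>\<^bsub>C\<^esub> x) (coevl C x)"
definition typed_piv where "typed_piv C x = Arr x (rdual C (rdual C x)) (piv C x)"

lemmas typed_dual_defs = typed_ev_def typed_coev_def typed_evl_def typed_coevl_def typed_piv_def

lemma (in fusion_category) typed_pivotal:
  "typed_pivotal (\<lambda>x. x \<in> Ob C) (typed_arr C) (typed_idn C) (typed_comp C) (tens_ob C) (typed_tens C)
    \<one> (typed_assoc C) (typed_inv_assoc C) (typed_lunit C) (typed_inv_lunit C) (typed_runit C) (typed_inv_runit C)
    (rdual C) (ldual C) (typed_ev C) (typed_coev C) (typed_evl C) (typed_coevl C)"
  by unfold_locales
    (auto simp: typed_dual_defs rdual_in_Ob ldual_in_Ob intro!: duality_of_dual_pair right_dual left_dual)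

sublocale fusion_category \<subseteq> T: typed_pivotal "\<lambda>x. x \<in> Ob C" "typed_arr C" "typed_idn C"
  "typed_comp C" "tens_ob C" "typed_tens C" "\<one>" "typed_assoc C" "typed_inv_assoc C" "typed_lunit C"
  "typed_inv_lunit C" "typed_runit C" "typed_inv_runit C"
  "rdual C" "ldual C" "typed_ev C" "typed_coev C" "typed_evl C" "typed_coevl C" "typed_piv C"
  by (rule typed_pivotal)

context fusion_category
begin

lemma ev_in_Hom:
  assumes "x \<in> Ob C"
  shows "ev C x \<in> Hom C (rdual C x \<otimes> x) \<one>" "coev C x \<in> Hom C \<one> (x \<otimes> rdual C x)"
    "evl C x \<in> Hom C (x \<otimes> ldual C x) \<one>" "coevl C x \<in> Hom C \<one> (ldual C x \<otimes> x)"
  using right_dual[OF assms] left_dual[OF assms] by (simp_all add: dual_pair_def)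

lemma dual_map_eq_dual_ar:
  assumes "x \<in> Ob C" "y \<in> Ob C" "f \<in> Hom C x y"
  shows "T.dual_map (Arr x y f) = Arr (rdual C y) (rdual C x) (dual_ar C x y f)"
  unfolding T.dual_map_def dual_ar_def typed_dual_defs arrow.sel
  by (rule typed_mate_eq_mate) (use assms rdual_in_Ob ev_in_Hom in auto)

lemma ldual_iso_eq_rdual_ldual:
  assumes "x \<in> Ob C"
  shows "T.ldual_iso x = Arr x (rdual C (ldual C x)) (rdual_ldual C x)"
  unfolding T.ldual_iso_def rdual_ldual_def typed_dual_defs typed_idn_def[of C "ldual C x"]
  by (rule typed_mate_eq_mate) (use assms rdual_in_Ob ldual_in_Ob ev_in_Hom ident_in_Hom in auto)

lemma tens_coev_eq:
  assumes x: "x \<in> Ob C" and y: "y \<in> Ob C"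
  shows "T.nest_coev x y (rdual C y) (rdual C x) (typed_coev C x) (typed_coev C y)
    = Arr \<one> ((x \<otimes> y) \<otimes> (rdual C y \<otimes> rdual C x)) (tens_coev C x y)"
proof -
  note [simp] = x y
  let ?c = "typed_comp C" and ?t = "typed_tens C" and ?v = "rdual C y \<otimes> rdual C x"
  have "Arr \<one> ((x \<otimes> y) \<otimes> ?v) (tens_coev C x y)
    = ?c (?c (?c (?c (typed_inv_assoc C x y ?v)
        (?t (typed_idn C x) (typed_assoc C y (rdual C y) (rdual C x))))
        (?t (typed_idn C x) (?t (typed_coev C y) (typed_idn C (rdual C x)))))
        (?t (typed_idn C x) (typed_inv_lunit C (rdual C x)))) (typed_coev C x)"
    by (simp add: typed_defs typed_dual_defs tens_coev_def)
  then show ?thesis by (simp add: T.nest_coev_def T.comp_assoc T.reg.whisker_left)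
qed

lemma rdual_tens_iso_eq_rdual_tens:
  assumes x: "x \<in> Ob C" and y: "y \<in> Ob C"
  shows "T.rdual_tens_iso x y = Arr (rdual C (x \<otimes> y)) (rdual C y \<otimes> rdual C x) (rdual_tens C x y)"
proof -
  have "tens_coev C x y \<in> Hom C \<one> ((x \<otimes> y) \<otimes> (rdual C y \<otimes> rdual C x))"
    using T.hom_nest_coev[of x y "rdual C y" "rdual C x" "typed_coev C x" "typed_coev C y"] x y
    by (simp add: tens_coev_eq)
  then show ?thesis
    unfolding T.rdual_tens_iso_def rdual_tens_def tens_coev_eq[OF x y]
    unfolding typed_dual_defs typed_idn_def[of C "x \<otimes> y"]
    by (intro typed_mate_eq_mate) (use x y tens_ob_in_Ob rdual_in_Ob ev_in_Hom ident_in_Hom in auto)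
qed

end

text \<open>
  The raw morphisms of duals and canonical isomorphisms are mates, so they agree with the typed ones
  by \<open>typed_mate_eq_mate\<close>.
\<close>

lemma (in pivotal_fusion_category) typed_pivotal_structure:
  "typed_pivotal_structure (\<lambda>x. x \<in> Ob C) (typed_arr C) (typed_idn C) (typed_comp C) (tens_ob C) (typed_tens C)
    \<one> (typed_assoc C) (typed_inv_assoc C) (typed_lunit C) (typed_inv_lunit C) (typed_runit C) (typed_inv_runit C)
    (rdual C) (ldual C) (typed_ev C) (typed_coev C) (typed_evl C) (typed_coevl C) (typed_piv C)"
proof
  show "typed_arr C (typed_piv C x)" if "x \<in> Ob C" for x
    using piv_iso[OF that] that rdual_in_Ob by (simp add: typed_piv_def iso_def)
  show "src (typed_piv C x) = x" "tgt (typed_piv C x) = rdual C (rdual C x)" for x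
    by (simp_all add: typed_piv_def)
next
  fix f assume f: "typed_arr C f"
  obtain x y a where [simp]: "f = Arr x y a" by (cases f) 
  have [simp]: "x \<in> Ob C" "y \<in> Ob C" "a \<in> Hom C x y" using f by (auto simp: typed_arr_def)
  have "T.dual_map f = Arr (rdual C y) (rdual C x) (dual_ar C x y a)" by (simp add: dual_map_eq_dual_ar)
  moreover have "dual_ar C x y a \<in> Hom C (rdual C y) (rdual C x)"
    using T.hom_dual_map(1)[of f] rdual_in_Ob by (simp add: dual_map_eq_dual_ar)
  ultimately have "T.dual_map (T.dual_map f) = Arr (rdual C (rdual C x)) (rdual C (rdual C y))
      (dual_ar C (rdual C y) (rdual C x) (dual_ar C x y a))"
    using rdual_in_Ob by (simp add: dual_map_eq_dual_ar)
  then show "typed_comp C (typed_piv C (tgt f)) f = typed_comp C (T.dual_map (T.dual_map f)) (typed_piv C (src f))"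
    using piv_natural[of x y a] by (simp add: typed_comp_def typed_piv_def)
next
  fix x y s
  assume x: "x \<in> Ob C" and y: "y \<in> Ob C"
    and s: "typed_arr C s \<and> src s = rdual C (rdual C x) \<otimes> rdual C (rdual C y) \<and>
       tgt s = rdual C (rdual C y \<otimes> rdual C x)"
    and s1: "typed_comp C (T.rdual_tens_iso (rdual C y) (rdual C x)) s
       = typed_idn C (rdual C (rdual C x) \<otimes> rdual C (rdual C y))"
    and s2: "typed_comp C s (T.rdual_tens_iso (rdual C y) (rdual C x)) = typed_idn C (rdual C (rdual C y \<otimes> rdual C x))"
  note [simp] = x y
  let ?r = "rdual C"
  have R: "T.rdual_tens_iso (?r y) (?r x) = Arr (?r (?r y \<otimes> ?r x)) (?r (?r x) \<otimes> ?r (?r y)) (rdual_tens C (?r y) (?r x))"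
    using rdual_in_Ob by (simp add: rdual_tens_iso_eq_rdual_tens)
  have r0: "T.rdual_tens_iso x y = Arr (?r (x \<otimes> y)) (?r y \<otimes> ?r x) (rdual_tens C x y)"
    by (simp add: rdual_tens_iso_eq_rdual_tens)
  have h0: "rdual_tens C x y \<in> Hom C (?r (x \<otimes> y)) (?r y \<otimes> ?r x)"
    using T.hom_rdual_tens_iso(1)[OF x y] by (simp add: r0)
  have "rdual_tens C (?r y) (?r x) \<in> Hom C (?r (?r y \<otimes> ?r x)) (?r (?r x) \<otimes> ?r (?r y))"
    using T.hom_rdual_tens_iso(1)[of "?r y" "?r x"] by (simp add: R)
  moreover have sa: "ar s \<in> Hom C (?r (?r x) \<otimes> ?r (?r y)) (?r (?r y \<otimes> ?r x))"
    using s unfolding typed_arr_def by metis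
  moreover have "is_inverse C (?r (?r y \<otimes> ?r x)) (?r (?r x) \<otimes> ?r (?r y)) (rdual_tens C (?r y) (?r x)) (ar s)"
    using sa arg_cong[OF s1, of ar] arg_cong[OF s2, of ar] unfolding R
    by (simp add: is_inverse_def typed_comp_def typed_idn_def)
  ultimately have inv: "inv_ar C (?r (?r y \<otimes> ?r x)) (?r (?r x) \<otimes> ?r (?r y)) (rdual_tens C (?r y) (?r x)) = ar s"
    by (intro inv_ar_eq) auto
  have dl0: "T.dual_map (T.rdual_tens_iso x y) = Arr (?r (?r y \<otimes> ?r x)) (?r (?r (x \<otimes> y)))
      (dual_ar C (?r (x \<otimes> y)) (?r y \<otimes> ?r x) (rdual_tens C x y))"
    unfolding r0 by (rule dual_map_eq_dual_ar) (use h0 in auto)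
  have p: "typed_arr C (typed_piv C z)" if "z \<in> Ob C" for z
    using piv_iso[OF that] that rdual_in_Ob by (simp add: typed_piv_def iso_def)
  have sp: "src (typed_piv C z) = z" "tgt (typed_piv C z) = ?r (?r z)" for z
    by (simp_all add: typed_piv_def)
  have "typed_piv C (x \<otimes> y) = typed_comp C (typed_comp C (T.dual_map (T.rdual_tens_iso x y)) s) (typed_tens C (typed_piv C x) (typed_piv C y))"
    unfolding dl0 using piv_tens[OF x y] s
    by (simp add: typed_comp_def typed_tens_def typed_piv_def ddual_tens_def inv)
  then show "typed_piv C (x \<otimes> y) = typed_comp C (T.dual_map (T.rdual_tens_iso x y)) (typed_comp C s (typed_tens C (typed_piv C x) (typed_piv C y)))"
    using s p sp by (simp add: T.comp_assoc)
qed

sublocale pivotal_fusion_category \<subseteq> T: typed_pivotal_structure "\<lambda>x. x \<in> Ob C" "typed_arr C" "typed_idn C"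
  "typed_comp C" "tens_ob C" "typed_tens C" "\<one>" "typed_assoc C" "typed_inv_assoc C" "typed_lunit C"
  "typed_inv_lunit C" "typed_runit C" "typed_inv_runit C"
  "rdual C" "ldual C" "typed_ev C" "typed_coev C" "typed_evl C" "typed_coevl C" "typed_piv C"
  by (rule typed_pivotal_structure)

definition typed_act ::
    "('o, 'a, 'n, 'b, 'w) module_cat_scheme \<Rightarrow> ('o, 'a) arrow \<Rightarrow> ('n, 'b) arrow \<Rightarrow> ('n, 'b) arrow" where
  "typed_act M f k = Arr (src f \<rhd>\<^bsub>M\<^esub> src k) (tgt f \<rhd>\<^bsub>M\<^esub> tgt k) (ar f \<unrhd>\<^bsub>M\<^esub> ar k)"
definition typed_act_assoc where
  "typed_act_assoc C M x y p = Arr ((x \<otimes>\<^bsub>C\<^esub> y) \<rhd>\<^bsub>M\<^esub> p) (x \<rhd>\<^bsub>M\<^esub> (y \<rhd>\<^bsub>M\<^esub> p)) (act_assoc M x y p)"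
definition typed_inv_act_assoc where
  "typed_inv_act_assoc C M x y p = Arr (x \<rhd>\<^bsub>M\<^esub> (y \<rhd>\<^bsub>M\<^esub> p)) ((x \<otimes>\<^bsub>C\<^esub> y) \<rhd>\<^bsub>M\<^esub> p)
     (inv_ar M ((x \<otimes>\<^bsub>C\<^esub> y) \<rhd>\<^bsub>M\<^esub> p) (x \<rhd>\<^bsub>M\<^esub> (y \<rhd>\<^bsub>M\<^esub> p)) (act_assoc M x y p))"
definition typed_act_unit where
  "typed_act_unit C M p = Arr (\<one>\<^bsub>C\<^esub> \<rhd>\<^bsub>M\<^esub> p) p (act_unit M p)"
definition typed_inv_act_unit where
  "typed_inv_act_unit C M p = Arr p (\<one>\<^bsub>C\<^esub> \<rhd>\<^bsub>M\<^esub> p) (inv_ar M (\<one>\<^bsub>C\<^esub> \<rhd>\<^bsub>M\<^esub> p) p (act_unit M p))"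

lemmas typed_act_defs = typed_act_def typed_act_assoc_def typed_inv_act_assoc_def typed_act_unit_def
  typed_inv_act_unit_def

lemma (in module_category) typed_module:
  "typed_module (\<lambda>x. x \<in> Ob C) (typed_arr C) (typed_idn C) (typed_comp C) (tens_ob C) (typed_tens C)
    \<one>\<^bsub>C\<^esub> (typed_assoc C) (typed_inv_assoc C) (typed_lunit C) (typed_inv_lunit C) (typed_runit C) (typed_inv_runit C)
    (\<lambda>p. p \<in> Ob M) (typed_arr M) (typed_idn M) (typed_comp M) (act_ob M) (typed_act M)
    (typed_act_assoc C M) (typed_inv_act_assoc C M) (typed_act_unit C M) (typed_inv_act_unit C M)"
proof -
  note O = act_ob_in_Ob C.tens_ob_in_Ob C.unit_in_Ob
  note ia = M.iso_inverse_in_Hom[OF _ _ act_assoc_iso] and iu = M.iso_inverse_in_Hom[OF _ _ act_unit_iso]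
  show ?thesis
  proof (intro typed_module.intro C.typed_monoidal M.typed_category typed_module_axioms.intro)
    fix f f' :: "('o, 'a) arrow" and k k' :: "('n, 'b) arrow"
    assume "typed_arr C f" "typed_arr C f'" "typed_arr M k" "typed_arr M k'" "src f' = tgt f" "src k' = tgt k"
    then show "typed_act M (typed_comp C f' f) (typed_comp M k' k) = typed_comp M (typed_act M f' k') (typed_act M f k)"
      using act_cmp[of "src f" "tgt f" "tgt f'" "src k" "tgt k" "tgt k'" "ar f" "ar f'" "ar k" "ar k'"]
      by (simp add: typed_arr_def typed_defs typed_act_defs del: C.T.ob_src C.T.ob_tgt)
  next
    fix f g :: "('o, 'a) arrow" and k :: "('n, 'b) arrow" and x y p
    assume "typed_arr C f" "typed_arr C g" "typed_arr M k" "tgt f = x" "tgt g = y" "tgt k = p"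
    then show "typed_comp M (typed_act_assoc C M x y p) (typed_act M (typed_tens C f g) k) =
       typed_comp M (typed_act M f (typed_act M g k)) (typed_act_assoc C M (src f) (src g) (src k))"
      using act_assoc_natural[of "src f" "tgt f" "src g" "tgt g" "src k" "tgt k" "ar f" "ar g" "ar k"]
      by (simp add: typed_arr_def typed_defs typed_act_defs del: C.T.ob_src C.T.ob_tgt)
  next
    fix x y z p assume *: "x \<in> Ob C" "y \<in> Ob C" "z \<in> Ob C" "p \<in> Ob M"
    have "(\<i>\<^bsub>C\<^esub> x \<unrhd>\<^bsub>M\<^esub> act_assoc M y z p) \<cdot>\<^bsub>M\<^esub> act_assoc M x (y \<otimes>\<^bsub>C\<^esub> z) p \<cdot>\<^bsub>M\<^esub> (assoc C x y z \<unrhd>\<^bsub>M\<^esub> \<i>\<^bsub>M\<^esub> p)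
      = (\<i>\<^bsub>C\<^esub> x \<unrhd>\<^bsub>M\<^esub> act_assoc M y z p) \<cdot>\<^bsub>M\<^esub> (act_assoc M x (y \<otimes>\<^bsub>C\<^esub> z) p \<cdot>\<^bsub>M\<^esub> (assoc C x y z \<unrhd>\<^bsub>M\<^esub> \<i>\<^bsub>M\<^esub> p))"
      using * by (intro M.cmp_assoc[symmetric, of "((x \<otimes>\<^bsub>C\<^esub> y) \<otimes>\<^bsub>C\<^esub> z) \<rhd>\<^bsub>M\<^esub> p" "(x \<otimes>\<^bsub>C\<^esub> (y \<otimes>\<^bsub>C\<^esub> z)) \<rhd>\<^bsub>M\<^esub> p"
          "x \<rhd>\<^bsub>M\<^esub> ((y \<otimes>\<^bsub>C\<^esub> z) \<rhd>\<^bsub>M\<^esub> p)" "x \<rhd>\<^bsub>M\<^esub> (y \<rhd>\<^bsub>M\<^esub> (z \<rhd>\<^bsub>M\<^esub> p))"])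
        (auto intro!: act_in_Hom O C.ident_in_Hom M.ident_in_Hom ia(1) C.iso_inverse_in_Hom(1)[OF _ _ C.assoc_iso])
    then show "typed_comp M (typed_act_assoc C M x y (z \<rhd>\<^bsub>M\<^esub> p)) (typed_act_assoc C M (x \<otimes>\<^bsub>C\<^esub> y) z p) =
       typed_comp M (typed_act M (typed_idn C x) (typed_act_assoc C M y z p))
        (typed_comp M (typed_act_assoc C M x (y \<otimes>\<^bsub>C\<^esub> z) p) (typed_act M (typed_assoc C x y z) (typed_idn M p)))"
      using act_pentagon[OF *] by (simp add: typed_arr_def typed_defs typed_act_defs del: C.T.ob_src C.T.ob_tgt)
  qed (auto simp: typed_arr_def typed_defs typed_act_defs O act_in_Hom act_ident ia iu act_unit_natural act_triangle simp del: C.T.ob_src C.T.ob_tgt)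
qed

section \<open>Pivotal dimensions\<close>

lemma (in typed_module) ptrace_idM:
  assumes "ob w" "ob x" "hom \<epsilon> (w \<otimes>\<^sub>o x) unit" "hom \<eta> unit (w \<otimes>\<^sub>o x)" "obM p"
  shows "ptrace w x \<epsilon> \<eta> p (idM (x \<rhd>\<^sub>o p)) = \<u> p \<bullet> ((\<epsilon> \<star> \<eta>) \<rhd>\<^sub>a idM p) \<bullet> \<u>' p"
  using assms by (simp add: ptrace_def M.comp_nest[OF \<beta>'_\<beta>] whisker_right M.comp_assoc)

context linear_monoidal_category
begin

lemma tens_zero_left: "\<lbrakk>x \<in> Ob C; x' \<in> Ob C; y \<in> Ob C; y' \<in> Ob C; g \<in> Hom C y y'\<rbrakk> \<Longrightarrow> 0 \<odot> g = 0"
  using tens_smul_left[of x x' y y' 0 g 0] by simp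

lemma tens_zero_right: "\<lbrakk>x \<in> Ob C; x' \<in> Ob C; y \<in> Ob C; y' \<in> Ob C; f \<in> Hom C x x'\<rbrakk> \<Longrightarrow> f \<odot> 0 = 0"
  using tens_smul_right[of x x' y y' f 0 0] by simp

end

context fusion_category
begin

lemma unit_scalar_smul: "unit_scalar C (smul C z (\<i> \<one>)) = z"
  unfolding unit_scalar_def using simple_nonzero[OF simple_unit] by (intro the_equality) simp_all

lemma smul_unit_scalar:
  assumes "f \<in> Hom C \<one> \<one>"
  shows "smul C (unit_scalar C f) (\<i> \<one>) = f"
proof -
  obtain a where a: "f = smul C a (\<i> \<one>)" by (rule schur_scalar[OF simple_unit assms])
  show ?thesis unfolding a unit_scalar_smul ..
qed

lemma unit_scalar_add:
  assumes "f \<in> Hom C \<one> \<one>" "g \<in> Hom C \<one> \<one>"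
  shows "unit_scalar C (f + g) = unit_scalar C f + unit_scalar C g"
  using unit_scalar_smul[of "unit_scalar C f + unit_scalar C g"] smul_unit_scalar[OF assms(1)]
    smul_unit_scalar[OF assms(2)] by (simp add: scale_left_distrib)

lemma unit_scalar_scale:
  assumes "f \<in> Hom C \<one> \<one>"
  shows "unit_scalar C (smul C r f) = r * unit_scalar C f"
  using unit_scalar_smul[of "r * unit_scalar C f"] smul_unit_scalar[OF assms]
  by (simp add: scale_scale[symmetric] del: scale_scale)

text \<open>
  Transposition is a linear bijection, being given by tensoring with an identity followed by
  composition with a fixed morphism.
\<close>

lemma dim_Hom_tens_adjoint:
  assumes x: "x \<in> Ob C" and p: "p \<in> Ob C" and q: "q \<in> Ob C"
  shows "dim (Hom C (rdual C x \<otimes> p) q) = dim (Hom C p (x \<otimes> q))"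
proof -
  interpret vp: vector_space_pair "smul C" "smul C" ..
  note [simp] = x p q
  note d = T.duality_right[OF x]
  let ?V = "Hom C (rdual C x \<otimes> p) q" and ?W = "Hom C p (x \<otimes> q)"
  let ?K = "typed_comp C (typed_assoc C x (rdual C x) p)
     (typed_comp C (typed_tens C (typed_coev C x) (typed_idn C p)) (typed_inv_lunit C p))"
  let ?T = "\<lambda>f. ar (T.reg.curry x (rdual C x) (typed_coev C x) p (Arr (rdual C x \<otimes> p) q f))"
  let ?S = "\<lambda>k. ar (T.reg.uncurry x (rdual C x) (typed_ev C x) q (Arr p (x \<otimes> q) k))"
  have K: "T.hom ?K p (x \<otimes> (rdual C x \<otimes> p))" by simp
  have Kr: "ar ?K \<in> Hom C p (x \<otimes> (rdual C x \<otimes> p))" using K unfolding typed_arr_def by metis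
  have T: "?T f = (\<i> x \<odot> f) \<cdot> ar ?K" for f
    by (simp add: T.reg.curry_def typed_defs)
  have TA: "T.reg.curry x (rdual C x) (typed_coev C x) p (Arr (rdual C x \<otimes> p) q f) = Arr p (x \<otimes> q) (?T f)"
    "?T f \<in> ?W" if "f \<in> ?V" for f
  proof -
    have h: "T.hom (T.reg.curry x (rdual C x) (typed_coev C x) p (Arr (rdual C x \<otimes> p) q f)) p (x \<otimes> q)"
      using that by (simp add: T.reg.arr_curry)
    then show "T.reg.curry x (rdual C x) (typed_coev C x) p (Arr (rdual C x \<otimes> p) q f) = Arr p (x \<otimes> q) (?T f)"
      by (metis arrow.collapse)
    show "?T f \<in> ?W" using h unfolding typed_arr_def by metis
  qed
  have SA: "T.reg.uncurry x (rdual C x) (typed_ev C x) q (Arr p (x \<otimes> q) k) = Arr (rdual C x \<otimes> p) q (?S k)"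
    "?S k \<in> ?V" if "k \<in> ?W" for k
  proof -
    have h: "T.hom (T.reg.uncurry x (rdual C x) (typed_ev C x) q (Arr p (x \<otimes> q) k)) (rdual C x \<otimes> p) q"
      using that by (simp add: T.reg.arr_uncurry)
    then show "T.reg.uncurry x (rdual C x) (typed_ev C x) q (Arr p (x \<otimes> q) k) = Arr (rdual C x \<otimes> p) q (?S k)"
      by (metis arrow.collapse)
    show "?S k \<in> ?V" using h unfolding typed_arr_def by metis
  qed
  have bij: "bij_betw ?T ?V ?W"
  proof (rule bij_betw_byWitness[where f' = ?S])
    show "\<forall>f\<in>?V. ?S (?T f) = f"
    proof
      fix f assume f: "f \<in> ?V"
      show "?S (?T f) = f"
        using T.reg.uncurry_curry[OF d, of "Arr (rdual C x \<otimes> p) q f" p q] TA(1)[OF f] f by simp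
    qed
    show "\<forall>k\<in>?W. ?T (?S k) = k"
    proof
      fix k assume k: "k \<in> ?W"
      show "?T (?S k) = k"
        using T.reg.curry_uncurry[OF d, of "Arr p (x \<otimes> q) k" p q] SA(1)[OF k] k by simp
    qed
  qed (use TA(2) SA(2) in blast)+
  have O: "rdual C x \<otimes> p \<in> Ob C" "x \<otimes> q \<in> Ob C" "x \<otimes> (rdual C x \<otimes> p) \<in> Ob C" "rdual C x \<in> Ob C" by simp_all
  have xf: "\<i> x \<odot> f \<in> Hom C (x \<otimes> (rdual C x \<otimes> p)) (x \<otimes> q)" if "f \<in> ?V" for f
    using tens_in_Hom[OF x x O(1) q ident_in_Hom[OF x] that] .
  obtain B where B: "finite B" "?V = span B" using Hom_finite_dim[OF O(1) q] by blast
  show ?thesis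
  proof (rule vp.dim_eq_of_linear_bij[OF _ B _ bij])
    show "subspace ?V" "subspace ?W" using Hom_subspace O by simp_all
    fix f g r assume f: "f \<in> ?V"
    show "?T (smul C r f) = smul C r (?T f)"
      unfolding T using tens_smul_right[OF x x O(1) q ident_in_Hom[OF x] f]
        cmp_smul_left[OF p O(3) O(2) Kr xf[OF f]] by simp
    assume g: "g \<in> ?V"
    show "?T (f + g) = ?T f + ?T g"
      unfolding T using tens_add_right[OF x x O(1) q ident_in_Hom[OF x] f g]
        cmp_add_left[OF p O(3) O(2) Kr xf[OF f] xf[OF g]] by simp
  qed
qed

end

context pivotal_fusion_category
begin

lemma typed_hom_cases:
  assumes "T.hom h x y"
  obtains f where "h = Arr x y f" "f \<in> Hom C x y"
  using assms that[of "ar h"] unfolding typed_arr_def by (metis arrow.collapse)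

lemma typed_piv_ldual:
  assumes x: "x \<in> Ob C"
  shows "typed_comp C (T.dual_map (T.ldual_iso x)) (typed_piv C (ldual C x)) = Arr (ldual C x) (rdual C x) (piv_ldual C x)"
    and "piv_ldual C x \<in> Hom C (ldual C x) (rdual C x)"
proof -
  have ldual_iso: "rdual_ldual C x \<in> Hom C x (rdual C (ldual C x))"
    using T.hom_ldual_iso(1)[OF x] x by (simp add: ldual_iso_eq_rdual_ldual)
  then have "T.dual_map (T.ldual_iso x) = Arr (rdual C (rdual C (ldual C x))) (rdual C x)
      (dual_ar C x (rdual C (ldual C x)) (rdual_ldual C x))"
    using x by (simp add: ldual_iso_eq_rdual_ldual dual_map_eq_dual_ar)
  then show *: "typed_comp C (T.dual_map (T.ldual_iso x)) (typed_piv C (ldual C x)) = Arr (ldual C x) (rdual C x) (piv_ldual C x)"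
    by (simp add: typed_comp_def typed_piv_def piv_ldual_def)
  have "typed_arr C (typed_comp C (T.dual_map (T.ldual_iso x)) (typed_piv C (ldual C x)))" using x by simp
  then show "piv_ldual C x \<in> Hom C (ldual C x) (rdual C x)"
    unfolding * using x by simp
qed

lemma trace_ar_eq:
  assumes x: "x \<in> Ob C" and f: "f \<in> Hom C x x"
  shows "T.trace_ar x (Arr x x f) = Arr \<one> \<one> (ev C x \<cdot> (piv_ldual C x \<odot> f) \<cdot> coevl C x)"
    and "ev C x \<cdot> (piv_ldual C x \<odot> f) \<cdot> coevl C x \<in> Hom C \<one> \<one>"
proof -
  note [simp] = x f
  let ?j = "Arr (ldual C x) (rdual C x) (piv_ldual C x)"
  have j: "typed_arr C ?j" using typed_piv_ldual(2)[OF x] by simp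
  have "T.trace_ar x (Arr x x f) = typed_comp C (typed_comp C (typed_ev C x) (typed_tens C ?j (Arr x x f))) (typed_coevl C x)"
    using j T.tens_comp[of "typed_idn C (ldual C x)" ?j "Arr x x f" "typed_idn C x"]
    by (simp add: T.trace_ar_def T.piv_ev_def typed_piv_ldual(1) T.comp_assoc)
  then show *: "T.trace_ar x (Arr x x f) = Arr \<one> \<one> (ev C x \<cdot> (piv_ldual C x \<odot> f) \<cdot> coevl C x)"
    by (simp add: typed_defs typed_dual_defs)
  have "typed_arr C (T.trace_ar x (Arr x x f))" by (simp add: T.trace_ar_def)
  then show "ev C x \<cdot> (piv_ldual C x \<odot> f) \<cdot> coevl C x \<in> Hom C \<one> \<one>"
    unfolding * by simp
qed

lemma left_trace_eq:
  assumes "x \<in> Ob C" "f \<in> Hom C x x"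
  shows "left_trace C x f = unit_scalar C (ar (T.trace_ar x (Arr x x f)))"
  using trace_ar_eq(1)[OF assms] by (simp add: left_trace_def)

lemma symmetric_left_trace: "symmetric_trace (left_trace C)"
  unfolding symmetric_trace_def
proof (intro conjI ballI allI)
  fix x f assume x: "x \<in> Ob C" and f: "f \<in> Hom C x x"
  note O = x unit_in_Ob ldual_in_Ob[OF x] rdual_in_Ob[OF x]
  let ?j = "piv_ldual C x" and ?D = "rdual C x \<otimes> x" and ?A = "ldual C x \<otimes> x"
  have DA: "?D \<in> Ob C" "?A \<in> Ob C" using O tens_ob_in_Ob by simp_all
  have j: "?j \<in> Hom C (ldual C x) (rdual C x)" by (rule typed_piv_ldual(2)[OF x])
  have jf: "?j \<odot> h \<in> Hom C ?A ?D" if "h \<in> Hom C x x" for h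
    using tens_in_Hom[OF O(3,4,1,1) j that] .
  have e: "ev C x \<in> Hom C ?D \<one>" "coevl C x \<in> Hom C \<one> ?A" using ev_in_Hom[OF x] by simp_all
  have ejf: "ev C x \<cdot> (?j \<odot> h) \<in> Hom C ?A \<one>" if "h \<in> Hom C x x" for h
    using cmp_in_Hom[OF DA(2,1) O(2) jf[OF that] e(1)] .
  show "left_trace C x (smul C r f) = r * left_trace C x f" for r
    unfolding left_trace_def
    using tens_smul_right[OF O(3,4,1,1) j f] cmp_smul_right[OF DA(2,1) O(2) jf[OF f] e(1)]
      cmp_smul_left[OF O(2) DA(2) O(2) e(2) ejf[OF f]] unit_scalar_scale[OF trace_ar_eq(2)[OF x f]] by simp
  fix g assume g: "g \<in> Hom C x x"
  show "left_trace C x (f + g) = left_trace C x f + left_trace C x g"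
    unfolding left_trace_def
    using tens_add_right[OF O(3,4,1,1) j f g] cmp_add_right[OF DA(2,1) O(2) jf[OF f] jf[OF g] e(1)]
      cmp_add_left[OF O(2) DA(2) O(2) e(2) ejf[OF f] ejf[OF g]]
      unit_scalar_add[OF trace_ar_eq(2)[OF x f] trace_ar_eq(2)[OF x g]] by simp
next
  fix x y f g assume *: "x \<in> Ob C" "y \<in> Ob C" "f \<in> Hom C x y" "g \<in> Hom C y x"
  have "T.trace_ar x (typed_comp C (Arr y x g) (Arr x y f)) = T.trace_ar y (typed_comp C (Arr x y f) (Arr y x g))"
    by (rule T.trace_ar_cyclic) (use * in simp_all)
  then show "left_trace C x (g \<cdot> f) = left_trace C y (f \<cdot> g)"
    using * cmp_in_Hom by (simp add: left_trace_eq typed_comp_def)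
qed

lemma trace_ar_ident: "x \<in> Ob C \<Longrightarrow> T.trace_ar x (typed_idn C x) = Arr \<one> \<one> (smul C (ob_dim C x) (\<i> \<one>))"
  using trace_ar_eq[OF _ ident_in_Hom] left_trace_eq[OF _ ident_in_Hom] smul_unit_scalar
  by (simp add: ob_dim_def typed_idn_def)

lemma trace_ar_ident': "x \<in> Ob C \<Longrightarrow> typed_comp C (T.piv_ev x) (typed_coevl C x) = Arr \<one> \<one> (smul C (ob_dim C x) (\<i> \<one>))"
  using trace_ar_ident[of x] by (simp add: T.trace_ar_def)

text \<open>
  The partial trace of an identity over \<open>x\<close> is the scalar \<open>ob_dim C x\<close>.
\<close>

lemma ob_dim_tens:
  assumes x: "x \<in> Ob C" and y: "y \<in> Ob C"
  shows "ob_dim C (x \<otimes> y) = ob_dim C x * ob_dim C y"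
proof -
  note [simp] = x y
  let ?d = "ob_dim C x" and ?ii = "\<i> (\<one> \<otimes> y)"
  have u: "\<one> \<in> Ob C" "\<one> \<otimes> y \<in> Ob C" by simp_all
  note l = iso_inverse_in_Hom[OF u(2) y lunit_iso[OF y], folded inv_lunit_def]
  have "T.reg.ptrace (ldual C x) x (T.piv_ev x) (typed_coevl C x) y (typed_idn C (x \<otimes> y))
    = typed_comp C (typed_lunit C y) (typed_comp C (typed_tens C (Arr \<one> \<one> (smul C ?d (\<i> \<one>))) (typed_idn C y)) (typed_inv_lunit C y))"
    by (subst T.reg.ptrace_idM) (simp_all add: trace_ar_ident')
  also have "\<dots> = Arr y y (lunit C y \<cdot> (smul C ?d ?ii \<cdot> inv_lunit C y))"
    using tens_smul_left[OF u(1) u(1) y y ident_in_Hom[OF u(1)] ident_in_Hom[OF y]] tens_ident[OF u(1) y]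
    by (simp add: typed_defs)
  also have "lunit C y \<cdot> (smul C ?d ?ii \<cdot> inv_lunit C y) = smul C ?d (\<i> y)"
    using cmp_smul_left[OF y u(2) u(2) l(2) ident_in_Hom[OF u(2)]] cmp_ident_left[OF y u(2) l(2)]
      cmp_smul_right[OF y u(2) y l(2) l(1)] l(4) by simp
  finally have pt: "T.reg.ptrace (ldual C x) x (T.piv_ev x) (typed_coevl C x) y (typed_idn C (x \<otimes> y)) = Arr y y (smul C ?d (\<i> y))" .
  have "T.trace_ar (x \<otimes> y) (typed_idn C (x \<otimes> y)) = T.trace_ar y (Arr y y (smul C ?d (\<i> y)))"
    unfolding pt[symmetric] by (rule T.trace_ar_tens) simp_all
  then have "left_trace C (x \<otimes> y) (\<i> (x \<otimes> y)) = left_trace C y (smul C ?d (\<i> y))"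
    using ident_in_Hom smul_in_Hom by (simp add: left_trace_eq typed_idn_def)
  then show ?thesis
    using symmetric_traceD(2)[OF symmetric_left_trace y ident_in_Hom[OF y]] by (simp add: ob_dim_def)
qed

text \<open>
  Every \<open>h : 1 \<rightarrow> ldual x \<otimes> x\<close> transposes to an endomorphism of \<open>x\<close> and is therefore a multiple of the
  coevaluation.  If the dimension vanished, the twisted evaluation \<open>q\<close> would kill all such \<open>h\<close>, and
  by semisimplicity \<open>q = 0\<close>; but then the morphisms from which \<open>q\<close> is built, and finally the
  identity of \<open>x\<close>, would vanish.
\<close>

lemma ob_dim_simple_nonzero:
  assumes s: "simple_object C x"
  shows "ob_dim C x \<noteq> 0"
proof
  assume 0: "ob_dim C x = 0"
  have x[simp]: "x \<in> Ob C" using s by (simp add: simple_object_def)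
  let ?a = "ldual C x" and ?A = "ldual C x \<otimes> x"
  have O: "?a \<in> Ob C" "?A \<in> Ob C" "\<one> \<in> Ob C" "rdual C ?a \<in> Ob C" "rdual C x \<in> Ob C" "rdual C (rdual C ?a) \<in> Ob C" by simp_all
  obtain q where q: "T.piv_ev x = Arr ?A \<one> q" "q \<in> Hom C ?A \<one>"
    by (rule typed_hom_cases[of "T.piv_ev x" ?A \<one>]) simp
  have qc: "q \<cdot> coevl C x = 0" using trace_ar_ident'[OF x] 0 by (simp add: q typed_comp_def typed_coevl_def)
  have kill: "q \<cdot> h = 0" if h: "h \<in> Hom C \<one> ?A" for h
  proof -
    obtain g where g: "T.hom g x x" "typed_comp C (typed_tens C (typed_idn C ?a) g) (typed_coevl C x) = Arr \<one> ?A h"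
      by (rule T.coev_right_exists[OF T.duality_left[OF x], of "Arr \<one> ?A h" x]) (use h in simp_all)
    obtain g' where g': "g = Arr x x g'" "g' \<in> Hom C x x" by (rule typed_hom_cases[OF g(1)])
    obtain b where b: "g' = smul C b (\<i> x)" by (rule schur_scalar[OF s g'(2)])
    have "h = (\<i> ?a \<odot> g') \<cdot> coevl C x" using g(2) by (simp add: g' typed_defs typed_coevl_def)
    also have "\<dots> = smul C b (coevl C x)"
      using tens_smul_right[OF O(1) O(1) x x ident_in_Hom[OF O(1)] ident_in_Hom[OF x]] tens_ident[OF O(1) x]
        cmp_smul_left[OF O(3) O(2) O(2) ev_in_Hom(4)[OF x] ident_in_Hom[OF O(2)]]
        cmp_ident_left[OF O(3) O(2) ev_in_Hom(4)[OF x]] by (simp add: b)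
    finally show ?thesis using cmp_smul_right[OF O(3) O(2) O(3) ev_in_Hom(4)[OF x] q(2)] qc by simp
  qed
  have "q = 0"
  proof (rule ccontr)
    assume q0: "q \<noteq> 0"
    obtain n :: nat and S e p where S: "\<And>k. k < n \<Longrightarrow> simple_object C (S k)"
      and e: "\<And>k. k < n \<Longrightarrow> e k \<in> Hom C (S k) ?A" and p: "\<And>k. k < n \<Longrightarrow> p k \<in> Hom C ?A (S k)"
      and ep: "(\<Sum>k<n. e k \<cdot> p k) = \<i> ?A"
      by (rule decomposition[OF O(2)]) blast
    have SO: "S k \<in> Ob C" if "k < n" for k using S[OF that] by (simp add: simple_object_def)
    have E: "e k \<cdot> p k \<in> Hom C ?A ?A" if "k < n" for k
      using cmp_in_Hom[OF O(2) SO[OF that] O(2) p[OF that] e[OF that]] .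
    have "q \<cdot> e k = 0" if k: "k < n" for k
    proof (rule ccontr)
      assume nz: "q \<cdot> e k \<noteq> 0"
      have qe: "q \<cdot> e k \<in> Hom C (S k) \<one>" by (rule cmp_in_Hom[OF SO[OF k] O(2) O(3) e[OF k] q(2)])
      obtain r where r: "r \<in> Hom C \<one> (S k)" "(q \<cdot> e k) \<cdot> r = \<i> \<one>"
        using schur_iso[OF S[OF k] simple_unit qe nz] by (auto simp: iso_def is_inverse_def)
      have "q \<cdot> (e k \<cdot> r) = \<i> \<one>"
        using cmp_assoc[OF O(3) SO[OF k] O(2) O(3) r(1) e[OF k] q(2)] r(2) by simp
      then show False
        using kill[OF cmp_in_Hom[OF O(3) SO[OF k] O(2) r(1) e[OF k]]] simple_nonzero[OF simple_unit] by simp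
    qed
    then have "q \<cdot> (e k \<cdot> p k) = 0" if "k < n" for k
      using cmp_assoc[OF O(2) SO[OF that] O(2) O(3) p[OF that] e[OF that] q(2)]
        cmp_zero_left[OF O(2) SO[OF that] O(3) p[OF that]] that by simp
    then have "(\<Sum>k<n. q \<cdot> (e k \<cdot> p k)) = 0" by simp
    moreover have "q = q \<cdot> (\<Sum>k<n. e k \<cdot> p k)" using cmp_ident_right[OF O(2) O(3) q(2)] ep by simp
    moreover have "q \<cdot> (\<Sum>k<n. e k \<cdot> p k) = (\<Sum>k<n. q \<cdot> (e k \<cdot> p k))"
      using O q(2) E by (intro cmp_sum_right[of ?A ?A \<one>]) auto
    ultimately show False using q0 by simp
  qed
  \<comment> \<open>Since \<open>q\<close> is the evaluation precomposed with \<open>?j\<close>, also \<open>?j\<close> vanishes; the zeros then propagate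
    through the pivotal structure, \<open>dual_map\<close> and \<open>ldual_iso\<close> by non-degeneracy of the evaluations.\<close>
  let ?j = "piv_ldual C x"
  have j: "T.hom (Arr ?a (rdual C x) ?j) ?a (rdual C x)" using typed_piv_ldual(2)[OF x] by simp
  have zero: "T.hom (Arr u v 0) u v" if "u \<in> Ob C" "v \<in> Ob C" for u v using that by simp
  have "typed_comp C (typed_ev C x) (typed_tens C (Arr ?a (rdual C x) ?j) (typed_idn C x)) = Arr ?A \<one> 0"
    using q(1) \<open>q = 0\<close> by (simp add: T.piv_ev_def typed_piv_ldual(1))
  also have "\<dots> = typed_comp C (typed_ev C x) (typed_tens C (Arr ?a (rdual C x) 0) (typed_idn C x))"
    using tens_zero_left[OF O(1) O(5) x x ident_in_Hom[OF x]] cmp_zero_right[OF O(2) _ O(3) ev_in_Hom(1)[OF x]]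
    by (simp add: typed_defs typed_ev_def)
  finally have "Arr ?a (rdual C x) ?j = Arr ?a (rdual C x) 0"
    by (intro T.ev_left_inj[OF T.duality_right[OF x] j zero[OF O(1) O(5)]])
  then have j0: "?j = 0" by simp
  obtain d where d: "T.dual_map (T.ldual_iso x) = Arr (rdual C (rdual C ?a)) (rdual C x) d" "d \<in> Hom C (rdual C (rdual C ?a)) (rdual C x)"
    by (rule typed_hom_cases[of "T.dual_map (T.ldual_iso x)" "rdual C (rdual C ?a)" "rdual C x"]) simp
  obtain piv' where piv': "piv' \<in> Hom C (rdual C (rdual C ?a)) ?a" "piv C ?a \<cdot> piv' = \<i> (rdual C (rdual C ?a))"
    and pv: "piv C ?a \<in> Hom C ?a (rdual C (rdual C ?a))"
    using piv_iso[OF O(1)] by (auto simp: iso_def is_inverse_def)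
  have "d \<cdot> piv C ?a = 0"
    using typed_piv_ldual(1)[OF x] j0 by (simp add: d typed_comp_def typed_piv_def)
  then have "d = 0"
    using cmp_assoc[OF O(6) O(1) O(6) O(5) piv'(1) pv d(2)] piv'(2) cmp_ident_right[OF O(6) O(5) d(2)]
      cmp_zero_left[OF O(6) O(1) O(5) piv'(1)] by simp
  obtain r where r: "T.ldual_iso x = Arr x (rdual C ?a) r" "r \<in> Hom C x (rdual C ?a)"
    by (rule typed_hom_cases[of "T.ldual_iso x" x "rdual C ?a"]) simp
  have hr: "T.hom (Arr x (rdual C ?a) r) x (rdual C ?a)" using r by simp
  have "typed_comp C (typed_ev C (rdual C ?a)) (typed_tens C (typed_idn C (rdual C (rdual C ?a))) (Arr x (rdual C ?a) r))
      = typed_comp C (typed_ev C x) (typed_tens C (Arr (rdual C (rdual C ?a)) (rdual C x) 0) (typed_idn C x))"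
    using T.ev_dual_map[of "T.ldual_iso x"] d(1) r \<open>d = 0\<close> by simp
  also have "\<dots> = typed_comp C (typed_ev C (rdual C ?a)) (typed_tens C (typed_idn C (rdual C (rdual C ?a))) (Arr x (rdual C ?a) 0))"
    using tens_zero_left[OF O(6) O(5) x x ident_in_Hom[OF x]] tens_zero_right[OF O(6) O(6) x O(4) ident_in_Hom[OF O(6)]]
      cmp_zero_right[OF tens_ob_in_Ob[OF O(6) x] tens_ob_in_Ob[OF O(5) x] O(3) ev_in_Hom(1)[OF x]]
      cmp_zero_right[OF tens_ob_in_Ob[OF O(6) x] tens_ob_in_Ob[OF O(6) O(4)] O(3) ev_in_Hom(1)[OF O(4)]]
    by (simp add: typed_defs typed_ev_def)
  finally have "Arr x (rdual C ?a) r = Arr x (rdual C ?a) 0"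
    by (intro T.ev_right_inj[OF T.duality_right[OF O(4)] hr zero[OF x O(4)]])
  then have r0: "r = 0" by simp
  have "typed_comp C (typed_evl C x) (typed_tens C (typed_idn C x) (typed_idn C ?a)) = typed_evl C x" by simp
  also have "\<dots> = typed_comp C (typed_ev C ?a) (typed_tens C (Arr x (rdual C ?a) 0) (typed_idn C ?a))"
    using T.ev_ldual_iso[OF x] r(1) r0 by simp
  also have "\<dots> = typed_comp C (typed_evl C x) (typed_tens C (Arr x x 0) (typed_idn C ?a))"
    using tens_zero_left[OF x O(4) O(1) O(1) ident_in_Hom[OF O(1)]] tens_zero_left[OF x x O(1) O(1) ident_in_Hom[OF O(1)]]
      cmp_zero_right[OF tens_ob_in_Ob[OF x O(1)] tens_ob_in_Ob[OF O(4) O(1)] O(3) ev_in_Hom(1)[OF O(1)]]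
      cmp_zero_right[OF tens_ob_in_Ob[OF x O(1)] tens_ob_in_Ob[OF x O(1)] O(3) ev_in_Hom(3)[OF x]]
    by (simp add: typed_defs typed_ev_def typed_evl_def)
  finally have "typed_idn C x = Arr x x 0"
    by (intro T.ev_left_inj[OF T.duality_left[OF x] _ zero[OF x x]]) simp_all
  then show False using simple_nonzero[OF s] by (simp add: typed_idn_def)
qed

lemma cat_dim_nonzero:
  assumes U: "simple_representatives C U c" and fin: "finite U"
  shows "cat_dim C U c \<noteq> 0"
proof -
  obtain u where u: "u \<in> U" using simple_unit U unfolding simple_representatives_def by blast
  have "0 < (cmod (ob_dim C (c u)))\<^sup>2"
    using ob_dim_simple_nonzero[OF rep_simple[OF U u]] by simp
  also have "\<dots> \<le> (\<Sum>u\<in>U. (cmod (ob_dim C (c u)))\<^sup>2)" using fin u by (intro member_le_sum) auto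
  finally have "(\<Sum>u\<in>U. (cmod (ob_dim C (c u)))\<^sup>2) \<noteq> 0" by simp
  then show ?thesis unfolding cat_dim_def of_real_sum[symmetric] by (simp only: of_real_eq_0_iff not_False_eq_True)
qed

lemma ob_dim_sum:
  assumes U: "simple_representatives C U c" and fin: "finite U" and x: "x \<in> Ob C"
  shows "ob_dim C x = (\<Sum>u\<in>U. of_nat (dim (Hom C (c u) x)) * ob_dim C (c u))"
  unfolding ob_dim_def by (rule symmetric_trace_ident[OF U symmetric_left_trace x fin])

text \<open>
  Tensoring with \<open>x\<close> has a matrix \<open>A x\<close> of non-negative integers on the classes of simple objects, and
  \<open>A (x*)\<close> is its transpose.  The vector \<open>v\<close> of dimensions is a common eigenvector with eigenvalues
  \<open>dim x\<close> and \<open>dim x*\<close>, so computing \<open>\<langle>A x v, v\<rangle> = \<langle>v, A (x*) v\<rangle>\<close> in both ways gives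
  \<open>dim x \<cdot> \<langle>v, v\<rangle> = cnj (dim x*) \<cdot> \<langle>v, v\<rangle>\<close>, where \<open>\<langle>v, v\<rangle>\<close> is the dimension of the category.
\<close>

lemma ob_dim_rdual:
  assumes U: "simple_representatives C U c" and fin: "finite U" and x: "x \<in> Ob C"
  shows "ob_dim C (rdual C x) = cnj (ob_dim C x)"
proof -
  note O = rep_Ob[OF U]
  note rx = rdual_in_Ob[OF x]
  define v where "v u = ob_dim C (c u)" for u
  define A where "A y u w = (of_nat (dim (Hom C (c w) (y \<otimes> c u))) :: complex)" for y u w
  have eig: "(\<Sum>w\<in>U. A y u w * v w) = ob_dim C y * v u" if "y \<in> Ob C" "u \<in> U" for y u
    using ob_dim_sum[OF U fin tens_ob_in_Ob[OF that(1) O[OF that(2)]]] ob_dim_tens[OF that(1) O[OF that(2)]]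
    by (simp add: A_def v_def)
  have tr: "A (rdual C x) w u = A x u w" if u: "u \<in> U" and w: "w \<in> U" for u w
    using dim_Hom_swap[OF U tens_ob_in_Ob[OF rx O[OF w]] u] dim_Hom_tens_adjoint[OF x O[OF w] O[OF u]]
    by (simp add: A_def)
  have cA: "cnj (A y u w) = A y u w" for y u w by (simp add: A_def)
  have D: "cat_dim C U c = (\<Sum>u\<in>U. v u * cnj (v u))"
    unfolding cat_dim_def v_def by (intro sum.cong refl) (simp only: complex_norm_square)
  have "ob_dim C x * cat_dim C U c = (\<Sum>u\<in>U. (\<Sum>w\<in>U. A x u w * v w) * cnj (v u))"
    unfolding D sum_distrib_left by (intro sum.cong refl) (simp add: eig[OF x] mult.assoc)
  also have "\<dots> = (\<Sum>u\<in>U. \<Sum>w\<in>U. v w * cnj (A (rdual C x) w u * v u))"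
    unfolding sum_distrib_right by (intro sum.cong refl) (simp add: tr cA mult_ac)
  also have "\<dots> = (\<Sum>w\<in>U. v w * cnj (\<Sum>u\<in>U. A (rdual C x) w u * v u))"
    by (subst sum.swap) (simp add: sum_distrib_left)
  also have "\<dots> = (\<Sum>w\<in>U. v w * cnj (ob_dim C (rdual C x) * v w))"
    by (intro sum.cong refl) (simp only: eig[OF rx])
  also have "\<dots> = cnj (ob_dim C (rdual C x)) * cat_dim C U c"
    unfolding D sum_distrib_left by (intro sum.cong refl) (simp add: mult_ac)
  finally have "ob_dim C x = cnj (ob_dim C (rdual C x))" using cat_dim_nonzero[OF U fin] by simp
  then show ?thesis by simp
qed

end

section \<open>Module traces and eigenvectors\<close>

locale pivotal_module_category = pivotal_fusion_category C + module_category C M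
  for C :: "('o, 'a::ab_group_add, 'z) pivotal_cat_scheme" (structure)
    and M :: "('o, 'a, 'n, 'b::ab_group_add, 'w) module_cat_scheme"

sublocale pivotal_module_category \<subseteq> TM: typed_module "\<lambda>x. x \<in> Ob C" "typed_arr C" "typed_idn C"
  "typed_comp C" "tens_ob C" "typed_tens C" "\<one>\<^bsub>C\<^esub>" "typed_assoc C" "typed_inv_assoc C" "typed_lunit C"
  "typed_inv_lunit C" "typed_runit C" "typed_inv_runit C"
  "\<lambda>p. p \<in> Ob M" "typed_arr M" "typed_idn M" "typed_comp M" "act_ob M" "typed_act M"
  "typed_act_assoc C M" "typed_inv_act_assoc C M" "typed_act_unit C M" "typed_inv_act_unit C M"
  by (rule typed_module)

context pivotal_module_category
begin

lemma typed_arr_M_Arr [simp]: "p \<in> Ob M \<Longrightarrow> q \<in> Ob M \<Longrightarrow> typed_arr M (Arr p q f) \<longleftrightarrow> f \<in> Hom M p q"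
  by (simp add: typed_arr_def)

lemma dim_Hom_act_adjoint:
  assumes x: "x \<in> Ob C" and p: "p \<in> Ob M" and q: "q \<in> Ob M"
  shows "M.dim (Hom M (rdual C x \<rhd>\<^bsub>M\<^esub> p) q) = M.dim (Hom M p (x \<rhd>\<^bsub>M\<^esub> q))"
proof -
  interpret vp: vector_space_pair "smul M" "smul M" ..
  note [simp] = x p q
  note d = T.duality_right[OF x]
  let ?V = "Hom M (rdual C x \<rhd>\<^bsub>M\<^esub> p) q" and ?W = "Hom M p (x \<rhd>\<^bsub>M\<^esub> q)"
  let ?K = "typed_comp M (typed_act_assoc C M x (rdual C x) p)
     (typed_comp M (typed_act M (typed_coev C x) (typed_idn M p)) (typed_inv_act_unit C M p))"
  let ?T = "\<lambda>f. ar (TM.curry x (rdual C x) (typed_coev C x) p (Arr (rdual C x \<rhd>\<^bsub>M\<^esub> p) q f))"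
  let ?S = "\<lambda>k. ar (TM.uncurry x (rdual C x) (typed_ev C x) q (Arr p (x \<rhd>\<^bsub>M\<^esub> q) k))"
  have K: "TM.M.hom ?K p (x \<rhd>\<^bsub>M\<^esub> (rdual C x \<rhd>\<^bsub>M\<^esub> p))" by simp
  have Kr: "ar ?K \<in> Hom M p (x \<rhd>\<^bsub>M\<^esub> (rdual C x \<rhd>\<^bsub>M\<^esub> p))" using K unfolding typed_arr_def by metis
  have T: "?T f = (\<i>\<^bsub>C\<^esub> x \<unrhd>\<^bsub>M\<^esub> f) \<cdot>\<^bsub>M\<^esub> ar ?K" for f
    by (simp add: TM.curry_def typed_defs typed_act_defs)
  have TA: "TM.curry x (rdual C x) (typed_coev C x) p (Arr (rdual C x \<rhd>\<^bsub>M\<^esub> p) q f) = Arr p (x \<rhd>\<^bsub>M\<^esub> q) (?T f)"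
    "?T f \<in> ?W" if "f \<in> ?V" for f
  proof -
    have h: "TM.M.hom (TM.curry x (rdual C x) (typed_coev C x) p (Arr (rdual C x \<rhd>\<^bsub>M\<^esub> p) q f)) p (x \<rhd>\<^bsub>M\<^esub> q)"
      using that by (simp add: TM.arr_curry)
    then show "TM.curry x (rdual C x) (typed_coev C x) p (Arr (rdual C x \<rhd>\<^bsub>M\<^esub> p) q f) = Arr p (x \<rhd>\<^bsub>M\<^esub> q) (?T f)"
      by (metis arrow.collapse)
    show "?T f \<in> ?W" using h unfolding typed_arr_def by metis
  qed
  have SA: "TM.uncurry x (rdual C x) (typed_ev C x) q (Arr p (x \<rhd>\<^bsub>M\<^esub> q) k) = Arr (rdual C x \<rhd>\<^bsub>M\<^esub> p) q (?S k)"
    "?S k \<in> ?V" if "k \<in> ?W" for k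
  proof -
    have h: "TM.M.hom (TM.uncurry x (rdual C x) (typed_ev C x) q (Arr p (x \<rhd>\<^bsub>M\<^esub> q) k)) (rdual C x \<rhd>\<^bsub>M\<^esub> p) q"
      using that by (simp add: TM.arr_uncurry)
    then show "TM.uncurry x (rdual C x) (typed_ev C x) q (Arr p (x \<rhd>\<^bsub>M\<^esub> q) k) = Arr (rdual C x \<rhd>\<^bsub>M\<^esub> p) q (?S k)"
      by (metis arrow.collapse)
    show "?S k \<in> ?V" using h unfolding typed_arr_def by metis
  qed
  have bij: "bij_betw ?T ?V ?W"
  proof (rule bij_betw_byWitness[where f' = ?S])
    show "\<forall>f\<in>?V. ?S (?T f) = f"
    proof
      fix f assume f: "f \<in> ?V"
      show "?S (?T f) = f"
        using TM.uncurry_curry[OF d, of "Arr (rdual C x \<rhd>\<^bsub>M\<^esub> p) q f" p q] TA(1)[OF f] f by simp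
    qed
    show "\<forall>k\<in>?W. ?T (?S k) = k"
    proof
      fix k assume k: "k \<in> ?W"
      show "?T (?S k) = k"
        using TM.curry_uncurry[OF d, of "Arr p (x \<rhd>\<^bsub>M\<^esub> q) k" p q] SA(1)[OF k] k by simp
    qed
  qed (use TA(2) SA(2) in blast)+
  have O: "rdual C x \<rhd>\<^bsub>M\<^esub> p \<in> Ob M" "x \<rhd>\<^bsub>M\<^esub> q \<in> Ob M" "x \<rhd>\<^bsub>M\<^esub> (rdual C x \<rhd>\<^bsub>M\<^esub> p) \<in> Ob M" by simp_all
  have xf: "\<i>\<^bsub>C\<^esub> x \<unrhd>\<^bsub>M\<^esub> f \<in> Hom M (x \<rhd>\<^bsub>M\<^esub> (rdual C x \<rhd>\<^bsub>M\<^esub> p)) (x \<rhd>\<^bsub>M\<^esub> q)" if "f \<in> ?V" for f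
    using act_in_Hom[OF x x O(1) q ident_in_Hom[OF x] that] .
  obtain B where B: "finite B" "?V = M.span B" using M.Hom_finite_dim[OF O(1) q] by blast
  show ?thesis
  proof (rule vp.dim_eq_of_linear_bij[OF _ B _ bij])
    show "M.subspace ?V" "M.subspace ?W" using M.Hom_subspace O by simp_all
    fix f g r assume f: "f \<in> ?V"
    show "?T (smul M r f) = smul M r (?T f)"
      unfolding T using act_smul_right[OF x x O(1) q ident_in_Hom[OF x] f]
        M.cmp_smul_left[OF p O(3) O(2) Kr xf[OF f]] by simp
    assume g: "g \<in> ?V"
    show "?T (f + g) = ?T f + ?T g"
      unfolding T using act_add_right[OF x x O(1) q ident_in_Hom[OF x] f g]
        M.cmp_add_left[OF p O(3) O(2) Kr xf[OF f] xf[OF g]] by simp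
  qed
qed

lemma typed_partial_trace:
  assumes x: "x \<in> Ob C" and p: "p \<in> Ob M" and f: "f \<in> Hom M (x \<rhd>\<^bsub>M\<^esub> p) (x \<rhd>\<^bsub>M\<^esub> p)"
  shows "TM.ptrace (ldual C x) x (T.piv_ev x) (typed_coevl C x) p (Arr (x \<rhd>\<^bsub>M\<^esub> p) (x \<rhd>\<^bsub>M\<^esub> p) f)
      = Arr p p (partial_trace C M x p f)"
    and "partial_trace C M x p f \<in> Hom M p p"
proof -
  note [simp] = x p f
  let ?f = "Arr (x \<rhd>\<^bsub>M\<^esub> p) (x \<rhd>\<^bsub>M\<^esub> p) f" and ?a = "ldual C x" and ?b = "rdual C x"
  let ?c = "typed_comp M" and ?t = "typed_act M" and ?j = "Arr (ldual C x) (rdual C x) (piv_ldual C x)"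
  have j[simp]: "typed_arr C ?j" using typed_piv_ldual(2)[OF x] by simp
  have "TM.ptrace ?a x (T.piv_ev x) (typed_coevl C x) p ?f
    = ?c (typed_act_unit C M p) (?c (?t (typed_ev C x) (typed_idn M p)) (?c (?t (typed_tens C ?j (typed_idn C x)) (typed_idn M p))
      (?c (typed_inv_act_assoc C M ?a x p) (?c (?t (typed_idn C ?a) ?f) (?c (typed_act_assoc C M ?a x p)
        (?c (?t (typed_coevl C x) (typed_idn M p)) (typed_inv_act_unit C M p)))))))"
    by (simp add: TM.ptrace_def T.piv_ev_def typed_piv_ldual(1) TM.whisker_right TM.M.comp_assoc)
  also have "\<dots> = ?c (typed_act_unit C M p) (?c (?t (typed_ev C x) (typed_idn M p))
      (?c (typed_inv_act_assoc C M ?b x p) (?c (?t ?j (typed_idn M (x \<rhd>\<^bsub>M\<^esub> p))) (?c (?t (typed_idn C ?a) ?f) (?c (typed_act_assoc C M ?a x p)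
        (?c (?t (typed_coevl C x) (typed_idn M p)) (typed_inv_act_unit C M p)))))))"
    using TM.M.comp_nest[OF TM.\<beta>'_nat[of ?j "typed_idn C x" "typed_idn M p" ?b x p, symmetric],
        of "?c (?t (typed_idn C ?a) ?f) (?c (typed_act_assoc C M ?a x p)
        (?c (?t (typed_coevl C x) (typed_idn M p)) (typed_inv_act_unit C M p)))"]
    by (simp add: TM.M.comp_assoc)
  also have "\<dots> = ?c (typed_act_unit C M p) (?c (?t (typed_ev C x) (typed_idn M p))
      (?c (typed_inv_act_assoc C M ?b x p) (?c (?t ?j ?f) (?c (typed_act_assoc C M ?a x p)
        (?c (?t (typed_coevl C x) (typed_idn M p)) (typed_inv_act_unit C M p))))))"
    using TM.M.comp_nest[OF TM.act_comp[of "typed_idn C ?a" ?j ?f "typed_idn M (x \<rhd>\<^bsub>M\<^esub> p)", symmetric]]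
    by simp
  also have "\<dots> = ?c (?c (?c (?c (?c (?c (typed_act_unit C M p) (?t (typed_ev C x) (typed_idn M p)))
      (typed_inv_act_assoc C M ?b x p)) (?t ?j ?f)) (typed_act_assoc C M ?a x p))
        (?t (typed_coevl C x) (typed_idn M p))) (typed_inv_act_unit C M p)"
    by (simp add: TM.M.comp_assoc)
  also have "\<dots> = Arr p p (partial_trace C M x p f)"
    by (simp add: typed_defs typed_dual_defs typed_act_defs partial_trace_def)
  finally show *: "TM.ptrace ?a x (T.piv_ev x) (typed_coevl C x) p ?f = Arr p p (partial_trace C M x p f)" .
  have "typed_arr M (TM.ptrace ?a x (T.piv_ev x) (typed_coevl C x) p ?f)"
    using TM.hom_ptrace[of ?a x "T.piv_ev x" "typed_coevl C x" p ?f] by simp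
  then show "partial_trace C M x p f \<in> Hom M p p" unfolding * by simp
qed

lemma partial_trace_ident:
  assumes x: "x \<in> Ob C" and p: "p \<in> Ob M"
  shows "partial_trace C M x p (\<i>\<^bsub>M\<^esub> (x \<rhd>\<^bsub>M\<^esub> p)) = smul M (ob_dim C x) (\<i>\<^bsub>M\<^esub> p)"
proof -
  note [simp] = x p
  let ?d = "ob_dim C x" and ?ii = "\<i>\<^bsub>M\<^esub> (\<one>\<^bsub>C\<^esub> \<rhd>\<^bsub>M\<^esub> p)"
  have u: "\<one>\<^bsub>C\<^esub> \<in> Ob C" "\<one>\<^bsub>C\<^esub> \<rhd>\<^bsub>M\<^esub> p \<in> Ob M" by simp_all
  note l = M.iso_inverse_in_Hom[OF u(2) p act_unit_iso[OF p]]
  have "Arr p p (partial_trace C M x p (\<i>\<^bsub>M\<^esub> (x \<rhd>\<^bsub>M\<^esub> p)))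
      = TM.ptrace (ldual C x) x (T.piv_ev x) (typed_coevl C x) p (typed_idn M (x \<rhd>\<^bsub>M\<^esub> p))"
    using typed_partial_trace(1)[OF x p M.ident_in_Hom] by (simp add: typed_idn_def)
  also have "\<dots> = typed_comp M (typed_act_unit C M p)
      (typed_comp M (typed_act M (Arr \<one>\<^bsub>C\<^esub> \<one>\<^bsub>C\<^esub> (smul C ?d (\<i>\<^bsub>C\<^esub> \<one>\<^bsub>C\<^esub>))) (typed_idn M p)) (typed_inv_act_unit C M p))"
    by (subst TM.ptrace_idM) (simp_all add: trace_ar_ident')
  also have "\<dots> = Arr p p (act_unit M p \<cdot>\<^bsub>M\<^esub> (smul M ?d ?ii \<cdot>\<^bsub>M\<^esub> inv_ar M (\<one>\<^bsub>C\<^esub> \<rhd>\<^bsub>M\<^esub> p) p (act_unit M p)))"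
    using act_smul_left[OF u(1) u(1) p p ident_in_Hom[OF u(1)] M.ident_in_Hom[OF p]] act_ident[OF u(1) p]
    by (simp add: typed_defs typed_act_defs)
  also have "act_unit M p \<cdot>\<^bsub>M\<^esub> (smul M ?d ?ii \<cdot>\<^bsub>M\<^esub> inv_ar M (\<one>\<^bsub>C\<^esub> \<rhd>\<^bsub>M\<^esub> p) p (act_unit M p)) = smul M ?d (\<i>\<^bsub>M\<^esub> p)"
    using M.cmp_smul_left[OF p u(2) u(2) l(2) M.ident_in_Hom[OF u(2)]] M.cmp_ident_left[OF p u(2) l(2)]
      M.cmp_smul_right[OF p u(2) p l(2) l(1)] l(4) by simp
  finally show ?thesis by simp
qed

lemma symmetric_trace_of_module_trace:
  assumes "module_trace C M \<Theta>"
  shows "M.symmetric_trace \<Theta>"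
proof -
  interpret module_trace C M \<Theta> by fact
  show ?thesis
    unfolding M.symmetric_trace_def
    by (intro conjI ballI allI; rule trace_add trace_smul trace_symmetric; assumption)
qed

lemma module_trace_act:
  assumes "module_trace C M \<Theta>" and x: "x \<in> Ob C" and p: "p \<in> Ob M"
  shows "trace_dim M \<Theta> (x \<rhd>\<^bsub>M\<^esub> p) = ob_dim C x * trace_dim M \<Theta> p"
proof -
  interpret module_trace C M \<Theta> by fact
  show ?thesis
    using trace_compatible[OF x p M.ident_in_Hom] trace_smul[OF p M.ident_in_Hom[OF p]] x p
    by (simp add: trace_dim_def partial_trace_ident)
qed

text \<open>
  Endomorphisms of a simple object are multiples of the identity, so a vanishing dimension would make
  the trace form on them zero.
\<close>

lemma module_trace_simple_nonzero:
  assumes "module_trace C M \<Theta>" and s: "simple_object M p"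
  shows "trace_dim M \<Theta> p \<noteq> 0"
proof
  interpret module_trace C M \<Theta> by fact
  have p: "p \<in> Ob M" using s by (simp add: simple_object_def)
  note i = M.ident_in_Hom[OF p]
  assume 0: "trace_dim M \<Theta> p = 0"
  have "\<Theta> p (g \<cdot>\<^bsub>M\<^esub> \<i>\<^bsub>M\<^esub> p) = 0" if g: "g \<in> Hom M p p" for g
  proof -
    obtain b where b: "g = smul M b (\<i>\<^bsub>M\<^esub> p)" by (rule M.schur_scalar[OF s g])
    show ?thesis using M.cmp_ident_right[OF p p g] trace_smul[OF p i] 0 by (simp add: b trace_dim_def)
  qed
  then have "\<i>\<^bsub>M\<^esub> p = 0" using trace_nondegenerate_left[OF p p i] by blast
  then show False using M.simple_nonzero[OF s] by simp
qed

end

locale pivotal_inner_hom = pivotal_module_category C M + is_inner_hom C M H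
  for C :: "('o, 'a::ab_group_add, 'z) pivotal_cat_scheme" (structure)
    and M :: "('o, 'a, 'n, 'b::ab_group_add, 'w) module_cat_scheme"
    and H :: "('o, 'a, 'n, 'b, 'v) inner_hom_scheme"
begin

lemma dim_Hom_ihom:
  assumes x: "x \<in> Ob C" and p: "p \<in> Ob M" and q: "q \<in> Ob M"
  shows "M.dim (Hom M (x \<rhd>\<^bsub>M\<^esub> p) q) = dim (Hom C x (ihom_ob H p q))"
proof -
  interpret vp: vector_space_pair "smul M" "smul C" ..
  note O = act_ob_in_Ob[OF x p] ihom_ob_in_Ob[OF p q]
  obtain B where B: "finite B" "Hom M (x \<rhd>\<^bsub>M\<^esub> p) q = M.span B" using M.Hom_finite_dim[OF O(1) q] by blast
  show ?thesis
    by (rule vp.dim_eq_of_linear_bij[OF M.Hom_subspace[OF O(1) q] B Hom_subspace[OF x O(2)] adj_bij[OF x p q]])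
      (use adj_add[OF x p q] adj_smul[OF x p q] in auto)
qed

context
  fixes m assumes m: "m \<in> Ob M"
begin

text \<open>
  The evaluation morphism \<open>ihom_ob H m n \<rhd> m \<rightarrow> n\<close>: the adjunction sends it to the identity.
\<close>

definition counit where
  "counit n = inv_into (Hom M (ihom_ob H m n \<rhd>\<^bsub>M\<^esub> m) n) (ihom_adj H (ihom_ob H m n) m n) (\<i>\<^bsub>C\<^esub> (ihom_ob H m n))"

lemma counit:
  assumes n: "n \<in> Ob M"
  shows "counit n \<in> Hom M (ihom_ob H m n \<rhd>\<^bsub>M\<^esub> m) n"
    and "ihom_adj H (ihom_ob H m n) m n (counit n) = \<i>\<^bsub>C\<^esub> (ihom_ob H m n)"
proof -
  note O = ihom_ob_in_Ob[OF m n]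
  have "\<i>\<^bsub>C\<^esub> (ihom_ob H m n) \<in> ihom_adj H (ihom_ob H m n) m n ` Hom M (ihom_ob H m n \<rhd>\<^bsub>M\<^esub> m) n"
    using adj_bij[OF O m n] ident_in_Hom[OF O] by (simp add: bij_betw_def)
  then show "counit n \<in> Hom M (ihom_ob H m n \<rhd>\<^bsub>M\<^esub> m) n"
    "ihom_adj H (ihom_ob H m n) m n (counit n) = \<i>\<^bsub>C\<^esub> (ihom_ob H m n)"
    unfolding counit_def by (rule inv_into_into, rule f_inv_into_f)
qed

text \<open>
  Naturality of the adjunction in the first variable makes \<open>h \<mapsto> counit n \<cdot> (h \<unrhd> \<i> m)\<close> its inverse.
\<close>

lemma adj_counit:
  assumes y: "y \<in> Ob C" and n: "n \<in> Ob M" and h: "h \<in> Hom C y (ihom_ob H m n)"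
  shows "ihom_adj H y m n (counit n \<cdot>\<^bsub>M\<^esub> (h \<unrhd>\<^bsub>M\<^esub> \<i>\<^bsub>M\<^esub> m)) = h"
proof -
  note O = ihom_ob_in_Ob[OF m n]
  show ?thesis
    using adj_natural[OF O y m m n n h M.ident_in_Hom[OF m] M.ident_in_Hom[OF n] counit(1)[OF n]]
      M.cmp_ident_left[OF act_ob_in_Ob[OF O m] n counit(1)[OF n]] counit(2)[OF n]
      ihom_ident[OF m n] cmp_ident_left[OF O O ident_in_Hom[OF O]] cmp_ident_left[OF y O h] by simp
qed

text \<open>
  So the action of the inner hom on morphisms is determined by the adjunction; in particular it is
  linear.
\<close>

lemma adj_cmp_counit:
  assumes n: "n \<in> Ob M" and n': "n' \<in> Ob M" and f: "f \<in> Hom M n n'"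
  shows "ihom_adj H (ihom_ob H m n) m n' (f \<cdot>\<^bsub>M\<^esub> counit n) = ihom_ar H (\<i>\<^bsub>M\<^esub> m) f"
proof -
  note O = ihom_ob_in_Ob[OF m n] ihom_ob_in_Ob[OF m n']
  note A = act_ob_in_Ob[OF O(1) m]
  have fc: "f \<cdot>\<^bsub>M\<^esub> counit n \<in> Hom M (ihom_ob H m n \<rhd>\<^bsub>M\<^esub> m) n'"
    by (rule M.cmp_in_Hom[OF A n n' counit(1)[OF n] f])
  have ih: "ihom_ar H (\<i>\<^bsub>M\<^esub> m) f \<in> Hom C (ihom_ob H m n) (ihom_ob H m n')"
    by (rule ihom_ar_in_Hom[OF m m n n' M.ident_in_Hom[OF m] f])
  show ?thesis
    using adj_natural[OF O(1) O(1) m m n n' ident_in_Hom[OF O(1)] M.ident_in_Hom[OF m] f counit(1)[OF n]]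
      act_ident[OF O(1) m] M.cmp_ident_right[OF A n' fc] counit(2)[OF n]
      cmp_ident_right[OF O ih] by simp
qed

definition typed_ihom where
  "typed_ihom k = Arr (ihom_ob H m (src k)) (ihom_ob H m (tgt k)) (ihom_ar H (\<i>\<^bsub>M\<^esub> m) (ar k))"

definition typed_counit where
  "typed_counit n = Arr (ihom_ob H m n \<rhd>\<^bsub>M\<^esub> m) n (counit n)"

lemma typed_inner_hom:
  "typed_inner_hom (\<lambda>x. x \<in> Ob C) (typed_arr C) (typed_idn C) (typed_comp C) (tens_ob C) (typed_tens C)
    \<one>\<^bsub>C\<^esub> (typed_assoc C) (typed_inv_assoc C) (typed_lunit C) (typed_inv_lunit C) (typed_runit C) (typed_inv_runit C)
    (rdual C) (ldual C) (typed_ev C) (typed_coev C) (typed_evl C) (typed_coevl C) (typed_piv C)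
    (\<lambda>p. p \<in> Ob M) (typed_arr M) (typed_idn M) (typed_comp M) (act_ob M) (typed_act M)
    (typed_act_assoc C M) (typed_inv_act_assoc C M) (typed_act_unit C M) (typed_inv_act_unit C M)
    m (ihom_ob H m) typed_ihom typed_counit"
proof (intro typed_inner_hom.intro typed_pivotal_structure typed_module typed_inner_hom_axioms.intro)
  show "m \<in> Ob M" by (rule m)
  show "ihom_ob H m n \<in> Ob C" if "n \<in> Ob M" for n using ihom_ob_in_Ob[OF m that] .
  show "typed_arr M (typed_counit n)" if "n \<in> Ob M" for n
    using counit(1)[OF that] act_ob_in_Ob[OF ihom_ob_in_Ob[OF m that] m] that by (simp add: typed_counit_def)
  show "src (typed_counit n) = ihom_ob H m n \<rhd>\<^bsub>M\<^esub> m" "tgt (typed_counit n) = n" for n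
    by (simp_all add: typed_counit_def)
  show "typed_arr C (typed_ihom k)" if "typed_arr M k" for k
  proof -
    have k: "src k \<in> Ob M" "tgt k \<in> Ob M" "ar k \<in> Hom M (src k) (tgt k)" using that unfolding typed_arr_def by blast+
    show ?thesis
      using ihom_ar_in_Hom[OF m m k(1,2) M.ident_in_Hom[OF m] k(3)] ihom_ob_in_Ob[OF m k(1)] ihom_ob_in_Ob[OF m k(2)]
      by (simp add: typed_ihom_def)
  qed
  show "src (typed_ihom k) = ihom_ob H m (src k)" "tgt (typed_ihom k) = ihom_ob H m (tgt k)" for k
    by (simp_all add: typed_ihom_def)
next
  fix k n assume "typed_arr M k" and n: "tgt k = n"
  then have k: "src k \<in> Ob M" "n \<in> Ob M" "ar k \<in> Hom M (src k) n" unfolding typed_arr_def by blast+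
  note O = ihom_ob_in_Ob[OF m k(1)] ihom_ob_in_Ob[OF m k(2)]
  note A = act_ob_in_Ob[OF O(1) m] act_ob_in_Ob[OF O(2) m]
  let ?h = "ihom_ar H (\<i>\<^bsub>M\<^esub> m) (ar k)"
  have h: "?h \<in> Hom C (ihom_ob H m (src k)) (ihom_ob H m n)"
    by (rule ihom_ar_in_Hom[OF m m k(1,2) M.ident_in_Hom[OF m] k(3)])
  have "counit n \<cdot>\<^bsub>M\<^esub> (?h \<unrhd>\<^bsub>M\<^esub> \<i>\<^bsub>M\<^esub> m) = ar k \<cdot>\<^bsub>M\<^esub> counit (src k)"
  proof (rule inj_onD[OF bij_betw_imp_inj_on[OF adj_bij[OF O(1) m k(2)]]])
    show "ihom_adj H (ihom_ob H m (src k)) m n (counit n \<cdot>\<^bsub>M\<^esub> (?h \<unrhd>\<^bsub>M\<^esub> \<i>\<^bsub>M\<^esub> m))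
        = ihom_adj H (ihom_ob H m (src k)) m n (ar k \<cdot>\<^bsub>M\<^esub> counit (src k))"
      using adj_counit[OF O(1) k(2) h] adj_cmp_counit[OF k] by simp
    show "counit n \<cdot>\<^bsub>M\<^esub> (?h \<unrhd>\<^bsub>M\<^esub> \<i>\<^bsub>M\<^esub> m) \<in> Hom M (ihom_ob H m (src k) \<rhd>\<^bsub>M\<^esub> m) n"
      by (rule M.cmp_in_Hom[OF A k(2) act_in_Hom[OF O m m h M.ident_in_Hom[OF m]] counit(1)[OF k(2)]])
    show "ar k \<cdot>\<^bsub>M\<^esub> counit (src k) \<in> Hom M (ihom_ob H m (src k) \<rhd>\<^bsub>M\<^esub> m) n"
      by (rule M.cmp_in_Hom[OF A(1) k(1,2) counit(1)[OF k(1)] k(3)])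
  qed
  then show "typed_comp M (typed_counit n) (typed_act M (typed_ihom k) (typed_idn M m)) = typed_comp M k (typed_counit (src k))"
    using n by (simp add: typed_comp_def typed_act_def typed_idn_def typed_ihom_def typed_counit_def)
next
  fix n h h' y
  assume n: "n \<in> Ob M" and *: "typed_arr C h" "typed_arr C h'" "src h = y" "src h' = y"
    "tgt h = ihom_ob H m n" "tgt h' = ihom_ob H m n"
    and eq: "typed_comp M (typed_counit n) (typed_act M h (typed_idn M m)) = typed_comp M (typed_counit n) (typed_act M h' (typed_idn M m))"
  have h: "ar h \<in> Hom C y (ihom_ob H m n)" "ar h' \<in> Hom C y (ihom_ob H m n)" "y \<in> Ob C"
    using * unfolding typed_arr_def by metis+
  have "counit n \<cdot>\<^bsub>M\<^esub> (ar h \<unrhd>\<^bsub>M\<^esub> \<i>\<^bsub>M\<^esub> m) = counit n \<cdot>\<^bsub>M\<^esub> (ar h' \<unrhd>\<^bsub>M\<^esub> \<i>\<^bsub>M\<^esub> m)"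
    using arg_cong[OF eq, of ar] by (simp add: typed_comp_def typed_act_def typed_idn_def typed_counit_def)
  then have "ar h = ar h'" using adj_counit[OF h(3) n h(1)] adj_counit[OF h(3) n h(2)] by metis
  then show "h = h'" using * by (metis arrow.collapse)
next
  fix y n k
  assume y: "y \<in> Ob C" and n: "n \<in> Ob M" and *: "typed_arr M k" "src k = y \<rhd>\<^bsub>M\<^esub> m" "tgt k = n"
  have k: "ar k \<in> Hom M (y \<rhd>\<^bsub>M\<^esub> m) n" using * unfolding typed_arr_def by metis
  note O = ihom_ob_in_Ob[OF m n]
  let ?h = "ihom_adj H y m n (ar k)"
  have h: "?h \<in> Hom C y (ihom_ob H m n)" using adj_bij[OF y m n] k by (auto simp: bij_betw_def)
  have "counit n \<cdot>\<^bsub>M\<^esub> (?h \<unrhd>\<^bsub>M\<^esub> \<i>\<^bsub>M\<^esub> m) = ar k"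
  proof (rule inj_onD[OF bij_betw_imp_inj_on[OF adj_bij[OF y m n]] _ _ k])
    show "ihom_adj H y m n (counit n \<cdot>\<^bsub>M\<^esub> (?h \<unrhd>\<^bsub>M\<^esub> \<i>\<^bsub>M\<^esub> m)) = ?h" by (rule adj_counit[OF y n h])
    show "counit n \<cdot>\<^bsub>M\<^esub> (?h \<unrhd>\<^bsub>M\<^esub> \<i>\<^bsub>M\<^esub> m) \<in> Hom M (y \<rhd>\<^bsub>M\<^esub> m) n"
      by (rule M.cmp_in_Hom[OF act_ob_in_Ob[OF y m] act_ob_in_Ob[OF O m] n
            act_in_Hom[OF y O m m h M.ident_in_Hom[OF m]] counit(1)[OF n]])
  qed
  then have "typed_comp M (typed_counit n) (typed_act M (Arr y (ihom_ob H m n) ?h) (typed_idn M m)) = k"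
    using * by (cases k) (simp add: typed_comp_def typed_act_def typed_idn_def typed_counit_def)
  then show "\<exists>h. typed_arr C h \<and> src h = y \<and> tgt h = ihom_ob H m n \<and>
      typed_comp M (typed_counit n) (typed_act M h (typed_idn M m)) = k"
    using h y O by (intro exI[of _ "Arr y (ihom_ob H m n) ?h"]) simp
qed

lemma left_trace_ihom_compatible:
  assumes x: "x \<in> Ob C" and n: "n \<in> Ob M" and f: "f \<in> Hom M (x \<rhd>\<^bsub>M\<^esub> n) (x \<rhd>\<^bsub>M\<^esub> n)"
  shows "left_trace C (ihom_ob H m (x \<rhd>\<^bsub>M\<^esub> n)) (ihom_ar H (\<i>\<^bsub>M\<^esub> m) f)
    = left_trace C (ihom_ob H m n) (ihom_ar H (\<i>\<^bsub>M\<^esub> m) (partial_trace C M x n f))"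
proof -
  interpret I: typed_inner_hom "\<lambda>x. x \<in> Ob C" "typed_arr C" "typed_idn C" "typed_comp C" "tens_ob C" "typed_tens C"
    "\<one>\<^bsub>C\<^esub>" "typed_assoc C" "typed_inv_assoc C" "typed_lunit C" "typed_inv_lunit C" "typed_runit C" "typed_inv_runit C"
    "rdual C" "ldual C" "typed_ev C" "typed_coev C" "typed_evl C" "typed_coevl C" "typed_piv C"
    "\<lambda>p. p \<in> Ob M" "typed_arr M" "typed_idn M" "typed_comp M" "act_ob M" "typed_act M"
    "typed_act_assoc C M" "typed_inv_act_assoc C M" "typed_act_unit C M" "typed_inv_act_unit C M"
    m "ihom_ob H m" typed_ihom typed_counit
    by (rule typed_inner_hom)
  note A = act_ob_in_Ob[OF x n]
  note pt = typed_partial_trace[OF x n f]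
  have F: "ihom_ar H (\<i>\<^bsub>M\<^esub> m) g \<in> Hom C (ihom_ob H m q) (ihom_ob H m q)" if "q \<in> Ob M" "g \<in> Hom M q q" for q g
    using ihom_ar_in_Hom[OF m m that(1,1) M.ident_in_Hom[OF m] that(2)] .
  have "T.trace_ar (ihom_ob H m (x \<rhd>\<^bsub>M\<^esub> n)) (typed_ihom (Arr (x \<rhd>\<^bsub>M\<^esub> n) (x \<rhd>\<^bsub>M\<^esub> n) f))
      = T.trace_ar (ihom_ob H m n) (typed_ihom (Arr n n (partial_trace C M x n f)))"
    unfolding pt(1)[symmetric] by (rule I.trace_ar_\<F>_compatible) (use x n A f in simp_all)
  then show ?thesis
    using left_trace_eq[OF ihom_ob_in_Ob[OF m A] F[OF A f]] left_trace_eq[OF ihom_ob_in_Ob[OF m n] F[OF n pt(2)]]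
    by (simp add: typed_ihom_def)
qed

lemma ihom_ar_add:
  assumes n: "n \<in> Ob M" and n': "n' \<in> Ob M" and f: "f \<in> Hom M n n'" and g: "g \<in> Hom M n n'"
  shows "ihom_ar H (\<i>\<^bsub>M\<^esub> m) (f + g) = ihom_ar H (\<i>\<^bsub>M\<^esub> m) f + ihom_ar H (\<i>\<^bsub>M\<^esub> m) g"
proof -
  note O = ihom_ob_in_Ob[OF m n]
  note A = act_ob_in_Ob[OF O m]
  have c: "h \<cdot>\<^bsub>M\<^esub> counit n \<in> Hom M (ihom_ob H m n \<rhd>\<^bsub>M\<^esub> m) n'" if "h \<in> Hom M n n'" for h
    by (rule M.cmp_in_Hom[OF A n n' counit(1)[OF n] that])
  show ?thesis
    using adj_cmp_counit[OF n n' M.add_in_Hom[OF n n' f g]] adj_cmp_counit[OF n n' f] adj_cmp_counit[OF n n' g]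
      M.cmp_add_left[OF A n n' counit(1)[OF n] f g] adj_add[OF O m n' c[OF f] c[OF g]] by simp
qed

lemma ihom_ar_smul:
  assumes n: "n \<in> Ob M" and n': "n' \<in> Ob M" and f: "f \<in> Hom M n n'"
  shows "ihom_ar H (\<i>\<^bsub>M\<^esub> m) (smul M r f) = smul C r (ihom_ar H (\<i>\<^bsub>M\<^esub> m) f)"
proof -
  note O = ihom_ob_in_Ob[OF m n]
  note A = act_ob_in_Ob[OF O m]
  have c: "f \<cdot>\<^bsub>M\<^esub> counit n \<in> Hom M (ihom_ob H m n \<rhd>\<^bsub>M\<^esub> m) n'"
    by (rule M.cmp_in_Hom[OF A n n' counit(1)[OF n] f])
  show ?thesis
    using adj_cmp_counit[OF n n' M.smul_in_Hom[OF n n' f]] adj_cmp_counit[OF n n' f]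
      M.cmp_smul_left[OF A n n' counit(1)[OF n] f] adj_smul[OF O m n' c] by simp
qed

lemma symmetric_ihom_trace:
  "M.symmetric_trace (\<lambda>n f. left_trace C (ihom_ob H m n) (ihom_ar H (\<i>\<^bsub>M\<^esub> m) f))"
proof -
  note i = M.ident_in_Hom[OF m]
  have F: "ihom_ar H (\<i>\<^bsub>M\<^esub> m) f \<in> Hom C (ihom_ob H m n) (ihom_ob H m n')"
    if "n \<in> Ob M" "n' \<in> Ob M" "f \<in> Hom M n n'" for n n' f
    using ihom_ar_in_Hom[OF m m that(1,2) i that(3)] .
  have cmp: "ihom_ar H (\<i>\<^bsub>M\<^esub> m) (g \<cdot>\<^bsub>M\<^esub> f) = ihom_ar H (\<i>\<^bsub>M\<^esub> m) g \<cdot>\<^bsub>C\<^esub> ihom_ar H (\<i>\<^bsub>M\<^esub> m) f"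
    if "n \<in> Ob M" "n' \<in> Ob M" "f \<in> Hom M n n'" "g \<in> Hom M n' n" for n n' f g
    using ihom_cmp[OF m m m that(1,2,1) i i that(3,4)] M.cmp_ident_left[OF m m i] by simp
  note t = symmetric_traceD[OF symmetric_left_trace]
  show ?thesis
    unfolding M.symmetric_trace_def
    using ihom_ob_in_Ob[OF m] F by (auto simp: ihom_ar_add ihom_ar_smul cmp t(1,2) intro!: t(3))
qed

end

context
  fixes U :: "'u set" and c :: "'u \<Rightarrow> 'o" and I :: "'i set" and m :: "'i \<Rightarrow> 'n"
  assumes U: "simple_representatives C U c" and I: "finite I" and m: "simple_representatives M I m"
begin

lemma finite_U: "finite U"
  using finitely_many_simples finite_representatives[OF _ _ U] by blast

abbreviation "Q \<equiv> ihom_matrix C H m"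
abbreviation "D \<equiv> cat_dim C U c"
abbreviation "trace_of d \<equiv> trace_of_vector C M H D I m d"

lemma D_nonzero: "D \<noteq> 0"
  by (rule cat_dim_nonzero[OF U finite_U])

text \<open>
  Decomposing \<open>ihom_ob H (m j) (m i)\<close> into simple objects \<open>c u\<close>, the multiplicity of \<open>c u\<close> is
  \<open>dim Hom (c u \<rhd> m j) (m i) = dim Hom (m j) (rdual (c u) \<rhd> m i)\<close>.  Summed over \<open>j\<close> with weights
  \<open>d j\<close> these give the dimension of \<open>rdual (c u) \<rhd> m i\<close>, which is \<open>cnj (ob_dim (c u)) \<cdot> d i\<close>.
\<close>

theorem eigenvector_of_module_trace:
  assumes t: "module_trace C M \<Theta>"
  shows "nonzero_eigenvector I Q D (\<lambda>i. trace_dim M \<Theta> (m i))"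
  unfolding nonzero_eigenvector_def
proof (intro conjI ballI)
  fix i assume i: "i \<in> I"
  show "trace_dim M \<Theta> (m i) \<noteq> 0"
    by (rule module_trace_simple_nonzero[OF t M.rep_simple[OF m i]])
  let ?d = "\<lambda>j. trace_dim M \<Theta> (m j)"
  note mO = M.rep_Ob[OF m] and cO = rep_Ob[OF U]
  have Q: "Q i j = (\<Sum>u\<in>U. ob_dim C (c u) * of_nat (M.dim (Hom M (m j) (rdual C (c u) \<rhd>\<^bsub>M\<^esub> m i))))"
    if j: "j \<in> I" for j
  proof -
    have "dim (Hom C (c u) (ihom_ob H (m j) (m i))) = M.dim (Hom M (m j) (rdual C (c u) \<rhd>\<^bsub>M\<^esub> m i))"
      if u: "u \<in> U" for u
    proof -
      have "dim (Hom C (c u) (ihom_ob H (m j) (m i))) = M.dim (Hom M (c u \<rhd>\<^bsub>M\<^esub> m j) (m i))"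
        by (rule dim_Hom_ihom[OF cO[OF u] mO[OF j] mO[OF i], symmetric])
      also have "\<dots> = M.dim (Hom M (m i) (c u \<rhd>\<^bsub>M\<^esub> m j))"
        by (rule M.dim_Hom_swap[OF m act_ob_in_Ob[OF cO[OF u] mO[OF j]] i, symmetric])
      also have "\<dots> = M.dim (Hom M (rdual C (c u) \<rhd>\<^bsub>M\<^esub> m i) (m j))"
        by (rule dim_Hom_act_adjoint[OF cO[OF u] mO[OF i] mO[OF j], symmetric])
      also have "\<dots> = M.dim (Hom M (m j) (rdual C (c u) \<rhd>\<^bsub>M\<^esub> m i))"
        by (rule M.dim_Hom_swap[OF m act_ob_in_Ob[OF rdual_in_Ob[OF cO[OF u]] mO[OF i]] j, symmetric])
      finally show ?thesis .
    qed
    then show ?thesis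
      using ob_dim_sum[OF U finite_U ihom_ob_in_Ob[OF mO[OF j] mO[OF i]]]
      by (simp add: ihom_matrix_def mult.commute)
  qed
  have "(\<Sum>j\<in>I. Q i j * ?d j)
      = (\<Sum>j\<in>I. \<Sum>u\<in>U. ob_dim C (c u) * (of_nat (M.dim (Hom M (m j) (rdual C (c u) \<rhd>\<^bsub>M\<^esub> m i))) * ?d j))"
    by (intro sum.cong refl) (simp add: Q sum_distrib_right mult.assoc)
  also have "\<dots> = (\<Sum>u\<in>U. ob_dim C (c u) * (\<Sum>j\<in>I. of_nat (M.dim (Hom M (m j) (rdual C (c u) \<rhd>\<^bsub>M\<^esub> m i))) * ?d j))"
    by (subst sum.swap) (simp add: sum_distrib_left)
  also have "\<dots> = (\<Sum>u\<in>U. ob_dim C (c u) * (cnj (ob_dim C (c u)) * ?d i))"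
  proof (intro sum.cong refl)
    fix u assume u: "u \<in> U"
    note rO = rdual_in_Ob[OF cO[OF u]]
    have "(\<Sum>j\<in>I. of_nat (M.dim (Hom M (m j) (rdual C (c u) \<rhd>\<^bsub>M\<^esub> m i))) * ?d j)
        = trace_dim M \<Theta> (rdual C (c u) \<rhd>\<^bsub>M\<^esub> m i)"
      using M.symmetric_trace_ident[OF m symmetric_trace_of_module_trace[OF t] act_ob_in_Ob[OF rO mO[OF i]] I]
      by (simp add: trace_dim_def)
    also have "\<dots> = cnj (ob_dim C (c u)) * ?d i"
      using module_trace_act[OF t rO mO[OF i]] ob_dim_rdual[OF U finite_U cO[OF u]] by simp
    finally show "ob_dim C (c u) * (\<Sum>j\<in>I. of_nat (M.dim (Hom M (m j) (rdual C (c u) \<rhd>\<^bsub>M\<^esub> m i))) * ?d j)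
        = ob_dim C (c u) * (cnj (ob_dim C (c u)) * ?d i)" by simp
  qed
  also have "\<dots> = D * ?d i"
    unfolding cat_dim_def sum_distrib_right
    by (intro sum.cong refl) (simp only: complex_norm_square mult.assoc)
  finally show "(\<Sum>j\<in>I. Q i j * ?d j) = D * ?d i" .
qed

lemma symmetric_trace_of: "M.symmetric_trace (trace_of d)"
proof -
  note t = M.symmetric_traceD[OF symmetric_ihom_trace[OF M.rep_Ob[OF m]]]
  show ?thesis
    unfolding M.symmetric_trace_def trace_of_vector_def
  proof (intro conjI ballI allI)
    fix n f g assume *: "n \<in> Ob M" "f \<in> Hom M n n" "g \<in> Hom M n n"
    show "1 / D * (\<Sum>i\<in>I. left_trace C (ihom_ob H (m i) n) (ihom_ar H (\<i>\<^bsub>M\<^esub> (m i)) (f + g)) * d i)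
      = 1 / D * (\<Sum>i\<in>I. left_trace C (ihom_ob H (m i) n) (ihom_ar H (\<i>\<^bsub>M\<^esub> (m i)) f) * d i)
      + 1 / D * (\<Sum>i\<in>I. left_trace C (ihom_ob H (m i) n) (ihom_ar H (\<i>\<^bsub>M\<^esub> (m i)) g) * d i)"
      using t(1)[OF _ *] by (simp add: distrib_right sum.distrib add_divide_distrib)
  next
    fix n f r assume *: "n \<in> Ob M" "f \<in> Hom M n n"
    show "1 / D * (\<Sum>i\<in>I. left_trace C (ihom_ob H (m i) n) (ihom_ar H (\<i>\<^bsub>M\<^esub> (m i)) (smul M r f)) * d i)
      = r * (1 / D * (\<Sum>i\<in>I. left_trace C (ihom_ob H (m i) n) (ihom_ar H (\<i>\<^bsub>M\<^esub> (m i)) f) * d i))"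
      using t(2)[OF _ *] by (simp add: sum_distrib_left mult_ac)
  next
    fix n n' f g assume *: "n \<in> Ob M" "n' \<in> Ob M" "f \<in> Hom M n n'" "g \<in> Hom M n' n"
    show "1 / D * (\<Sum>i\<in>I. left_trace C (ihom_ob H (m i) n) (ihom_ar H (\<i>\<^bsub>M\<^esub> (m i)) (g \<cdot>\<^bsub>M\<^esub> f)) * d i)
      = 1 / D * (\<Sum>i\<in>I. left_trace C (ihom_ob H (m i) n') (ihom_ar H (\<i>\<^bsub>M\<^esub> (m i)) (f \<cdot>\<^bsub>M\<^esub> g)) * d i)"
      using t(3)[OF _ *] by simp
  qed
qed

text \<open>
  The eigenvector equation is what normalises the values on simple objects.
\<close>

lemma trace_of_simple:
  assumes d: "nonzero_eigenvector I Q D d" and j: "j \<in> I"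
  shows "trace_of d (m j) (\<i>\<^bsub>M\<^esub> (m j)) = d j"
proof -
  have "trace_of d (m j) (\<i>\<^bsub>M\<^esub> (m j)) = 1 / D * (\<Sum>i\<in>I. Q j i * d i)"
    using ihom_ident[OF M.rep_Ob[OF m] M.rep_Ob[OF m j]]
    by (simp add: trace_of_vector_def ihom_matrix_def ob_dim_def)
  then show ?thesis using d j D_nonzero by (simp add: nonzero_eigenvector_def)
qed

text \<open>
  Compatibility holds for each summand of the trace separately.  The eigenvector property enters
  through \<open>trace_of_simple\<close>, which gives non-degeneracy.
\<close>

theorem module_trace_of_eigenvector:
  assumes d: "nonzero_eigenvector I Q D d"
  shows "module_trace C M (trace_of d)"
proof
  note t = M.symmetric_traceD[OF symmetric_trace_of[of d]]
  have nz: "trace_of d (m i) (\<i>\<^bsub>M\<^esub> (m i)) \<noteq> 0" if "i \<in> I" for i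
    using trace_of_simple[OF d that] d that by (simp add: nonzero_eigenvector_def)
  note nondeg = M.symmetric_trace_nondegenerate[OF m symmetric_trace_of nz]
  show "trace_of d n (f + g) = trace_of d n f + trace_of d n g"
    if "n \<in> Ob M" "f \<in> Hom M n n" "g \<in> Hom M n n" for n f g using t(1)[OF that] .
  show "trace_of d n (smul M r f) = r * trace_of d n f"
    if "n \<in> Ob M" "f \<in> Hom M n n" for n f r using t(2)[OF that] .
  show sym: "trace_of d n (g \<cdot>\<^bsub>M\<^esub> f) = trace_of d n' (f \<cdot>\<^bsub>M\<^esub> g)"
    if "n \<in> Ob M" "n' \<in> Ob M" "f \<in> Hom M n n'" "g \<in> Hom M n' n" for n n' f g using t(3)[OF that] .
  show left: "f = 0" if "n \<in> Ob M" "n' \<in> Ob M" "f \<in> Hom M n n'"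
    "\<And>g. g \<in> Hom M n' n \<Longrightarrow> trace_of d n (g \<cdot>\<^bsub>M\<^esub> f) = 0" for n n' f
    using nondeg[OF _ that(1-3)] that(4) by blast
  show "g = 0" if "n \<in> Ob M" "n' \<in> Ob M" "g \<in> Hom M n' n"
    "\<And>f. f \<in> Hom M n n' \<Longrightarrow> trace_of d n (g \<cdot>\<^bsub>M\<^esub> f) = 0" for n n' g
    using left[OF that(2,1,3)] that(4) sym[OF that(1,2) _ that(3)] by simp
  show "trace_of d (x \<rhd>\<^bsub>M\<^esub> n) f = trace_of d n (partial_trace C M x n f)"
    if "x \<in> Ob C" "n \<in> Ob M" "f \<in> Hom M (x \<rhd>\<^bsub>M\<^esub> n) (x \<rhd>\<^bsub>M\<^esub> n)" for x n f
    using left_trace_ihom_compatible[OF M.rep_Ob[OF m] that] by (simp add: trace_of_vector_def)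
qed

text \<open>
  Both sides are symmetric traces with the same values on simple objects.
\<close>

theorem trace_of_trace_dims:
  assumes t: "module_trace C M \<Theta>" and n: "n \<in> Ob M" and f: "f \<in> Hom M n n"
  shows "trace_of (\<lambda>i. trace_dim M \<Theta> (m i)) n f = \<Theta> n f"
  by (rule M.symmetric_trace_eqI[OF m symmetric_trace_of symmetric_trace_of_module_trace[OF t] _ n f])
    (simp add: trace_of_simple[OF eigenvector_of_module_trace[OF t]], simp add: trace_dim_def)

end

end

theorem proposition5p4:
  fixes C :: "('o, 'a::ab_group_add) pivotal_cat"
    and M :: "('o, 'a, 'n, 'b::ab_group_add) module_cat"
    and H :: "('o, 'a, 'n, 'b) inner_hom"
    and U :: "'u set" and c :: "'u \<Rightarrow> 'o"
    and I :: "'i set" and m :: "'i \<Rightarrow> 'n"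
  assumes "pivotal_fusion_category C"
    and "simple_representatives C U c"
    and "module_category C M"
    and "finite I"
    and "simple_representatives M I m"
    and "is_inner_hom C M H"
  shows
    "(\<forall>\<Theta>. module_trace C M \<Theta> \<longrightarrow>
        nonzero_eigenvector I (ihom_matrix C H m) (cat_dim C U c) (\<lambda>i. trace_dim M \<Theta> (m i))) \<and>
     (\<forall>d. nonzero_eigenvector I (ihom_matrix C H m) (cat_dim C U c) d \<longrightarrow>
        module_trace C M (trace_of_vector C M H (cat_dim C U c) I m d)) \<and>
     (\<forall>\<Theta>. module_trace C M \<Theta> \<longrightarrow>
        (\<forall>n\<in>Ob M. \<forall>f\<in>Hom M n n.
           trace_of_vector C M H (cat_dim C U c) I m (\<lambda>i. trace_dim M \<Theta> (m i)) n f = \<Theta> n f)) \<and>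
     (\<forall>d. nonzero_eigenvector I (ihom_matrix C H m) (cat_dim C U c) d \<longrightarrow>
        (\<forall>i\<in>I. trace_dim M (trace_of_vector C M H (cat_dim C U c) I m d) (m i) = d i))"
proof -
  interpret pivotal_inner_hom C M H
    by (intro pivotal_inner_hom.intro pivotal_module_category.intro assms)
  note a = assms(2,4,5)
  show ?thesis
    using eigenvector_of_module_trace[OF a] module_trace_of_eigenvector[OF a] trace_of_trace_dims[OF a]
      trace_of_simple[OF a] unfolding trace_dim_def by blast
qed

end
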